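(* Let $(M_k,Q_k)_{k\in\mathbb{N}}$ be independent copies of an $\mathbb{R}^2$-valued random vector $(M,Q)$ with arbitrary dependence of the components, and let $X_0$ be a real random variable independent of $(M_k,Q_k)_{k\in\mathbb{N}}$. Set $\Pi_n:=M_1M_2\cdots M_n$, $X_n:=M_nX_{n-1}+Q_n$ and $Y_n:=\sum_{k=1}^{n}M_1M_2\cdots M_{k-1}Q_k$ for $n\in\mathbb{N}$. Suppose that $\mathbb{P}\{M=0\}=0$, that $\lim_{n\to\infty}\Pi_n=0$ a.s., and that $$\mathbb{P}\{\log|Q|>x\}\sim x^{-\alpha}\ell(x),\quad x\to\infty,$$ for some $\alpha\in(0,1]$ and some $\ell$ slowly varying at $\infty$. Let $(b_n)$ be a positive sequence which satisfies $\lim_{n\to\infty}n\,\mathbb{P}\{\log|Q|>b_n\}=1$. In the case $\alpha=1$ assume additionally that $\lim_{x\to\infty}\ell(x)=+\infty$. In the case $\mathbb{E}\log^-|M|=\infty$ assume that $$\lim_{x\to\infty}\frac{\mathbb{E}\big(\log^-|M|\wedge x\big)}{x\,\mathbb{P}\{\log|Q|>x\}}=0.$$ Let $\sum_k\varepsilon_{(t_k,\,j_k)}$ be a Poisson random measure on $[0,\infty)\times(0,\infty]$ with mean measure $\mathrm{LEB}\times\mu_{1,\alpha}$, where $\mu_{1,\alpha}((x,\infty])=x^{-\alpha}$ for $x>0$. (i) If $\mathbb{P}\{Y_k=0\}=0$ for each $k\in\mathbb{N}$, then, as $n\to\infty$, $$\frac{\log|Y_{[n\cdot]+1}|}{b_n}\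 \Rightarrow\ \sup_{t_k\le\,\cdot}\,j_k.$$ (ii) If $\mathbb{P}\{X_k=0\}=0$ for each $k\in\mathbb{N}$, then, as $n\to\infty$, $$\frac{\log|X_{[n\cdot]+1}|}{b_n}\ \Rightarrow\ \sup_{t_k\le\,\cdot}\,j_k.$$
   Context: The empty product is $1$, so $Y_1=Q_1$. $\log^-x=\max(-\log x,0)$ and $x\wedge y=\min(x,y)$. $f(x)\sim g(x)$ means $f(x)/g(x)\to1$. $\varepsilon_{(t,x)}$ denotes the unit point mass at $(t,x)$ and $\mathrm{LEB}$ is Lebesgue measure on $[0,\infty)$. $[x]$ is the integer part of $x$; $Y_{[n\cdot]+1}$ denotes the process $t\mapsto Y_{[nt]+1}$, $t\ge0$, and similarly for $X$. $D=D[0,\infty)$ is the Skorokhod space of right-continuous real functions on $[0,\infty)$ with finite left limits at positive points, and $\Rightarrow$ denotes weak convergence in $D$ equipped with the $J_1$-topology. The notation $\sup_{t_k\le\,\cdot}j_k$ denotes the process whose value at $t\ge0$ is the supremum over all $k$ with $t_k\le t$; the supremum over the empty set is equal to zero. *)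

theory Defs
  imports "HOL-Probability.Probability" "HOL-Library.Landau_Symbols"
begin

section \<open>Perpetuities\<close>

text \<open>The sequences \<open>m\<close> and \<open>q\<close> are indexed by \<open>k \<ge> 1\<close>; their values at \<open>0\<close> are never used.\<close>

definition partial_prod :: "(nat \<Rightarrow> real) \<Rightarrow> nat \<Rightarrow> real" where
  "partial_prod m n = (\<Prod>k=1..n. m k)"

fun affine_rec :: "(nat \<Rightarrow> real) \<Rightarrow> (nat \<Rightarrow> real) \<Rightarrow> real \<Rightarrow> nat \<Rightarrow> real" where
  "affine_rec m q x0 0 = x0"
| "affine_rec m q x0 (Suc n) = m (Suc n) * affine_rec m q x0 n + q (Suc n)"

definition perpetuity :: "(nat \<Rightarrow> real) \<Rightarrow> (nat \<Rightarrow> real) \<Rightarrow> nat \<Rightarrow> real" where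
  "perpetuity m q n = (\<Sum>k=1..n. partial_prod m (k - 1) * q k)"

definition log_minus :: "real \<Rightarrow> real" where
  "log_minus x = max (- ln x) 0"

definition slowly_varying :: "(real \<Rightarrow> real) \<Rightarrow> bool" where
  "slowly_varying l \<longleftrightarrow>
     (\<exists>a. (\<forall>x\<ge>a. l x > 0) \<and> l \<in> borel_measurable (restrict_space borel {a..})) \<and>
     (\<forall>c>0. ((\<lambda>x. l (c * x) / l x) \<longlongrightarrow> 1) at_top)"

section \<open>The Skorokhod space\<close>

text \<open>Functions on \<open>[0,\<infinity>)\<close> are functions on the reals that are \<open>undefined\<close> on the negative
  half-line, so that equality of elements of \<open>skorokhod_D\<close> is equality on \<open>[0,\<infinity>)\<close>.\<close>

definition skorokhod_D :: "(real \<Rightarrow> real) set" where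
  "skorokhod_D = {x \<in> extensional {0..}.
     (\<forall>t\<ge>0. (x \<longlongrightarrow> x t) (at_right t)) \<and> (\<forall>t>0. \<exists>l. (x \<longlongrightarrow> l) (at_left t))}"

definition time_changes :: "(real \<Rightarrow> real) set" where
  "time_changes = {h. strict_mono_on {0..} h \<and> continuous_on {0..} h \<and> h ` {0..} = {0..}}"

text \<open>The sets \<open>J1_nbhd x T e\<close> form a neighbourhood base at \<open>x\<close> of the \<open>J\<^sub>1\<close>-topology:
  \<open>y\<^sub>n\<close> is eventually in each of them iff there are time changes \<open>h\<^sub>n\<close> with
  \<open>sup {\<bar>h\<^sub>n s - s\<bar> | s \<ge> 0} \<rightarrow> 0\<close> and \<open>sup {\<bar>y\<^sub>n (h\<^sub>n s) - x s\<bar> | s \<le> T} \<rightarrow> 0\<close> for every \<open>T\<close>,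
  which is the usual criterion for \<open>J\<^sub>1\<close>-convergence in \<open>D[0,\<infinity>)\<close>
  (Billingsley, Convergence of Probability Measures, 2nd ed., Theorem 16.1).\<close>

definition J1_nbhd :: "(real \<Rightarrow> real) \<Rightarrow> real \<Rightarrow> real \<Rightarrow> (real \<Rightarrow> real) set" where
  "J1_nbhd x T e = {y \<in> skorokhod_D. \<exists>h\<in>time_changes.
     (\<forall>s\<ge>0. \<bar>h s - s\<bar> < e) \<and> (\<forall>s\<in>{0..T}. \<bar>y (h s) - x s\<bar> < e)}"

definition J1_topology :: "(real \<Rightarrow> real) topology" where
  "J1_topology = topology (\<lambda>U. U \<subseteq> skorokhod_D \<and> (\<forall>x\<in>U. \<exists>T>0. \<exists>e>0. J1_nbhd x T e \<subseteq> U))"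

lemma J1_nbhd_mono:
  assumes "T' \<le> T" "e \<le> e'"
  shows "J1_nbhd x T e \<subseteq> J1_nbhd x T' e'"
proof
  fix y assume "y \<in> J1_nbhd x T e"
  then obtain h where y: "y \<in> skorokhod_D" and h: "h \<in> time_changes"
    and close: "\<forall>s\<ge>0. \<bar>h s - s\<bar> < e" "\<forall>s\<in>{0..T}. \<bar>y (h s) - x s\<bar> < e"
    unfolding J1_nbhd_def by blast
  from close(1) assms(2) have "\<forall>s\<ge>0. \<bar>h s - s\<bar> < e'"
    by (meson less_le_trans)
  moreover have "\<forall>s\<in>{0..T'}. \<bar>y (h s) - x s\<bar> < e'"
  proof
    fix s assume "s \<in> {0..T'}"
    with assms(1) have "s \<in> {0..T}" by simp
    with close(2) have "\<bar>y (h s) - x s\<bar> < e" by blast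
    with assms(2) show "\<bar>y (h s) - x s\<bar> < e'" by linarith
  qed
  ultimately show "y \<in> J1_nbhd x T' e'"
    unfolding J1_nbhd_def using y h by blast
qed

lemma istopology_J1:
  "istopology (\<lambda>U. U \<subseteq> skorokhod_D \<and> (\<forall>x\<in>U. \<exists>T>0. \<exists>e>0. J1_nbhd x T e \<subseteq> U))"
proof -
  have int: "\<exists>T>0. \<exists>e>0. J1_nbhd x T e \<subseteq> U \<inter> V"
    if "T1 > 0" "e1 > 0" "J1_nbhd x T1 e1 \<subseteq> U" "T2 > 0" "e2 > 0" "J1_nbhd x T2 e2 \<subseteq> V"
    for x U V T1 e1 T2 e2
  proof (intro exI conjI)
    show "max T1 T2 > 0" "min e1 e2 > 0"
      using that by auto
    have "J1_nbhd x (max T1 T2) (min e1 e2) \<subseteq> J1_nbhd x T1 e1"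
         "J1_nbhd x (max T1 T2) (min e1 e2) \<subseteq> J1_nbhd x T2 e2"
      by (rule J1_nbhd_mono; simp)+
    with that show "J1_nbhd x (max T1 T2) (min e1 e2) \<subseteq> U \<inter> V"
      by blast
  qed
  show ?thesis
    unfolding istopology_def
  proof (intro conjI allI impI)
    fix U V
    assume U: "U \<subseteq> skorokhod_D \<and> (\<forall>x\<in>U. \<exists>T>0. \<exists>e>0. J1_nbhd x T e \<subseteq> U)"
      and V: "V \<subseteq> skorokhod_D \<and> (\<forall>x\<in>V. \<exists>T>0. \<exists>e>0. J1_nbhd x T e \<subseteq> V)"
    then show "U \<inter> V \<subseteq> skorokhod_D" by blast
    show "\<forall>x\<in>U \<inter> V. \<exists>T>0. \<exists>e>0. J1_nbhd x T e \<subseteq> U \<inter> V"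
    proof
      fix x assume "x \<in> U \<inter> V"
      then have x: "x \<in> U" "x \<in> V" by auto
      obtain T1 e1 where 1: "T1 > 0" "e1 > 0" "J1_nbhd x T1 e1 \<subseteq> U"
        using U x(1) by blast
      obtain T2 e2 where 2: "T2 > 0" "e2 > 0" "J1_nbhd x T2 e2 \<subseteq> V"
        using V x(2) by blast
      from 1 2 show "\<exists>T>0. \<exists>e>0. J1_nbhd x T e \<subseteq> U \<inter> V"
        by (rule int)
    qed
  next
    fix K
    assume K: "\<forall>U\<in>K. U \<subseteq> skorokhod_D \<and> (\<forall>x\<in>U. \<exists>T>0. \<exists>e>0. J1_nbhd x T e \<subseteq> U)"
    then show "\<Union>K \<subseteq> skorokhod_D" by blast
    show "\<forall>x\<in>\<Union>K. \<exists>T>0. \<exists>e>0. J1_nbhd x T e \<subseteq> \<Union>K"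
    proof
      fix x assume "x \<in> \<Union>K"
      then obtain U where U: "U \<in> K" "x \<in> U" by blast
      with K obtain T e where "T > 0" "e > 0" "J1_nbhd x T e \<subseteq> U" by blast
      with U show "\<exists>T>0. \<exists>e>0. J1_nbhd x T e \<subseteq> \<Union>K" by blast
    qed
  qed
qed

lemma openin_J1:
  "openin J1_topology U \<longleftrightarrow> U \<subseteq> skorokhod_D \<and> (\<forall>x\<in>U. \<exists>T>0. \<exists>e>0. J1_nbhd x T e \<subseteq> U)"
  unfolding J1_topology_def by (simp add: topology_inverse'[OF istopology_J1])

lemma topspace_J1: "topspace J1_topology = skorokhod_D"
proof -
  have "\<exists>T>0. \<exists>e>0. J1_nbhd x T e \<subseteq> skorokhod_D" for x
    by (rule exI[of _ 1], simp, rule exI[of _ 1]) (auto simp: J1_nbhd_def)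
  then have "openin J1_topology skorokhod_D"
    by (simp add: openin_J1)
  then show ?thesis
    using openin_topspace[of J1_topology] openin_subset[of J1_topology skorokhod_D]
    unfolding openin_J1 by blast
qed

section \<open>Weak convergence of random elements\<close>

definition borel_of :: "'a topology \<Rightarrow> 'a measure" where
  "borel_of T = sigma (topspace T) {U. openin T U}"

text \<open>A path that is an element of the space only almost surely (as the supremum process below)
  is identified with any everywhere defined random element to which it is almost surely equal.\<close>

definition random_element_version ::
    "'w measure \<Rightarrow> 'a topology \<Rightarrow> ('w \<Rightarrow> 'a) \<Rightarrow> ('w \<Rightarrow> 'a) \<Rightarrow> bool" where
  "random_element_version P T Z Z' \<longleftrightarrow> Z' \<in> measurable P (borel_of T) \<and> (AE \<omega> in P. Z' \<omega> = Z \<omega>)"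

definition converges_weakly ::
    "'a topology \<Rightarrow> 'w measure \<Rightarrow> (nat \<Rightarrow> 'w \<Rightarrow> 'a) \<Rightarrow> 'v measure \<Rightarrow> ('v \<Rightarrow> 'a) \<Rightarrow> bool" where
  "converges_weakly T P Z S W \<longleftrightarrow>
     (\<exists>Z' W'. (\<forall>n. random_element_version P T (Z n) (Z' n)) \<and> random_element_version S T W W' \<and>
        (\<forall>f. continuous_map T euclideanreal f \<and> bounded (f ` topspace T) \<longrightarrow>
           (\<lambda>n. \<integral>\<omega>. f (Z' n \<omega>) \<partial>P) \<longlonglongrightarrow> (\<integral>\<omega>. f (W' \<omega>) \<partial>S)))"

section \<open>Poisson random measures and the limit process\<close>

definition sum_dirac :: "'e measure \<Rightarrow> (nat \<Rightarrow> 'e) \<Rightarrow> 'e measure" where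
  "sum_dirac E p = distr (count_space UNIV) E p"

lemma emeasure_sum_dirac:
  assumes "\<And>k. p k \<in> space E" and A: "A \<in> sets E"
  shows "emeasure (sum_dirac E p) A = (\<Sum>k. emeasure (return E (p k)) A)"
proof -
  have "p \<in> measurable (count_space UNIV) E"
    using assms by auto
  then have "emeasure (sum_dirac E p) A = emeasure (count_space UNIV) (p -` A)"
    unfolding sum_dirac_def using A by (subst emeasure_distr) auto
  also have "\<dots> = (\<integral>\<^sup>+k. indicator (p -` A) k \<partial>count_space UNIV)"
    by simp
  also have "\<dots> = (\<Sum>k. indicator (p -` A) k)"
    by (rule nn_integral_count_space_nat)
  also have "\<dots> = (\<Sum>k. emeasure (return E (p k)) A)"
    using A by (simp add: emeasure_return indicator_def)
  finally show ?thesis .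
qed

text \<open>\<open>poisson_pmf\<close> is not used below because it is unspecified for rate \<open>0\<close>.\<close>

definition poisson_random_measure ::
    "'w measure \<Rightarrow> 'e measure \<Rightarrow> ('w \<Rightarrow> 'e measure) \<Rightarrow> bool" where
  "poisson_random_measure S E N \<longleftrightarrow>
     (\<forall>\<omega>\<in>space S. sets (N \<omega>) = sets E) \<and>
     (\<forall>A\<in>sets E. (\<lambda>\<omega>. emeasure (N \<omega>) A) \<in> borel_measurable S) \<and>
     (\<forall>A\<in>sets E. emeasure E A < \<infinity> \<longrightarrow>
        (\<forall>n::nat. measure S {\<omega>\<in>space S. emeasure (N \<omega>) A = of_nat n} =
           measure E A ^ n / fact n * exp (- measure E A))) \<and>
     (\<forall>A\<in>sets E. emeasure E A = \<infinity> \<longrightarrow> (AE \<omega> in S. emeasure (N \<omega>) A = \<infinity>)) \<and>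
     (\<forall>I (A :: nat \<Rightarrow> 'e set). finite I \<and> A ` I \<subseteq> sets E \<and> disjoint_family_on A I \<longrightarrow>
        prob_space.indep_vars S (\<lambda>_. borel) (\<lambda>i \<omega>. emeasure (N \<omega>) (A i)) I)"

text \<open>The supremum is formed in the extended reals, since the \<open>j k\<close> may be \<open>\<infinity>\<close>.\<close>

definition sup_process :: "(nat \<Rightarrow> real) \<Rightarrow> (nat \<Rightarrow> ereal) \<Rightarrow> real \<Rightarrow> real" where
  "sup_process t j = (\<lambda>s\<in>{0..}.
     if {k. t k \<le> s} = {} then 0 else real_of_ereal (SUP k\<in>{k. t k \<le> s}. j k))"

text \<open>Here \<open>ln 0 = 0\<close>; the process is used only when \<open>z k \<noteq> 0\<close> almost surely for all \<open>k \<ge> 1\<close>.\<close>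

definition scaled_log_path :: "(nat \<Rightarrow> real) \<Rightarrow> (nat \<Rightarrow> real) \<Rightarrow> nat \<Rightarrow> real \<Rightarrow> real" where
  "scaled_log_path b z n = (\<lambda>s\<in>{0..}. ln \<bar>z (nat \<lfloor>real n * s\<rfloor> + 1)\<bar> / b n)"

end

theory Submission
  imports Defs
begin

text \<open>
  Write \<open>\<Pi>\<^sub>k = M\<^sub>1 \<dots> M\<^sub>k\<close>. Both \<open>Y\<^sub>k\<close> and \<open>X\<^sub>k\<close> are sums \<open>c\<^sub>0 + (\<Sum>i\<le>k. c\<^sub>i Q\<^sub>i)\<close>, where \<open>c\<^sub>i\<close> is
  \<open>\<Pi>\<close> at \<open>i - 1\<close> for \<open>Y\<close> and \<open>\<Pi>\<^sub>k / \<Pi>\<^sub>i\<close> for \<open>X\<close>. For all indices up to a multiple of \<open>n\<close> the numbers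
  \<open>ln \<bar>c\<^sub>i\<bar>\<close> are \<open>o(b\<^sub>n)\<close> in probability: \<open>\<Pi>\<close> is bounded because it tends to \<open>0\<close>, and the sum of the
  \<open>log\<^sup>- \<bar>M\<^sub>i\<bar>\<close> is small by Markov's inequality for the truncated summands, since
  \<open>n E(log\<^sup>- \<bar>M\<bar> \<and> b\<^sub>n) / b\<^sub>n \<rightarrow> 0\<close> (\<open>neg_part_small\<close>). If \<open>E log\<^sup>- \<bar>M\<bar>\<close> is finite this limit holds because
  \<open>x P(log \<bar>Q\<bar> > x) \<rightarrow> \<infinity>\<close>; otherwise it is what the assumption on \<open>M\<close> says. On the scale \<open>b\<^sub>n\<close> the
  logarithm of such a sum should therefore be the record \<open>max\<^sub>i (ln \<bar>Q\<^sub>i\<bar>)\<^sup>+\<close>, and the records converge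
  to the running supremum of Poisson points. Two effects could destroy this.

  Large terms could cancel. With high probability they do not: two values \<open>ln \<bar>Q\<^sub>i\<bar> / b\<^sub>n\<close> that exceed a
  positive level differ by at least a small constant (\<open>gap_event\<close>), so that the largest term exceeds
  the sum of all others exponentially (\<open>log_sum_near_max\<close>).

  As long as no \<open>Q\<^sub>i\<close> is large, the sum could come within \<open>exp (- \<epsilon> b\<^sub>n)\<close> of \<open>0\<close> without being \<open>0\<close>. This is
  the main difficulty, since the law of \<open>(M, Q)\<close> is arbitrary and need not be smooth; \<open>no_dip\<close>
  excludes it by an anti-concentration bound that rests on exchangeability. Swapping
  the pairs with indices \<open>s + 1\<close> and \<open>s + 2\<close> preserves the joint law and \<open>\<Pi>\<^sub>k\<close>, and it changes \<open>Y\<^sub>k\<close> by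
  \<open>\<Pi>\<^sub>s\<close> times \<open>Q\<^sub>1(1 - M\<^sub>2) - Q\<^sub>2(1 - M\<^sub>1)\<close>, evaluated at the two pairs. That factor is not almost surely \<open>0\<close>:
  otherwise all \<open>Q\<^sub>j\<close> would be the same multiple of \<open>1 - M\<^sub>j\<close>, a huge \<open>Q\<^sub>j\<close> would come with a huge \<open>M\<^sub>j\<close>,
  and \<open>\<Pi>\<close> could not tend to \<open>0\<close> (\<open>swap_gap_not_zero\<close>). If \<open>L\<close> slots \<open>s\<close> are chosen at which the walk
  \<open>ln \<bar>\<Pi>\<^sub>s\<bar>\<close> takes well separated values, the possible changes form a lacunary family, and at most one
  choice of swaps in the nondegenerate slots brings the sum close to a given point. Averaging over all
  swaps bounds the probability by a power with exponent \<open>L\<close> (\<open>anti_concentration\<close>). The walk tends to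
  \<open>-\<infinity>\<close>, so its expected number of visits to a bounded set is finite; hence for \<open>k\<close> in a dyadic
  interval one can take \<open>L\<close> of order \<open>log k\<close> slots that are separated outside an event of summable
  probability, and a union bound over \<open>k\<close> applies. The sequence \<open>X\<close> is covered by the same bound because
  \<open>X\<^sub>k\<close> is \<open>\<Pi>\<^sub>k\<close> times the sum of \<open>X\<^sub>0\<close> and a perpetuity of the pairs \<open>(1/M\<^sub>i, Q\<^sub>i/M\<^sub>i)\<close>.

  For the convergence in \<open>J\<^sub>1\<close>, cut time into blocks of length \<open>1/m\<close> and replace the maximum over each
  block by a multiple of \<open>\<eta>\<close>. If no block contains two points above \<open>\<eta>\<close>, a piecewise linear change of
  time moves the large jumps onto the grid, so the running supremum is close to a step path on
  the grid (\<open>running_sup_near_grid_path\<close>). Such step paths take finitely many values; their laws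
  converge because the event that all block maxima stay below given levels says that a region contains no
  point, and its probability is explicit both for the Poisson points and for the sample
  (\<open>block_levels_prob\<close>, \<open>block_levels_obs_tendsto\<close>). Convergence of the laws of finite-valued
  approximations implies weak convergence (\<open>converges_weakly_J1I\<close>).
\<close>

section \<open>Neighbourhoods in the \<open>J\<^sub>1\<close>-topology\<close>

text \<open>Continuity comes for free: an increasing surjection has no jumps.\<close>

lemma time_changesI:
  assumes mono: "strict_mono_on {0..} h" and onto: "h ` {0..} = {0..}"
  shows "h \<in> time_changes"
proof -
  define g where "g s = (if s < 0 then s else h s)" for s :: real
  have h0: "h s \<ge> 0" if "s \<ge> 0" for s using onto that by auto
  have "g x \<le> g y" if "x \<le> y" for x y
    using that h0[of y] strict_mono_onD[OF mono, of x y] by (cases "x = y") (auto simp: g_def less_le)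
  moreover have "range g = UNIV"
  proof -
    have "y \<in> range g" for y
    proof (cases "y < 0")
      case True then show ?thesis by (intro image_eqI[of _ _ y]) (auto simp: g_def)
    next
      case False
      then obtain s where "s \<ge> 0" "y = h s" using onto by (metis atLeast_iff imageE not_less)
      then show ?thesis by (intro image_eqI[of _ _ s]) (auto simp: g_def)
    qed
    then show ?thesis by auto
  qed
  ultimately have "continuous_on UNIV g" by (intro continuous_onI_mono) auto
  then have "continuous_on {0..} g" by (rule continuous_on_subset) simp
  then have "continuous_on {0..} h" by (rule continuous_on_eq) (auto simp: g_def)
  with assms show ?thesis by (simp add: time_changes_def)
qed

lemma time_changes_nonneg: "h \<in> time_changes \<Longrightarrow> s \<ge> 0 \<Longrightarrow> h s \<ge> 0"
  by (auto simp: time_changes_def)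

lemma time_changes_id: "(\<lambda>s. s) \<in> time_changes"
  by (rule time_changesI) (auto simp: strict_mono_on_def)

lemma time_changes_compose:
  assumes "h \<in> time_changes" "g \<in> time_changes"
  shows "(\<lambda>s. g (h s)) \<in> time_changes"
proof (rule time_changesI)
  show "strict_mono_on {0..} (\<lambda>s. g (h s))"
    using assms time_changes_nonneg[OF assms(1)] by (auto simp: monotone_on_def time_changes_def)
  have "(\<lambda>s. g (h s)) ` {0..} = g ` (h ` {0..})" by (simp add: image_image)
  with assms show "(\<lambda>s. g (h s)) ` {0..} = {0..}" by (simp add: time_changes_def)
qed

lemma time_changes_inverse:
  assumes h: "h \<in> time_changes"
  obtains g where "g \<in> time_changes" "\<And>s. s \<ge> 0 \<Longrightarrow> h (g s) = s" "\<And>s. s \<ge> 0 \<Longrightarrow> g (h s) = s"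
proof -
  have mono: "strict_mono_on {0..} h" and onto: "h ` {0..} = {0..}"
    using h by (auto simp: time_changes_def)
  define g where "g = inv_into {0..} h"
  have inj: "inj_on h {0..}" using mono by (rule strict_mono_on_imp_inj_on)
  have hg: "h (g s) = s" "g s \<ge> 0" if "s \<ge> 0" for s
  proof -
    have s: "s \<in> h ` {0..}" using that onto by simp
    show "h (g s) = s" unfolding g_def using s by (rule f_inv_into_f)
    show "g s \<ge> 0" unfolding g_def using inv_into_into[OF s] by simp
  qed
  have gh: "g (h s) = s" if "s \<ge> 0" for s
    unfolding g_def using inj that by (intro inv_into_f_f) auto
  have "g \<in> time_changes"
  proof (rule time_changesI)
    show "strict_mono_on {0..} g"
    proof (rule strict_mono_onI)
      fix r s :: real assume rs: "r \<in> {0..}" "s \<in> {0..}" "r < s"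
      show "g r < g s"
      proof (rule ccontr)
        assume "\<not> g r < g s"
        then have "g s \<le> g r" by simp
        moreover have "g r \<in> {0..}" "g s \<in> {0..}" using hg(2)[of r] hg(2)[of s] rs(1,2) by auto
        ultimately have "h (g s) \<le> h (g r)" by (intro strict_mono_on_leD[OF mono])
        with hg(1)[of r] hg(1)[of s] rs show False by simp
      qed
    qed
    show "g ` {0..} = {0..}"
    proof
      show "g ` {0..} \<subseteq> {0..}" using hg by auto
      show "{0..} \<subseteq> g ` {0..}"
      proof
        fix s :: real assume "s \<in> {0..}"
        then show "s \<in> g ` {0..}" using gh[of s] time_changes_nonneg[OF h, of s]
          by (intro image_eqI[of _ _ "h s"]) auto
      qed
    qed
  qed
  then show thesis by (rule that[OF _ hg(1) gh])
qed

lemma J1_nbhd_subset: "J1_nbhd x T e \<subseteq> skorokhod_D"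
  by (auto simp: J1_nbhd_def)

lemma J1_nbhdI:
  assumes "y \<in> skorokhod_D" "h \<in> time_changes" "\<And>s. s \<ge> 0 \<Longrightarrow> \<bar>h s - s\<bar> < e"
    and "\<And>s. 0 \<le> s \<Longrightarrow> s \<le> T \<Longrightarrow> \<bar>y (h s) - x s\<bar> < e"
  shows "y \<in> J1_nbhd x T e"
  unfolding J1_nbhd_def by (intro CollectI conjI assms(1) bexI[OF _ assms(2)]) (use assms in auto)

lemma J1_nbhd_uniform:
  assumes "y \<in> skorokhod_D" "e > 0" "\<And>s. 0 \<le> s \<Longrightarrow> s \<le> T \<Longrightarrow> \<bar>y s - x s\<bar> < e"
  shows "y \<in> J1_nbhd x T e"
  by (rule J1_nbhdI[OF assms(1) time_changes_id]) (use assms in auto)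

lemma J1_nbhd_self: "x \<in> skorokhod_D \<Longrightarrow> e > 0 \<Longrightarrow> x \<in> J1_nbhd x T e"
  by (rule J1_nbhd_uniform) auto

text \<open>The base sets obey a triangle inequality at the price of a longer horizon: the first time
  change may move \<open>T\<close> to a point below \<open>T + e\<close>, up to which the second approximation is needed.\<close>

lemma J1_nbhd_trans:
  assumes y: "y \<in> J1_nbhd x T e" and z: "z \<in> J1_nbhd y T' e'" and T': "T + e \<le> T'"
  shows "z \<in> J1_nbhd x T (e + e')"
proof -
  obtain h where h: "h \<in> time_changes" "\<And>s. s \<ge> 0 \<Longrightarrow> \<bar>h s - s\<bar> < e"
    "\<And>s. 0 \<le> s \<Longrightarrow> s \<le> T \<Longrightarrow> \<bar>y (h s) - x s\<bar> < e"
    using y unfolding J1_nbhd_def by auto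
  obtain g where g: "g \<in> time_changes" "\<And>s. s \<ge> 0 \<Longrightarrow> \<bar>g s - s\<bar> < e'"
    "\<And>s. 0 \<le> s \<Longrightarrow> s \<le> T' \<Longrightarrow> \<bar>z (g s) - y s\<bar> < e'" and zD: "z \<in> skorokhod_D"
    using z unfolding J1_nbhd_def by auto
  have "\<bar>g (h s) - s\<bar> < e + e'" if "s \<ge> 0" for s
    using h(2)[of s] g(2)[of "h s"] time_changes_nonneg[OF h(1), of s] that by linarith
  moreover have "\<bar>z (g (h s)) - x s\<bar> < e + e'" if "0 \<le> s" "s \<le> T" for s
    using h(2,3)[of s] g(3)[of "h s"] time_changes_nonneg[OF h(1), of s] that T' by linarith
  ultimately show ?thesis
    by (rule J1_nbhdI[OF zD time_changes_compose[OF h(1) g(1)]])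
qed

text \<open>Invert the time change; the horizon shrinks because the inverse may move a time by \<open>e\<close>.\<close>

lemma J1_nbhd_sym:
  assumes x: "x \<in> skorokhod_D" and y: "y \<in> J1_nbhd x T e" and T': "T' + e \<le> T"
  shows "x \<in> J1_nbhd y T' e"
proof -
  obtain h where h: "h \<in> time_changes" "\<And>s. s \<ge> 0 \<Longrightarrow> \<bar>h s - s\<bar> < e"
    "\<And>s. 0 \<le> s \<Longrightarrow> s \<le> T \<Longrightarrow> \<bar>y (h s) - x s\<bar> < e"
    using y unfolding J1_nbhd_def by auto
  obtain g where g: "g \<in> time_changes" "\<And>s. s \<ge> 0 \<Longrightarrow> h (g s) = s"
    using time_changes_inverse[OF h(1)] by metis
  have close: "\<bar>g s - s\<bar> < e" if "s \<ge> 0" for s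
    using h(2)[of "g s"] g(2)[OF that] time_changes_nonneg[OF g(1) that] by linarith
  moreover have "\<bar>x (g s) - y s\<bar> < e" if "0 \<le> s" "s \<le> T'" for s
    using h(3)[of "g s"] g(2)[of s] close[of s] time_changes_nonneg[OF g(1), of s] that T'
    by (auto simp: abs_minus_commute)
  ultimately show ?thesis by (rule J1_nbhdI[OF x g(1)])
qed

text \<open>The sets \<open>J1_nbhd x T e\<close> need not be open. This is the interior of \<open>A\<close>, written with the base so
  that membership can be checked with a single neighbourhood.\<close>

definition J1_interior :: "(real \<Rightarrow> real) set \<Rightarrow> (real \<Rightarrow> real) set" where
  "J1_interior A = {x \<in> skorokhod_D. \<exists>T>0. \<exists>e>0. J1_nbhd x T e \<subseteq> A}"

lemma J1_interiorI:
  "x \<in> skorokhod_D \<Longrightarrow> T > 0 \<Longrightarrow> e > 0 \<Longrightarrow> J1_nbhd x T e \<subseteq> A \<Longrightarrow> x \<in> J1_interior A"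
  by (auto simp: J1_interior_def)

lemma J1_interior_subset: "J1_interior A \<subseteq> A"
proof
  fix x assume "x \<in> J1_interior A"
  then obtain T e where "x \<in> skorokhod_D" "e > 0" "J1_nbhd x T e \<subseteq> A" by (auto simp: J1_interior_def)
  then show "x \<in> A" using J1_nbhd_self by blast
qed

lemma J1_interior_mono: assumes "A \<subseteq> B" shows "J1_interior A \<subseteq> J1_interior B"
proof
  fix x assume "x \<in> J1_interior A"
  with assms obtain T e where "x \<in> skorokhod_D" "T > 0" "e > 0" "J1_nbhd x T e \<subseteq> B" by (auto simp: J1_interior_def)
  then show "x \<in> J1_interior B" by (rule J1_interiorI)
qed

lemma openin_J1_interior: "openin J1_topology (J1_interior A)"
  unfolding openin_J1
proof (intro conjI ballI)
  fix x assume "x \<in> J1_interior A"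
  then obtain T e where Te: "T > 0" "e > 0" "J1_nbhd x T e \<subseteq> A" by (auto simp: J1_interior_def)
  have "J1_nbhd x T (e/2) \<subseteq> J1_interior A"
  proof
    fix y assume y: "y \<in> J1_nbhd x T (e/2)"
    show "y \<in> J1_interior A"
    proof (rule J1_interiorI[of _ "T + e/2" "e/2"])
      show "J1_nbhd y (T + e/2) (e/2) \<subseteq> A"
      proof
        fix z assume "z \<in> J1_nbhd y (T + e/2) (e/2)"
        from J1_nbhd_trans[OF y this] Te show "z \<in> A" by auto
      qed
    qed (use y J1_nbhd_subset Te in auto)
  qed
  then show "\<exists>T>0. \<exists>e>0. J1_nbhd x T e \<subseteq> J1_interior A"
    using Te(1,2) half_gt_zero by blast
qed (auto simp: J1_interior_def)

lemma space_borel_of [simp]: "space (borel_of T) = topspace T"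
  unfolding borel_of_def by (rule space_measure_of) (auto dest: openin_subset)

lemma measurable_borel_ofI:
  assumes "\<And>\<omega>. \<omega> \<in> space P \<Longrightarrow> V \<omega> \<in> topspace T"
    and "\<And>U. openin T U \<Longrightarrow> {\<omega> \<in> space P. V \<omega> \<in> U} \<in> sets P"
  shows "V \<in> measurable P (borel_of T)"
  unfolding borel_of_def
proof (rule measurable_sigma_sets)
  show "V \<in> space P \<rightarrow> topspace T" using assms(1) by auto
  show "V -` y \<inter> space P \<in> sets P" if "y \<in> {U. openin T U}" for y
  proof -
    have "V -` y \<inter> space P = {\<omega> \<in> space P. V \<omega> \<in> y}" by auto
    then show ?thesis using assms(2)[of y] that by simp
  qed
qed (auto simp: sets_measure_of_conv dest: openin_subset)

lemma measurable_borel_ofD: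
  assumes "V \<in> measurable P (borel_of T)" "openin T U"
  shows "{\<omega> \<in> space P. V \<omega> \<in> U} \<in> sets P"
proof -
  have "U \<in> sets (borel_of T)"
    unfolding borel_of_def using assms(2) by (auto simp: sets_measure_of_conv dest: openin_subset)
  then have "V -` U \<inter> space P \<in> sets P" using assms(1) by (rule measurable_sets[rotated])
  moreover have "V -` U \<inter> space P = {\<omega> \<in> space P. V \<omega> \<in> U}" by auto
  ultimately show ?thesis by simp
qed

lemma continuous_map_measurable_borel_of:
  assumes "continuous_map T euclideanreal f" "V \<in> measurable P (borel_of T)"
  shows "(\<lambda>\<omega>. f (V \<omega>)) \<in> borel_measurable P"
proof (rule borel_measurableI)
  fix B :: "real set" assume "open B"
  then have "openin T {x \<in> topspace T. f x \<in> B}"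
    using assms(1) by (auto simp: continuous_map_def)
  from measurable_borel_ofD[OF assms(2) this]
  have "{\<omega> \<in> space P. V \<omega> \<in> {x \<in> topspace T. f x \<in> B}} \<in> sets P" .
  moreover have "{\<omega> \<in> space P. V \<omega> \<in> {x \<in> topspace T. f x \<in> B}} = (\<lambda>\<omega>. f (V \<omega>)) -` B \<inter> space P"
    using measurable_space[OF assms(2)] by auto
  ultimately show "(\<lambda>\<omega>. f (V \<omega>)) -` B \<inter> space P \<in> sets P" by simp
qed

text \<open>Limits of random elements are random elements. The proof avoids a metric: \<open>V \<in> U\<close>
  holds iff for some \<open>m\<close> the approximations are eventually in the interior of the set of points whose
  neighbourhood of size \<open>1 / m\<close> lies in \<open>U\<close>, and this is a countable combination of events.\<close>

lemma J1_limit_measurable: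
  fixes G :: "nat \<Rightarrow> 'w \<Rightarrow> real \<Rightarrow> real"
  assumes G: "\<And>k. G k \<in> measurable P (borel_of J1_topology)"
    and lim: "\<And>\<omega> T e. \<omega> \<in> space P \<Longrightarrow> T > 0 \<Longrightarrow> e > 0 \<Longrightarrow>
               \<forall>\<^sub>F k in sequentially. V \<omega> \<in> J1_nbhd (G k \<omega>) T e"
  shows "V \<in> measurable P (borel_of J1_topology)"
proof (rule measurable_borel_ofI)
  have GD: "G k \<omega> \<in> skorokhod_D" if "\<omega> \<in> space P" for k \<omega>
    using measurable_space[OF G that] by (simp add: topspace_J1)
  have VD: "V \<omega> \<in> skorokhod_D" if w: "\<omega> \<in> space P" for \<omega>
  proof -
    have "\<forall>\<^sub>F k in sequentially. V \<omega> \<in> J1_nbhd (G k \<omega>) 1 1" by (rule lim[OF w]) auto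
    then show ?thesis using J1_nbhd_subset unfolding eventually_sequentially by blast
  qed
  then show "V \<omega> \<in> topspace J1_topology" if "\<omega> \<in> space P" for \<omega>
    using that by (simp add: topspace_J1)
  fix U assume U: "openin J1_topology U"
  define I where "I m = J1_interior {x. J1_nbhd x (real (Suc m)) (1 / real (Suc m)) \<subseteq> U}" for m
  have Iopen: "openin J1_topology (I m)" for m unfolding I_def by (rule openin_J1_interior)
  have "V \<omega> \<in> U \<longleftrightarrow> (\<exists>m k0. \<forall>k\<ge>k0. G k \<omega> \<in> I m)" if w: "\<omega> \<in> space P" for \<omega>
  proof
    assume "V \<omega> \<in> U"
    then obtain T e where Te: "T > 0" "e > 0" "J1_nbhd (V \<omega>) T e \<subseteq> U"
      using U by (auto simp: openin_J1)
    obtain m where m: "T + e/2 \<le> real (Suc m)" "1 / real (Suc m) \<le> e/2"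
    proof -
      obtain m where "max (T + e/2) (2/e) < real m" using reals_Archimedean2 by blast
      then have "T + e/2 \<le> real (Suc m)" "2/e \<le> real (Suc m)" by auto
      moreover from this(2) have "1 / real (Suc m) \<le> e/2" using Te by (simp add: field_simps)
      ultimately show thesis using that by blast
    qed
    have *: "J1_nbhd y (real (Suc m)) (1 / real (Suc m)) \<subseteq> U" if "y \<in> J1_nbhd (V \<omega>) T (e/2)" for y
    proof
      fix z assume "z \<in> J1_nbhd y (real (Suc m)) (1 / real (Suc m))"
      then have "z \<in> J1_nbhd (V \<omega>) T (e/2 + 1 / real (Suc m))"
        by (rule J1_nbhd_trans[OF that]) (use m in simp)
      then show "z \<in> U" using J1_nbhd_mono[of T T "e/2 + 1 / real (Suc m)" e "V \<omega>"] m Te by auto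
    qed
    have "\<forall>\<^sub>F k in sequentially. V \<omega> \<in> J1_nbhd (G k \<omega>) (T + e/2 + e/2) (e/4)"
      by (rule lim[OF w]) (use Te in auto)
    then obtain k0 where k0: "\<And>k. k \<ge> k0 \<Longrightarrow> V \<omega> \<in> J1_nbhd (G k \<omega>) (T + e/2 + e/2) (e/4)"
      by (auto simp: eventually_sequentially)
    have "G k \<omega> \<in> I m" if "k \<ge> k0" for k
    proof -
      have G1: "G k \<omega> \<in> J1_nbhd (V \<omega>) T (e/4)"
        by (rule J1_nbhd_sym[OF GD[OF w] k0[OF that]]) (use Te in auto)
      have "J1_nbhd (G k \<omega>) (T + e/4) (e/4) \<subseteq> {x. J1_nbhd x (real (Suc m)) (1 / real (Suc m)) \<subseteq> U}"
      proof
        fix y assume "y \<in> J1_nbhd (G k \<omega>) (T + e/4) (e/4)"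
        from J1_nbhd_trans[OF G1 this] have "y \<in> J1_nbhd (V \<omega>) T (e/2)" by simp
        from *[OF this] show "y \<in> {x. J1_nbhd x (real (Suc m)) (1 / real (Suc m)) \<subseteq> U}" by simp
      qed
      then show ?thesis unfolding I_def using GD[OF w] Te
        by (intro J1_interiorI[of _ "T + e/4" "e/4"]) auto
    qed
    then show "\<exists>m k0. \<forall>k\<ge>k0. G k \<omega> \<in> I m" by blast
  next
    assume "\<exists>m k0. \<forall>k\<ge>k0. G k \<omega> \<in> I m"
    then obtain m k0 where k0: "\<And>k. k \<ge> k0 \<Longrightarrow> G k \<omega> \<in> I m" by blast
    have "\<forall>\<^sub>F k in sequentially. V \<omega> \<in> J1_nbhd (G k \<omega>) (real (Suc m)) (1 / real (Suc m))"
      by (rule lim[OF w]) auto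
    then obtain k where k: "k \<ge> k0" "V \<omega> \<in> J1_nbhd (G k \<omega>) (real (Suc m)) (1 / real (Suc m))"
      unfolding eventually_sequentially by (meson nle_le)
    from k0[OF k(1)] k(2) J1_interior_subset show "V \<omega> \<in> U" unfolding I_def by blast
  qed
  then have "{\<omega> \<in> space P. V \<omega> \<in> U} = (\<Union>m. \<Union>k0. \<Inter>k\<in>{k0..}. {\<omega> \<in> space P. G k \<omega> \<in> I m})"
    by (auto; metis atLeast_iff)
  also have "\<dots> \<in> sets P"
    using measurable_borel_ofD[OF G Iopen] by (intro sets.countable_UN sets.countable_INT'') auto
  finally show "{\<omega> \<in> space P. V \<omega> \<in> U} \<in> sets P" .
qed

lemma step_path_in_D:
  assumes c: "c \<ge> 0"
  shows "(\<lambda>s\<in>{0..}. x (nat \<lfloor>c * s\<rfloor>)) \<in> skorokhod_D"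
proof (cases "c = 0")
  case True
  have "((\<lambda>s\<in>{0..}. x 0) \<longlongrightarrow> x 0) (at_right t)" if "t \<ge> 0" for t :: real
    by (rule tendsto_eventually, rule eventually_mono[OF eventually_at_right_less[of t]]) (use that in auto)
  moreover have "((\<lambda>s\<in>{0..}. x 0) \<longlongrightarrow> x 0) (at_left t)" if "t > 0" for t :: real
    by (rule tendsto_eventually, rule eventually_mono[OF eventually_at_left_real[OF that]]) auto
  ultimately show ?thesis using True by (auto simp: skorokhod_D_def)
next
  case False
  with c have c: "c > 0" by simp
  let ?y = "\<lambda>s\<in>{0..}. x (nat \<lfloor>c * s\<rfloor>)"
  have "(?y \<longlongrightarrow> ?y t) (at_right t)" if t: "t \<ge> 0" for t
  proof (rule tendsto_eventually, rule eventually_mono[OF eventually_at_right_real])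
    have "c * t < of_int \<lfloor>c * t\<rfloor> + 1" by linarith
    then show "t < (of_int \<lfloor>c * t\<rfloor> + 1) / c" using c by (simp add: field_simps)
    fix s assume s: "s \<in> {t<..<(of_int \<lfloor>c * t\<rfloor> + 1) / c}"
    have "c * t \<le> c * s" using s c by simp
    then have "of_int \<lfloor>c * t\<rfloor> \<le> c * s" by linarith
    moreover have "c * s < of_int \<lfloor>c * t\<rfloor> + 1" using s c by (simp add: field_simps)
    ultimately have "\<lfloor>c * s\<rfloor> = \<lfloor>c * t\<rfloor>" by (rule floor_unique)
    then show "?y s = ?y t" using s t by simp
  qed
  moreover have "\<exists>l. (?y \<longlongrightarrow> l) (at_left t)" if t: "t > 0" for t
  proof -
    define k where "k = \<lceil>c * t\<rceil> - 1"
    have k0: "k \<ge> 0" using c t by (simp add: k_def)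
    have "(?y \<longlongrightarrow> x (nat k)) (at_left t)"
    proof (rule tendsto_eventually, rule eventually_mono[OF eventually_at_left_real])
      have "of_int k < c * t" unfolding k_def by linarith
      then show "of_int k / c < t" using c by (simp add: field_simps)
      fix s assume s: "s \<in> {of_int k / c<..<t}"
      have "0 \<le> of_int k / c" using k0 c by simp
      then have "s \<ge> 0" using s by simp
      have "c * s < c * t" using s c by simp
      then have "c * s < of_int k + 1" unfolding k_def by linarith
      moreover have "of_int k \<le> c * s" using s c by (simp add: field_simps)
      ultimately have "\<lfloor>c * s\<rfloor> = k" by (intro floor_unique)
      then show "?y s = x (nat k)" using \<open>s \<ge> 0\<close> by simp
    qed
    then show ?thesis ..
  qed
  ultimately show ?thesis by (auto simp: skorokhod_D_def)
qed

text \<open>The step path depends continuously on its values, for the product topology on sequences: only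
  finitely many of them are seen before time \<open>T\<close>. The Borel sets of that
  topology are generated by the coordinates.\<close>

lemma step_path_measurable:
  fixes z :: "nat \<Rightarrow> 'w \<Rightarrow> real"
  assumes z: "\<And>i. z i \<in> borel_measurable P" and c: "c \<ge> 0"
  shows "(\<lambda>\<omega>. \<lambda>s\<in>{0..}. z (nat \<lfloor>c * s\<rfloor>) \<omega>) \<in> measurable P (borel_of J1_topology)"
proof (rule measurable_borel_ofI)
  define \<phi> :: "(nat \<Rightarrow> real) \<Rightarrow> real \<Rightarrow> real" where "\<phi> u = (\<lambda>s\<in>{0..}. u (nat \<lfloor>c * s\<rfloor>))" for u
  have D: "\<phi> u \<in> skorokhod_D" for u unfolding \<phi>_def by (rule step_path_in_D[OF c])
  show "(\<lambda>s\<in>{0..}. z (nat \<lfloor>c * s\<rfloor>) \<omega>) \<in> topspace J1_topology" for \<omega>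
    using D[of "\<lambda>i. z i \<omega>"] by (simp add: topspace_J1 \<phi>_def)
  fix U assume U: "openin J1_topology U"
  have "open (\<phi> -` U)"
  proof (subst open_subopen, rule ballI)
    fix u assume "u \<in> \<phi> -` U"
    then obtain T e where Te: "T > 0" "e > 0" "J1_nbhd (\<phi> u) T e \<subseteq> U" using U by (auto simp: openin_J1)
    define N where "N = nat \<lfloor>c * T\<rfloor>"
    define B where "B i = (if i \<le> N then {u i - e<..<u i + e} else UNIV)" for i
    have "open (Pi\<^sub>E UNIV B)"
      by (rule open_PiE) (auto simp: B_def intro: finite_subset[of _ "{..N}"])
    moreover have "u \<in> Pi\<^sub>E UNIV B" using Te by (auto simp: B_def)
    moreover have "Pi\<^sub>E UNIV B \<subseteq> \<phi> -` U"
    proof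
      fix v assume v: "v \<in> Pi\<^sub>E UNIV B"
      have "\<phi> v \<in> J1_nbhd (\<phi> u) T e"
      proof (rule J1_nbhd_uniform[OF D Te(2)])
        fix s assume s: "0 \<le> s" "s \<le> T"
        have "nat \<lfloor>c * s\<rfloor> \<le> N" unfolding N_def using s c by (intro nat_mono floor_mono mult_left_mono) auto
        moreover have "v (nat \<lfloor>c * s\<rfloor>) \<in> B (nat \<lfloor>c * s\<rfloor>)" using v by auto
        ultimately show "\<bar>\<phi> v s - \<phi> u s\<bar> < e" using s by (auto simp: B_def \<phi>_def abs_less_iff)
      qed
      with Te show "v \<in> \<phi> -` U" by auto
    qed
    ultimately show "\<exists>T. open T \<and> u \<in> T \<and> T \<subseteq> \<phi> -` U" by blast
  qed
  moreover have "(\<lambda>\<omega> i. z i \<omega>) \<in> borel_measurable P"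
    by (rule measurable_coordinatewise_then_product) (rule z)
  ultimately have "(\<lambda>\<omega> i. z i \<omega>) -` (\<phi> -` U) \<inter> space P \<in> sets P"
    by (intro measurable_sets[of _ P borel]) auto
  moreover have "{\<omega> \<in> space P. (\<lambda>s\<in>{0..}. z (nat \<lfloor>c * s\<rfloor>) \<omega>) \<in> U} = (\<lambda>\<omega> i. z i \<omega>) -` (\<phi> -` U) \<inter> space P"
    by (auto simp: \<phi>_def)
  ultimately show "{\<omega> \<in> space P. (\<lambda>s\<in>{0..}. z (nat \<lfloor>c * s\<rfloor>) \<omega>) \<in> U} \<in> sets P" by simp
qed

lemma measurable_finite_J1:
  assumes "G \<in> measurable P (count_space F)" "F \<subseteq> skorokhod_D"
  shows "G \<in> measurable P (borel_of J1_topology)"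
proof (rule measurable_borel_ofI)
  show "G \<omega> \<in> topspace J1_topology" if "\<omega> \<in> space P" for \<omega>
    using measurable_space[OF assms(1) that] assms(2) by (auto simp: topspace_J1)
  fix U assume "openin J1_topology U"
  have "G -` (F \<inter> U) \<inter> space P \<in> sets P" by (rule measurable_sets[OF assms(1)]) auto
  moreover have "{\<omega> \<in> space P. G \<omega> \<in> U} = G -` (F \<inter> U) \<inter> space P"
    using measurable_space[OF assms(1)] by auto
  ultimately show "{\<omega> \<in> space P. G \<omega> \<in> U} \<in> sets P" by simp
qed

section \<open>Weak convergence through finite-valued approximations\<close>

definition J1_close :: "'w measure \<Rightarrow> ('w \<Rightarrow> real \<Rightarrow> real) \<Rightarrow> ('w \<Rightarrow> real \<Rightarrow> real) \<Rightarrow> real \<Rightarrow> real \<Rightarrow> bool" where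
  "J1_close P W G T e \<longleftrightarrow>
     (\<exists>A\<in>sets P. measure P A < e \<and> (\<forall>\<omega>\<in>space P - A. W \<omega> \<in> J1_nbhd (G \<omega>) T e))"

lemma J1_closeI:
  assumes "A \<in> sets P" "measure P A < e" "\<And>\<omega>. \<omega> \<in> space P - A \<Longrightarrow> W \<omega> \<in> J1_nbhd (G \<omega>) T e"
  shows "J1_close P W G T e"
  unfolding J1_close_def using assms by blast

text \<open>A path that is approximable in probability by random elements with discrete targets has a
  measurable version: along approximations with exceptional sets of probability \<open>2\<^sup>-\<^sup>k\<close>, the
  Borel-Cantelli lemma gives convergence almost surely, and limits of random elements are measurable.\<close>

lemma J1_version_exists:
  fixes V :: "'w \<Rightarrow> real \<Rightarrow> real"
  assumes "prob_space P"
    and approx: "\<And>T e. T > 0 \<Longrightarrow> e > 0 \<Longrightarrow>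
      \<exists>F G. F \<subseteq> skorokhod_D \<and> G \<in> measurable P (count_space F) \<and> J1_close P V G T e"
  shows "\<exists>V'. random_element_version P J1_topology V V'"
proof -
  interpret prob_space P by fact
  have "\<exists>F G A. F \<subseteq> skorokhod_D \<and> G \<in> measurable P (count_space F) \<and> A \<in> sets P \<and>
      measure P A < (1/2)^k \<and> (\<forall>\<omega>\<in>space P - A. V \<omega> \<in> J1_nbhd (G \<omega>) (real (Suc k)) ((1/2)^k))" for k :: nat
  proof -
    obtain F G where FG: "F \<subseteq> skorokhod_D" "G \<in> measurable P (count_space F)"
      and "J1_close P V G (real (Suc k)) ((1/2)^k)"
      using approx[of "real (Suc k)" "(1/2)^k"] by auto
    then obtain A where "A \<in> sets P" "measure P A < (1/2)^k"
      "\<forall>\<omega>\<in>space P - A. V \<omega> \<in> J1_nbhd (G \<omega>) (real (Suc k)) ((1/2)^k)"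
      unfolding J1_close_def by blast
    with FG show ?thesis by blast
  qed
  then obtain F G A where F: "\<And>k::nat. F k \<subseteq> skorokhod_D"
    and G: "\<And>k. G k \<in> measurable P (count_space (F k))" and A: "\<And>k. A k \<in> sets P"
    and PA: "\<And>k. measure P (A k) < (1/2)^k"
    and cl: "\<And>k \<omega>. \<omega> \<in> space P - A k \<Longrightarrow> V \<omega> \<in> J1_nbhd (G k \<omega>) (real (Suc k)) ((1/2)^k)"
    by metis
  define N where "N = {\<omega> \<in> space P. \<forall>\<^sub>F k in sequentially. \<omega> \<in> space P - A k}"
  have "N = (\<Union>k0. \<Inter>k\<in>{k0..}. space P - A k)"
    by (auto simp: N_def eventually_sequentially)
  then have N: "N \<in> sets P" using A by (auto intro!: sets.countable_UN sets.countable_INT'')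
  have "norm (measure P (A k)) \<le> (1/2)^k" for k using PA[of k] by simp
  then have "summable (\<lambda>k. measure P (A k))"
    by (intro summable_comparison_test'[OF summable_geometric[of "1/2::real"]]) auto
  then have "AE \<omega> in P. \<forall>\<^sub>F k in sequentially. \<omega> \<in> space P - A k"
    by (intro borel_cantelli_AE1) (use A in \<open>auto simp: less_top[symmetric]\<close>)
  then have AEN: "AE \<omega> in P. \<omega> \<in> N"
    by eventually_elim (auto simp: N_def eventually_sequentially)
  \<comment> \<open>Off the set of convergence the version is the zero path.\<close>
  define z :: "real \<Rightarrow> real" where "z = (\<lambda>s\<in>{0..}. 0)"
  have z: "z \<in> skorokhod_D" using step_path_in_D[of 1 "\<lambda>_. 0"] by (simp add: z_def)
  define V' where "V' \<omega> = (if \<omega> \<in> N then V \<omega> else z)" for \<omega>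
  define G' where "G' k \<omega> = (if \<omega> \<in> N then G k \<omega> else z)" for k \<omega>
  have "V' \<in> measurable P (borel_of J1_topology)"
  proof (rule J1_limit_measurable)
    show "G' k \<in> measurable P (borel_of J1_topology)" for k
      unfolding G'_def using measurable_finite_J1[OF G F] N z
      by (intro measurable_If_set) (auto simp: topspace_J1)
    fix \<omega> and T e :: real assume w: "\<omega> \<in> space P" and Te: "T > 0" "e > 0"
    show "\<forall>\<^sub>F k in sequentially. V' \<omega> \<in> J1_nbhd (G' k \<omega>) T e"
    proof (cases "\<omega> \<in> N")
      case True
      have "(\<lambda>k. (1/2::real)^k) \<longlonglongrightarrow> 0" by (rule LIMSEQ_power_zero) simp
      then have e1: "\<forall>\<^sub>F k in sequentially. (1/2::real)^k < e" using Te(2) by (rule order_tendstoD)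
      have e2: "\<forall>\<^sub>F k in sequentially. T \<le> real k"
        using filterlim_real_sequentially by (auto simp: filterlim_at_top)
      have e3: "\<forall>\<^sub>F k in sequentially. \<omega> \<in> space P - A k" using True unfolding N_def by blast
      from e1 e2 e3 show ?thesis
      proof eventually_elim
        case (elim k)
        have "J1_nbhd (G k \<omega>) (real (Suc k)) ((1/2)^k) \<subseteq> J1_nbhd (G k \<omega>) T e"
          by (rule J1_nbhd_mono) (use elim in auto)
        with cl[OF elim(3)] True show ?case by (auto simp: V'_def G'_def)
      qed
    next
      case False then show ?thesis using J1_nbhd_self[OF z Te(2)] by (simp add: V'_def G'_def)
    qed
  qed
  moreover have "AE \<omega> in P. V' \<omega> = V \<omega>" using AEN by (auto simp: V'_def)
  ultimately show ?thesis unfolding random_element_version_def by blast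
qed

lemma (in prob_space) integral_diff_bound:
  fixes f g :: "'a \<Rightarrow> real"
  assumes f: "f \<in> borel_measurable M" "\<And>\<omega>. \<omega> \<in> space M \<Longrightarrow> \<bar>f \<omega>\<bar> \<le> C"
    and g: "g \<in> borel_measurable M" "\<And>\<omega>. \<omega> \<in> space M \<Longrightarrow> \<bar>g \<omega>\<bar> \<le> C"
    and A: "A \<in> events" "\<And>\<omega>. \<omega> \<in> space M - A \<Longrightarrow> \<bar>f \<omega> - g \<omega>\<bar> \<le> e" and e: "e \<ge> 0"
  shows "\<bar>(\<integral>\<omega>. f \<omega> \<partial>M) - (\<integral>\<omega>. g \<omega> \<partial>M)\<bar> \<le> e + 2 * C * prob A"
proof -
  have if': "integrable M f" by (rule integrable_const_bound[of _ C]) (use f in auto)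
  have ig: "integrable M g" by (rule integrable_const_bound[of _ C]) (use g in auto)
  obtain \<omega>0 where "\<omega>0 \<in> space M" using not_empty by blast
  then have C: "C \<ge> 0" using f(2)[of \<omega>0] by linarith
  have b: "\<bar>f \<omega> - g \<omega>\<bar> \<le> e + 2 * C * indicator A \<omega>" if "\<omega> \<in> space M" for \<omega>
    using f(2)[OF that] g(2)[OF that] A(2)[of \<omega>] that e by (cases "\<omega> \<in> A") auto
  have "\<bar>(\<integral>\<omega>. f \<omega> \<partial>M) - (\<integral>\<omega>. g \<omega> \<partial>M)\<bar> = \<bar>\<integral>\<omega>. f \<omega> - g \<omega> \<partial>M\<bar>"
    using if' ig by simp
  also have "\<dots> \<le> (\<integral>\<omega>. \<bar>f \<omega> - g \<omega>\<bar> \<partial>M)" by (rule integral_abs_bound)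
  also have "\<dots> \<le> (\<integral>\<omega>. e + 2 * C * indicator A \<omega> \<partial>M)"
    by (rule integral_mono) (use if' ig A b in \<open>auto intro!: integrable_add integrable_mult_right integrable_real_indicator simp: less_top[symmetric]\<close>)
  also have "\<dots> = e + 2 * C * prob A"
    using A by (subst Bochner_Integration.integral_add) (auto simp: prob_space less_top[symmetric])
  finally show ?thesis .
qed

lemma expectation_finite_valued:
  fixes f :: "'b \<Rightarrow> real"
  assumes "prob_space P" "finite F" and G: "G \<in> measurable P (count_space F)"
  shows "(\<integral>\<omega>. f (G \<omega>) \<partial>P) = (\<Sum>x\<in>F. f x * measure P {\<omega> \<in> space P. G \<omega> = x})"
proof -
  interpret prob_space P by fact
  have m: "{\<omega> \<in> space P. G \<omega> = x} \<in> events" if "x \<in> F" for x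
    using measurable_sets[OF G, of "{x}"] that by (auto simp: vimage_def Int_def conj_commute)
  have "(\<integral>\<omega>. f (G \<omega>) \<partial>P) = (\<integral>\<omega>. (\<Sum>x\<in>F. f x * indicator {\<omega> \<in> space P. G \<omega> = x} \<omega>) \<partial>P)"
  proof (rule Bochner_Integration.integral_cong[OF refl])
    fix \<omega> assume w: "\<omega> \<in> space P"
    then have "G \<omega> \<in> F" using measurable_space[OF G] by auto
    then have "(\<Sum>x\<in>F. f x * indicator {\<omega> \<in> space P. G \<omega> = x} \<omega>) = (\<Sum>x\<in>{G \<omega>}. f x * indicator {\<omega> \<in> space P. G \<omega> = x} \<omega>)"
      by (intro sum.mono_neutral_right) (auto simp: assms)
    then show "f (G \<omega>) = (\<Sum>x\<in>F. f x * indicator {\<omega> \<in> space P. G \<omega> = x} \<omega>)" using w by simp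
  qed
  also have "\<dots> = (\<Sum>x\<in>F. f x * measure P {\<omega> \<in> space P. G \<omega> = x})"
    by (subst Bochner_Integration.integral_sum) (use m in \<open>auto simp: less_top[symmetric]\<close>)
  finally show ?thesis .
qed

lemma J1_close_AE:
  assumes "prob_space P" and close: "J1_close P V G T e" and ae: "AE \<omega> in P. V' \<omega> = V \<omega>"
  shows "J1_close P V' G T e"
proof -
  interpret prob_space P by fact
  obtain A where A: "A \<in> sets P" "measure P A < e" "\<And>\<omega>. \<omega> \<in> space P - A \<Longrightarrow> V \<omega> \<in> J1_nbhd (G \<omega>) T e"
    using close unfolding J1_close_def by auto
  obtain N where N: "N \<in> null_sets P" "{\<omega> \<in> space P. V' \<omega> \<noteq> V \<omega>} \<subseteq> N"
    using ae unfolding eventually_ae_filter by auto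
  show ?thesis unfolding J1_close_def
  proof (intro bexI conjI ballI)
    show "A \<union> N \<in> sets P" using A N by auto
    show "measure P (A \<union> N) < e" using A N by (simp add: measure_Un_null_set)
    fix \<omega> assume w: "\<omega> \<in> space P - (A \<union> N)"
    then have "V' \<omega> = V \<omega>" using N by auto
    then show "V' \<omega> \<in> J1_nbhd (G \<omega>) T e" using A(3)[of \<omega>] w by auto
  qed
qed

text \<open>Near a fixed random element \<open>V\<close>, a continuous \<open>f\<close> oscillates little on neighbourhoods of one common
  size \<open>1 / k\<close>, except with small probability. Hence \<open>f\<close> varies little on the neighbourhoods of most values
  of the finite-valued \<open>G\<close>; as the laws of the \<open>G\<^sub>n\<close> converge to that of \<open>G\<close>, most values of \<open>G\<^sub>n\<close> have this
  property as well, and it transfers the convergence of the expectations of \<open>f(G\<^sub>n)\<close> to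
  \<open>f(W\<^sub>n)\<close>.\<close>

lemma J1_weak_convergence:
  fixes W :: "nat \<Rightarrow> 'w \<Rightarrow> real \<Rightarrow> real" and V :: "'v \<Rightarrow> real \<Rightarrow> real"
  assumes "prob_space P" "prob_space S"
    and W: "\<And>n. W n \<in> measurable P (borel_of J1_topology)"
    and V: "V \<in> measurable S (borel_of J1_topology)"
    and approx: "\<And>T e. T > 0 \<Longrightarrow> e > 0 \<Longrightarrow> \<exists>F Gn G. finite F \<and> F \<subseteq> skorokhod_D \<and>
       (\<forall>n. Gn n \<in> measurable P (count_space F)) \<and> G \<in> measurable S (count_space F) \<and>
       (\<forall>x\<in>F. (\<lambda>n. measure P {\<omega>\<in>space P. Gn n \<omega> = x}) \<longlonglongrightarrow> measure S {\<omega>\<in>space S. G \<omega> = x}) \<and>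
       (\<forall>\<^sub>F n in sequentially. J1_close P (W n) (Gn n) T e) \<and> J1_close S V G T e"
    and f: "continuous_map J1_topology euclideanreal f" and bdd: "bounded (f ` skorokhod_D)"
  shows "(\<lambda>n. \<integral>\<omega>. f (W n \<omega>) \<partial>P) \<longlonglongrightarrow> (\<integral>\<omega>. f (V \<omega>) \<partial>S)"
proof -
  interpret P: prob_space P by fact
  interpret S: prob_space S by fact
  obtain C where C: "\<And>x. x \<in> skorokhod_D \<Longrightarrow> \<bar>f x\<bar> \<le> C" using bdd by (auto simp: bounded_iff)
  have WD: "W n \<omega> \<in> skorokhod_D" if "\<omega> \<in> space P" for n \<omega>
    using measurable_space[OF W that] by (simp add: topspace_J1)
  have VD: "V \<omega> \<in> skorokhod_D" if "\<omega> \<in> space S" for \<omega>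
    using measurable_space[OF V that] by (simp add: topspace_J1)
  obtain \<omega>0 where "\<omega>0 \<in> space S" using S.not_empty by blast
  then have C0: "C \<ge> 0" using C[OF VD] by (meson abs_ge_zero order_trans)
  note mf = continuous_map_measurable_borel_of[OF f]
  show ?thesis
  proof (rule metric_LIMSEQ_I)
    fix r :: real assume r: "r > 0"
    \<comment> \<open>The errors below add up to less than \<open>5 \<epsilon> + 12 C \<epsilon>\<close>.\<close>
    define \<epsilon> where "\<epsilon> = r / (5 + 12 * C)"
    have \<epsilon>: "\<epsilon> > 0" using r C0 by (simp add: \<epsilon>_def)
    define O' where "O' k = J1_interior {x. \<forall>y\<in>J1_nbhd x (real (Suc k)) (1 / real (Suc k)). \<bar>f y - f x\<bar> \<le> \<epsilon>}" for k
    have O'open: "openin J1_topology (O' k)" for k unfolding O'_def by (rule openin_J1_interior)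
    have inc: "incseq O'"
    proof (rule incseq_SucI)
      show "O' k \<subseteq> O' (Suc k)" for k unfolding O'_def
      proof (rule J1_interior_mono, safe)
        fix x y assume "\<forall>y\<in>J1_nbhd x (real (Suc k)) (1 / real (Suc k)). \<bar>f y - f x\<bar> \<le> \<epsilon>"
          and "y \<in> J1_nbhd x (real (Suc (Suc k))) (1 / real (Suc (Suc k)))"
        moreover have "J1_nbhd x (real (Suc (Suc k))) (1 / real (Suc (Suc k))) \<subseteq> J1_nbhd x (real (Suc k)) (1 / real (Suc k))"
          by (rule J1_nbhd_mono) (auto simp: field_simps)
        ultimately show "\<bar>f y - f x\<bar> \<le> \<epsilon>" by blast
      qed
    qed
    have cover: "\<exists>k. x \<in> O' k" if x: "x \<in> skorokhod_D" for x
    proof -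
      have "openin J1_topology {y \<in> topspace J1_topology. f y \<in> ball (f x) (\<epsilon>/2)}"
        by (rule openin_continuous_map_preimage[OF f]) simp
      moreover have "x \<in> {y \<in> topspace J1_topology. f y \<in> ball (f x) (\<epsilon>/2)}"
        using x \<epsilon> by (simp add: topspace_J1)
      ultimately obtain T e where Te: "T > 0" "e > 0" 
        and "J1_nbhd x T e \<subseteq> {y \<in> topspace J1_topology. f y \<in> ball (f x) (\<epsilon>/2)}"
        unfolding openin_J1 by blast
      then have near: "\<bar>f y - f x\<bar> < \<epsilon>/2" if "y \<in> J1_nbhd x T e" for y
        using that by (auto simp: dist_real_def abs_minus_commute)
      obtain k where k: "T + e/2 \<le> real (Suc k)" "1 / real (Suc k) \<le> e/2"
      proof -
        obtain m where "max (T + e/2) (2/e) < real m" using reals_Archimedean2 by blast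
        then have "T + e/2 \<le> real (Suc m)" "2/e \<le> real (Suc m)" by auto
        moreover from this(2) have "1 / real (Suc m) \<le> e/2" using Te by (simp add: field_simps)
        ultimately show thesis using that by blast
      qed
      have "x \<in> O' k" unfolding O'_def
      proof (rule J1_interiorI[OF x])
        show "T > 0" "e/2 > 0" using Te by auto
        show "J1_nbhd x T (e/2) \<subseteq> {x. \<forall>y\<in>J1_nbhd x (real (Suc k)) (1 / real (Suc k)). \<bar>f y - f x\<bar> \<le> \<epsilon>}"
        proof (safe)
          fix y z assume y: "y \<in> J1_nbhd x T (e/2)" and z: "z \<in> J1_nbhd y (real (Suc k)) (1 / real (Suc k))"
          have "z \<in> J1_nbhd x T (e/2 + 1 / real (Suc k))"
            by (rule J1_nbhd_trans[OF y z]) (use k in simp)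
          moreover have "J1_nbhd x T (e/2 + 1 / real (Suc k)) \<subseteq> J1_nbhd x T e"
            by (rule J1_nbhd_mono) (use k in auto)
          ultimately have "\<bar>f z - f x\<bar> < \<epsilon>/2" using near by blast
          moreover have "\<bar>f y - f x\<bar> < \<epsilon>/2"
            using near y J1_nbhd_mono[of T T "e/2" e x] Te by auto
          ultimately show "\<bar>f z - f y\<bar> \<le> \<epsilon>" by linarith
        qed
      qed
      then show ?thesis ..
    qed
    define E where "E k = {\<omega> \<in> space S. V \<omega> \<in> O' k}" for k
    have E: "E k \<in> sets S" for k unfolding E_def by (rule measurable_borel_ofD[OF V O'open])
    have "(\<lambda>k. measure S (E k)) \<longlonglongrightarrow> measure S (\<Union>k. E k)"
      by (rule S.finite_Lim_measure_incseq) (use E inc in \<open>auto simp: E_def incseq_def\<close>)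
    moreover have "(\<Union>k. E k) = space S" using cover VD by (auto simp: E_def)
    ultimately have "(\<lambda>k. measure S (E k)) \<longlonglongrightarrow> 1" by (simp add: S.prob_space)
    then have "\<forall>\<^sub>F k in sequentially. measure S (E k) > 1 - \<epsilon>" using \<epsilon> by (intro order_tendstoD) auto
    then obtain k where k: "measure S (E k) > 1 - \<epsilon>" by (auto simp: eventually_sequentially)
    define e where "e = min \<epsilon> (1 / (2 * real (Suc k)))"
    define T where "T = real (Suc k) + e"
    have e: "e > 0" "e \<le> \<epsilon>" "2 * e \<le> 1 / real (Suc k)"
    proof -
      show "e > 0" "e \<le> \<epsilon>" using \<epsilon> by (auto simp: e_def)
      have "e \<le> 1 / (2 * real (Suc k))" by (simp add: e_def)
      then show "2 * e \<le> 1 / real (Suc k)" by (simp add: field_simps)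
    qed
    have T: "T > 0" using e by (simp add: T_def)
    obtain F Gn G where F: "finite F" "F \<subseteq> skorokhod_D"
      and Gn: "\<And>n. Gn n \<in> measurable P (count_space F)" and G: "G \<in> measurable S (count_space F)"
      and lim: "\<And>x. x\<in>F \<Longrightarrow> (\<lambda>n. measure P {\<omega>\<in>space P. Gn n \<omega> = x}) \<longlonglongrightarrow> measure S {\<omega>\<in>space S. G \<omega> = x}"
      and clW: "\<forall>\<^sub>F n in sequentially. J1_close P (W n) (Gn n) T e" and clV: "J1_close S V G T e"
      using approx[OF T e(1)] by (elim exE conjE) (rule that, assumption+, erule spec, assumption, erule (1) bspec, assumption+)
    note GnJ = measurable_finite_J1[OF Gn F(2)] and GJ = measurable_finite_J1[OF G F(2)]
    have GF: "G \<omega> \<in> F" if "\<omega> \<in> space S" for \<omega> using measurable_space[OF G that] by simp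
    have GnF: "Gn n \<omega> \<in> F" if "\<omega> \<in> space P" for n \<omega> using measurable_space[OF Gn that] by simp
    \<comment> \<open>the values near which \<open>f\<close> varies little\<close>
    define F' where "F' = {x \<in> F. \<forall>y\<in>J1_nbhd x T e. \<bar>f y - f x\<bar> \<le> 2 * \<epsilon>}"
    obtain B where B: "B \<in> sets S" "measure S B < e" "\<And>\<omega>. \<omega> \<in> space S - B \<Longrightarrow> V \<omega> \<in> J1_nbhd (G \<omega>) T e"
      using clV unfolding J1_close_def by blast
    have good: "G \<omega> \<in> F' \<and> \<bar>f (V \<omega>) - f (G \<omega>)\<bar> \<le> \<epsilon>" if w: "\<omega> \<in> space S - (B \<union> (space S - E k))" for \<omega>
    proof -
      have ws: "\<omega> \<in> space S" and wE: "V \<omega> \<in> O' k" using w by (auto simp: E_def)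
      have GD: "G \<omega> \<in> skorokhod_D" using GF[OF ws] F by auto
      have G1: "G \<omega> \<in> J1_nbhd (V \<omega>) (real (Suc k)) e"
        by (rule J1_nbhd_sym[OF GD B(3)]) (use w T_def in auto)
      have sub: "J1_nbhd (V \<omega>) (real (Suc k)) (e + e) \<subseteq> J1_nbhd (V \<omega>) (real (Suc k)) (1 / real (Suc k))"
        by (rule J1_nbhd_mono) (use e in auto)
      have sub': "J1_nbhd (V \<omega>) (real (Suc k)) e \<subseteq> J1_nbhd (V \<omega>) (real (Suc k)) (e + e)"
        by (rule J1_nbhd_mono) (use e in auto)
      have "V \<omega> \<in> {x. \<forall>y\<in>J1_nbhd x (real (Suc k)) (1 / real (Suc k)). \<bar>f y - f x\<bar> \<le> \<epsilon>}"
        using wE J1_interior_subset unfolding O'_def by (rule rev_subsetD)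
      then have osc: "\<bar>f y - f (V \<omega>)\<bar> \<le> \<epsilon>" if "y \<in> J1_nbhd (V \<omega>) (real (Suc k)) (e + e)" for y
        using subsetD[OF sub that] by simp
      have o1: "\<bar>f (G \<omega>) - f (V \<omega>)\<bar> \<le> \<epsilon>" by (rule osc[OF subsetD[OF sub' G1]])
      have "\<bar>f y - f (G \<omega>)\<bar> \<le> 2 * \<epsilon>" if y: "y \<in> J1_nbhd (G \<omega>) T e" for y
      proof -
        have "y \<in> J1_nbhd (V \<omega>) (real (Suc k)) (e + e)"
          by (rule J1_nbhd_trans[OF G1 y]) (simp add: T_def)
        from osc[OF this] o1 show ?thesis by linarith
      qed
      then show ?thesis using GF[OF ws] o1 by (auto simp: F'_def)
    qed
    have PB: "measure S (B \<union> (space S - E k)) \<le> 2 * \<epsilon>"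
    proof -
      have "measure S (B \<union> (space S - E k)) \<le> measure S B + measure S (space S - E k)"
        by (rule measure_Un_le) (use B E in auto)
      also have "measure S (space S - E k) = 1 - measure S (E k)" by (rule S.prob_compl[OF E])
      finally show ?thesis using k B e by linarith
    qed
    have "\<bar>(\<integral>\<omega>. f (V \<omega>) \<partial>S) - (\<integral>\<omega>. f (G \<omega>) \<partial>S)\<bar> \<le> \<epsilon> + 2 * C * measure S (B \<union> (space S - E k))"
      by (rule S.integral_diff_bound) (use mf[OF V] mf[OF GJ] VD GF F C B E good \<epsilon> in auto)
    also have "\<dots> \<le> \<epsilon> + 2 * C * (2 * \<epsilon>)" using PB C0 by (intro add_left_mono mult_left_mono) auto
    finally have b1: "\<bar>(\<integral>\<omega>. f (V \<omega>) \<partial>S) - (\<integral>\<omega>. f (G \<omega>) \<partial>S)\<bar> \<le> \<epsilon> + 4 * C * \<epsilon>" by simp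
    have evG: "{\<omega> \<in> space P. Gn n \<omega> \<in> F'} \<in> sets P" for n
    proof -
      have "Gn n -` F' \<inter> space P \<in> sets P" by (rule measurable_sets[OF Gn]) (auto simp: F'_def)
      moreover have "{\<omega> \<in> space P. Gn n \<omega> \<in> F'} = Gn n -` F' \<inter> space P" by auto
      ultimately show ?thesis by simp
    qed
    have GF'_sum: "measure Q {\<omega> \<in> space Q. H \<omega> \<in> F'} = (\<Sum>x\<in>F'. measure Q {\<omega> \<in> space Q. H \<omega> = x})"
      if "prob_space Q" and H: "H \<in> measurable Q (count_space F)" for Q :: "'z measure" and H
    proof -
      interpret Q: prob_space Q by fact
      have m: "{\<omega> \<in> space Q. H \<omega> = x} \<in> sets Q" if "x \<in> F" for x
        using measurable_sets[OF H, of "{x}"] that by (auto simp: vimage_def Int_def conj_commute)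
      have "{\<omega> \<in> space Q. H \<omega> \<in> F'} = (\<Union>x\<in>F'. {\<omega> \<in> space Q. H \<omega> = x})" by auto
      then show ?thesis using m F
        by (simp, intro Q.finite_measure_finite_Union) (auto simp: F'_def disjoint_family_on_def)
    qed
    have "measure S {\<omega> \<in> space S. G \<omega> \<in> F'} \<ge> measure S (space S - (B \<union> (space S - E k)))"
    proof (rule S.finite_measure_mono)
      have "G -` F' \<inter> space S \<in> sets S" by (rule measurable_sets[OF G]) (auto simp: F'_def)
      moreover have "{\<omega> \<in> space S. G \<omega> \<in> F'} = G -` F' \<inter> space S" by auto
      ultimately show "{\<omega> \<in> space S. G \<omega> \<in> F'} \<in> sets S" by simp
    qed (use good in auto)
    moreover have "measure S (space S - (B \<union> (space S - E k))) = 1 - measure S (B \<union> (space S - E k))"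
      by (rule S.prob_compl) (use B E in auto)
    ultimately have PG: "measure S {\<omega> \<in> space S. G \<omega> \<in> F'} \<ge> 1 - 2 * \<epsilon>" using PB by linarith
    have "(\<lambda>n. measure P {\<omega> \<in> space P. Gn n \<omega> \<in> F'}) \<longlonglongrightarrow> measure S {\<omega> \<in> space S. G \<omega> \<in> F'}"
      unfolding GF'_sum[OF \<open>prob_space P\<close> Gn] GF'_sum[OF \<open>prob_space S\<close> G]
      by (rule tendsto_sum) (auto simp: F'_def intro: lim)
    then have ev1: "\<forall>\<^sub>F n in sequentially. measure P {\<omega> \<in> space P. Gn n \<omega> \<in> F'} > 1 - 3 * \<epsilon>"
      by (rule order_tendstoD) (use PG \<epsilon> in linarith)
    have "(\<lambda>n. \<integral>\<omega>. f (Gn n \<omega>) \<partial>P) \<longlonglongrightarrow> (\<integral>\<omega>. f (G \<omega>) \<partial>S)"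
      unfolding expectation_finite_valued[OF \<open>prob_space P\<close> F(1) Gn] expectation_finite_valued[OF \<open>prob_space S\<close> F(1) G]
      by (intro tendsto_sum tendsto_mult tendsto_const lim)
    then have ev2: "\<forall>\<^sub>F n in sequentially. \<bar>(\<integral>\<omega>. f (Gn n \<omega>) \<partial>P) - (\<integral>\<omega>. f (G \<omega>) \<partial>S)\<bar> < \<epsilon>"
      using \<epsilon> by (auto simp: tendsto_iff dist_real_def)
    have "\<forall>\<^sub>F n in sequentially. \<bar>(\<integral>\<omega>. f (W n \<omega>) \<partial>P) - (\<integral>\<omega>. f (V \<omega>) \<partial>S)\<bar> < r"
      using ev1 ev2 clW
    proof eventually_elim
      case (elim n)
      obtain A where A: "A \<in> sets P" "measure P A < e" "\<And>\<omega>. \<omega> \<in> space P - A \<Longrightarrow> W n \<omega> \<in> J1_nbhd (Gn n \<omega>) T e"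
        using elim(3) unfolding J1_close_def by auto
      let ?A = "A \<union> (space P - {\<omega> \<in> space P. Gn n \<omega> \<in> F'})"
      have "measure P ?A \<le> measure P A + measure P (space P - {\<omega> \<in> space P. Gn n \<omega> \<in> F'})"
        by (rule measure_Un_le) (use A evG in auto)
      also have "measure P (space P - {\<omega> \<in> space P. Gn n \<omega> \<in> F'}) = 1 - measure P {\<omega> \<in> space P. Gn n \<omega> \<in> F'}"
        by (rule P.prob_compl[OF evG])
      finally have PA: "measure P ?A \<le> 4 * \<epsilon>" using elim(1) A e by linarith
      have gd: "\<bar>f (W n \<omega>) - f (Gn n \<omega>)\<bar> \<le> 2 * \<epsilon>" if "\<omega> \<in> space P - ?A" for \<omega>
        using that A(3)[of \<omega>] by (auto simp: F'_def)
      have fGn: "\<bar>f (Gn n \<omega>)\<bar> \<le> C" if "\<omega> \<in> space P" for \<omega>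
        by (rule C[OF subsetD[OF F(2) GnF[OF that]]])
      have "\<bar>(\<integral>\<omega>. f (W n \<omega>) \<partial>P) - (\<integral>\<omega>. f (Gn n \<omega>) \<partial>P)\<bar> \<le> 2 * \<epsilon> + 2 * C * measure P ?A"
        by (rule P.integral_diff_bound) (use fGn mf[OF W] mf[OF GnJ] WD GnF F C A evG gd \<epsilon> in auto)
      also have "\<dots> \<le> 2 * \<epsilon> + 2 * C * (4 * \<epsilon>)" using PA C0 by (intro add_left_mono mult_left_mono) auto
      finally have b2: "\<bar>(\<integral>\<omega>. f (W n \<omega>) \<partial>P) - (\<integral>\<omega>. f (Gn n \<omega>) \<partial>P)\<bar> \<le> 2 * \<epsilon> + 8 * C * \<epsilon>" by simp
      have "5 + 12 * C \<noteq> 0" using C0 by simp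
      then have "r = \<epsilon> * (5 + 12 * C)" by (simp add: \<epsilon>_def)
      then have "r = 5 * \<epsilon> + 12 * C * \<epsilon>" by (simp add: algebra_simps)
      with b1 b2 elim(2) \<epsilon> show ?case by linarith
    qed
    then show "\<exists>no. \<forall>n\<ge>no. dist (\<integral>\<omega>. f (W n \<omega>) \<partial>P) (\<integral>\<omega>. f (V \<omega>) \<partial>S) < r"
      by (simp add: eventually_sequentially dist_real_def)
  qed
qed

text \<open>The approximations supply both the measurable version of the limit and the
  convergence of expectations.\<close>

lemma converges_weakly_J1I:
  fixes W :: "nat \<Rightarrow> 'w \<Rightarrow> real \<Rightarrow> real" and V :: "'v \<Rightarrow> real \<Rightarrow> real"
  assumes P: "prob_space P" and S: "prob_space S"
    and W: "\<And>n. W n \<in> measurable P (borel_of J1_topology)"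
    and approx: "\<And>T e. T > 0 \<Longrightarrow> e > 0 \<Longrightarrow> \<exists>F Gn G. finite F \<and> F \<subseteq> skorokhod_D \<and>
       (\<forall>n. Gn n \<in> measurable P (count_space F)) \<and> G \<in> measurable S (count_space F) \<and>
       (\<forall>x\<in>F. (\<lambda>n. measure P {\<omega>\<in>space P. Gn n \<omega> = x}) \<longlonglongrightarrow> measure S {\<omega>\<in>space S. G \<omega> = x}) \<and>
       (\<forall>\<^sub>F n in sequentially. J1_close P (W n) (Gn n) T e) \<and> J1_close S V G T e"
  shows "converges_weakly J1_topology P W S V"
proof -
  have "\<exists>F G. F \<subseteq> skorokhod_D \<and> G \<in> measurable S (count_space F) \<and> J1_close S V G T e"
    if "T > 0" "e > 0" for T e using approx[OF that] by blast
  from J1_version_exists[OF S this] obtain V' where V': "random_element_version S J1_topology V V'" by blast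
  then have V'm: "V' \<in> measurable S (borel_of J1_topology)" and ae: "AE \<omega> in S. V' \<omega> = V \<omega>"
    by (auto simp: random_element_version_def)
  have "\<exists>F Gn G. finite F \<and> F \<subseteq> skorokhod_D \<and>
       (\<forall>n. Gn n \<in> measurable P (count_space F)) \<and> G \<in> measurable S (count_space F) \<and>
       (\<forall>x\<in>F. (\<lambda>n. measure P {\<omega>\<in>space P. Gn n \<omega> = x}) \<longlonglongrightarrow> measure S {\<omega>\<in>space S. G \<omega> = x}) \<and>
       (\<forall>\<^sub>F n in sequentially. J1_close P (W n) (Gn n) T e) \<and> J1_close S V' G T e"
    if "T > 0" "e > 0" for T e using approx[OF that] J1_close_AE[OF S _ ae] by blast
  note conv = J1_weak_convergence[OF P S W V'm this]
  show ?thesis unfolding converges_weakly_def topspace_J1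
  proof (intro exI[of _ W] exI[of _ V'] conjI allI impI)
    show "random_element_version P J1_topology (W n) (W n)" for n
      using W by (simp add: random_element_version_def)
  qed (use V' conv in auto)
qed

section \<open>Running suprema and paths on a grid\<close>

text \<open>Both the limit process and the record process of a sample are described by this relation. It avoids
  suprema of extended reals and their value on the empty set: \<open>V s\<close> is the least nonnegative bound of the heights
  up to time \<open>s\<close>.\<close>

definition running_sup :: "(nat \<Rightarrow> real) \<Rightarrow> (nat \<Rightarrow> ereal) \<Rightarrow> (real \<Rightarrow> real) \<Rightarrow> bool" where
  "running_sup t j V \<longleftrightarrow> (\<forall>s\<ge>0. V s \<ge> 0 \<and> (\<forall>k. t k \<le> s \<longrightarrow> j k \<le> ereal (V s)) \<and>
     (\<forall>c\<ge>0. (\<forall>k. t k \<le> s \<longrightarrow> j k \<le> ereal c) \<longrightarrow> V s \<le> c))"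

lemma running_supD:
  assumes "running_sup t j V" "s \<ge> 0"
  shows "V s \<ge> 0" "\<And>k. t k \<le> s \<Longrightarrow> j k \<le> ereal (V s)"
    "\<And>c. c \<ge> 0 \<Longrightarrow> (\<And>k. t k \<le> s \<Longrightarrow> j k \<le> ereal c) \<Longrightarrow> V s \<le> c"
  using assms unfolding running_sup_def by auto

lemma running_sup_sup_process:
  assumes j0: "\<And>k. j k > 0" and jfin: "\<And>k. j k \<noteq> \<infinity>"
    and fin: "\<And>T e. e > 0 \<Longrightarrow> finite {k. t k \<le> T \<and> j k > ereal e}"
  shows "running_sup t j (sup_process t j)"
  unfolding running_sup_def
proof (intro allI impI)
  fix s :: real assume s: "s \<ge> 0"
  show "0 \<le> sup_process t j s \<and> (\<forall>k. t k \<le> s \<longrightarrow> j k \<le> ereal (sup_process t j s)) \<and>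
      (\<forall>c\<ge>0. (\<forall>k. t k \<le> s \<longrightarrow> j k \<le> ereal c) \<longrightarrow> sup_process t j s \<le> c)"
  proof (cases "{k. t k \<le> s} = {}")
    case True then show ?thesis using s by (auto simp: sup_process_def)
  next
    case False
    then obtain k0 where k0: "t k0 \<le> s" by auto
    let ?S = "SUP k\<in>{k. t k \<le> s}. j k"
    let ?B = "{k. t k \<le> s \<and> j k > ereal 1}"
    have "?S \<le> Max (insert 1 (j ` ?B))"
    proof (rule SUP_least)
      fix k assume "k \<in> {k. t k \<le> s}"
      then show "j k \<le> Max (insert 1 (j ` ?B))"
        using fin[of 1 s] by (cases "j k > ereal 1") (auto simp: Max_ge_iff not_less one_ereal_def)
    qed
    also have "\<dots> < \<infinity>"
      using fin[of 1 s] jfin by (subst Max_less_iff) (auto simp: less_top[symmetric] top_ereal_def)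
    finally have Sfin: "?S < \<infinity>" .
    have Sge: "j k \<le> ?S" if "t k \<le> s" for k using that by (intro SUP_upper) auto
    have "0 < ?S" using j0[of k0] Sge[OF k0] by (rule less_le_trans)
    with Sfin obtain v where v: "?S = ereal v" "v > 0"
      by (cases ?S) auto
    have eq: "sup_process t j s = v" using s False v by (simp add: sup_process_def)
    have "v \<le> c" if "c \<ge> 0" "\<forall>k. t k \<le> s \<longrightarrow> j k \<le> ereal c" for c
    proof -
      have "?S \<le> ereal c" by (rule SUP_least) (use that in auto)
      then show ?thesis using v by simp
    qed
    then show ?thesis unfolding eq using v Sge by auto
  qed
qed

text \<open>Right-continuity: for every level \<open>e\<close> there are only finitely many points above \<open>e\<close> shortly after \<open>u\<close>,
  hence none in a short interval to the right of \<open>u\<close>. Left limits exist by monotonicity.\<close>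

lemma running_sup_in_D:
  assumes V: "running_sup t j V" and ext: "V \<in> extensional {0..}"
    and fin: "\<And>T e. e > 0 \<Longrightarrow> finite {k. t k \<le> T \<and> j k > ereal e}"
  shows "V \<in> skorokhod_D"
proof -
  have mono: "V r \<le> V s" if "0 \<le> r" "r \<le> s" for r s
  proof (rule running_supD(3)[OF V that(1)])
    show "0 \<le> V s" using running_supD(1)[OF V] that by simp
    show "j k \<le> ereal (V s)" if "t k \<le> r" for k
      using running_supD(2)[OF V, of s k] that \<open>0 \<le> r\<close> \<open>r \<le> s\<close> by simp
  qed
  have "(V \<longlongrightarrow> V u) (at_right u)" if u: "u \<ge> 0" for u
  proof (rule tendstoI)
    fix e :: real assume e: "e > 0"
    define A where "A = {k. u < t k \<and> t k \<le> u + 1 \<and> j k > ereal (e/2)}"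
    have A: "finite A" by (rule finite_subset[OF _ fin[of "e/2" "u+1"]]) (use e in \<open>auto simp: A_def\<close>)
    define d where "d = Min (insert (u + 1) (t ` A))"
    have d: "u < d" "d \<le> u + 1" "\<And>k. k \<in> A \<Longrightarrow> d \<le> t k" using A by (auto simp: d_def A_def)
    show "\<forall>\<^sub>F s in at_right u. dist (V s) (V u) < e"
    proof (rule eventually_mono[OF eventually_at_right_real[OF d(1)]])
      fix s assume s: "s \<in> {u<..<d}"
      have "V s \<le> max (V u) (e/2)"
      proof (rule running_supD(3)[OF V])
        show "0 \<le> s" "0 \<le> max (V u) (e/2)" using s u e by auto
        show "j k \<le> ereal (max (V u) (e/2))" if k: "t k \<le> s" for k
        proof (cases "t k \<le> u")
          case True
          have "ereal (V u) \<le> ereal (max (V u) (e/2))" by simp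
          with running_supD(2)[OF V u True] show ?thesis by (rule order_trans)
        next
          case False
          have "k \<notin> A" using d(3)[of k] s k by auto
          then have "j k \<le> ereal (e/2)" using False k s d(2) by (auto simp: A_def not_less)
          also have "\<dots> \<le> ereal (max (V u) (e/2))" by simp
          finally show ?thesis .
        qed
      qed
      moreover have "V u \<le> V s" by (rule mono) (use s u in auto)
      ultimately show "dist (V s) (V u) < e"
        using running_supD(1)[OF V u] e by (auto simp: dist_real_def max_def split: if_splits)
    qed
  qed
  moreover have "\<exists>l. (V \<longlongrightarrow> l) (at_left u)" if u: "u > 0" for u
  proof -
    define l where "l = (SUP s\<in>{0..<u}. V s)"
    have bdd: "bdd_above (V ` {0..<u})"
      by (rule bdd_aboveI[of _ "V u"]) (use mono in auto)
    have ne: "{0..<u} \<noteq> {}" using u by auto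
    have "(V \<longlongrightarrow> l) (at_left u)"
    proof (rule order_tendstoI)
      fix a assume "a < l"
      then obtain s0 where s0: "s0 \<in> {0..<u}" "a < V s0"
        unfolding l_def using less_cSUP_iff[OF ne bdd] by auto
      then have "s0 < u" by simp
      show "\<forall>\<^sub>F s in at_left u. a < V s"
        by (rule eventually_mono[OF eventually_at_left_real[OF \<open>s0 < u\<close>]])
           (use s0 mono[of s0] in \<open>auto intro: less_le_trans\<close>)
    next
      fix a assume a: "l < a"
      show "\<forall>\<^sub>F s in at_left u. V s < a"
      proof (rule eventually_mono[OF eventually_at_left_real[OF u]])
        fix s assume "s \<in> {0<..<u}"
        then have "V s \<le> l" unfolding l_def by (intro cSUP_upper[OF _ bdd]) auto
        with a show "V s < a" by simp
      qed
    qed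
    then show ?thesis ..
  qed
  ultimately show ?thesis using ext by (auto simp: skorokhod_D_def)
qed

text \<open>Interpolate linearly between the grid points \<open>a / m\<close> and the prescribed images \<open>\<tau> a\<close>. As
  \<open>\<tau> a\<close> lies in the block that starts at \<open>a / m\<close>, the images increase and the displacement is a convex combination
  of numbers in \<open>[0, 1 / m)\<close>.\<close>

lemma interpolating_time_change:
  fixes m :: real and \<tau> :: "nat \<Rightarrow> real"
  assumes m: "m > 0" and \<tau>0: "\<tau> 0 = 0"
    and \<tau>: "\<And>a. real a / m \<le> \<tau> a" "\<And>a. \<tau> a < (real a + 1) / m"
  obtains h where "h \<in> time_changes" "\<And>s. s \<ge> 0 \<Longrightarrow> \<bar>h s - s\<bar> < 1 / m"
    "\<And>s. s \<ge> 0 \<Longrightarrow> \<tau> (nat \<lfloor>m * s\<rfloor>) \<le> h s \<and> h s < \<tau> (Suc (nat \<lfloor>m * s\<rfloor>))"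
proof -
  define A where "A s = nat \<lfloor>m * s\<rfloor>" for s
  define h where "h s = \<tau> (A s) + (m * s - real (A s)) * (\<tau> (Suc (A s)) - \<tau> (A s))" for s
  have step: "\<tau> a < \<tau> (Suc a)" for a using \<tau>(2)[of a] \<tau>(1)[of "Suc a"] by (simp add: add.commute)
  have \<tau>mono: "\<tau> a \<le> \<tau> c" if "a \<le> c" for a c
    using lift_Suc_mono_le[of \<tau>, OF less_imp_le[OF step] that] .
  have A: "real (A s) \<le> m * s" "m * s < real (A s) + 1" if "s \<ge> 0" for s
  proof -
    have "0 \<le> \<lfloor>m * s\<rfloor>" using that m by simp
    then have "real (A s) = of_int \<lfloor>m * s\<rfloor>" by (simp add: A_def)
    then show "real (A s) \<le> m * s" "m * s < real (A s) + 1" by linarith+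
  qed
  have between: "\<tau> (A s) \<le> h s \<and> h s < \<tau> (Suc (A s))" if "s \<ge> 0" for s
  proof -
    have "0 \<le> (m * s - real (A s)) * (\<tau> (Suc (A s)) - \<tau> (A s))"
      using A[OF that] step[of "A s"] by simp
    moreover have "(m * s - real (A s)) * (\<tau> (Suc (A s)) - \<tau> (A s)) < 1 * (\<tau> (Suc (A s)) - \<tau> (A s))"
      using A[OF that] step[of "A s"] by (intro mult_strict_right_mono) auto
    ultimately show ?thesis by (simp add: h_def)
  qed
  have "h \<in> time_changes"
  proof (rule time_changesI)
    show "strict_mono_on {0..} h"
    proof (rule strict_mono_onI)
      fix r s :: real assume rs: "r \<in> {0..}" "s \<in> {0..}" "r < s"
      have "A r \<le> A s" unfolding A_def using rs m by (intro nat_mono floor_mono) auto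
      then consider "A r = A s" | "Suc (A r) \<le> A s" by linarith
      then show "h r < h s"
      proof cases
        case 1
        have "(m * r - real (A r)) * (\<tau> (Suc (A r)) - \<tau> (A r)) < (m * s - real (A r)) * (\<tau> (Suc (A r)) - \<tau> (A r))"
          using rs m step[of "A r"] by (intro mult_strict_right_mono) auto
        then show ?thesis using 1 by (simp add: h_def)
      next
        case 2
        then show ?thesis using between[of r] between[of s] \<tau>mono[OF 2] rs by auto
      qed
    qed
    show "h ` {0..} = {0..}"
    proof
      show "h ` {0..} \<subseteq> {0..}" using between \<tau>mono[of 0] \<tau>0 by (force intro: order_trans)
      show "{0..} \<subseteq> h ` {0..}"
      proof
        fix y :: real assume y: "y \<in> {0..}"
        obtain a0 where "m * y < real a0" using reals_Archimedean2 by blast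
        then have "y < real a0 / m" using m by (simp add: field_simps)
        then have ex: "y < \<tau> a0" using \<tau>(1)[of a0] by linarith
        define c where "c = (LEAST a. y < \<tau> a)"
        have c: "y < \<tau> c" unfolding c_def by (rule LeastI[of _ a0]) (rule ex)
        then have "c \<noteq> 0" using y \<tau>0 by (metis atLeast_iff not_less)
        then obtain a where a: "c = Suc a" by (cases c) auto
        have "\<not> y < \<tau> a" using not_less_Least[of a "\<lambda>a. y < \<tau> a"] a by (simp add: c_def)
        then have ya: "\<tau> a \<le> y" "y < \<tau> (Suc a)" using c a by auto
        define \<theta> where "\<theta> = (y - \<tau> a) / (\<tau> (Suc a) - \<tau> a)"
        have \<theta>: "0 \<le> \<theta>" "\<theta> < 1" using ya by (auto simp: \<theta>_def)
        define s where "s = (real a + \<theta>) / m"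
        have s: "s \<ge> 0" "m * s = real a + \<theta>" using \<theta> m by (auto simp: s_def)
        have "\<lfloor>m * s\<rfloor> = int a" using s \<theta> by (intro floor_unique) auto
        then have "A s = a" by (simp add: A_def)
        then have "h s = y" using s ya by (simp add: h_def \<theta>_def)
        then show "y \<in> h ` {0..}" using s by auto
      qed
    qed
  qed
  moreover have "\<bar>h s - s\<bar> < 1 / m" if "s \<ge> 0" for s
  proof -
    define \<theta> where "\<theta> = m * s - real (A s)"
    define x where "x = \<tau> (A s) - real (A s) / m"
    define y where "y = \<tau> (Suc (A s)) - (real (A s) + 1) / m"
    have \<theta>: "0 \<le> \<theta>" "\<theta> < 1" using A[OF that] by (auto simp: \<theta>_def)
    have x: "0 \<le> x" "x < 1 / m" using \<tau>[of "A s"] by (auto simp: x_def add_divide_distrib)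
    have y: "0 \<le> y" "y < 1 / m" using \<tau>[of "Suc (A s)"] by (auto simp: y_def add_divide_distrib)
    define w u where "w = 1 / m" and "u = real (A s) / m"
    have "s = u + \<theta> * w" using m by (simp add: \<theta>_def w_def u_def field_simps)
    moreover have "h s = \<tau> (A s) + \<theta> * (\<tau> (Suc (A s)) - \<tau> (A s))" by (simp add: h_def \<theta>_def)
    moreover have "x = \<tau> (A s) - u" "y = \<tau> (Suc (A s)) - (u + w)"
      by (simp_all add: x_def y_def u_def w_def add_divide_distrib)
    ultimately have "h s - s = \<tau> (A s) + \<theta> * (\<tau> (Suc (A s)) - \<tau> (A s)) - (u + \<theta> * w)"
      and xy: "x = \<tau> (A s) - u" "y = \<tau> (Suc (A s)) - (u + w)" by linarith+
    moreover have "\<tau> (A s) + \<theta> * (\<tau> (Suc (A s)) - \<tau> (A s)) - (u + \<theta> * w) = (1 - \<theta>) * x + \<theta> * y"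
      unfolding xy by (simp add: algebra_simps)
    ultimately have "h s - s = (1 - \<theta>) * x + \<theta> * y" by simp
    moreover have "(1 - \<theta>) * x + \<theta> * y < 1 / m"
      using \<theta> x y by (intro convex_bound_lt) auto
    moreover have "(1 - \<theta>) * x + \<theta> * y \<ge> 0" using \<theta> x y by simp
    ultimately show ?thesis by simp
  qed
  ultimately show thesis using between that unfolding A_def by blast
qed

definition block_hit :: "nat \<Rightarrow> (nat \<Rightarrow> real) \<Rightarrow> (nat \<Rightarrow> ereal) \<Rightarrow> nat \<Rightarrow> real \<Rightarrow> bool" where
  "block_hit m t j a x \<longleftrightarrow> (\<exists>k. real a / real m \<le> t k \<and> t k < (real a + 1) / real m \<and> j k > ereal x)"

text \<open>Up to rounding, the maximum of the heights in block \<open>a\<close> divided by \<open>\<eta>\<close>, capped at \<open>R\<close>. With this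
  encoding, to be below a level is an event about the absence of points.\<close>

definition block_level :: "nat \<Rightarrow> nat \<Rightarrow> real \<Rightarrow> (nat \<Rightarrow> real) \<Rightarrow> (nat \<Rightarrow> ereal) \<Rightarrow> nat \<Rightarrow> nat" where
  "block_level m R \<eta> t j a = card {r \<in> {1..R}. block_hit m t j a (real r * \<eta>)}"

definition grid_path :: "nat \<Rightarrow> real \<Rightarrow> (nat \<Rightarrow> nat) \<Rightarrow> real \<Rightarrow> real" where
  "grid_path m \<eta> v = (\<lambda>s\<in>{0..}. \<eta> * real (Max (v ` {..nat \<lfloor>real m * s\<rfloor>})))"

lemma block_hit_mono: "block_hit m t j a y \<Longrightarrow> x \<le> y \<Longrightarrow> block_hit m t j a x"
  unfolding block_hit_def by (meson ereal_less_eq(3) le_less_trans)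

lemma block_level_less_iff:
  assumes "\<eta> > 0"
  shows "block_level m R \<eta> t j a < r \<longleftrightarrow> r \<ge> 1 \<and> (r > R \<or> \<not> block_hit m t j a (real r * \<eta>))"
proof -
  let ?H = "{r \<in> {1..R}. block_hit m t j a (real r * \<eta>)}"
  have fin: "finite ?H" by simp
  have down: "r' \<in> ?H" if "r \<in> ?H" "1 \<le> r'" "r' \<le> r" for r r'
    using that assms by (auto elim!: block_hit_mono)
  show ?thesis
  proof (cases "r \<ge> 1 \<and> r \<le> R \<and> block_hit m t j a (real r * \<eta>)")
    case True
    then have "{1..r} \<subseteq> ?H" using down[of r] by auto
    from card_mono[OF fin this] True show ?thesis by (simp add: block_level_def)
  next
    case False
    show ?thesis
    proof (cases "r = 0")
      case r: False
      have "?H \<subseteq> {1..r - 1}"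
      proof
        fix r' assume r': "r' \<in> ?H"
        have "r' < r"
        proof (rule ccontr)
          assume "\<not> r' < r"
          then have "r \<in> ?H" using down[OF r', of r] r by auto
          with False r show False by auto
        qed
        then show "r' \<in> {1..r-1}" using r' by auto
      qed
      from card_mono[OF _ this] False r show ?thesis by (auto simp: block_level_def)
    qed auto
  qed
qed

lemma block_level_le: "block_level m R \<eta> t j a \<le> R"
proof -
  have "card {r \<in> {1..R}. block_hit m t j a (real r * \<eta>)} \<le> card {1..R}" by (rule card_mono) auto
  then show ?thesis by (simp add: block_level_def)
qed

lemma grid_path_in_D: "grid_path m \<eta> v \<in> skorokhod_D"
  unfolding grid_path_def by (rule step_path_in_D[of "real m" "\<lambda>i. \<eta> * real (Max (v ` {..i}))"]) simp

text \<open>The time change sends the left end of a block to the time of its only large point, if there is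
  one. Then \<open>h s\<close> with \<open>s\<close> in block \<open>a\<close> has passed exactly the large points of the blocks up to \<open>a\<close>, so the
  running supremum at \<open>h s\<close> and the grid path at \<open>s\<close> see the same large points and differ by the
  rounding. Block \<open>0\<close> must not contain a large point because every time change fixes \<open>0\<close>.\<close>

lemma running_sup_near_grid_path:
  fixes m N R :: nat and T \<eta> :: real
  assumes m: "m \<ge> 1" and \<eta>: "\<eta> > 0" and N: "real m * T + 1 < real N"
    and V: "running_sup t j V" and t0: "\<And>k. t k \<ge> 0"
    and quiet: "\<not> block_hit m t j 0 \<eta>"
    and single: "\<And>a k k'. a < N \<Longrightarrow> real a / real m \<le> t k \<Longrightarrow> t k < (real a + 1) / real m \<Longrightarrow> j k > ereal \<eta> \<Longrightarrow>
        real a / real m \<le> t k' \<Longrightarrow> t k' < (real a + 1) / real m \<Longrightarrow> j k' > ereal \<eta> \<Longrightarrow> k = k'"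
    and low: "\<And>k. t k < real N / real m \<Longrightarrow> j k \<le> ereal ((real R + 1) * \<eta>)"
    and v: "\<And>a. a < N \<Longrightarrow> v a = block_level m R \<eta> t j a"
  obtains h where "h \<in> time_changes" "\<And>s. s \<ge> 0 \<Longrightarrow> \<bar>h s - s\<bar> < 1 / real m"
    "\<And>s. 0 \<le> s \<Longrightarrow> s \<le> T \<Longrightarrow> \<bar>V (h s) - grid_path m \<eta> v s\<bar> \<le> \<eta>"
proof -
  define big where "big a k \<longleftrightarrow> real a / real m \<le> t k \<and> t k < (real a + 1) / real m \<and> j k > ereal \<eta>" for a k
  \<comment> \<open>the time of the large point of block \<open>a\<close>, and the left end of the block if there is none\<close>
  define \<tau> where "\<tau> a = (if a < N \<and> (\<exists>k. big a k) then t (SOME k. big a k) else real a / real m)" for a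
  have \<tau>big: "\<tau> a = t k" if "a < N" "big a k" for a k
  proof -
    have "big a (SOME k. big a k)" using that(2) by (rule someI)
    then have "(SOME k. big a k) = k" using that single[of a "SOME k. big a k" k] by (auto simp: big_def)
    then show ?thesis using that by (auto simp: \<tau>_def)
  qed
  have \<tau>1: "real a / real m \<le> \<tau> a" and \<tau>2: "\<tau> a < (real a + 1) / real m" for a
  proof -
    have "real a / real m \<le> \<tau> a \<and> \<tau> a < (real a + 1) / real m"
    proof (cases "a < N \<and> (\<exists>k. big a k)")
      case True
      then obtain k where "big a k" by blast
      then show ?thesis using \<tau>big[of a k] True by (simp add: big_def)
    next
      case False
      then have "\<tau> a = real a / real m" unfolding \<tau>_def by (rule if_not_P)
      then show ?thesis using m by (simp add: divide_strict_right_mono)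
    qed
    then show "real a / real m \<le> \<tau> a" "\<tau> a < (real a + 1) / real m" by auto
  qed
  have "\<tau> 0 = 0" using quiet by (auto simp: \<tau>_def big_def block_hit_def)
  obtain h where h: "h \<in> time_changes" "\<And>s. s \<ge> 0 \<Longrightarrow> \<bar>h s - s\<bar> < 1 / real m"
    and hb: "\<And>s. s \<ge> 0 \<Longrightarrow> \<tau> (nat \<lfloor>real m * s\<rfloor>) \<le> h s \<and> h s < \<tau> (Suc (nat \<lfloor>real m * s\<rfloor>))"
    using interpolating_time_change[of "real m" \<tau>, OF _ \<open>\<tau> 0 = 0\<close> \<tau>1 \<tau>2] m by (auto simp: field_simps)
  have \<tau>mono: "\<tau> a \<le> \<tau> c" if "a \<le> c" for a c
  proof (rule lift_Suc_mono_le[of \<tau>, OF _ that])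
    show "\<tau> n \<le> \<tau> (Suc n)" for n using \<tau>2[of n] \<tau>1[of "Suc n"] by (simp add: add.commute)
  qed
  have "\<bar>V (h s) - grid_path m \<eta> v s\<bar> \<le> \<eta>" if s: "0 \<le> s" "s \<le> T" for s
  proof -
    define a where "a = nat \<lfloor>real m * s\<rfloor>"
    have ha: "\<tau> a \<le> h s" "h s < \<tau> (Suc a)" using hb[OF s(1)] by (auto simp: a_def)
    have hs: "h s \<ge> 0" by (rule time_changes_nonneg[OF h(1) s(1)])
    have "real m * s \<le> real m * T" using s by (simp add: mult_left_mono)
    moreover have "real a \<le> real m * s" using s by (simp add: a_def)
    ultimately have aN: "Suc a < N" using N by linarith
    define q where "q = Max (v ` {..a})"
    have g: "grid_path m \<eta> v s = \<eta> * real q" using s by (simp add: grid_path_def q_def a_def)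
    have qge: "v a' \<le> q" if "a' \<le> a" for a' using that by (auto simp: q_def)
    have "\<eta> * real q \<le> V (h s)"
    proof (cases "q = 0")
      case True then show ?thesis using running_supD(1)[OF V hs] by simp
    next
      case False
      have "q \<in> v ` {..a}" unfolding q_def by (rule Max_in) auto
      then obtain a' where a': "a' \<le> a" "v a' = q" by auto
      then have "\<not> block_level m R \<eta> t j a' < q" using v[of a'] aN by auto
      then have "block_hit m t j a' (real q * \<eta>)" using False block_level_less_iff[OF \<eta>] by auto
      then obtain k where k: "real a' / real m \<le> t k" "t k < (real a' + 1) / real m" "j k > ereal (real q * \<eta>)"
        by (auto simp: block_hit_def)
      have "\<eta> \<le> real q * \<eta>" using False \<eta> by simp
      then have "ereal \<eta> \<le> ereal (real q * \<eta>)" by simp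
      then have "j k > ereal \<eta>" using k(3) by (rule le_less_trans)
      then have "big a' k" using k by (simp add: big_def)
      then have "t k = \<tau> a'" using \<tau>big a' aN by simp
      then have "t k \<le> h s" using \<tau>mono[OF a'(1)] ha by simp
      from running_supD(2)[OF V hs this] k(3) have "ereal (real q * \<eta>) \<le> ereal (V (h s))" by (rule less_imp_le[OF less_le_trans, rotated])
      then show ?thesis by (simp add: mult.commute)
    qed
    moreover have "V (h s) \<le> \<eta> * real q + \<eta>"
    proof (rule running_supD(3)[OF V hs])
      show "0 \<le> \<eta> * real q + \<eta>" using \<eta> by simp
      fix k assume k: "t k \<le> h s"
      show "j k \<le> ereal (\<eta> * real q + \<eta>)"
      proof (cases "j k > ereal \<eta>")
        case False
        then have "j k \<le> ereal \<eta>" by simp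
        also have "\<dots> \<le> ereal (\<eta> * real q + \<eta>)" using \<eta> by simp
        finally show ?thesis .
      next
        case True
        define a' where "a' = nat \<lfloor>real m * t k\<rfloor>"
        have "0 \<le> \<lfloor>real m * t k\<rfloor>" using t0[of k] by simp
        then have "real a' = of_int \<lfloor>real m * t k\<rfloor>" by (simp add: a'_def)
        then have "real a' \<le> real m * t k" "real m * t k < real a' + 1" by linarith+
        then have blk: "real a' / real m \<le> t k" "t k < (real a' + 1) / real m" using m by (auto simp: field_simps)
        have "real a' / real m < (real (Suc a) + 1) / real m"
          using blk(1) k ha(2) \<tau>2[of "Suc a"] by linarith
        then have "real a' < real (Suc a) + 1" using m by (simp add: divide_less_cancel)
        then have a'a: "a' \<le> Suc a" by linarith
        have bigk: "big a' k" using blk True by (simp add: big_def)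
        have "t k = \<tau> a'" using \<tau>big[OF _ bigk] a'a aN by simp
        then have "a' \<noteq> Suc a" using k ha(2) by auto
        then have a'le: "a' \<le> a" using a'a by simp
        let ?r = "block_level m R \<eta> t j a'"
        have "j k \<le> ereal ((real ?r + 1) * \<eta>)"
        proof (cases "?r < R")
          case True
          have "?r < Suc ?r" by simp
          then have "\<not> block_hit m t j a' (real (Suc ?r) * \<eta>)"
            using block_level_less_iff[OF \<eta>, of m R t j a' "Suc ?r"] True by auto
          then have "\<not> j k > ereal (real (Suc ?r) * \<eta>)" using blk by (auto simp: block_hit_def)
          then show ?thesis by (simp add: not_less add.commute)
        next
          case False
          then have "?r = R" using block_level_le[of m R \<eta> t j a'] by simp
          moreover have "t k < real N / real m"
          proof -
            have "(real a' + 1) / real m \<le> real N / real m" using a'le aN m by (intro divide_right_mono) auto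
            then show ?thesis using blk(2) by simp
          qed
          ultimately show ?thesis using low by simp
        qed
        also have "ereal ((real ?r + 1) * \<eta>) \<le> ereal (\<eta> * real q + \<eta>)"
          using qge[OF a'le] v[of a'] a'le aN \<eta> by (simp add: algebra_simps)
        finally show ?thesis .
      qed
    qed
    ultimately show ?thesis unfolding g by (simp add: abs_le_iff)
  qed
  with h that show thesis by blast
qed

section \<open>Poisson points with a power-law intensity\<close>

locale poisson_points = prob_space S for S :: "'v measure" +
  fixes E :: "'e measure" and p :: "nat \<Rightarrow> 'v \<Rightarrow> 'e"
  assumes prm: "poisson_random_measure S E (\<lambda>\<omega>. sum_dirac E (\<lambda>k. p k \<omega>))"
    and p_space: "\<And>k \<omega>. \<omega> \<in> space S \<Longrightarrow> p k \<omega> \<in> space E"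
begin

lemma count_eq:
  assumes "\<omega> \<in> space S" "A \<in> sets E"
  shows "emeasure (sum_dirac E (\<lambda>k. p k \<omega>)) A = emeasure (count_space UNIV) {k. p k \<omega> \<in> A}"
proof -
  have "(\<lambda>k. p k \<omega>) \<in> measurable (count_space UNIV) E" using p_space[OF assms(1)] by auto
  then show ?thesis unfolding sum_dirac_def using assms(2)
    by (subst emeasure_distr) (auto simp: vimage_def)
qed

text \<open>The number of indices \<open>k\<close> with \<open>p k \<omega> \<in> A\<close> is the mass of \<open>A\<close>; points are counted with multiplicity.\<close>

lemma count_is_n:
  assumes "\<omega> \<in> space S" "A \<in> sets E"
  shows "emeasure (sum_dirac E (\<lambda>k. p k \<omega>)) A = of_nat n \<longleftrightarrow> finite {k. p k \<omega> \<in> A} \<and> card {k. p k \<omega> \<in> A} = n"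
proof (cases "finite {k. p k \<omega> \<in> A}")
  case True
  then show ?thesis unfolding count_eq[OF assms] by (simp add: emeasure_count_space_finite)
next
  case False
  then have "emeasure (count_space UNIV) {k. p k \<omega> \<in> A} = \<infinity>" by simp
  then show ?thesis using False unfolding count_eq[OF assms] by (simp only: ) (metis ennreal_of_nat_neq_top infinity_ennreal_def)
qed

lemma count_event:
  assumes A: "A \<in> sets E"
  shows "{\<omega> \<in> space S. finite {k. p k \<omega> \<in> A} \<and> card {k. p k \<omega> \<in> A} = n} \<in> events"
proof -
  have [measurable]: "(\<lambda>\<omega>. emeasure (sum_dirac E (\<lambda>k. p k \<omega>)) A) \<in> borel_measurable S"
    using prm A by (auto simp: poisson_random_measure_def)
  have "{\<omega> \<in> space S. emeasure (sum_dirac E (\<lambda>k. p k \<omega>)) A = of_nat n} \<in> events" by measurable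
  also have "{\<omega> \<in> space S. emeasure (sum_dirac E (\<lambda>k. p k \<omega>)) A = of_nat n} =
     {\<omega> \<in> space S. finite {k. p k \<omega> \<in> A} \<and> card {k. p k \<omega> \<in> A} = n}"
    using count_is_n[OF _ A] by auto
  finally show ?thesis .
qed

lemma count_prob:
  assumes A: "A \<in> sets E" "emeasure E A < \<infinity>"
  shows "prob {\<omega> \<in> space S. finite {k. p k \<omega> \<in> A} \<and> card {k. p k \<omega> \<in> A} = n} =
     measure E A ^ n / fact n * exp (- measure E A)"
proof -
  have "prob {\<omega> \<in> space S. emeasure (sum_dirac E (\<lambda>k. p k \<omega>)) A = of_nat n} = measure E A ^ n / fact n * exp (- measure E A)"
    using prm A by (auto simp: poisson_random_measure_def)
  also have "{\<omega> \<in> space S. emeasure (sum_dirac E (\<lambda>k. p k \<omega>)) A = of_nat n} =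
     {\<omega> \<in> space S. finite {k. p k \<omega> \<in> A} \<and> card {k. p k \<omega> \<in> A} = n}"
    using count_is_n[OF _ A(1)] by auto
  finally show ?thesis .
qed

lemma void_event: "A \<in> sets E \<Longrightarrow> {\<omega> \<in> space S. \<forall>k. p k \<omega> \<notin> A} \<in> events"
proof -
  assume A: "A \<in> sets E"
  have "{\<omega> \<in> space S. \<forall>k. p k \<omega> \<notin> A} = {\<omega> \<in> space S. finite {k. p k \<omega> \<in> A} \<and> card {k. p k \<omega> \<in> A} = 0}"
    by auto
  then show ?thesis using count_event[OF A, of 0] by simp
qed

lemma void_prob:
  assumes A: "A \<in> sets E" "emeasure E A < \<infinity>"
  shows "prob {\<omega> \<in> space S. \<forall>k. p k \<omega> \<notin> A} = exp (- measure E A)"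
proof -
  have "{\<omega> \<in> space S. \<forall>k. p k \<omega> \<notin> A} = {\<omega> \<in> space S. finite {k. p k \<omega> \<in> A} \<and> card {k. p k \<omega> \<in> A} = 0}"
    by auto
  then show ?thesis using count_prob[OF A, of 0] by simp
qed

lemma hit_prob_le:
  assumes A: "A \<in> sets E" "emeasure E A < \<infinity>"
  shows "{\<omega> \<in> space S. \<exists>k. p k \<omega> \<in> A} \<in> events" "prob {\<omega> \<in> space S. \<exists>k. p k \<omega> \<in> A} \<le> measure E A"
proof -
  have eq: "{\<omega> \<in> space S. \<exists>k. p k \<omega> \<in> A} = space S - {\<omega> \<in> space S. \<forall>k. p k \<omega> \<notin> A}" by auto
  show "{\<omega> \<in> space S. \<exists>k. p k \<omega> \<in> A} \<in> events" unfolding eq using void_event[OF A(1)] by auto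
  show "prob {\<omega> \<in> space S. \<exists>k. p k \<omega> \<in> A} \<le> measure E A"
    unfolding eq prob_compl[OF void_event[OF A(1)]] void_prob[OF A]
    using exp_ge_add_one_self[of "- measure E A"] by simp
qed

text \<open>A Poisson variable with mean \<open>x\<close> is at most \<open>1\<close> with probability \<open>(1 + x) exp (- x)\<close>, which is at least \<open>1 - x\<^sup>2\<close>.\<close>

lemma two_points_prob_le:
  assumes A: "A \<in> sets E" "emeasure E A < \<infinity>"
  obtains B where "B \<in> events" "prob B \<le> (measure E A)\<^sup>2"
    "\<And>\<omega> k k'. \<omega> \<in> space S - B \<Longrightarrow> p k \<omega> \<in> A \<Longrightarrow> p k' \<omega> \<in> A \<Longrightarrow> k = k'"
proof -
  define C where "C n = {\<omega> \<in> space S. finite {k. p k \<omega> \<in> A} \<and> card {k. p k \<omega> \<in> A} = n}" for n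
  have C: "C n \<in> events" for n unfolding C_def by (rule count_event[OF A(1)])
  define x where "x = measure E A"
  have x: "x \<ge> 0" by (simp add: x_def)
  have "prob (C 0 \<union> C 1) = prob (C 0) + prob (C 1)"
    by (rule finite_measure_Union) (use C in \<open>auto simp: C_def\<close>)
  also have "\<dots> = (1 + x) * exp (- x)" unfolding C_def count_prob[OF A] x_def[symmetric] by (simp add: algebra_simps)
  finally have PC: "prob (C 0 \<union> C 1) = (1 + x) * exp (- x)" .
  have "(1 + x) * (1 - x) \<le> (1 + x) * exp (- x)"
    using exp_ge_add_one_self[of "- x"] x by (intro mult_left_mono) auto
  then have "1 - prob (C 0 \<union> C 1) \<le> x\<^sup>2" unfolding PC by (simp add: algebra_simps power2_eq_square)
  moreover have "prob (space S - (C 0 \<union> C 1)) = 1 - prob (C 0 \<union> C 1)" by (rule prob_compl) (use C in auto)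
  moreover have "k = k'" if "\<omega> \<in> space S - (space S - (C 0 \<union> C 1))" "p k \<omega> \<in> A" "p k' \<omega> \<in> A" for \<omega> k k'
  proof -
    have "finite {k. p k \<omega> \<in> A}" "card {k. p k \<omega> \<in> A} \<le> 1" using that by (auto simp: C_def)
    then show ?thesis using that card_le_Suc0_iff_eq[of "{k. p k \<omega> \<in> A}"] by auto
  qed
  ultimately show thesis using that[of "space S - (C 0 \<union> C 1)"] C by (auto simp: x_def)
qed

lemma AE_finite_points:
  assumes A: "A \<in> sets E" "emeasure E A < \<infinity>"
  shows "AE \<omega> in S. finite {k. p k \<omega> \<in> A}"
proof -
  define C where "C n = {\<omega> \<in> space S. finite {k. p k \<omega> \<in> A} \<and> card {k. p k \<omega> \<in> A} = n}" for n
  have C: "C n \<in> events" for n unfolding C_def by (rule count_event[OF A(1)])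
  have "(\<lambda>n. prob (C n)) sums prob (\<Union>n. C n)"
    by (rule finite_measure_UNION) (use C in \<open>auto simp: disjoint_family_on_def C_def\<close>)
  moreover have "(\<lambda>n. prob (C n)) sums 1"
  proof -
    have "(\<lambda>n. measure E A ^ n /\<^sub>R fact n * exp (- measure E A)) sums (exp (measure E A) * exp (- measure E A))"
      by (intro sums_mult2 exp_converges)
    then show ?thesis unfolding C_def count_prob[OF A] by (simp add: exp_minus divide_inverse mult.commute)
  qed
  ultimately have "prob (\<Union>n. C n) = 1" by (rule sums_unique2)
  then have "AE \<omega> in S. \<omega> \<in> (\<Union>n. C n)" by (subst (asm) prob_eq_1) (use C in auto)
  then show ?thesis by eventually_elim (auto simp: C_def)
qed

lemma AE_no_point:
  assumes A: "A \<in> sets E" "emeasure E A = 0"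
  shows "AE \<omega> in S. \<forall>k. p k \<omega> \<notin> A"
proof -
  have "measure E A = 0" using A by (simp add: measure_def)
  then have "prob {\<omega> \<in> space S. \<forall>k. p k \<omega> \<notin> A} = 1" using void_prob[of A] A by simp
  then show ?thesis by (subst (asm) prob_eq_1[OF void_event[OF A(1)]]) auto
qed

end

text \<open>The region that must be free of points if block \<open>a\<close> is to have a level below \<open>r a\<close>, for all \<open>a < N\<close>.
  Blocks with \<open>r a > R\<close> impose no condition because levels are at most \<open>R\<close>.\<close>

definition level_cells :: "nat \<Rightarrow> real \<Rightarrow> nat \<Rightarrow> nat \<Rightarrow> (nat \<Rightarrow> nat) \<Rightarrow> (real \<times> ereal) set" where
  "level_cells m \<eta> R N r =
     (\<Union>a\<in>{a. a < N \<and> r a \<le> R}. {real a / real m..<(real a + 1) / real m} \<times> {ereal (real (r a) * \<eta>)<..})"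

locale prm_pareto =
  fixes S :: "'v measure" and \<mu> :: "ereal measure" and t :: "nat \<Rightarrow> 'v \<Rightarrow> real" and j :: "nat \<Rightarrow> 'v \<Rightarrow> ereal"
    and \<alpha> :: real
  assumes S: "prob_space S" and alpha: "\<alpha> > 0"
    and mu_sets: "sets \<mu> = sets (restrict_space borel {0<..})"
    and mu: "\<And>x::real. x > 0 \<Longrightarrow> emeasure \<mu> {ereal x<..} = ennreal (x powr (- \<alpha>))"
    and points: "\<And>k \<omega>. \<omega> \<in> space S \<Longrightarrow> t k \<omega> \<ge> 0 \<and> j k \<omega> > 0"
    and prm': "poisson_random_measure S (restrict_space lborel {0..} \<Otimes>\<^sub>M \<mu>)
          (\<lambda>\<omega>. sum_dirac (restrict_space lborel {0..} \<Otimes>\<^sub>M \<mu>) (\<lambda>k. (t k \<omega>, j k \<omega>)))"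
begin

abbreviation "E \<equiv> restrict_space lborel {0..} \<Otimes>\<^sub>M \<mu>"

lemma space_mu: "space \<mu> = {0<..}"
  using sets_eq_imp_space_eq[OF mu_sets] by (simp add: space_restrict_space)

sublocale poisson_points S E "\<lambda>k \<omega>. (t k \<omega>, j k \<omega>)"
proof (intro poisson_points.intro poisson_points_axioms.intro S prm')
  show "(t k \<omega>, j k \<omega>) \<in> space E" if "\<omega> \<in> space S" for k \<omega>
    using points[OF that, of k] by (auto simp: space_pair_measure space_mu space_restrict_space)
qed

lemma sets_mu_above: "x > 0 \<Longrightarrow> {ereal x<..} \<in> sets \<mu>"
  unfolding mu_sets by (subst sets_restrict_space_iff) (auto intro: less_trans[of 0 "ereal x"])

lemma sigma_finite_mu: "sigma_finite_measure \<mu>"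
proof (rule sigma_finite_measure.intro)
  let ?A = "range (\<lambda>n. {ereal (1 / real (Suc n))<..})"
  have "\<Union> ?A = space \<mu>"
  proof
    show "\<Union> ?A \<subseteq> space \<mu>"
      by (auto simp: space_mu intro: less_trans[of 0 "ereal (1 / real (Suc _))"])
    show "space \<mu> \<subseteq> \<Union> ?A"
    proof
      fix x assume "x \<in> space \<mu>"
      then have x: "x > 0" by (simp add: space_mu)
      show "x \<in> \<Union> ?A"
      proof (cases x)
        case (real y)
        then obtain n where "1 / real (Suc n) < y" using x nat_approx_posE[of y] by auto
        then show ?thesis using real by auto
      qed (use x in auto)
    qed
  qed
  then show "\<exists>A. countable A \<and> A \<subseteq> sets \<mu> \<and> \<Union> A = space \<mu> \<and> (\<forall>a\<in>A. emeasure \<mu> a \<noteq> \<infinity>)"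
    by (intro exI[of _ ?A]) (auto simp: sets_mu_above mu)
qed

lemma rectangle:
  assumes c: "0 \<le> c" "c \<le> d" and x: "x > 0"
  shows "{c..<d} \<times> {ereal x<..} \<in> sets E" "emeasure E ({c..<d} \<times> {ereal x<..}) = ennreal ((d - c) * x powr (- \<alpha>))"
proof -
  have 1: "{c..<d} \<in> sets (restrict_space lborel {0..})"
    using c by (subst sets_restrict_space_iff) auto
  show "{c..<d} \<times> {ereal x<..} \<in> sets E" using 1 sets_mu_above[OF x] by auto
  have "emeasure E ({c..<d} \<times> {ereal x<..}) = emeasure (restrict_space lborel {0..}) {c..<d} * emeasure \<mu> {ereal x<..}"
    by (rule sigma_finite_measure.emeasure_pair_measure_Times[OF sigma_finite_mu 1 sets_mu_above[OF x]])
  also have "emeasure (restrict_space lborel {0..}) {c..<d} = ennreal (d - c)"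
    using c by (subst emeasure_restrict_space) auto
  finally show "emeasure E ({c..<d} \<times> {ereal x<..}) = ennreal ((d - c) * x powr (- \<alpha>))"
    using c x by (simp add: mu ennreal_mult)
qed

lemma rectangle_measure:
  assumes c: "0 \<le> c" "c \<le> d" and x: "x > 0"
  shows "measure E ({c..<d} \<times> {ereal x<..}) = (d - c) * x powr (- \<alpha>)" "emeasure E ({c..<d} \<times> {ereal x<..}) < \<infinity>"
  using rectangle(2)[OF assms] c by (auto simp: measure_def)

lemma level_cells_measure:
  assumes m: "m \<ge> 1" and \<eta>: "\<eta> > 0" and r: "\<And>a. a < N \<Longrightarrow> r a \<ge> 1"
  shows "level_cells m \<eta> R N r \<in> sets E" "emeasure E (level_cells m \<eta> R N r) < \<infinity>"
    "measure E (level_cells m \<eta> R N r) = (\<Sum>a\<in>{a. a < N \<and> r a \<le> R}. (real (r a) * \<eta>) powr (- \<alpha>) / real m)"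
proof -
  define K where "K = {a. a < N \<and> r a \<le> R}"
  define A where "A a = {real a / real m..<(real a + 1) / real m} \<times> {ereal (real (r a) * \<eta>)<..}" for a
  have K: "finite K" by (simp add: K_def)
  have pos: "0 \<le> real a / real m" "real a / real m \<le> (real a + 1) / real m" for a by (auto simp: divide_right_mono)
  have xpos: "real (r a) * \<eta> > 0" if "a \<in> K" for a using r[of a] that \<eta> by (auto simp: K_def)
  have A: "A a \<in> sets E" "emeasure E (A a) < \<infinity>" "measure E (A a) = (real (r a) * \<eta>) powr (- \<alpha>) / real m" if "a \<in> K" for a
    unfolding A_def using rectangle(1)[OF pos xpos[OF that]] rectangle_measure[OF pos xpos[OF that]]
    by (auto simp: diff_divide_distrib[symmetric])
  have disj: "disjoint_family_on A K"
  proof -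
    have "False" if "a < a'" "x \<in> {real a / real m..<(real a + 1) / real m}" "x \<in> {real a' / real m..<(real a' + 1) / real m}" for a a' x
    proof -
      have "real a' / real m < (real a + 1) / real m" using that by simp
      then have "real a' < real a + 1" using m by (simp add: divide_less_cancel)
      then show False using that by simp
    qed
    then have "A a \<inter> A a' = {}" if "a < a'" for a a' using that by (fastforce simp: A_def)
    then show ?thesis unfolding disjoint_family_on_def by (metis Int_commute linorder_neqE_nat)
  qed
  have eq: "level_cells m \<eta> R N r = (\<Union>a\<in>K. A a)" by (simp add: level_cells_def K_def A_def)
  show "level_cells m \<eta> R N r \<in> sets E" unfolding eq using A K by auto
  have "emeasure E (\<Union>a\<in>K. A a) \<le> (\<Sum>a\<in>K. emeasure E (A a))"
    by (rule emeasure_subadditive_finite) (use A K in auto)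
  also have "\<dots> < \<infinity>" using A(2) K by (simp add: ennreal_sum_less_top)
  finally show "emeasure E (level_cells m \<eta> R N r) < \<infinity>" unfolding eq .
  have "measure E (\<Union>a\<in>K. A a) = (\<Sum>a\<in>K. measure E (A a))"
    by (rule measure_finite_Union) (use A K disj in \<open>auto simp: less_top[symmetric]\<close>)
  also have "\<dots> = (\<Sum>a\<in>K. (real (r a) * \<eta>) powr (- \<alpha>) / real m)" using A(3) by simp
  finally show "measure E (level_cells m \<eta> R N r) = (\<Sum>a\<in>{a. a < N \<and> r a \<le> R}. (real (r a) * \<eta>) powr (- \<alpha>) / real m)"
    unfolding eq by (simp add: K_def)
qed

lemma block_levels_less_iff_void:
  assumes \<eta>: "\<eta> > 0" and r: "\<And>a. a < N \<Longrightarrow> r a \<ge> 1"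
  shows "(\<forall>a<N. block_level m R \<eta> (\<lambda>k. t k \<omega>) (\<lambda>k. j k \<omega>) a < r a) \<longleftrightarrow>
     (\<forall>k. (t k \<omega>, j k \<omega>) \<notin> level_cells m \<eta> R N r)"
  unfolding block_level_less_iff[OF \<eta>] block_hit_def level_cells_def using r by (auto simp: not_less) (meson not_less)+

text \<open>The joint distribution function of the block levels is a void probability. If some \<open>r a\<close> is
  \<open>0\<close> the event is empty.\<close>

lemma block_levels_prob:
  assumes m: "m \<ge> 1" and \<eta>: "\<eta> > 0"
  shows "prob {\<omega> \<in> space S. \<forall>a<N. block_level m R \<eta> (\<lambda>k. t k \<omega>) (\<lambda>k. j k \<omega>) a < r a} =
    (if \<exists>a<N. r a = 0 then 0 else exp (- (\<Sum>a\<in>{a. a < N \<and> r a \<le> R}. (real (r a) * \<eta>) powr (- \<alpha>) / real m)))"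
    (is ?th1)
  and "{\<omega> \<in> space S. block_level m R \<eta> (\<lambda>k. t k \<omega>) (\<lambda>k. j k \<omega>) a < r'} \<in> events" (is ?th2)
proof -
  show ?th1
  proof (cases "\<exists>a<N. r a = 0")
    case True
    then have "{\<omega> \<in> space S. \<forall>a<N. block_level m R \<eta> (\<lambda>k. t k \<omega>) (\<lambda>k. j k \<omega>) a < r a} = {}" by auto
    then show ?thesis using True by (simp only: measure_empty if_True)
  next
    case False
    then have r: "\<And>a. a < N \<Longrightarrow> r a \<ge> 1" by (metis One_nat_def Suc_leI neq0_conv)
    have "{\<omega> \<in> space S. \<forall>a<N. block_level m R \<eta> (\<lambda>k. t k \<omega>) (\<lambda>k. j k \<omega>) a < r a} =
        {\<omega> \<in> space S. \<forall>k. (t k \<omega>, j k \<omega>) \<notin> level_cells m \<eta> R N r}"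
      using block_levels_less_iff_void[where N = N and r = r, OF \<eta> r] by simp
    then show ?thesis
      using void_prob[OF level_cells_measure(1,2)[where N = N and r = r, OF m \<eta> r]] False
      by (simp add: level_cells_measure(3)[where N = N and r = r, OF m \<eta> r])
  qed
  show ?th2
  proof (cases "r' = 0 \<or> r' > R")
    case True
    have "{\<omega> \<in> space S. block_level m R \<eta> (\<lambda>k. t k \<omega>) (\<lambda>k. j k \<omega>) a < r'} = (if r' = 0 then {} else space S)"
      using True le_less_trans[OF block_level_le[of m R \<eta>]] by auto
    then show ?thesis by (cases "r' = 0") simp_all
  next
    case False
    then have x: "real r' * \<eta> > 0" using \<eta> by simp
    have pos: "0 \<le> real a / real m" "real a / real m \<le> (real a + 1) / real m" by (auto simp: divide_right_mono)
    have "{\<omega> \<in> space S. block_level m R \<eta> (\<lambda>k. t k \<omega>) (\<lambda>k. j k \<omega>) a < r'} =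
      {\<omega> \<in> space S. \<forall>k. (t k \<omega>, j k \<omega>) \<notin> {real a / real m..<(real a + 1) / real m} \<times> {ereal (real r' * \<eta>)<..}}"
      unfolding block_level_less_iff[OF \<eta>] block_hit_def using False by (auto simp: not_less)
    then show ?thesis using void_event[OF rectangle(1)[OF pos x]] by simp
  qed
qed

text \<open>Almost surely no point has height \<open>\<infinity>\<close>, and only finitely many points before a given time
  exceed a given positive height, since \<open>\<mu>\<close> is finite there.\<close>

lemma sup_process_running_sup:
  obtains B where "B \<in> null_sets S" "\<And>\<omega>. \<omega> \<in> space S - B \<Longrightarrow>
     running_sup (\<lambda>k. t k \<omega>) (\<lambda>k. j k \<omega>) (sup_process (\<lambda>k. t k \<omega>) (\<lambda>k. j k \<omega>)) \<and>
     sup_process (\<lambda>k. t k \<omega>) (\<lambda>k. j k \<omega>) \<in> skorokhod_D"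
proof -
  have fin: "AE \<omega> in S. \<forall>n::nat. finite {k. (t k \<omega>, j k \<omega>) \<in> {0..<real (Suc n)} \<times> {ereal (1 / real (Suc n))<..}}"
    by (subst AE_all_countable, intro allI AE_finite_points rectangle(1) rectangle_measure(2)) auto
  have inf: "AE \<omega> in S. \<forall>n::nat. \<forall>k. (t k \<omega>, j k \<omega>) \<notin> {0..<real n} \<times> {\<infinity>}"
  proof (subst AE_all_countable, intro allI)
    fix n :: nat
    have inf_set: "{\<infinity>::ereal} \<in> sets \<mu>" unfolding mu_sets by (subst sets_restrict_space_iff) auto
    have le: "emeasure \<mu> {\<infinity>} \<le> ennreal (x powr (- \<alpha>))" if "x > 0" for x
      unfolding mu[OF that, symmetric] by (rule emeasure_mono) (use sets_mu_above[OF that] in auto)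
    have mu0: "emeasure \<mu> {\<infinity>} = 0"
    proof -
      have "((\<lambda>x. ennreal (x powr (- \<alpha>))) \<longlongrightarrow> ennreal 0) at_top"
        by (intro tendsto_ennrealI tendsto_neg_powr filterlim_ident) (use alpha in auto)
      moreover have "\<forall>\<^sub>F x in at_top. emeasure \<mu> {\<infinity>} \<le> ennreal (x powr (- \<alpha>))"
        using eventually_gt_at_top[of 0] by eventually_elim (rule le)
      ultimately have "emeasure \<mu> {\<infinity>} \<le> ennreal 0" by (rule tendsto_lowerbound) simp
      then show ?thesis by simp
    qed
    have 1: "{0..<real n} \<in> sets (restrict_space lborel {0..})" by (subst sets_restrict_space_iff) auto
    show "AE \<omega> in S. \<forall>k. (t k \<omega>, j k \<omega>) \<notin> {0..<real n} \<times> {\<infinity>}"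
    proof (rule AE_no_point)
      show "{0..<real n} \<times> {\<infinity>} \<in> sets E" using 1 inf_set by auto
      show "emeasure E ({0..<real n} \<times> {\<infinity>}) = 0"
        using sigma_finite_measure.emeasure_pair_measure_Times[OF sigma_finite_mu 1 inf_set] by (simp add: mu0)
    qed
  qed
  have ae: "AE \<omega> in S. running_sup (\<lambda>k. t k \<omega>) (\<lambda>k. j k \<omega>) (sup_process (\<lambda>k. t k \<omega>) (\<lambda>k. j k \<omega>)) \<and>
     sup_process (\<lambda>k. t k \<omega>) (\<lambda>k. j k \<omega>) \<in> skorokhod_D"
    using fin inf AE_space
  proof eventually_elim
    case (elim \<omega>)
    have F: "finite {k. t k \<omega> \<le> T \<and> j k \<omega> > ereal e}" if e: "e > 0" for T e
    proof -
      obtain n1 :: nat where n1: "T < real n1" using reals_Archimedean2 by blast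
      obtain n2 :: nat where n2: "1 / real (Suc n2) < e" using nat_approx_posE[OF e] by blast
      define n where "n = max n1 n2"
      have "1 / real (Suc n) \<le> 1 / real (Suc n2)" by (rule divide_left_mono) (auto simp: n_def)
      then have n: "T < real (Suc n)" "1 / real (Suc n) < e" using n1 n2 by (auto simp: n_def)
      have "{k. t k \<omega> \<le> T \<and> j k \<omega> > ereal e} \<subseteq> {k. (t k \<omega>, j k \<omega>) \<in> {0..<real (Suc n)} \<times> {ereal (1 / real (Suc n))<..}}"
      proof
        fix k assume k: "k \<in> {k. t k \<omega> \<le> T \<and> j k \<omega> > ereal e}"
        have "ereal (1 / real (Suc n)) < ereal e" using n by simp
        also have "ereal e < j k \<omega>" using k by simp
        finally show "k \<in> {k. (t k \<omega>, j k \<omega>) \<in> {0..<real (Suc n)} \<times> {ereal (1 / real (Suc n))<..}}"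
          using k n(1) points[OF elim(3), of k] by auto
      qed
      then show ?thesis using elim(1) finite_subset by blast
    qed
    have jfin: "j k \<omega> \<noteq> \<infinity>" for k
    proof
      assume "j k \<omega> = \<infinity>"
      obtain n :: nat where "t k \<omega> < real n" using reals_Archimedean2 by blast
      with \<open>j k \<omega> = \<infinity>\<close> have "(t k \<omega>, j k \<omega>) \<in> {0..<real n} \<times> {\<infinity>}" using points[OF elim(3), of k] by auto
      with elim(2) show False by blast
    qed
    have R: "running_sup (\<lambda>k. t k \<omega>) (\<lambda>k. j k \<omega>) (sup_process (\<lambda>k. t k \<omega>) (\<lambda>k. j k \<omega>))"
      by (rule running_sup_sup_process) (use points[OF elim(3)] jfin F in auto)
    then show ?case using running_sup_in_D[OF R _ F] by (auto simp: sup_process_def)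
  qed
  then obtain B where "B \<in> null_sets S" "{\<omega> \<in> space S. \<not> (running_sup (\<lambda>k. t k \<omega>) (\<lambda>k. j k \<omega>) (sup_process (\<lambda>k. t k \<omega>) (\<lambda>k. j k \<omega>)) \<and>
     sup_process (\<lambda>k. t k \<omega>) (\<lambda>k. j k \<omega>) \<in> skorokhod_D)} \<subseteq> B"
    unfolding eventually_ae_filter by auto
  then show thesis using that[of B] by blast
qed

end

section \<open>Regularly varying tails\<close>

text \<open>Squeeze \<open>ln (1 - \<tau>)\<close> between \<open>- \<tau> - 2 \<tau>\<^sup>2\<close> and \<open>- \<tau>\<close>.\<close>

lemma power_one_minus_tendsto_exp:
  fixes \<tau> :: "nat \<Rightarrow> real" and c :: "nat \<Rightarrow> nat"
  assumes \<tau>: "\<And>n. \<tau> n \<ge> 0" "\<tau> \<longlonglongrightarrow> 0" and lim: "(\<lambda>n. real (c n) * \<tau> n) \<longlonglongrightarrow> x"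
  shows "(\<lambda>n. (1 - \<tau> n) ^ c n) \<longlonglongrightarrow> exp (- x)"
proof (rule tendsto_sandwich)
  have small: "\<forall>\<^sub>F n in sequentially. \<tau> n < 1/2" using \<tau>(2) by (rule order_tendstoD) simp
  show "(\<lambda>n. exp (- (real (c n) * \<tau> n) - 2 * (real (c n) * \<tau> n) * \<tau> n)) \<longlonglongrightarrow> exp (- x)"
  proof -
    have "(\<lambda>n. exp (- (real (c n) * \<tau> n) - 2 * (real (c n) * \<tau> n) * \<tau> n)) \<longlonglongrightarrow> exp (- x - 2 * x * 0)"
      by (intro tendsto_intros lim \<tau>)
    then show ?thesis by simp
  qed
  show "(\<lambda>n. exp (- (real (c n) * \<tau> n))) \<longlonglongrightarrow> exp (- x)" by (intro tendsto_intros lim)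
  show "\<forall>\<^sub>F n in sequentially. exp (- (real (c n) * \<tau> n) - 2 * (real (c n) * \<tau> n) * \<tau> n) \<le> (1 - \<tau> n) ^ c n"
    using small
  proof eventually_elim
    case (elim n)
    have "- \<tau> n - 2 * (\<tau> n)\<^sup>2 \<le> ln (1 - \<tau> n)"
      using elim \<tau>(1)[of n] by (intro ln_one_minus_pos_lower_bound) auto
    then have "exp (- \<tau> n - 2 * (\<tau> n)\<^sup>2) \<le> 1 - \<tau> n" using elim by (subst ln_ge_iff[symmetric]) auto
    then have "exp (- \<tau> n - 2 * (\<tau> n)\<^sup>2) ^ c n \<le> (1 - \<tau> n) ^ c n" by (rule power_mono) simp
    then show ?case by (simp add: exp_of_nat_mult[symmetric] power2_eq_square algebra_simps)
  qed
  show "\<forall>\<^sub>F n in sequentially. (1 - \<tau> n) ^ c n \<le> exp (- (real (c n) * \<tau> n))"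
    using small
  proof eventually_elim
    case (elim n)
    have "1 - \<tau> n \<le> exp (- \<tau> n)" using exp_ge_add_one_self[of "- \<tau> n"] by simp
    then have "(1 - \<tau> n) ^ c n \<le> exp (- \<tau> n) ^ c n" using elim by (intro power_mono) auto
    then show ?case by (simp add: exp_of_nat_mult[symmetric])
  qed
qed

text \<open>The assumptions on the tail \<open>F\<close> of \<open>log \<bar>Q\<bar>\<close> and on the norming sequence, without reference to a probability
  space.\<close>

locale regular_tail =
  fixes F l :: "real \<Rightarrow> real" and \<alpha> :: real and b :: "nat \<Rightarrow> real"
  assumes antimono: "\<And>x y. x \<le> y \<Longrightarrow> F y \<le> F x" and nonneg: "\<And>x. F x \<ge> 0"
    and alpha: "0 < \<alpha>" "\<alpha> \<le> 1" and l_slow: "slowly_varying l"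
    and tail: "F \<sim>[at_top] (\<lambda>x. x powr (- \<alpha>) * l x)"
    and b_lim: "(\<lambda>n. real n * F (b n)) \<longlonglongrightarrow> 1"
    and alpha_1: "\<alpha> = 1 \<Longrightarrow> filterlim l at_top at_top"
begin

lemma l_pos: "\<forall>\<^sub>F x in at_top. l x > 0"
  using l_slow unfolding slowly_varying_def eventually_at_top_linorder by auto

lemma tail_ratio_1: "((\<lambda>x. F x / (x powr (- \<alpha>) * l x)) \<longlongrightarrow> 1) at_top"
proof (rule asymp_equivD_strong[OF tail])
  show "\<forall>\<^sub>F x in at_top. F x \<noteq> 0 \<or> x powr (- \<alpha>) * l x \<noteq> 0"
    using l_pos eventually_gt_at_top[of 0] by eventually_elim auto
qed

lemma tail_pos: "F x > 0"
proof -
  have "\<forall>\<^sub>F y in at_top. F y / (y powr (- \<alpha>) * l y) > 0"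
    using tail_ratio_1 by (rule order_tendstoD) simp
  then have "\<forall>\<^sub>F y in at_top. F y > 0 \<and> y \<ge> x"
    using l_pos eventually_gt_at_top[of 0] eventually_ge_at_top[of x]
  proof eventually_elim
    case (elim y)
    then have "y powr (- \<alpha>) * l y > 0" by simp
    then show ?case using elim nonneg[of y] by (auto simp: zero_less_divide_iff)
  qed
  then obtain y where "F y > 0" "y \<ge> x" by (auto simp: eventually_at_top_linorder)
  then show ?thesis using antimono[of x y] by simp
qed

lemma tail_ratio:
  assumes c: "c > 0"
  shows "((\<lambda>x. F (c * x) / F x) \<longlongrightarrow> c powr (- \<alpha>)) at_top"
proof -
  let ?g = "\<lambda>x. x powr (- \<alpha>) * l x"
  have lim: "filterlim (\<lambda>x. c * x) at_top at_top"
    using c by (intro filterlim_tendsto_pos_mult_at_top[OF tendsto_const _ filterlim_ident]) auto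
  have 1: "((\<lambda>x. F (c * x) / ?g (c * x)) \<longlongrightarrow> 1) at_top"
    by (rule filterlim_compose[OF tail_ratio_1 lim])
  have 2: "((\<lambda>x. l (c * x) / l x) \<longlongrightarrow> 1) at_top"
    using l_slow c by (auto simp: slowly_varying_def)
  have 3: "((\<lambda>x. inverse (F x / ?g x)) \<longlongrightarrow> inverse 1) at_top"
    by (rule tendsto_inverse[OF tail_ratio_1]) simp
  have "((\<lambda>x. F (c * x) / ?g (c * x) * (c powr (- \<alpha>) * (l (c * x) / l x)) * inverse (F x / ?g x))
       \<longlongrightarrow> 1 * (c powr (- \<alpha>) * 1) * inverse 1) at_top"
    by (intro tendsto_mult 1 2 3 tendsto_const)
  moreover have "\<forall>\<^sub>F x in at_top. l (c * x) > 0"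
    by (rule eventually_compose_filterlim[OF l_pos lim])
  then have "\<forall>\<^sub>F x in at_top. F (c * x) / ?g (c * x) * (c powr (- \<alpha>) * (l (c * x) / l x)) * inverse (F x / ?g x) = F (c * x) / F x"
    using l_pos eventually_gt_at_top[of 0]
    by eventually_elim (use c tail_pos in \<open>auto simp: powr_mult field_simps less_imp_neq[symmetric]\<close>)
  ultimately show ?thesis by (auto elim: Lim_transform_eventually)
qed

text \<open>For \<open>\<alpha> = 1\<close> this is the assumption \<open>\<ell> \<rightarrow> \<infinity>\<close>. For \<open>\<alpha> < 1\<close>, doubling \<open>x\<close> multiplies \<open>x F x\<close> by
  almost \<open>2\<close> to the power \<open>1 - \<alpha>\<close>, hence eventually by more than a constant \<open>\<rho> > 1\<close>; monotonicity of \<open>F\<close> controls the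
  values between successive doublings.\<close>

lemma x_tail_at_top: "filterlim (\<lambda>x. x * F x) at_top at_top"
proof (cases "\<alpha> = 1")
  case True
  have "\<forall>\<^sub>F x in at_top. F x / (x powr (- \<alpha>) * l x) > 1/2"
    using tail_ratio_1 by (rule order_tendstoD) simp
  then have ev: "\<forall>\<^sub>F x in at_top. 1/2 * l x \<le> x * F x"
    using l_pos eventually_gt_at_top[of 0]
    by eventually_elim (auto simp: True powr_minus field_simps)
  have "filterlim (\<lambda>x. 1/2 * l x) at_top at_top"
    by (rule filterlim_tendsto_pos_mult_at_top[OF tendsto_const _ alpha_1[OF True]]) simp
  then show ?thesis by (rule filterlim_at_top_mono[OF _ ev])
next
  case False
  with alpha have \<alpha>: "\<alpha> < 1" by simp
  define h where "h x = x * F x" for x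
  define \<rho> where "\<rho> = (1 + 2 powr (1 - \<alpha>)) / 2"
  have "2 powr (1 - \<alpha>) > (1::real)" using \<alpha> by (intro gr_one_powr) auto
  then have \<rho>: "\<rho> > 1" "\<rho> < 2 powr (1 - \<alpha>)" by (auto simp: \<rho>_def)
  have "((\<lambda>x. 2 * (F (2 * x) / F x)) \<longlongrightarrow> 2 * 2 powr (- \<alpha>)) at_top"
    by (intro tendsto_mult tendsto_const tail_ratio) simp
  moreover have "2 * 2 powr (- \<alpha>) = 2 powr (1 - \<alpha>)" by (simp add: powr_diff powr_minus field_simps)
  ultimately have "\<forall>\<^sub>F x in at_top. 2 * (F (2 * x) / F x) > \<rho>"
    using \<rho> by (intro order_tendstoD) auto
  then have "\<forall>\<^sub>F x in at_top. h (2 * x) \<ge> \<rho> * h x"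
    using eventually_gt_at_top[of 0]
    by eventually_elim (use tail_pos in \<open>auto simp: h_def field_simps\<close>)
  then obtain x0' where x0': "\<And>x. x \<ge> x0' \<Longrightarrow> h (2 * x) \<ge> \<rho> * h x"
    by (auto simp: eventually_at_top_linorder)
  define x0 where "x0 = max x0' 1"
  have x0: "x0 > 0" "\<And>x. x \<ge> x0 \<Longrightarrow> h (2 * x) \<ge> \<rho> * h x" using x0' by (auto simp: x0_def)
  define c where "c = x0 * F (2 * x0)"
  have c: "c > 0" using x0 tail_pos by (simp add: c_def)
  have grow: "h x \<ge> \<rho> ^ k * c" if "2 ^ k * x0 \<le> x" "x \<le> 2 ^ Suc k * x0" for x k
    using that
  proof (induction k arbitrary: x)
    case 0
    have "x0 * F (2 * x0) \<le> x * F x" using 0 x0 antimono[of x "2 * x0"] nonneg by (intro mult_mono) auto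
    then show ?case by (simp add: h_def c_def)
  next
    case (Suc k)
    have "h (x/2) \<ge> \<rho> ^ k * c" by (rule Suc.IH) (use Suc.prems in auto)
    moreover have "x / 2 \<ge> x0"
    proof -
      have "1 * x0 \<le> 2 ^ k * x0" using x0 by (intro mult_right_mono) auto
      then show ?thesis using Suc.prems by simp
    qed
    then have "h x \<ge> \<rho> * h (x/2)" using x0(2)[of "x/2"] by simp
    ultimately show ?case using \<rho> by (simp add: mult.assoc) (meson less_imp_le less_trans mult_left_mono order_trans zero_less_one)
  qed
  have "\<forall>\<^sub>F x in at_top. h x \<ge> B" for B
  proof -
    obtain K where K: "B / c < \<rho> ^ K" using real_arch_pow[OF \<rho>(1)] by blast
    have "h x \<ge> B" if x: "x \<ge> 2 ^ K * x0" for x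
    proof -
      have ex: "\<exists>n. x < 2 ^ n * x0"
        using real_arch_pow[of 2 "x / x0"] x0 by (auto simp: field_simps)
      define n where "n = (LEAST n. x < 2 ^ n * x0)"
      have n: "x < 2 ^ n * x0" unfolding n_def using ex by (rule LeastI_ex)
      have "\<not> n \<le> K"
      proof
        assume "n \<le> K"
        then have "2 ^ n * x0 \<le> 2 ^ K * x0" using x0 by (intro mult_right_mono power_increasing) auto
        with n x show False by simp
      qed
      then obtain k where k: "n = Suc k" "K \<le> k" by (cases n) auto
      have "\<not> x < 2 ^ k * x0" using not_less_Least[of k "\<lambda>n. x < 2 ^ n * x0"] k by (simp add: n_def)
      then have "h x \<ge> \<rho> ^ k * c" using n k by (intro grow) auto
      moreover have "\<rho> ^ K * c \<le> \<rho> ^ k * c" using k \<rho> c by (intro mult_right_mono power_increasing) auto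
      moreover have "B < \<rho> ^ K * c" using K c by (simp add: field_simps)
      ultimately show ?thesis by linarith
    qed
    then show ?thesis by (auto simp: eventually_at_top_linorder)
  qed
  then show ?thesis unfolding filterlim_at_top h_def by blast
qed

lemma tail_b_0: "(\<lambda>n. F (b n)) \<longlonglongrightarrow> 0"
proof -
  have "(\<lambda>n. real n * F (b n) * (1 / real n)) \<longlonglongrightarrow> 1 * 0"
    by (intro tendsto_mult b_lim lim_1_over_n)
  moreover have "\<forall>\<^sub>F n in sequentially. real n * F (b n) * (1 / real n) = F (b n)"
    using eventually_gt_at_top[of 0] by eventually_elim simp
  ultimately show ?thesis by (auto elim: Lim_transform_eventually)
qed

lemma b_at_top: "filterlim b at_top sequentially"
  unfolding filterlim_at_top
proof
  fix B
  have "\<forall>\<^sub>F n in sequentially. F (b n) < F B" using tail_b_0 tail_pos by (intro order_tendstoD) auto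
  then show "\<forall>\<^sub>F n in sequentially. B \<le> b n"
  proof eventually_elim
    case (elim n)
    show "B \<le> b n"
    proof (rule ccontr)
      assume "\<not> B \<le> b n"
      with antimono[of "b n" B] elim show False by simp
    qed
  qed
qed

lemma scaled_tail:
  assumes "x > 0"
  shows "(\<lambda>n. real n * F (x * b n)) \<longlonglongrightarrow> x powr (- \<alpha>)"
proof -
  have "(\<lambda>n. F (x * b n) / F (b n) * (real n * F (b n))) \<longlonglongrightarrow> x powr (- \<alpha>) * 1"
    by (intro tendsto_mult b_lim filterlim_compose[OF tail_ratio[OF assms] b_at_top])
  then show ?thesis using tail_pos by (simp add: less_imp_neq[symmetric] mult.commute)
qed

text \<open>It is the quotient of \<open>n F(b\<^sub>n) \<rightarrow> 1\<close> and \<open>b\<^sub>n F(b\<^sub>n) \<rightarrow> \<infinity>\<close>.\<close>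

lemma n_over_b: "(\<lambda>n. real n / b n) \<longlonglongrightarrow> 0"
proof -
  have "filterlim (\<lambda>n. b n * F (b n)) at_top sequentially"
    by (rule filterlim_compose[OF x_tail_at_top b_at_top])
  then have "(\<lambda>n. inverse (b n * F (b n))) \<longlonglongrightarrow> 0"
    by (rule tendsto_inverse_0_at_top)
  from tendsto_mult[OF b_lim this]
  have "(\<lambda>n. real n * F (b n) * inverse (b n * F (b n))) \<longlonglongrightarrow> 0" by simp
  then show ?thesis using tail_pos by (simp add: field_simps less_imp_neq[symmetric])
qed

lemma n_truncated_over_b:
  fixes e :: "real \<Rightarrow> real"
  assumes e: "((\<lambda>x. e x / (x * F x)) \<longlongrightarrow> 0) at_top"
  shows "(\<lambda>n. real n * e (b n) / b n) \<longlonglongrightarrow> 0"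
proof -
  have "(\<lambda>n. e (b n) / (b n * F (b n)) * (real n * F (b n))) \<longlonglongrightarrow> 0 * 1"
    by (intro tendsto_mult b_lim filterlim_compose[OF e b_at_top])
  then show ?thesis using tail_pos by (simp add: field_simps less_imp_neq[symmetric])
qed

text \<open>Needed when \<open>log\<^sup>- \<bar>M\<bar>\<close> is integrable: the truncated expectations are then bounded, while \<open>x F x\<close>
  tends to infinity.\<close>

lemma bounded_truncated:
  fixes e :: "real \<Rightarrow> real"
  assumes "\<And>x. x > 0 \<Longrightarrow> \<bar>e x\<bar> \<le> K"
  shows "((\<lambda>x. e x / (x * F x)) \<longlongrightarrow> 0) at_top"
proof (rule Lim_null_comparison)
  show "\<forall>\<^sub>F x in at_top. norm (e x / (x * F x)) \<le> K * inverse (x * F x)"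
    using eventually_gt_at_top[of 0]
  proof eventually_elim
    case (elim x)
    have "x * F x > 0" using elim tail_pos by simp
    then have "\<bar>e x / (x * F x)\<bar> = \<bar>e x\<bar> / (x * F x)" by (simp only: abs_divide abs_of_pos)
    also have "\<dots> \<le> K / (x * F x)" using \<open>x * F x > 0\<close> assms[OF elim] by (intro divide_right_mono) auto
    finally show ?case by (simp add: divide_inverse)
  qed
  have "((\<lambda>x. K * inverse (x * F x)) \<longlongrightarrow> K * 0) at_top"
    by (intro tendsto_mult tendsto_const tendsto_inverse_0_at_top[OF x_tail_at_top])
  then show "((\<lambda>x. K * inverse (x * F x)) \<longlongrightarrow> 0) at_top" by simp
qed

end

section \<open>Independent sequences and transient walks\<close>

text \<open>Both families are independent with the same marginals. This expresses shifts of an i.i.d. sequence as well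
  as permutations of it.\<close>

lemma (in prob_space) distr_reindex_indep:
  fixes Z :: "nat \<Rightarrow> 'a \<Rightarrow> 'b"
  assumes indep: "indep_vars (\<lambda>_. N) Z J" and f: "inj_on f I" "f ` I \<subseteq> J" and I: "I \<subseteq> J" "I \<noteq> {}"
    and ident: "\<And>i. i \<in> I \<Longrightarrow> distr M N (Z (f i)) = distr M N (Z i)"
  shows "distr M (PiM I (\<lambda>_. N)) (\<lambda>\<omega>. \<lambda>i\<in>I. Z (f i) \<omega>) = distr M (PiM I (\<lambda>_. N)) (\<lambda>\<omega>. \<lambda>i\<in>I. Z i \<omega>)"
proof -
  have rv: "random_variable N (Z i)" if "i \<in> J" for i using indep that by (auto simp: indep_vars_def)
  have 1: "indep_vars (\<lambda>_. N) Z I" by (rule indep_vars_subset[OF indep I(1)])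
  have "indep_vars (\<lambda>j. PiM {f j} (\<lambda>_. N)) (\<lambda>j \<omega>. restrict (\<lambda>i. Z i \<omega>) {f j}) I"
    by (rule indep_vars_restrict[OF indep]) (use f in \<open>auto simp: disjoint_family_on_def inj_on_def\<close>)
  then have "indep_vars (\<lambda>_. N) (\<lambda>j \<omega>. (\<lambda>x. x (f j)) (restrict (\<lambda>i. Z i \<omega>) {f j})) I"
    by (rule indep_vars_compose2) (auto intro: measurable_component_singleton)
  then have 2: "indep_vars (\<lambda>_. N) (\<lambda>j. Z (f j)) I" by simp
  have "distr M (PiM I (\<lambda>_. N)) (\<lambda>\<omega>. \<lambda>i\<in>I. Z (f i) \<omega>) = PiM I (\<lambda>i. distr M N (Z (f i)))"
    using 2 f I rv by (subst (asm) indep_vars_iff_distr_eq_PiM') auto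
  also have "\<dots> = PiM I (\<lambda>i. distr M N (Z i))" by (rule PiM_cong) (use ident in auto)
  also have "\<dots> = distr M (PiM I (\<lambda>_. N)) (\<lambda>\<omega>. \<lambda>i\<in>I. Z i \<omega>)"
    using 1 I rv by (subst (asm) indep_vars_iff_distr_eq_PiM') auto
  finally show ?thesis .
qed

lemma (in prob_space) prob_reindex_indep:
  fixes Z :: "nat \<Rightarrow> 'a \<Rightarrow> 'b"
  assumes indep: "indep_vars (\<lambda>_. N) Z J" and f: "inj_on f I" "f ` I \<subseteq> J" and I: "I \<subseteq> J" "I \<noteq> {}"
    and ident: "\<And>i. i \<in> I \<Longrightarrow> distr M N (Z (f i)) = distr M N (Z i)"
    and A: "Measurable.pred (PiM I (\<lambda>_. N)) A"
  shows "prob {\<omega> \<in> space M. A (\<lambda>i\<in>I. Z (f i) \<omega>)} = prob {\<omega> \<in> space M. A (\<lambda>i\<in>I. Z i \<omega>)}"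
proof -
  have rv: "random_variable N (Z i)" if "i \<in> J" for i using indep that by (auto simp: indep_vars_def)
  let ?X = "{x \<in> space (PiM I (\<lambda>_. N)). A x}"
  have X: "?X \<in> sets (PiM I (\<lambda>_. N))" using A by simp
  have m: "(\<lambda>\<omega>. \<lambda>i\<in>I. Z (g i) \<omega>) \<in> measurable M (PiM I (\<lambda>_. N))" if "g ` I \<subseteq> J" for g
    by (rule measurable_restrict) (use rv that in auto)
  have e: "measure (distr M (PiM I (\<lambda>_. N)) (\<lambda>\<omega>. \<lambda>i\<in>I. Z (g i) \<omega>)) ?X = prob {\<omega> \<in> space M. A (\<lambda>i\<in>I. Z (g i) \<omega>)}"
    if "g ` I \<subseteq> J" for g
  proof -
    have "(\<lambda>\<omega>. \<lambda>i\<in>I. Z (g i) \<omega>) -` ?X \<inter> space M = {\<omega> \<in> space M. A (\<lambda>i\<in>I. Z (g i) \<omega>)}"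
      using measurable_space[OF m[OF that]] by auto
    then show ?thesis by (simp add: measure_distr[OF m[OF that] X])
  qed
  show ?thesis using distr_reindex_indep[OF indep f I ident] e[OF f(2)] e[of "\<lambda>i. i"] I by simp
qed

text \<open>Last-exit decomposition. Since the walk \<open>S\<close> tends to \<open>-\<infinity>\<close>, there is \<open>m\<^sub>0\<close> such that from \<open>m\<^sub>0\<close> on it
  stays below \<open>-2c\<close> with probability more than \<open>1/2\<close>. For each \<open>\<omega>\<close>, the times \<open>i\<close> with \<open>\<bar>S\<^sub>i\<bar> \<le> c\<close> after which
  the increments behave in this way lie in a window of length \<open>m\<^sub>0\<close>, so there are at most \<open>m\<^sub>0\<close> of
  them; and each visit is of this kind with probability more than \<open>1/2\<close>, independently of the past.\<close>

lemma (in prob_space) transient_walk_visits: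
  fixes U :: "nat \<Rightarrow> 'a \<Rightarrow> real"
  assumes indep: "indep_vars (\<lambda>_. borel) U {1..}"
    and ident: "\<And>k. k \<ge> 1 \<Longrightarrow> distr M borel (U k) = distr M borel (U 1)"
    and drift: "AE \<omega> in M. filterlim (\<lambda>n. \<Sum>k=1..n. U k \<omega>) at_bot sequentially"
  obtains C where "\<And>N. (\<Sum>n<N. prob {\<omega> \<in> space M. \<bar>\<Sum>k=1..n. U k \<omega>\<bar> \<le> c}) \<le> C"
proof -
  have rv[measurable]: "random_variable borel (U i)" if "i \<in> {1..}" for i
    using indep that by (auto simp: indep_vars_def)
  define S where "S n \<omega> = (\<Sum>k=1..n. U k \<omega>)" for n \<omega>
  have S[measurable]: "random_variable borel (S n)" for n
    unfolding S_def by (rule borel_measurable_sum) (use rv in auto)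
  define G where "G m = {\<omega> \<in> space M. \<forall>j\<ge>m. S j \<omega> < - 2 * c}" for m
  have G: "G m \<in> events" for m unfolding G_def by measurable
  have inc: "incseq G" by (auto simp: G_def incseq_def)
  have "AE \<omega> in M. \<omega> \<in> (\<Union>m. G m)"
    using drift AE_space
  proof eventually_elim
    case (elim \<omega>)
    have "\<forall>\<^sub>F n in sequentially. S n \<omega> < - 2 * c"
      using elim(1) unfolding filterlim_at_bot_dense S_def by blast
    then show ?case using elim(2) by (auto simp: eventually_sequentially G_def)
  qed
  then have "prob (\<Union>m. G m) = 1"
    by (intro prob_eq_1[THEN iffD2]) (use G in auto)
  moreover have "(\<lambda>m. prob (G m)) \<longlonglongrightarrow> prob (\<Union>m. G m)"
    by (rule finite_Lim_measure_incseq) (use G inc in auto)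
  ultimately have "\<forall>\<^sub>F m in sequentially. prob (G m) > 1/2" by (intro order_tendstoD) auto
  then obtain m0 where m0: "prob (G m0) > 1/2" by (auto simp: eventually_sequentially)
  define F where "F i = {\<omega> \<in> space M. \<bar>S i \<omega>\<bar> \<le> c \<and> (\<forall>j\<ge>m0. S (i + j) \<omega> - S i \<omega> < - 2 * c)}" for i
  have F: "F i \<in> events" for i unfolding F_def by measurable
  have PF: "prob (F i) = prob {\<omega> \<in> space M. \<bar>S i \<omega>\<bar> \<le> c} * prob (G m0)" for i
  proof -
    define A where "A x \<longleftrightarrow> \<bar>\<Sum>k=1..i. x k\<bar> \<le> c" for x :: "nat \<Rightarrow> real"
    define B where "B x \<longleftrightarrow> (\<forall>j\<ge>m0. (\<Sum>k=1..j. x k) < - 2 * c)" for x :: "nat \<Rightarrow> real"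
    define B' where "B' x \<longleftrightarrow> (\<forall>j\<ge>m0. (\<Sum>k=1..j. x (i + k)) < - 2 * c)" for x :: "nat \<Rightarrow> real"
    have A: "{x \<in> space (PiM {1..i} (\<lambda>_. borel)). A x} \<in> sets (PiM {1..i} (\<lambda>_. borel))"
      unfolding A_def by measurable
    have B: "Measurable.pred (PiM {1..} (\<lambda>_. borel)) B"
      unfolding B_def by measurable
    have B': "{x \<in> space (PiM {i+1..} (\<lambda>_. borel)). B' x} \<in> sets (PiM {i+1..} (\<lambda>_. borel))"
      unfolding B'_def by measurable
    have ind: "indep_var (PiM {1..i} (\<lambda>_. borel)) (\<lambda>\<omega>. restrict (\<lambda>i. U i \<omega>) {1..i})
        (PiM {i+1..} (\<lambda>_. borel)) (\<lambda>\<omega>. restrict (\<lambda>i. U i \<omega>) {i+1..})"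
      by (rule indep_var_restrict[OF indep]) auto
    have Ssplit: "S (i + j) \<omega> - S i \<omega> = (\<Sum>k=1..j. U (i + k) \<omega>)" for j \<omega>
    proof (induction j)
      case (Suc j) then show ?case by (simp add: S_def)
    qed simp
    have sp: "restrict (\<lambda>i. U i \<omega>) I \<in> space (PiM I (\<lambda>_. borel))" for \<omega> I
      by (auto simp: space_PiM)
    have FA: "{\<omega> \<in> space M. \<bar>S i \<omega>\<bar> \<le> c} = (\<lambda>\<omega>. restrict (\<lambda>i. U i \<omega>) {1..i}) -` {x \<in> space (PiM {1..i} (\<lambda>_. borel)). A x} \<inter> space M"
      using sp by (auto simp: A_def S_def)
    have FB: "{\<omega> \<in> space M. (\<forall>j\<ge>m0. S (i + j) \<omega> - S i \<omega> < - 2 * c)} = (\<lambda>\<omega>. restrict (\<lambda>i. U i \<omega>) {i+1..}) -` {x \<in> space (PiM {i+1..} (\<lambda>_. borel)). B' x} \<inter> space M"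
      using sp by (auto simp: B'_def Ssplit)
    have "prob (F i) = prob {\<omega> \<in> space M. \<bar>S i \<omega>\<bar> \<le> c} * prob {\<omega> \<in> space M. (\<forall>j\<ge>m0. S (i + j) \<omega> - S i \<omega> < - 2 * c)}"
      unfolding FA FB indep_varD[OF ind A B', symmetric]
      by (rule arg_cong[of _ _ prob]) (use sp in \<open>auto simp: F_def A_def B'_def Ssplit, auto simp: S_def\<close>)
    also have "{\<omega> \<in> space M. (\<forall>j\<ge>m0. S (i + j) \<omega> - S i \<omega> < - 2 * c)} = {\<omega> \<in> space M. B (\<lambda>k\<in>{1..}. U (k + i) \<omega>)}"
      unfolding Ssplit by (auto simp: B_def add.commute)
    also have "prob \<dots> = prob {\<omega> \<in> space M. B (\<lambda>k\<in>{1..}. U k \<omega>)}"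
    proof (rule prob_reindex_indep[OF indep _ _ _ _ _ B])
      show "distr M borel (U (k + i)) = distr M borel (U k)" if "k \<in> {1..}" for k
        using ident[of "k + i"] ident[of k] that by simp
    qed auto
    also have "{\<omega> \<in> space M. B (\<lambda>k\<in>{1..}. U k \<omega>)} = G m0" by (auto simp: G_def B_def S_def)
    finally show ?thesis .
  qed
  have "(\<Sum>n<N. prob {\<omega> \<in> space M. \<bar>\<Sum>k=1..n. U k \<omega>\<bar> \<le> c}) \<le> 2 * real m0" for N
  proof -
    have cnt: "(\<Sum>n<N. indicator (F n) \<omega>) \<le> real m0" for \<omega>
    proof -
      define H where "H = {n \<in> {..<N}. \<omega> \<in> F n}"
      have "(\<Sum>n<N. indicator (F n) \<omega>) = real (card H)"
        by (simp add: indicator_def sum.If_cases H_def Int_def)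
      moreover have "card H \<le> m0"
      proof (cases "H = {}")
        case False
        have fH: "finite H" by (simp add: H_def)
        have "n < Min H + m0" if n: "n \<in> H" for n
        proof (rule ccontr)
          assume ge: "\<not> n < Min H + m0"
          define j where "j = n - Min H"
          have j: "n = Min H + j" "j \<ge> m0" using ge by (auto simp: j_def)
          have "\<omega> \<in> F (Min H)" "\<omega> \<in> F n" using Min_in[OF fH False] n by (auto simp: H_def)
          then have "S n \<omega> - S (Min H) \<omega> < - 2 * c" "\<bar>S (Min H) \<omega>\<bar> \<le> c" "\<bar>S n \<omega>\<bar> \<le> c"
            using j by (auto simp: F_def)
          then show False by linarith
        qed
        then have "H \<subseteq> {Min H..<Min H + m0}" using fH by auto
        from card_mono[OF _ this] show ?thesis by simp
      qed simp
      ultimately show ?thesis by simp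
    qed
    have "(\<Sum>n<N. prob (F n)) = expectation (\<lambda>\<omega>. \<Sum>n<N. indicator (F n) \<omega>)"
      using F by (subst Bochner_Integration.integral_sum) (auto simp: less_top[symmetric])
    also have "\<dots> \<le> expectation (\<lambda>\<omega>. real m0)"
      by (rule integral_mono) (use F cnt in \<open>auto simp: less_top[symmetric]\<close>)
    finally have "(\<Sum>n<N. prob (F n)) \<le> real m0" by (simp add: prob_space)
    moreover have "prob {\<omega> \<in> space M. \<bar>S n \<omega>\<bar> \<le> c} \<le> 2 * prob (F n)" for n
    proof -
      have "prob {\<omega> \<in> space M. \<bar>S n \<omega>\<bar> \<le> c} * (1/2) \<le> prob {\<omega> \<in> space M. \<bar>S n \<omega>\<bar> \<le> c} * prob (G m0)"
        using m0 by (intro mult_left_mono) auto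
      then show ?thesis unfolding PF by simp
    qed
    then have "(\<Sum>n<N. prob {\<omega> \<in> space M. \<bar>S n \<omega>\<bar> \<le> c}) \<le> (\<Sum>n<N. 2 * prob (F n))" by (intro sum_mono)
    ultimately show ?thesis by (simp add: S_def sum_distrib_left[symmetric])
  qed
  with that show thesis by blast
qed

text \<open>A step \<open>g\<close> on whose multiples the sequence is small exists by averaging over \<open>g \<in> {A..<2A}\<close>: for fixed \<open>j\<close>
  the numbers \<open>j g\<close> are distinct, so the sum over all \<open>g\<close> and \<open>j\<close> is at most \<open>L C\<close>, and there are \<open>A\<close> choices of \<open>g\<close>.\<close>

lemma sparse_step_exists:
  fixes p :: "nat \<Rightarrow> real"
  assumes p: "\<And>n. p n \<ge> 0" "\<And>N. (\<Sum>n<N. p n) \<le> C" and A: "A \<ge> 1"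
  obtains g where "A \<le> g" "g < 2 * A" "(\<Sum>j=1..L. p (j * g)) \<le> real L * C / real A"
proof (rule ccontr)
  assume "\<not> thesis"
  with that have neg: "(\<Sum>j=1..L. p (j * g)) > real L * C / real A" if "g \<in> {A..<2*A}" for g
    using that by (meson atLeastLessThan_iff not_less)
  have "real L * C = (\<Sum>g\<in>{A..<2*A}. real L * C / real A)" using A by simp
  also have "\<dots> < (\<Sum>g\<in>{A..<2*A}. \<Sum>j=1..L. p (j * g))"
    by (rule sum_strict_mono) (use neg A in auto)
  also have "\<dots> = (\<Sum>j=1..L. \<Sum>g\<in>{A..<2*A}. p (j * g))" by (rule sum.swap)
  also have "\<dots> \<le> (\<Sum>j=1..L. C)"
  proof (rule sum_mono)
    fix j assume j: "j \<in> {1..L}"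
    have "(\<Sum>g\<in>{A..<2*A}. p (j * g)) = (\<Sum>n\<in>(\<lambda>g. j * g) ` {A..<2*A}. p n)"
      using j by (subst sum.reindex) (auto simp: inj_on_def)
    also have "\<dots> \<le> (\<Sum>n<j * (2 * A). p n)"
      by (rule sum_mono2) (use p j in auto)
    also have "\<dots> \<le> C" by (rule p)
    finally show "(\<Sum>g\<in>{A..<2*A}. p (j * g)) \<le> C" .
  qed
  finally show False by simp
qed

section \<open>Swapping adjacent pairs\<close>

text \<open>The permutation of indices that exchanges \<open>s + 1\<close> and \<open>s + 2\<close> for every slot \<open>s \<in> \<sigma>\<close>. It fixes \<open>0\<close>, so
  index \<open>0\<close> may carry an initial value with a law of its own.\<close>

definition swap_pairs :: "nat set \<Rightarrow> nat \<Rightarrow> nat" where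
  "swap_pairs \<sigma> i = (if i \<ge> 1 \<and> i - 1 \<in> \<sigma> then i + 1 else if i \<ge> 2 \<and> i - 2 \<in> \<sigma> then i - 1 else i)"

lemma swap_pairs_involution:
  assumes "\<And>s. s \<in> \<sigma> \<Longrightarrow> Suc s \<notin> \<sigma>"
  shows "swap_pairs \<sigma> (swap_pairs \<sigma> i) = i"
proof -
  consider "i \<ge> 1 \<and> i - 1 \<in> \<sigma>" | "i \<ge> 2 \<and> i - 2 \<in> \<sigma>" "\<not> (i \<ge> 1 \<and> i - 1 \<in> \<sigma>)"
    | "\<not> (i \<ge> 1 \<and> i - 1 \<in> \<sigma>)" "\<not> (i \<ge> 2 \<and> i - 2 \<in> \<sigma>)" by blast
  then show ?thesis
  proof cases
    case 1
    then have "i \<notin> \<sigma>" using assms[of "i - 1"] by (metis Suc_diff_1 less_eq_Suc_le One_nat_def)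
    then show ?thesis using 1 by (auto simp: swap_pairs_def)
  next
    case 2
    then have "i - 1 - 1 \<in> \<sigma>" by (simp add: numeral_2_eq_2)
    then show ?thesis using 2 by (auto simp: swap_pairs_def)
  qed (auto simp: swap_pairs_def)
qed

text \<open>For the affine maps \<open>f\<^sub>a(x) = fst a * x + snd a\<close> this is \<open>f\<^sub>a(f\<^sub>b(x)) - f\<^sub>b(f\<^sub>a(x))\<close>, which does not
  depend on \<open>x\<close>: the failure of the two maps to commute.\<close>

definition swap_gap :: "real \<times> real \<Rightarrow> real \<times> real \<Rightarrow> real" where
  "swap_gap a b = snd a * (1 - fst b) - snd b * (1 - fst a)"

abbreviation lin :: "(nat \<Rightarrow> real \<times> real) \<Rightarrow> nat \<Rightarrow> real" where
  "lin z n \<equiv> partial_prod (\<lambda>i. fst (z i)) n"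

abbreviation perp :: "(nat \<Rightarrow> real \<times> real) \<Rightarrow> nat \<Rightarrow> real" where
  "perp z n \<equiv> perpetuity (\<lambda>i. fst (z i)) (\<lambda>i. snd (z i)) n"

lemma partial_prod_0 [simp]: "partial_prod m 0 = 1"
  by (simp add: partial_prod_def)

lemma partial_prod_Suc [simp]: "partial_prod m (Suc n) = partial_prod m n * m (Suc n)"
  by (simp add: partial_prod_def)

lemma perpetuity_0 [simp]: "perpetuity m q 0 = 0"
  by (simp add: perpetuity_def)

lemma perpetuity_Suc [simp]: "perpetuity m q (Suc n) = perpetuity m q n + partial_prod m n * q (Suc n)"
  by (simp add: perpetuity_def)

lemma partial_prod_cong:
  assumes "\<And>i. 1 \<le> i \<Longrightarrow> i \<le> n \<Longrightarrow> m i = m' i"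
  shows "partial_prod m n = partial_prod m' n"
  unfolding partial_prod_def by (rule prod.cong) (use assms in auto)

lemma perpetuity_cong:
  assumes "\<And>i. 1 \<le> i \<Longrightarrow> i \<le> n \<Longrightarrow> m i = m' i" "\<And>i. 1 \<le> i \<Longrightarrow> i \<le> n \<Longrightarrow> q i = q' i"
  shows "perpetuity m q n = perpetuity m' q' n"
  unfolding perpetuity_def
proof (rule sum.cong[OF refl])
  fix i assume i: "i \<in> {1..n}"
  have "partial_prod m (i - 1) = partial_prod m' (i - 1)" by (rule partial_prod_cong) (use assms i in auto)
  then show "partial_prod m (i - 1) * q i = partial_prod m' (i - 1) * q' i" using assms(2)[of i] i by simp
qed

text \<open>The product up to \<open>n\<close> changes only for \<open>n = s + 1\<close>, where just one of the two pairs has been used.\<close>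

lemma swap_one_pair:
  fixes z :: "nat \<Rightarrow> real \<times> real"
  assumes z': "z' (s + 1) = z (s + 2)" "z' (s + 2) = z (s + 1)" "\<And>i. i \<noteq> s + 1 \<Longrightarrow> i \<noteq> s + 2 \<Longrightarrow> z' i = z i"
  shows "n \<noteq> s + 1 \<Longrightarrow> lin z' n = lin z n"
    and "s + 2 \<le> n \<Longrightarrow> perp z' n = perp z n - lin z s * swap_gap (z (s + 1)) (z (s + 2))"
proof -
  have le: "lin z' n = lin z n" "perp z' n = perp z n" if "n \<le> s" for n
  proof -
    show "lin z' n = lin z n" by (rule partial_prod_cong) (use that z' in auto)
    show "perp z' n = perp z n" by (rule perpetuity_cong) (use that z' in auto)
  qed
  have ge: "lin z' n = lin z n \<and> perp z' n = perp z n - lin z s * swap_gap (z (s + 1)) (z (s + 2))" if "s + 2 \<le> n" for n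
    using that
  proof (induction n rule: dec_induct)
    case base
    have "lin z' (Suc (Suc s)) = lin z (Suc (Suc s))" using le(1)[of s] z' by simp
    moreover have "perp z' (Suc (Suc s)) = perp z (Suc (Suc s)) - lin z s * swap_gap (z (s + 1)) (z (s + 2))"
      using le[of s] z' by (simp add: swap_gap_def algebra_simps)
    ultimately show ?case by simp
  next
    case (step n)
    have "z' (Suc n) = z (Suc n)" using step(1) z'(3) by simp
    then show ?case using step by simp
  qed
  show "lin z' n = lin z n" if "n \<noteq> s + 1" using le(1)[of n] ge[of n] that by (cases "n \<le> s") auto
  show "perp z' n = perp z n - lin z s * swap_gap (z (s + 1)) (z (s + 2))" if "s + 2 \<le> n"
    using ge[OF that] by simp
qed

text \<open>Swaps at nonadjacent slots do not interact: a product up to a slot is not affected by the other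
  swaps, so the changes of the perpetuity add up.\<close>

lemma swap_pairs_perpetuity:
  fixes z :: "nat \<Rightarrow> real \<times> real"
  assumes fin: "finite \<sigma>" and sp: "\<And>s. s \<in> \<sigma> \<Longrightarrow> Suc s \<notin> \<sigma>"
  shows "(\<forall>n. (\<forall>s\<in>\<sigma>. n \<noteq> s + 1) \<longrightarrow> lin (\<lambda>i. z (swap_pairs \<sigma> i)) n = lin z n) \<and>
    (\<forall>n. (\<forall>s\<in>\<sigma>. s + 2 \<le> n) \<longrightarrow> perp (\<lambda>i. z (swap_pairs \<sigma> i)) n =
       perp z n - (\<Sum>s\<in>\<sigma>. lin z s * swap_gap (z (s + 1)) (z (s + 2))))"
  using fin sp
proof (induction \<sigma> rule: finite_induct)
  case empty
  then show ?case by (simp add: swap_pairs_def)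
next
  case (insert s \<sigma>)
  have spF: "\<And>s. s \<in> \<sigma> \<Longrightarrow> Suc s \<notin> \<sigma>" using insert.prems by blast
  have ns: "Suc s \<notin> \<sigma>" using insert.prems[of s] by simp
  have ps: "s - 1 \<notin> \<sigma> \<or> s = 0" using insert.prems[of "s - 1"] by (cases s) auto
  let ?w = "\<lambda>i. z (swap_pairs \<sigma> i)" and ?w' = "\<lambda>i. z (swap_pairs (insert s \<sigma>) i)"
  note IH = insert.IH[OF spF]
  have fix1: "swap_pairs \<sigma> (s + 1) = s + 1" "swap_pairs \<sigma> (s + 2) = s + 2"
    using ns ps insert.hyps by (auto simp: swap_pairs_def)
  have w: "?w' (s + 1) = ?w (s + 2)" "?w' (s + 2) = ?w (s + 1)"
    "\<And>i. i \<noteq> s + 1 \<Longrightarrow> i \<noteq> s + 2 \<Longrightarrow> ?w' i = ?w i"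
  proof -
    show "?w' (s + 1) = ?w (s + 2)" unfolding fix1 by (simp add: swap_pairs_def)
    show "?w' (s + 2) = ?w (s + 1)" unfolding fix1 using ns insert.prems[of s] by (simp add: swap_pairs_def)
    show "?w' i = ?w i" if "i \<noteq> s + 1" "i \<noteq> s + 2" for i
    proof -
      have "(i \<ge> 1 \<and> i - 1 \<in> insert s \<sigma>) = (i \<ge> 1 \<and> i - 1 \<in> \<sigma>)" "(i \<ge> 2 \<and> i - 2 \<in> insert s \<sigma>) = (i \<ge> 2 \<and> i - 2 \<in> \<sigma>)"
        using that by auto
      then show ?thesis by (simp add: swap_pairs_def)
    qed
  qed
  have "lin ?w' n = lin z n" if "\<forall>s\<in>insert s \<sigma>. n \<noteq> s + 1" for n
    using swap_one_pair(1)[OF w, of n] IH that by simp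
  moreover have "perp ?w' n = perp z n - (\<Sum>s\<in>insert s \<sigma>. lin z s * swap_gap (z (s + 1)) (z (s + 2)))"
    if "\<forall>s\<in>insert s \<sigma>. s + 2 \<le> n" for n
  proof -
    have "\<forall>s'\<in>\<sigma>. s \<noteq> s' + 1" using insert.prems by auto
    then have "lin ?w s = lin z s" using conjunct1[OF IH] by blast
    then show ?thesis
      using swap_one_pair(2)[OF w, of n] IH that insert.hyps unfolding fix1 by simp
  qed
  ultimately show ?case by blast
qed

section \<open>Signed sums of lacunary families\<close>

definition lacunary :: "('i \<Rightarrow> real) \<Rightarrow> 'i set \<Rightarrow> bool" where
  "lacunary v J \<longleftrightarrow> (\<forall>s\<in>J. \<forall>s'\<in>J. s \<noteq> s' \<longrightarrow> 4 * \<bar>v s\<bar> \<le> \<bar>v s'\<bar> \<or> 4 * \<bar>v s'\<bar> \<le> \<bar>v s\<bar>)"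

lemma lacunary_subset: "lacunary v J \<Longrightarrow> K \<subseteq> J \<Longrightarrow> lacunary v K"
  by (auto simp: lacunary_def)

lemma lacunary_sum_le:
  assumes "finite J" "lacunary v J" "\<And>s. s \<in> J \<Longrightarrow> \<bar>v s\<bar> \<le> B" "B \<ge> 0"
  shows "(\<Sum>s\<in>J. \<bar>v s\<bar>) \<le> 4/3 * B"
  using assms
proof (induction J arbitrary: B rule: finite_psubset_induct)
  case (psubset J)
  show ?case
  proof (cases "J = {}")
    case True then show ?thesis using psubset.prems by simp
  next
    case False
    obtain m where m: "m \<in> J" "\<bar>v m\<bar> = Max ((\<lambda>s. \<bar>v s\<bar>) ` J)"
      using Max_in[of "(\<lambda>s. \<bar>v s\<bar>) ` J"] False psubset.hyps by fastforce
    have mmax: "\<bar>v s\<bar> \<le> \<bar>v m\<bar>" if "s \<in> J" for s unfolding m(2) using that psubset.hyps by auto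
    have "(\<Sum>s\<in>J - {m}. \<bar>v s\<bar>) \<le> 4/3 * (\<bar>v m\<bar> / 4)"
    proof (rule psubset.IH)
      show "J - {m} \<subset> J" using m by auto
      show "lacunary v (J - {m})" by (rule lacunary_subset[OF psubset.prems(1)]) auto
      fix s assume s: "s \<in> J - {m}"
      then have "4 * \<bar>v s\<bar> \<le> \<bar>v m\<bar> \<or> 4 * \<bar>v m\<bar> \<le> \<bar>v s\<bar>"
        using psubset.prems(1) m(1) by (auto simp: lacunary_def)
      then show "\<bar>v s\<bar> \<le> \<bar>v m\<bar> / 4" using mmax[of s] s by auto
    qed simp
    moreover have "(\<Sum>s\<in>J. \<bar>v s\<bar>) = \<bar>v m\<bar> + (\<Sum>s\<in>J - {m}. \<bar>v s\<bar>)"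
      using psubset.hyps m by (simp add: sum.remove)
    ultimately show ?thesis using psubset.prems(2)[OF m(1)] by linarith
  qed
qed

text \<open>The terms other than the one of largest modulus are at most \<open>1/4, 1/16, \<dots>\<close> of it, in decreasing order, and
  add up to at most a third of it; so they cannot cancel it.\<close>

lemma lacunary_signed_sum:
  fixes \<epsilon> :: "'i \<Rightarrow> real"
  assumes J: "finite J" "J \<noteq> {}" and lac: "lacunary v J" and big: "\<And>s. s \<in> J \<Longrightarrow> \<bar>v s\<bar> \<ge> 4 * \<rho>"
    and \<rho>: "\<rho> > 0" and \<epsilon>: "\<And>s. s \<in> J \<Longrightarrow> \<bar>\<epsilon> s\<bar> = 1"
  shows "\<bar>\<Sum>s\<in>J. \<epsilon> s * v s\<bar> > 2 * \<rho>"
proof -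
  obtain m where m: "m \<in> J" "\<bar>v m\<bar> = Max ((\<lambda>s. \<bar>v s\<bar>) ` J)"
    using Max_in[of "(\<lambda>s. \<bar>v s\<bar>) ` J"] J by fastforce
  have mmax: "\<bar>v s\<bar> \<le> \<bar>v m\<bar>" if "s \<in> J" for s unfolding m(2) using that J by auto
  have "(\<Sum>s\<in>J - {m}. \<bar>v s\<bar>) \<le> 4/3 * (\<bar>v m\<bar> / 4)"
  proof (rule lacunary_sum_le)
    show "lacunary v (J - {m})" by (rule lacunary_subset[OF lac]) auto
    fix s assume s: "s \<in> J - {m}"
    then have "4 * \<bar>v s\<bar> \<le> \<bar>v m\<bar> \<or> 4 * \<bar>v m\<bar> \<le> \<bar>v s\<bar>"
      using lac m(1) by (auto simp: lacunary_def)
    then show "\<bar>v s\<bar> \<le> \<bar>v m\<bar> / 4" using mmax[of s] s by auto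
  qed (use J in auto)
  moreover have "\<bar>\<Sum>s\<in>J - {m}. \<epsilon> s * v s\<bar> \<le> (\<Sum>s\<in>J - {m}. \<bar>v s\<bar>)"
    by (rule order_trans[OF sum_abs]) (auto simp: abs_mult \<epsilon> intro!: sum_mono)
  moreover have "(\<Sum>s\<in>J. \<epsilon> s * v s) = \<epsilon> m * v m + (\<Sum>s\<in>J - {m}. \<epsilon> s * v s)"
    using J m by (simp add: sum.remove)
  moreover have "\<bar>\<epsilon> m * v m\<bar> = \<bar>v m\<bar>" using \<epsilon>[OF m(1)] by (simp add: abs_mult)
  ultimately show ?thesis using big[OF m(1)] \<rho> by linarith
qed

text \<open>Two subsets that agree outside \<open>I\<close> have sums that differ by a signed sum over part of \<open>I\<close>, which
  exceeds \<open>2 \<rho>\<close>. So within an interval of length \<open>2 \<rho>\<close> a subset is determined by its part outside \<open>I\<close>.\<close>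

lemma card_small_subset_sums:
  fixes v :: "'i \<Rightarrow> real"
  assumes T: "finite T" and I: "I \<subseteq> T" and lac: "lacunary v I" and big: "\<And>s. s \<in> I \<Longrightarrow> \<bar>v s\<bar> \<ge> 4 * \<rho>"
    and \<rho>: "\<rho> > 0"
  shows "card {\<sigma> \<in> Pow T. \<bar>a - (\<Sum>s\<in>\<sigma>. v s)\<bar> \<le> \<rho>} \<le> 2 ^ card (T - I)"
proof -
  let ?A = "{\<sigma> \<in> Pow T. \<bar>a - (\<Sum>s\<in>\<sigma>. v s)\<bar> \<le> \<rho>}"
  have "inj_on (\<lambda>\<sigma>. \<sigma> - I) ?A"
  proof (rule inj_onI, rule ccontr)
    fix \<sigma> \<sigma>' assume s: "\<sigma> \<in> ?A" "\<sigma>' \<in> ?A" and eq: "\<sigma> - I = \<sigma>' - I" and ne: "\<sigma> \<noteq> \<sigma>'"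
    have f: "finite \<sigma>" "finite \<sigma>'" using s T finite_subset by auto
    define J where "J = (\<sigma> - \<sigma>') \<union> (\<sigma>' - \<sigma>)"
    have J: "finite J" "J \<noteq> {}" "J \<subseteq> I" using f ne eq by (auto simp: J_def)
    define \<epsilon> where "\<epsilon> s = (if s \<in> \<sigma> then 1 else - 1 :: real)" for s
    have "(\<Sum>s\<in>J. \<epsilon> s * v s) = (\<Sum>s\<in>\<sigma> - \<sigma>'. \<epsilon> s * v s) + (\<Sum>s\<in>\<sigma>' - \<sigma>. \<epsilon> s * v s)"
      unfolding J_def by (rule sum.union_disjoint) (use f in auto)
    also have "(\<Sum>s\<in>\<sigma> - \<sigma>'. \<epsilon> s * v s) = (\<Sum>s\<in>\<sigma> - \<sigma>'. v s)" by (rule sum.cong) (auto simp: \<epsilon>_def)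
    also have "(\<Sum>s\<in>\<sigma>' - \<sigma>. \<epsilon> s * v s) = - (\<Sum>s\<in>\<sigma>' - \<sigma>. v s)"
      by (subst sum_negf[symmetric], rule sum.cong) (auto simp: \<epsilon>_def)
    also have "(\<Sum>s\<in>\<sigma> - \<sigma>'. v s) + - (\<Sum>s\<in>\<sigma>' - \<sigma>. v s) = (\<Sum>s\<in>\<sigma>. v s) - (\<Sum>s\<in>\<sigma>'. v s)"
      using sum.Int_Diff[OF f(1), of v \<sigma>'] sum.Int_Diff[OF f(2), of v \<sigma>] by (simp add: Int_commute)
    finally have "(\<Sum>s\<in>J. \<epsilon> s * v s) = (\<Sum>s\<in>\<sigma>. v s) - (\<Sum>s\<in>\<sigma>'. v s)" .
    moreover have "\<bar>\<Sum>s\<in>J. \<epsilon> s * v s\<bar> > 2 * \<rho>"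
      by (rule lacunary_signed_sum) (use J big \<rho> lacunary_subset[OF lac J(3)] in \<open>auto simp: \<epsilon>_def\<close>)
    ultimately show False using s by auto
  qed
  then have "card ?A \<le> card (Pow (T - I))"
    by (rule card_inj_on_le) (use T in auto)
  then show ?thesis using T by (simp add: card_Pow)
qed

section \<open>Anti-concentration by exchangeability\<close>

lemma borel_measurable_fst_real: "fst \<in> borel_measurable (borel :: (real \<times> real) measure)"
  by (rule borel_measurable_continuous_onI[OF continuous_on_fst[OF continuous_on_id]])

lemma borel_measurable_snd_real: "snd \<in> borel_measurable (borel :: (real \<times> real) measure)"
  by (rule borel_measurable_continuous_onI[OF continuous_on_snd[OF continuous_on_id]])

lemma borel_measurable_fst_component:
  assumes "i \<in> I"
  shows "(\<lambda>z. fst (z i)) \<in> borel_measurable (PiM I (\<lambda>_. borel :: (real \<times> real) measure))"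
proof -
  have "(\<lambda>z. z i) \<in> measurable (PiM I (\<lambda>_. borel :: (real \<times> real) measure)) borel"
    using measurable_component_singleton[OF assms, of "\<lambda>_. borel"] .
  then show ?thesis by (rule measurable_compose[OF _ borel_measurable_fst_real])
qed

lemma borel_measurable_snd_component:
  assumes "i \<in> I"
  shows "(\<lambda>z. snd (z i)) \<in> borel_measurable (PiM I (\<lambda>_. borel :: (real \<times> real) measure))"
proof -
  have "(\<lambda>z. z i) \<in> measurable (PiM I (\<lambda>_. borel :: (real \<times> real) measure)) borel"
    using measurable_component_singleton[OF assms, of "\<lambda>_. borel"] .
  then show ?thesis by (rule measurable_compose[OF _ borel_measurable_snd_real])
qed

lemma borel_measurable_partial_prod:
  assumes "\<And>i. 1 \<le> i \<Longrightarrow> i \<le> n \<Longrightarrow> (\<lambda>x. m x i) \<in> borel_measurable N"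
  shows "(\<lambda>x. partial_prod (m x) n) \<in> borel_measurable N"
  unfolding partial_prod_def by (rule borel_measurable_prod) (use assms in auto)

lemma borel_measurable_perpetuity:
  assumes "\<And>i. 1 \<le> i \<Longrightarrow> i \<le> n \<Longrightarrow> (\<lambda>x. m x i) \<in> borel_measurable N" "\<And>i. 1 \<le> i \<Longrightarrow> i \<le> n \<Longrightarrow> (\<lambda>x. q x i) \<in> borel_measurable N"
  shows "(\<lambda>x. perpetuity (m x) (q x) n) \<in> borel_measurable N"
  unfolding perpetuity_def
  by (intro borel_measurable_sum borel_measurable_times borel_measurable_partial_prod) (use assms in auto)

text \<open>If the logarithms of the factors \<open>P s\<close> are more than \<open>ln (4 d' / d)\<close> apart, factors \<open>D s\<close> of modulus in
  \<open>[d, d']\<close> cannot spoil the ratio \<open>4\<close>.\<close>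

lemma lacunary_products:
  fixes P D :: "'i \<Rightarrow> real"
  assumes P: "\<And>s. s \<in> I \<Longrightarrow> P s \<noteq> 0" and D: "\<And>s. s \<in> I \<Longrightarrow> d \<le> \<bar>D s\<bar> \<and> \<bar>D s\<bar> \<le> d'" and d: "0 < d" "d \<le> d'"
    and sep: "\<And>s s'. s \<in> I \<Longrightarrow> s' \<in> I \<Longrightarrow> s \<noteq> s' \<Longrightarrow> \<bar>ln \<bar>P s\<bar> - ln \<bar>P s'\<bar>\<bar> > ln (4 * d' / d)"
  shows "lacunary (\<lambda>s. P s * D s) I"
proof -
  have *: "4 * \<bar>P s * D s\<bar> \<le> \<bar>P s' * D s'\<bar>"
    if s: "s \<in> I" "s' \<in> I" and l: "ln \<bar>P s'\<bar> - ln \<bar>P s\<bar> > ln (4 * d' / d)" for s s'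
  proof -
    have p: "\<bar>P s\<bar> > 0" "\<bar>P s'\<bar> > 0" using P s by auto
    have "ln (\<bar>P s'\<bar> / \<bar>P s\<bar>) > ln (4 * d' / d)" using l p by (simp add: ln_div)
    then have "\<bar>P s'\<bar> / \<bar>P s\<bar> > 4 * d' / d" using p d by (subst (asm) ln_less_cancel_iff) auto
    then have "4 * d' * \<bar>P s\<bar> < \<bar>P s'\<bar> * d" using p d by (simp add: field_simps)
    moreover have "4 * (\<bar>P s\<bar> * \<bar>D s\<bar>) \<le> 4 * (\<bar>P s\<bar> * d')" using D[OF s(1)] by (intro mult_left_mono) auto
    moreover have "\<bar>P s'\<bar> * d \<le> \<bar>P s'\<bar> * \<bar>D s'\<bar>" using D[OF s(2)] by (intro mult_left_mono) auto
    ultimately have "4 * (\<bar>P s\<bar> * \<bar>D s\<bar>) \<le> \<bar>P s'\<bar> * \<bar>D s'\<bar>" by (simp add: mult_ac)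
    then show ?thesis by (simp add: abs_mult)
  qed
  show ?thesis unfolding lacunary_def
  proof (intro ballI impI)
    fix s s' assume s: "s \<in> I" "s' \<in> I" "s \<noteq> s'"
    have "ln (4 * d' / d) \<ge> 0" using d by (intro ln_ge_zero) (simp add: field_simps)
    then consider "ln \<bar>P s'\<bar> - ln \<bar>P s\<bar> > ln (4 * d' / d)" | "ln \<bar>P s\<bar> - ln \<bar>P s'\<bar> > ln (4 * d' / d)"
      using sep[OF s] by linarith
    then show "4 * \<bar>P s * D s\<bar> \<le> \<bar>P s' * D s'\<bar> \<or> 4 * \<bar>P s' * D s'\<bar> \<le> \<bar>P s * D s\<bar>"
      by cases (use * s in auto)
  qed
qed

text \<open>Stated for abstract \<open>A\<close>, \<open>L\<close> and \<open>F\<close> so that it serves for the sequence space as well as for the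
  underlying probability space.\<close>

lemma measurable_regular_event:
  fixes A L F :: "nat \<Rightarrow> 'z \<Rightarrow> real" and \<rho> :: "real \<Rightarrow> real"
  assumes [measurable]: "\<And>n. A n \<in> borel_measurable N" "\<And>n. F n \<in> borel_measurable N"
      "\<And>n. L n \<in> borel_measurable N" "\<rho> \<in> borel_measurable borel"
    and T: "finite T"
  shows "Measurable.pred N (\<lambda>z. \<bar>A k z\<bar> \<le> \<rho> \<bar>L k z\<bar> \<and> (\<forall>i\<in>{1..k}. F i z \<noteq> 0) \<and>
      (\<forall>s\<in>T. \<forall>s'\<in>T. s \<noteq> s' \<longrightarrow> \<bar>ln \<bar>L s z\<bar> - ln \<bar>L s' z\<bar>\<bar> > c) \<and>
      (\<forall>s\<in>T. 4 * \<rho> \<bar>L k z\<bar> \<le> d * \<bar>L s z\<bar>))"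
proof -
  have [simp]: "countable T" using T by (rule countable_finite)
  show ?thesis by measurable
qed

text \<open>Index \<open>0\<close> carries the initial value. On the regular event, the products at the slots in \<open>T\<close>
  are separated and not too small compared with the radius \<open>\<rho>\<close>. That event is invariant under all swaps at
  subsets of \<open>T\<close>, so its intersection with a small ball has the same probability after every swap. Averaging
  over the \<open>2^card T\<close> swaps, a proportion of at most \<open>(1/2)^g\<close> puts the sum into the ball, \<open>g\<close> being the number of slots
  with swap gap in \<open>[d, d']\<close>; slots use disjoint pairs of indices, so the expectation of \<open>(1/2)^g\<close> is
  \<open>(1 - p/2)^card T\<close>. The radius may depend on \<open>\<bar>lin z k\<bar>\<close> because swaps do not change it.\<close>

lemma (in prob_space) anti_concentration:
  fixes Z :: "nat \<Rightarrow> 'a \<Rightarrow> real \<times> real" and \<rho> :: "real \<Rightarrow> real"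
  assumes indep: "indep_vars (\<lambda>_. borel) Z UNIV"
    and ident: "\<And>k. k \<ge> 1 \<Longrightarrow> distr M borel (Z k) = distr M borel (Z 1)"
    and T: "finite T" "\<And>s. s \<in> T \<Longrightarrow> Suc s \<notin> T" "\<And>s. s \<in> T \<Longrightarrow> s + 2 \<le> k"
    and d: "0 < d" "d \<le> d'"
    and \<rho>: "\<rho> \<in> borel_measurable borel" "\<And>x. x > 0 \<Longrightarrow> \<rho> x > 0"
  shows "prob {\<omega> \<in> space M.
      \<bar>fst (Z 0 \<omega>) + perp (\<lambda>i. Z i \<omega>) k\<bar> \<le> \<rho> \<bar>lin (\<lambda>i. Z i \<omega>) k\<bar> \<and>
      (\<forall>i\<in>{1..k}. fst (Z i \<omega>) \<noteq> 0) \<and>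
      (\<forall>s\<in>T. \<forall>s'\<in>T. s \<noteq> s' \<longrightarrow> \<bar>ln \<bar>lin (\<lambda>i. Z i \<omega>) s\<bar> - ln \<bar>lin (\<lambda>i. Z i \<omega>) s'\<bar>\<bar> > ln (4 * d' / d)) \<and>
      (\<forall>s\<in>T. 4 * \<rho> \<bar>lin (\<lambda>i. Z i \<omega>) k\<bar> \<le> d * \<bar>lin (\<lambda>i. Z i \<omega>) s\<bar>)}
    \<le> (1 - prob {\<omega> \<in> space M. \<bar>swap_gap (Z 1 \<omega>) (Z 2 \<omega>)\<bar> \<in> {d..d'}} / 2) ^ card T"
proof -
  note \<rho>(1)[measurable]
  have rv[measurable]: "random_variable borel (Z i)" for i using indep by (auto simp: indep_vars_def)
  have [measurable]: "random_variable borel (\<lambda>\<omega>. fst (Z i \<omega>))" "random_variable borel (\<lambda>\<omega>. snd (Z i \<omega>))" for i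
    by (rule measurable_compose[OF rv], rule borel_measurable_fst_real borel_measurable_snd_real)+
  define reg where "reg z \<longleftrightarrow> (\<forall>i\<in>{1..k}. fst (z i) \<noteq> 0) \<and>
      (\<forall>s\<in>T. \<forall>s'\<in>T. s \<noteq> s' \<longrightarrow> \<bar>ln \<bar>lin z s\<bar> - ln \<bar>lin z s'\<bar>\<bar> > ln (4 * d' / d)) \<and>
      (\<forall>s\<in>T. 4 * \<rho> \<bar>lin z k\<bar> \<le> d * \<bar>lin z s\<bar>)" for z :: "nat \<Rightarrow> real \<times> real"
  define E where "E z \<longleftrightarrow> \<bar>fst (z 0) + perp z k\<bar> \<le> \<rho> \<bar>lin z k\<bar> \<and> reg z" for z :: "nat \<Rightarrow> real \<times> real"
  define good where "good z s \<longleftrightarrow> \<bar>swap_gap (z (s + 1)) (z (s + 2))\<bar> \<in> {d..d'}" for z :: "nat \<Rightarrow> real \<times> real" and s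
  have [simp]: "countable T" using T(1) by (rule countable_finite)
  have Em: "Measurable.pred (PiM UNIV (\<lambda>_. borel)) E"
  proof -
    let ?N = "PiM UNIV (\<lambda>_. borel) :: (nat \<Rightarrow> real \<times> real) measure"
    note comp = borel_measurable_fst_component[OF UNIV_I] borel_measurable_snd_component[OF UNIV_I]
    define A F :: "nat \<Rightarrow> (nat \<Rightarrow> real \<times> real) \<Rightarrow> real" where "A n z = fst (z 0) + perp z n" and "F n z = fst (z n)" for n z
    define L where "L n z = lin z n" for n and z :: "nat \<Rightarrow> real \<times> real"
    have L: "L n \<in> borel_measurable ?N" for n
      unfolding L_def by (rule borel_measurable_partial_prod) (rule comp)
    have AF: "A n \<in> borel_measurable ?N" "F n \<in> borel_measurable ?N" for n
      unfolding A_def F_def by (intro borel_measurable_add borel_measurable_perpetuity comp)+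
    from measurable_regular_event[where A = A and F = F and L = L and k = k and c = "ln (4 * d' / d)" and d = d, OF AF L \<rho>(1) T(1)]
    show ?thesis unfolding E_def[abs_def] reg_def[abs_def] A_def F_def L_def .
  qed
  define p where "p = prob {\<omega> \<in> space M. \<bar>swap_gap (Z 1 \<omega>) (Z 2 \<omega>)\<bar> \<in> {d..d'}}"
  let ?Z = "\<lambda>\<omega> i. Z i \<omega>"
  have spT: "Suc s \<notin> \<sigma>" if "\<sigma> \<subseteq> T" "s \<in> \<sigma>" for \<sigma> s using T(2)[of s] that by auto
  \<comment> \<open>Swaps preserve the joint law.\<close>
  have exch: "prob {\<omega> \<in> space M. E (?Z \<omega>)} = prob {\<omega> \<in> space M. E (\<lambda>i. Z (swap_pairs \<sigma> i) \<omega>)}" if \<sigma>: "\<sigma> \<subseteq> T" for \<sigma>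
  proof -
    have inv: "swap_pairs \<sigma> (swap_pairs \<sigma> i) = i" for i by (rule swap_pairs_involution) (use spT[OF \<sigma>] in auto)
    have "prob {\<omega> \<in> space M. E (\<lambda>i\<in>UNIV. Z (swap_pairs \<sigma> i) \<omega>)} = prob {\<omega> \<in> space M. E (\<lambda>i\<in>UNIV. Z i \<omega>)}"
    proof (rule prob_reindex_indep[OF indep _ _ _ _ _ Em])
      show "inj_on (swap_pairs \<sigma>) UNIV" by (metis injI inv)
      show "distr M borel (Z (swap_pairs \<sigma> i)) = distr M borel (Z i)" for i
      proof (cases "i = 0")
        case True then show ?thesis by (simp add: swap_pairs_def)
      next
        case False
        then have "swap_pairs \<sigma> i \<ge> 1" by (auto simp: swap_pairs_def)
        then show ?thesis using ident[of i] ident[of "swap_pairs \<sigma> i"] False by simp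
      qed
    qed auto
    then show ?thesis by (simp add: restrict_def)
  qed
  \<comment> \<open>For a fixed sequence, few swaps bring the sum into the ball.\<close>
  have count: "(\<Sum>\<sigma>\<in>Pow T. of_bool (E (\<lambda>i. z (swap_pairs \<sigma> i)))) \<le> 2 ^ card T * (\<Prod>s\<in>T. if good z s then 1/2 else (1::real))" for z
  proof (cases "reg z")
    case False
    have "\<not> E (\<lambda>i. z (swap_pairs \<sigma> i))" if \<sigma>: "\<sigma> \<in> Pow T" for \<sigma>
    proof
      assume "E (\<lambda>i. z (swap_pairs \<sigma> i))"
      then have r: "reg (\<lambda>i. z (swap_pairs \<sigma> i))" by (simp add: E_def)
      have f: "finite \<sigma>" using \<sigma> T(1) finite_subset by auto
      have L: "lin (\<lambda>i. z (swap_pairs \<sigma> i)) n = lin z n" if "\<forall>s\<in>\<sigma>. n \<noteq> s + 1" for n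
        using swap_pairs_perpetuity[OF f spT, of z] \<sigma> that by auto
      have "lin (\<lambda>i. z (swap_pairs \<sigma> i)) s = lin z s" if "s \<in> T" for s
        by (rule L) (use T(2) \<sigma> that in auto)
      moreover have "lin (\<lambda>i. z (swap_pairs \<sigma> i)) k = lin z k" by (rule L) (use T(3) \<sigma> in force)
      moreover have "\<forall>i\<in>{1..k}. fst (z i) \<noteq> 0"
      proof
        fix i assume i: "i \<in> {1..k}"
        have "swap_pairs \<sigma> i \<in> {1..k}" using i T(3) \<sigma> by (force simp: swap_pairs_def)
        then have "fst (z (swap_pairs \<sigma> (swap_pairs \<sigma> i))) \<noteq> 0" using r by (auto simp: reg_def)
        then show "fst (z i) \<noteq> 0" using swap_pairs_involution[OF spT, of \<sigma>] \<sigma> by auto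
      qed
      ultimately have "reg z" using r by (simp add: reg_def)
      with False show False by simp
    qed
    then have "(\<Sum>\<sigma>\<in>Pow T. of_bool (E (\<lambda>i. z (swap_pairs \<sigma> i)))) = (0::real)" by (intro sum.neutral) auto
    also have "\<dots> \<le> 2 ^ card T * (\<Prod>s\<in>T. if good z s then 1/2 else (1::real))" by (intro mult_nonneg_nonneg prod_nonneg) auto
    finally show ?thesis .
  next
    case r: True
    define I where "I = {s \<in> T. good z s}"
    define v where "v s = lin z s * swap_gap (z (s + 1)) (z (s + 2))" for s
    define a where "a = fst (z 0) + perp z k"
    have nz: "lin z n \<noteq> 0" if "n \<le> k" for n using r that by (auto simp: reg_def partial_prod_def)
    have nzT: "lin z s \<noteq> 0" if "s \<in> T" for s using nz[of s] T(3)[OF that] by simp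
    have \<rho>0: "\<rho> \<bar>lin z k\<bar> > 0" using nz by (intro \<rho>(2)) auto
    have lac: "lacunary v I" unfolding v_def
      by (rule lacunary_products[OF _ _ d]) (use r nzT in \<open>auto simp: I_def good_def reg_def\<close>)
    have big: "\<bar>v s\<bar> \<ge> 4 * \<rho> \<bar>lin z k\<bar>" if s: "s \<in> I" for s
    proof -
      have "4 * \<rho> \<bar>lin z k\<bar> \<le> \<bar>lin z s\<bar> * d" using r s by (auto simp: reg_def I_def mult.commute)
      also have "\<dots> \<le> \<bar>lin z s\<bar> * \<bar>swap_gap (z (s + 1)) (z (s + 2))\<bar>"
        using s by (intro mult_left_mono) (auto simp: I_def good_def)
      finally show ?thesis by (simp add: v_def abs_mult)
    qed
    have "(\<Sum>\<sigma>\<in>Pow T. of_bool (E (\<lambda>i. z (swap_pairs \<sigma> i)))) \<le> (\<Sum>\<sigma>\<in>Pow T. of_bool (\<bar>a - (\<Sum>s\<in>\<sigma>. v s)\<bar> \<le> \<rho> \<bar>lin z k\<bar>) :: real)"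
    proof (rule sum_mono)
      fix \<sigma> assume \<sigma>: "\<sigma> \<in> Pow T"
      have f: "finite \<sigma>" using \<sigma> T(1) finite_subset by auto
      have "perp (\<lambda>i. z (swap_pairs \<sigma> i)) k = perp z k - (\<Sum>s\<in>\<sigma>. v s)"
        using swap_pairs_perpetuity[OF f spT, of z] \<sigma> T(3) unfolding v_def by blast
      moreover have "lin (\<lambda>i. z (swap_pairs \<sigma> i)) k = lin z k"
      proof -
        have "\<forall>s\<in>\<sigma>. k \<noteq> s + 1" using T(3) \<sigma> by force
        then show ?thesis using swap_pairs_perpetuity[OF f spT, of z] \<sigma> by blast
      qed
      moreover have "swap_pairs \<sigma> 0 = 0" by (simp add: swap_pairs_def)
      ultimately show "of_bool (E (\<lambda>i. z (swap_pairs \<sigma> i))) \<le> (of_bool (\<bar>a - (\<Sum>s\<in>\<sigma>. v s)\<bar> \<le> \<rho> \<bar>lin z k\<bar>) :: real)"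
        by (auto simp: E_def a_def of_bool_def algebra_simps)
    qed
    also have "\<dots> = real (card {\<sigma> \<in> Pow T. \<bar>a - (\<Sum>s\<in>\<sigma>. v s)\<bar> \<le> \<rho> \<bar>lin z k\<bar>})"
      using T(1) by (simp add: of_bool_def sum.If_cases Int_def)
    also have "\<dots> \<le> real (2 ^ card (T - I))"
      by (rule of_nat_mono, rule card_small_subset_sums[OF T(1) _ lac big \<rho>0]) (auto simp: I_def)
    also have "\<dots> = 2 ^ card T * (1/2) ^ card I"
    proof -
      have "card T = card (T - I) + card I" using T(1) by (subst card_Diff_subset) (auto simp: I_def card_mono finite_subset)
      then show ?thesis by (simp add: power_add power_divide)
    qed
    also have "(1/2) ^ card I = (\<Prod>s\<in>T. if good z s then 1/2 else (1::real))"
      using T(1) by (simp add: prod.If_cases I_def Int_def)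
    finally show ?thesis .
  qed
  define f where "f x = (if \<bar>swap_gap (fst x) (snd x)\<bar> \<in> {d..d'} then 1/2 else (1::real))" for x
  \<comment> \<open>Distinct slots use disjoint pairs of indices, so the expectation factorises.\<close>
  have slots: "expectation (\<lambda>\<omega>. \<Prod>s\<in>T. if good (?Z \<omega>) s then 1/2 else (1::real)) = (1 - p / 2) ^ card T"
  proof -
    have ind: "indep_vars (\<lambda>s. PiM {s + 1, s + 2} (\<lambda>_. borel)) (\<lambda>s \<omega>. restrict (\<lambda>i. Z i \<omega>) {s + 1, s + 2}) T"
      by (rule indep_vars_restrict[OF indep]) (use T(2) in \<open>auto simp: disjoint_family_on_def\<close>)
    have ind2: "indep_vars (\<lambda>s. borel) (\<lambda>s \<omega>. (\<lambda>x. if \<bar>swap_gap (x (s + 1)) (x (s + 2))\<bar> \<in> {d..d'} then 1/2 else (1::real)) (restrict (\<lambda>i. Z i \<omega>) {s + 1, s + 2})) T"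
    proof (rule indep_vars_compose2[OF ind])
      fix s
      have [measurable]: "(\<lambda>x. fst (x i)) \<in> borel_measurable (PiM {s + 1, s + 2} (\<lambda>_. borel :: (real \<times> real) measure))"
        "(\<lambda>x. snd (x i)) \<in> borel_measurable (PiM {s + 1, s + 2} (\<lambda>_. borel :: (real \<times> real) measure))"
        if "i \<in> {s + 1, s + 2}" for i
        by (rule borel_measurable_fst_component[OF that] borel_measurable_snd_component[OF that])+
      show "(\<lambda>x. if \<bar>swap_gap (x (s + 1)) (x (s + 2))\<bar> \<in> {d..d'} then 1/2 else (1::real)) \<in> borel_measurable (PiM {s + 1, s + 2} (\<lambda>_. borel))"
        unfolding swap_gap_def by measurable
    qed
    then have ind3: "indep_vars (\<lambda>s. borel) (\<lambda>s \<omega>. if good (?Z \<omega>) s then 1/2 else (1::real)) T"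
      by (simp add: good_def)
    have gm: "{\<omega> \<in> space M. good (?Z \<omega>) s} \<in> events" for s
      unfolding good_def swap_gap_def by measurable
    have int: "integrable M (\<lambda>\<omega>. if good (?Z \<omega>) s then 1/2 else (1::real))" for s
      by (rule integrable_const_bound[of _ 1], simp, intro measurable_If) (use gm in auto)
    have pg: "prob {\<omega> \<in> space M. good (?Z \<omega>) s} = p" for s
    proof -
      define A where "A z \<longleftrightarrow> \<bar>swap_gap (z 1) (z 2)\<bar> \<in> {d..d'}" for z :: "nat \<Rightarrow> real \<times> real"
      have [measurable]: "(\<lambda>x. fst (x i)) \<in> borel_measurable (PiM {1, 2} (\<lambda>_. borel :: (real \<times> real) measure))"
        "(\<lambda>x. snd (x i)) \<in> borel_measurable (PiM {1, 2} (\<lambda>_. borel :: (real \<times> real) measure))"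
        if "i \<in> {1, 2}" for i :: nat
        by (rule borel_measurable_fst_component[OF that] borel_measurable_snd_component[OF that])+
      have A: "Measurable.pred (PiM {1, 2} (\<lambda>_. borel)) A" unfolding A_def swap_gap_def by measurable
      have "prob {\<omega> \<in> space M. A (\<lambda>i\<in>{1,2}. Z (i + s) \<omega>)} = prob {\<omega> \<in> space M. A (\<lambda>i\<in>{1,2}. Z i \<omega>)}"
      proof (rule prob_reindex_indep[OF indep _ _ _ _ _ A])
        show "distr M borel (Z (i + s)) = distr M borel (Z i)" if "i \<in> {1, 2}" for i
          using ident[of "i + s"] ident[of i] that by auto
      qed auto
      then show ?thesis by (simp add: A_def p_def good_def add.commute)
    qed
    have ex: "expectation (\<lambda>\<omega>. if good (?Z \<omega>) s then 1/2 else (1::real)) = 1 - p / 2" for s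
    proof -
      have "expectation (\<lambda>\<omega>. if good (?Z \<omega>) s then 1/2 else (1::real)) = expectation (\<lambda>\<omega>. 1 - 1/2 * indicator {\<omega> \<in> space M. good (?Z \<omega>) s} \<omega>)"
        by (rule Bochner_Integration.integral_cong) auto
      also have "\<dots> = 1 - 1/2 * prob {\<omega> \<in> space M. good (?Z \<omega>) s}"
        using gm by (subst Bochner_Integration.integral_diff) (auto simp: prob_space less_top[symmetric])
      finally show ?thesis by (simp add: pg)
    qed
    show ?thesis using indep_vars_lebesgue_integral[OF T(1) ind3 int] ex by simp
  qed
  have gmeas: "random_variable borel (\<lambda>\<omega>. \<Prod>s\<in>T. if good (?Z \<omega>) s then 1/2 else (1::real))"
    unfolding good_def swap_gap_def by measurable
  have Zm: "(\<lambda>\<omega> i. Z (h i) \<omega>) \<in> measurable M (PiM UNIV (\<lambda>_. borel))" for h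
    using measurable_restrict[of UNIV "\<lambda>i. Z (h i)" M "\<lambda>_. borel", OF rv] by (simp add: restrict_def)
  have Ev: "{\<omega> \<in> space M. E (\<lambda>i. Z (h i) \<omega>)} \<in> events" for h
  proof -
    have "(\<lambda>\<omega> i. Z (h i) \<omega>) -` {x \<in> space (PiM UNIV (\<lambda>_. borel)). E x} \<inter> space M \<in> events"
      by (rule measurable_sets[OF Zm]) (use Em in simp)
    moreover have "(\<lambda>\<omega> i. Z (h i) \<omega>) -` {x \<in> space (PiM UNIV (\<lambda>_. borel)). E x} \<inter> space M = {\<omega> \<in> space M. E (\<lambda>i. Z (h i) \<omega>)}"
      by (auto simp: space_PiM)
    ultimately show ?thesis by simp
  qed
  have "2 ^ card T * prob {\<omega> \<in> space M. E (?Z \<omega>)} = (\<Sum>\<sigma>\<in>Pow T. prob {\<omega> \<in> space M. E (\<lambda>i. Z (swap_pairs \<sigma> i) \<omega>)})"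
  proof -
    have "(\<Sum>\<sigma>\<in>Pow T. prob {\<omega> \<in> space M. E (\<lambda>i. Z (swap_pairs \<sigma> i) \<omega>)}) = (\<Sum>\<sigma>\<in>Pow T. prob {\<omega> \<in> space M. E (?Z \<omega>)})"
      by (rule sum.cong[OF refl]) (use exch in auto)
    then show ?thesis using T(1) by (simp add: card_Pow)
  qed
  also have "\<dots> = (\<Sum>\<sigma>\<in>Pow T. expectation (\<lambda>\<omega>. of_bool (E (\<lambda>i. Z (swap_pairs \<sigma> i) \<omega>))))"
  proof (rule sum.cong[OF refl])
    fix \<sigma>
    have "expectation (\<lambda>\<omega>. of_bool (E (\<lambda>i. Z (swap_pairs \<sigma> i) \<omega>))) = expectation (indicator {\<omega> \<in> space M. E (\<lambda>i. Z (swap_pairs \<sigma> i) \<omega>)})"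
      by (rule Bochner_Integration.integral_cong) auto
    also have "\<dots> = prob ({\<omega> \<in> space M. E (\<lambda>i. Z (swap_pairs \<sigma> i) \<omega>)} \<inter> space M)"
      by (rule Bochner_Integration.integral_indicator)
    also have "{\<omega> \<in> space M. E (\<lambda>i. Z (swap_pairs \<sigma> i) \<omega>)} \<inter> space M = {\<omega> \<in> space M. E (\<lambda>i. Z (swap_pairs \<sigma> i) \<omega>)}"
      by auto
    finally show "prob {\<omega> \<in> space M. E (\<lambda>i. Z (swap_pairs \<sigma> i) \<omega>)} = expectation (\<lambda>\<omega>. of_bool (E (\<lambda>i. Z (swap_pairs \<sigma> i) \<omega>)))"
      by (rule sym)
  qed
  also have "\<dots> = expectation (\<lambda>\<omega>. \<Sum>\<sigma>\<in>Pow T. of_bool (E (\<lambda>i. Z (swap_pairs \<sigma> i) \<omega>)))"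
    by (subst Bochner_Integration.integral_sum) (use Ev in \<open>auto intro!: integrable_const_bound[of _ 1]\<close>)
  also have "\<dots> \<le> expectation (\<lambda>\<omega>. 2 ^ card T * (\<Prod>s\<in>T. if good (?Z \<omega>) s then 1/2 else (1::real)))"
  proof (rule integral_mono)
    show "integrable M (\<lambda>\<omega>. \<Sum>\<sigma>\<in>Pow T. of_bool (E (\<lambda>i. Z (swap_pairs \<sigma> i) \<omega>)) :: real)"
      by (rule Bochner_Integration.integrable_sum) (use Ev in \<open>auto intro!: integrable_const_bound[of _ 1]\<close>)
    show "integrable M (\<lambda>\<omega>. 2 ^ card T * (\<Prod>s\<in>T. if good (?Z \<omega>) s then 1/2 else (1::real)))"
    proof (rule integrable_mult_right, rule integrable_const_bound[of _ 1])
      show "AE \<omega> in M. norm (\<Prod>s\<in>T. if good (?Z \<omega>) s then 1/2 else (1::real)) \<le> 1"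
        by (auto simp: abs_prod intro!: prod_le_1)
    qed (rule gmeas)
  qed (rule count)
  also have "\<dots> = 2 ^ card T * (1 - p / 2) ^ card T" using slots by simp
  finally have "prob {\<omega> \<in> space M. E (?Z \<omega>)} \<le> (1 - p / 2) ^ card T" by simp
  then show ?thesis by (simp add: E_def reg_def p_def)
qed

section \<open>Perpetuities avoid small nonzero values\<close>

text \<open>Dominated convergence for indicators.\<close>

lemma (in prob_space) prob_tendsto_0:
  assumes A: "\<And>n. A n \<in> events" and ae: "AE \<omega> in M. \<forall>\<^sub>F n in sequentially. \<omega> \<notin> A n"
  shows "(\<lambda>n. prob (A n)) \<longlonglongrightarrow> 0"
proof -
  have "(\<lambda>n. \<integral>\<omega>. indicator (A n) \<omega> \<partial>M) \<longlonglongrightarrow> (\<integral>\<omega>. (0::real) \<partial>M)"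
  proof (rule integral_dominated_convergence[where w = "\<lambda>_. 1"])
    show "AE \<omega> in M. (\<lambda>n. indicator (A n) \<omega>) \<longlonglongrightarrow> (0::real)"
      using ae by eventually_elim (rule tendsto_eventually, auto elim: eventually_mono)
  qed (use A in auto)
  moreover have "(\<integral>\<omega>. indicator (A n) \<omega> \<partial>M) = prob (A n)" for n using A[of n] by simp
  ultimately show ?thesis by simp
qed

lemma ln_abs_lin:
  assumes "\<And>i. 1 \<le> i \<Longrightarrow> i \<le> n \<Longrightarrow> m i \<noteq> 0"
  shows "ln \<bar>partial_prod m n\<bar> = (\<Sum>k=1..n. ln \<bar>m k\<bar>)" "partial_prod m n \<noteq> 0"
proof -
  have "ln \<bar>partial_prod m n\<bar> = (\<Sum>k=1..n. ln \<bar>m k\<bar>) \<and> partial_prod m n \<noteq> 0"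
    using assms
  proof (induction n)
    case (Suc n)
    have "m (Suc n) \<noteq> 0" by (rule Suc.prems) auto
    then show ?case using Suc.IH Suc.prems by (simp add: abs_mult ln_mult)
  qed simp
  then show "ln \<bar>partial_prod m n\<bar> = (\<Sum>k=1..n. ln \<bar>m k\<bar>)" "partial_prod m n \<noteq> 0" by auto
qed

text \<open>Union bound over pairs of slots; by stationarity the probability of a small difference depends only on the
  distance of the slots, and each of the \<open>L\<close> distances occurs at most \<open>L\<close> times.\<close>

lemma (in prob_space) coincidence_prob_le:
  fixes U :: "nat \<Rightarrow> 'a \<Rightarrow> real"
  assumes indep: "indep_vars (\<lambda>_. borel) U {1..}"
    and ident: "\<And>k. k \<ge> 1 \<Longrightarrow> distr M borel (U k) = distr M borel (U 1)"
  defines "S n \<omega> \<equiv> \<Sum>k=1..n. U k \<omega>"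
  shows "{\<omega> \<in> space M. \<exists>l\<in>{1..L}. \<exists>l'\<in>{1..L}. l \<noteq> l' \<and> \<bar>S (l * g) \<omega> - S (l' * g) \<omega>\<bar> \<le> c} \<in> events"
    and "prob {\<omega> \<in> space M. \<exists>l\<in>{1..L}. \<exists>l'\<in>{1..L}. l \<noteq> l' \<and> \<bar>S (l * g) \<omega> - S (l' * g) \<omega>\<bar> \<le> c}
      \<le> real L * (\<Sum>j=1..L. prob {\<omega> \<in> space M. \<bar>\<Sum>k=1..j * g. U k \<omega>\<bar> \<le> c})"
proof -
  have rv: "random_variable borel (U i)" if "i \<in> {1..}" for i
    using indep that by (auto simp: indep_vars_def)
  have S[measurable]: "random_variable borel (S n)" for n
    unfolding S_def by (rule borel_measurable_sum) (use rv in auto)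
  show "{\<omega> \<in> space M. \<exists>l\<in>{1..L}. \<exists>l'\<in>{1..L}. l \<noteq> l' \<and> \<bar>S (l * g) \<omega> - S (l' * g) \<omega>\<bar> \<le> c} \<in> events"
    by measurable
  have Ssplit: "S (i + j) \<omega> - S i \<omega> = (\<Sum>k=1..j. U (k + i) \<omega>)" for i j \<omega>
    by (induction j) (auto simp: S_def add.commute)
  have shift: "prob {\<omega> \<in> space M. \<bar>S (i + n) \<omega> - S i \<omega>\<bar> \<le> c} = prob {\<omega> \<in> space M. \<bar>\<Sum>k=1..n. U k \<omega>\<bar> \<le> c}" for i n
  proof -
    define B where "B x \<longleftrightarrow> \<bar>\<Sum>k=1..n. x k\<bar> \<le> c" for x :: "nat \<Rightarrow> real"
    have B: "Measurable.pred (PiM {1..} (\<lambda>_. borel)) B" unfolding B_def by measurable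
    have "prob {\<omega> \<in> space M. B (\<lambda>k\<in>{1..}. U (k + i) \<omega>)} = prob {\<omega> \<in> space M. B (\<lambda>k\<in>{1..}. U k \<omega>)}"
    proof (rule prob_reindex_indep[OF indep _ _ _ _ _ B])
      show "distr M borel (U (k + i)) = distr M borel (U k)" if "k \<in> {1..}" for k
        using ident[of "k + i"] ident[of k] that by simp
    qed auto
    then show ?thesis unfolding Ssplit by (simp add: B_def)
  qed
  define B where "B l j = {\<omega> \<in> space M. \<bar>S (l * g + j * g) \<omega> - S (l * g) \<omega>\<bar> \<le> c}" for l j
  have Bm: "B l j \<in> events" for l j unfolding B_def by measurable
  have "{\<omega> \<in> space M. \<exists>l\<in>{1..L}. \<exists>l'\<in>{1..L}. l \<noteq> l' \<and> \<bar>S (l * g) \<omega> - S (l' * g) \<omega>\<bar> \<le> c}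
     \<subseteq> (\<Union>l\<in>{1..L}. \<Union>j\<in>{1..L}. B l j)"
  proof
    fix \<omega> assume "\<omega> \<in> {\<omega> \<in> space M. \<exists>l\<in>{1..L}. \<exists>l'\<in>{1..L}. l \<noteq> l' \<and> \<bar>S (l * g) \<omega> - S (l' * g) \<omega>\<bar> \<le> c}"
    then obtain l l' where l: "\<omega> \<in> space M" "l \<in> {1..L}" "l' \<in> {1..L}" "l < l'" "\<bar>S (l' * g) \<omega> - S (l * g) \<omega>\<bar> \<le> c"
      by (auto simp: abs_minus_commute elim!: linorder_neqE_nat)
    have "l * g + (l' - l) * g = l' * g" using l by (simp add: add_mult_distrib[symmetric])
    then have "\<omega> \<in> B l (l' - l)" using l by (simp add: B_def)
    moreover have "l' - l \<in> {1..L}" using l by auto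
    ultimately show "\<omega> \<in> (\<Union>l\<in>{1..L}. \<Union>j\<in>{1..L}. B l j)" using l(2) by blast
  qed
  then have "prob {\<omega> \<in> space M. \<exists>l\<in>{1..L}. \<exists>l'\<in>{1..L}. l \<noteq> l' \<and> \<bar>S (l * g) \<omega> - S (l' * g) \<omega>\<bar> \<le> c}
     \<le> prob (\<Union>l\<in>{1..L}. \<Union>j\<in>{1..L}. B l j)"
    by (rule finite_measure_mono) (use Bm in auto)
  also have "\<dots> \<le> (\<Sum>l\<in>{1..L}. prob (\<Union>j\<in>{1..L}. B l j))"
    by (rule measure_UNION_le) (use Bm in auto)
  also have "\<dots> \<le> (\<Sum>l\<in>{1..L}. \<Sum>j\<in>{1..L}. prob (B l j))"
    by (intro sum_mono measure_UNION_le) (use Bm in auto)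
  also have "\<dots> = real L * (\<Sum>j=1..L. prob {\<omega> \<in> space M. \<bar>\<Sum>k=1..j * g. U k \<omega>\<bar> \<le> c})"
    unfolding B_def shift by simp
  finally show "prob {\<omega> \<in> space M. \<exists>l\<in>{1..L}. \<exists>l'\<in>{1..L}. l \<noteq> l' \<and> \<bar>S (l * g) \<omega> - S (l' * g) \<omega>\<bar> \<le> c}
      \<le> real L * (\<Sum>j=1..L. prob {\<omega> \<in> space M. \<bar>\<Sum>k=1..j * g. U k \<omega>\<bar> \<le> c})" .
qed

text \<open>Since \<open>1/2 = (4/5)\<^sup>3 (125/128)\<close> and \<open>m (4/5)^m\<close> is bounded, the terms are dominated by a geometric series.\<close>

lemma summable_cube_half_power: "summable (\<lambda>m. real m ^ 3 * (1/2) ^ m)"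
proof -
  have "(\<lambda>m. real m * (4/5) ^ m) \<longlonglongrightarrow> 0" by (rule powser_times_n_limit_0) simp
  then have "Bseq (\<lambda>m. real m * (4/5) ^ m)" by (intro convergent_imp_Bseq convergentI)
  then obtain K where "\<forall>m. norm (real m * (4/5) ^ m) \<le> K" by (rule BseqE)
  then have K: "\<bar>real m * (4/5) ^ m\<bar> \<le> K" for m by (simp only: real_norm_def)
  have "norm (real m ^ 3 * (1/2) ^ m) \<le> K ^ 3 * (125/128) ^ m" for m
  proof -
    have "((4/5::real) ^ m) ^ 3 = ((4/5) ^ 3) ^ m" by (metis power_mult mult.commute)
    then have "((4/5::real) ^ m) ^ 3 * (125/128) ^ m = ((4/5) ^ 3 * (125/128)) ^ m" by (simp only: power_mult_distrib)
    also have "(4/5) ^ 3 * (125/128) = (1/2::real)" by (simp add: power3_eq_cube)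
    finally have e: "(1/2::real) ^ m = ((4/5) ^ m) ^ 3 * (125/128) ^ m" by (rule sym)
    have "(real m * (4/5) ^ m) ^ 3 \<le> K ^ 3" using K[of m] by (intro power_mono) auto
    then have "(real m * (4/5) ^ m) ^ 3 * (125/128) ^ m \<le> K ^ 3 * (125/128) ^ m" by (intro mult_right_mono) auto
    moreover have "real m ^ 3 * (1/2) ^ m = (real m * (4/5) ^ m) ^ 3 * (125/128) ^ m"
      by (simp only: e power_mult_distrib mult.assoc)
    moreover have "real m ^ 3 * (1/2) ^ m \<ge> 0" by simp
    ultimately show ?thesis by (simp only: real_norm_def abs_of_nonneg)
  qed
  then have bd: "\<And>m. m \<ge> 0 \<Longrightarrow> norm (real m ^ 3 * (1/2) ^ m) \<le> K ^ 3 * (125/128) ^ m" by simp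
  have "summable (\<lambda>m. K ^ 3 * (125/128 :: real) ^ m)" by (rule summable_mult, rule summable_geometric) simp
  then show ?thesis by (rule summable_comparison_test'[OF _ bd])
qed

text \<open>For \<open>k \<ge> 2^m\<close> use \<open>L = c\<^sub>0 m\<close> slots, at the multiples of a step \<open>g\<close> of order \<open>2^m / L\<close>. The constant \<open>c\<^sub>0\<close> is
  large enough to make the bound \<open>(1 - p/2)^L\<close> at most \<open>4^(-m)\<close>, which beats the \<open>2^m\<close> values of \<open>k\<close> in a dyadic
  interval. The event \<open>Cn m\<close> that two slots are not separated does not depend on \<open>k\<close>; by the choice of \<open>g\<close>
  its probability is of order \<open>L^3 / 2^m\<close>, which is summable in \<open>m\<close>.\<close>

lemma (in prob_space) dyadic_anti_concentration:
  fixes Z :: "nat \<Rightarrow> 'a \<Rightarrow> real \<times> real"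
  assumes indep: "indep_vars (\<lambda>_. borel) Z UNIV"
    and ident': "\<forall>k\<ge>1. distr M borel (Z k) = distr M borel (Z 1)"
    and d: "0 < d" "d \<le> d'"
    and p: "prob {\<omega> \<in> space M. \<bar>swap_gap (Z 1 \<omega>) (Z 2 \<omega>)\<bar> \<in> {d..d'}} > 0"
    and visits: "\<And>N. (\<Sum>n<N. prob {\<omega> \<in> space M. \<bar>\<Sum>k=1..n. ln \<bar>fst (Z k \<omega>)\<bar>\<bar> \<le> ln (4 * d' / d)}) \<le> C"
  shows "\<exists>(\<kappa> :: nat \<Rightarrow> real) (Cn :: nat \<Rightarrow> 'a set) m1. summable \<kappa> \<and> (\<forall>m. Cn m \<in> events \<and> prob (Cn m) \<le> \<kappa> m) \<and>
    (\<forall>m k \<rho>. m \<ge> m1 \<longrightarrow> 2 ^ m \<le> k \<longrightarrow> \<rho> \<in> borel_measurable borel \<longrightarrow> (\<forall>x>0. \<rho> x > 0) \<longrightarrow>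
       prob {\<omega> \<in> space M. \<omega> \<notin> Cn m \<and> \<bar>fst (Z 0 \<omega>) + perp (\<lambda>i. Z i \<omega>) k\<bar> \<le> \<rho> \<bar>lin (\<lambda>i. Z i \<omega>) k\<bar> \<and>
         (\<forall>i\<in>{1..k}. fst (Z i \<omega>) \<noteq> 0) \<and> (\<forall>s\<le>k. 4 * \<rho> \<bar>lin (\<lambda>i. Z i \<omega>) k\<bar> \<le> d * \<bar>lin (\<lambda>i. Z i \<omega>) s\<bar>)} \<le> (1/4) ^ m)"
proof -
  have ident: "distr M borel (Z k) = distr M borel (Z 1)" if "k \<ge> 1" for k using ident' that by blast
  have rv[measurable]: "random_variable borel (Z i)" for i using indep by (auto simp: indep_vars_def)
  define U where "U k \<omega> = ln \<bar>fst (Z k \<omega>)\<bar>" for k \<omega>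
  define c where "c = ln (4 * d' / d)"
  have lnm: "(\<lambda>x :: real \<times> real. ln \<bar>fst x\<bar>) \<in> borel_measurable borel"
    by (intro borel_measurable_ln borel_measurable_abs borel_measurable_fst_real)
  have indepU: "indep_vars (\<lambda>_. borel) U {1..}"
    unfolding U_def by (rule indep_vars_compose2[OF indep_vars_subset[OF indep]]) (use lnm in auto)
  have identU: "distr M borel (U k) = distr M borel (U 1)" if "k \<ge> 1" for k
  proof -
    have "distr M borel (U k) = distr (distr M borel (Z k)) borel (\<lambda>x. ln \<bar>fst x\<bar>)" for k
      unfolding U_def by (subst distr_distr[OF lnm rv]) (simp add: comp_def)
    then show ?thesis using ident[OF that] by metis
  qed
  define S where "S n \<omega> = (\<Sum>k=1..n. U k \<omega>)" for n \<omega>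
  define pn where "pn n = prob {\<omega> \<in> space M. \<bar>\<Sum>k=1..n. U k \<omega>\<bar> \<le> c}" for n
  have vis: "(\<Sum>n<N. pn n) \<le> C" for N using visits[of N] by (simp add: pn_def c_def U_def)
  have C0: "C \<ge> 0" using vis[of 0] by simp
  define p where "p = prob {\<omega> \<in> space M. \<bar>swap_gap (Z 1 \<omega>) (Z 2 \<omega>)\<bar> \<in> {d..d'}}"
  have p01: "0 < p" "p \<le> 1" using p by (auto simp: p_def)
  then have q: "0 \<le> 1 - p / 2" "1 - p / 2 < 1" by auto
  obtain c0 where c0: "(1 - p / 2) ^ c0 < 1/4" using real_arch_pow_inv[of "1/4" "1 - p/2"] q by auto
  have c0pos: "c0 \<ge> 1" using c0 by (cases c0) auto
  define L where "L m = c0 * m" for m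
  \<comment> \<open>With this choice all slots \<open>l g\<close>, where \<open>l \<le> L\<close> and \<open>g < 2 A\<close>, are at most \<open>2^m - 2\<close>.\<close>
  define A where "A m = 2 ^ m div (4 * L m)" for m :: nat
  have "(\<lambda>m. 8 * real c0 * (real m * (1/2) ^ m)) \<longlonglongrightarrow> 8 * real c0 * 0"
    by (intro tendsto_mult tendsto_const powser_times_n_limit_0) simp
  then have "\<forall>\<^sub>F m in sequentially. 8 * real c0 * (real m * (1/2) ^ m) < 1" by (intro order_tendstoD) auto
  then obtain m1' where m1': "\<And>m. m \<ge> m1' \<Longrightarrow> 8 * real c0 * (real m * (1/2) ^ m) < 1" by (auto simp: eventually_sequentially)
  define m1 where "m1 = max m1' 2"
  have L8: "8 * L m \<le> 2 ^ m" if "m \<ge> m1" for m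
  proof -
    have "8 * real c0 * real m < 2 ^ m" using m1'[of m] that by (simp add: m1_def field_simps)
    then have "real (8 * L m) < real (2 ^ m)" by (simp add: L_def)
    then show ?thesis by linarith
  qed
  have L2: "L m \<ge> 2" if "m \<ge> m1" for m
  proof -
    have "1 * 2 \<le> c0 * m" using that c0pos by (intro mult_le_mono) (auto simp: m1_def)
    then show ?thesis by (simp add: L_def)
  qed
  have A2: "A m \<ge> 2" and Age: "real (A m) \<ge> 2 ^ m / (8 * real (L m))" if m: "m \<ge> m1" for m
  proof -
    show "A m \<ge> 2" unfolding A_def using L8[OF m] L2[OF m] by (intro div_le_mono[of "2 * (4 * L m)" "2 ^ m" "4 * L m", simplified, THEN order_trans[rotated]]) auto
    have "2 ^ m = 4 * L m * A m + 2 ^ m mod (4 * L m)" by (simp add: A_def)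
    moreover have "2 ^ m mod (4 * L m) < 4 * L m" using L2[OF m] by (intro mod_less_divisor) auto
    ultimately have "2 ^ m < 4 * L m * A m + 4 * L m" by linarith
    also have "\<dots> \<le> 4 * L m * A m + 4 * L m * A m" using \<open>A m \<ge> 2\<close> by simp
    finally have "2 ^ m \<le> 8 * L m * A m" by linarith
    then have "real (2 ^ m) \<le> real (8 * L m * A m)" by (rule of_nat_mono)
    then show "real (A m) \<ge> 2 ^ m / (8 * real (L m))" using L2[OF m] by (simp add: field_simps)
  qed
  have "\<exists>g. A m \<le> g \<and> g < 2 * A m \<and> (\<Sum>j=1..L m. pn (j * g)) \<le> real (L m) * C / real (A m)" if m: "m \<ge> m1" for m
    using sparse_step_exists[of pn C "A m" "L m"] vis A2[OF m] by (auto simp: pn_def)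
  then obtain g where g: "\<And>m. m \<ge> m1 \<Longrightarrow> A m \<le> g m" "\<And>m. m \<ge> m1 \<Longrightarrow> g m < 2 * A m"
    "\<And>m. m \<ge> m1 \<Longrightarrow> (\<Sum>j=1..L m. pn (j * g m)) \<le> real (L m) * C / real (A m)" by metis
  define Cn where "Cn m = (if m \<ge> m1 then {\<omega> \<in> space M. \<exists>l\<in>{1..L m}. \<exists>l'\<in>{1..L m}. l \<noteq> l' \<and> \<bar>S (l * g m) \<omega> - S (l' * g m) \<omega>\<bar> \<le> c} else {})" for m
  define \<kappa> where "\<kappa> m = 8 * C * real c0 ^ 3 * (real m ^ 3 * (1/2) ^ m)" for m
  have 1: "summable \<kappa>" unfolding \<kappa>_def by (intro summable_mult summable_cube_half_power)
  have 2: "Cn m \<in> events" for m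
  proof (cases "m \<ge> m1")
    case True
    show ?thesis unfolding Cn_def if_P[OF True] S_def by (rule coincidence_prob_le(1)[OF indepU identU])
  next
    case False
    show ?thesis unfolding Cn_def if_not_P[OF False] by (rule sets.empty_sets)
  qed
  have 3: "prob (Cn m) \<le> \<kappa> m" for m
  proof (cases "m \<ge> m1")
    case True
    have Apos: "real (A m) > 0" using A2[OF True] by simp
    have "prob (Cn m) \<le> real (L m) * (\<Sum>j=1..L m. pn (j * g m))"
      unfolding Cn_def if_P[OF True] S_def pn_def by (rule coincidence_prob_le(2)[OF indepU identU])
    also have "\<dots> \<le> real (L m) * (real (L m) * C / real (A m))" using g(3)[OF True] by (intro mult_left_mono) auto
    also have "\<dots> \<le> real (L m) * (real (L m) * C / (2 ^ m / (8 * real (L m))))"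
      using Age[OF True] C0 L2[OF True] Apos by (intro mult_left_mono divide_left_mono mult_pos_pos divide_pos_pos) auto
    also have "\<dots> = \<kappa> m" using L2[OF True] by (simp add: \<kappa>_def L_def power_divide power_mult_distrib field_simps power3_eq_cube)
    finally show ?thesis .
  next
    case False then show ?thesis using C0 by (simp add: Cn_def \<kappa>_def)
  qed
  have 4: "prob {\<omega> \<in> space M. \<omega> \<notin> Cn m \<and> \<bar>fst (Z 0 \<omega>) + perp (\<lambda>i. Z i \<omega>) k\<bar> \<le> \<rho> \<bar>lin (\<lambda>i. Z i \<omega>) k\<bar> \<and>
         (\<forall>i\<in>{1..k}. fst (Z i \<omega>) \<noteq> 0) \<and> (\<forall>s\<le>k. 4 * \<rho> \<bar>lin (\<lambda>i. Z i \<omega>) k\<bar> \<le> d * \<bar>lin (\<lambda>i. Z i \<omega>) s\<bar>)} \<le> (1/4) ^ m"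
    if m: "m \<ge> m1" and k: "2 ^ m \<le> k" and \<rho>: "\<rho> \<in> borel_measurable borel" "\<And>x. x > 0 \<Longrightarrow> \<rho> x > 0" for m k \<rho>
  proof -
    have g2: "g m \<ge> 2" using g(1)[OF m] A2[OF m] by simp
    define T where "T = (\<lambda>l. l * g m) ` {1..L m}"
    have cT: "card T = L m" unfolding T_def using g2 by (subst card_image) (auto simp: inj_on_def)
    have T1: "finite T" by (simp add: T_def)
    have T2: "Suc s \<notin> T" if "s \<in> T" for s
    proof
      assume "Suc s \<in> T"
      then have "g m dvd Suc s" "g m dvd s" using that by (auto simp: T_def)
      then have "g m dvd 1" by (metis Suc_eq_plus1 dvd_add_right_iff)
      then show False using g2 by simp
    qed
    have T3: "s + 2 \<le> k" if "s \<in> T" for s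
    proof -
      obtain l where l: "l \<le> L m" "s = l * g m" using \<open>s \<in> T\<close> by (auto simp: T_def)
      have "s \<le> L m * (2 * A m - 1)" unfolding l(2) using l(1) g(2)[OF m] by (intro mult_le_mono) auto
      moreover have "L m * (2 * A m - 1) + L m = 2 * (L m * A m)" using A2[OF m] by (simp add: algebra_simps)
      moreover have "4 * (L m * A m) \<le> 2 ^ m"
        using div_times_less_eq_dividend[of "2 ^ m" "4 * L m"] by (simp add: A_def mult_ac)
      ultimately show ?thesis using L2[OF m] k by linarith
    qed
    let ?E = "{\<omega> \<in> space M.
      \<bar>fst (Z 0 \<omega>) + perp (\<lambda>i. Z i \<omega>) k\<bar> \<le> \<rho> \<bar>lin (\<lambda>i. Z i \<omega>) k\<bar> \<and>
      (\<forall>i\<in>{1..k}. fst (Z i \<omega>) \<noteq> 0) \<and>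
      (\<forall>s\<in>T. \<forall>s'\<in>T. s \<noteq> s' \<longrightarrow> \<bar>ln \<bar>lin (\<lambda>i. Z i \<omega>) s\<bar> - ln \<bar>lin (\<lambda>i. Z i \<omega>) s'\<bar>\<bar> > ln (4 * d' / d)) \<and>
      (\<forall>s\<in>T. 4 * \<rho> \<bar>lin (\<lambda>i. Z i \<omega>) k\<bar> \<le> d * \<bar>lin (\<lambda>i. Z i \<omega>) s\<bar>)}"
    have meas: "?E \<in> events"
    proof -
      have comp: "random_variable borel (\<lambda>\<omega>. fst (Z i \<omega>))" "random_variable borel (\<lambda>\<omega>. snd (Z i \<omega>))" for i
        by (rule measurable_compose[OF rv borel_measurable_fst_real] measurable_compose[OF rv borel_measurable_snd_real])+
      have Am: "random_variable borel (\<lambda>\<omega>. fst (Z 0 \<omega>) + perp (\<lambda>i. Z i \<omega>) n)" for n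
        by (intro borel_measurable_add borel_measurable_perpetuity comp)
      have Lm: "random_variable borel (\<lambda>\<omega>. lin (\<lambda>i. Z i \<omega>) n)" for n
        by (intro borel_measurable_partial_prod comp)
      from measurable_regular_event[where A = "\<lambda>n \<omega>. fst (Z 0 \<omega>) + perp (\<lambda>i. Z i \<omega>) n" and F = "\<lambda>n \<omega>. fst (Z n \<omega>)"
          and L = "\<lambda>n \<omega>. lin (\<lambda>i. Z i \<omega>) n" and k = k and c = "ln (4 * d' / d)" and d = d, OF Am comp(1) Lm \<rho>(1) T1]
      show ?thesis by (simp add: pred_def)
    qed
    have "prob {\<omega> \<in> space M. \<omega> \<notin> Cn m \<and> \<bar>fst (Z 0 \<omega>) + perp (\<lambda>i. Z i \<omega>) k\<bar> \<le> \<rho> \<bar>lin (\<lambda>i. Z i \<omega>) k\<bar> \<and>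
         (\<forall>i\<in>{1..k}. fst (Z i \<omega>) \<noteq> 0) \<and> (\<forall>s\<le>k. 4 * \<rho> \<bar>lin (\<lambda>i. Z i \<omega>) k\<bar> \<le> d * \<bar>lin (\<lambda>i. Z i \<omega>) s\<bar>)} \<le> prob ?E"
    proof (rule finite_measure_mono[OF _ meas], safe)
      fix \<omega> s s' assume w: "\<omega> \<in> space M" "\<omega> \<notin> Cn m" and nz: "\<forall>i\<in>{1..k}. fst (Z i \<omega>) \<noteq> 0"
        and s: "s \<in> T" "s' \<in> T" "s \<noteq> s'"
      obtain l l' where l: "l \<in> {1..L m}" "s = l * g m" "l' \<in> {1..L m}" "s' = l' * g m" using s by (auto simp: T_def)
      have "ln \<bar>lin (\<lambda>i. Z i \<omega>) n\<bar> = S n \<omega>" if "n \<in> T" for n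
        unfolding S_def U_def
      proof (rule ln_abs_lin(1))
        show "fst (Z i \<omega>) \<noteq> 0" if "1 \<le> i" "i \<le> n" for i
          using bspec[OF nz, of i] T3[OF \<open>n \<in> T\<close>] that by simp
      qed
      from this[OF s(1)] this[OF s(2)]
      have "ln \<bar>lin (\<lambda>i. Z i \<omega>) s\<bar> = S s \<omega>" "ln \<bar>lin (\<lambda>i. Z i \<omega>) s'\<bar> = S s' \<omega>" .
      moreover have nc: "\<not> (\<exists>l\<in>{1..L m}. \<exists>l'\<in>{1..L m}. l \<noteq> l' \<and> \<bar>S (l * g m) \<omega> - S (l' * g m) \<omega>\<bar> \<le> c)"
        using w unfolding Cn_def if_P[OF m] by simp
      have "\<not> \<bar>S s \<omega> - S s' \<omega>\<bar> \<le> c"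
      proof
        assume "\<bar>S s \<omega> - S s' \<omega>\<bar> \<le> c"
        then have "\<exists>l\<in>{1..L m}. \<exists>l'\<in>{1..L m}. l \<noteq> l' \<and> \<bar>S (l * g m) \<omega> - S (l' * g m) \<omega>\<bar> \<le> c"
          using l s(3) by (intro bexI[of _ l] bexI[of _ l']) auto
        with nc show False by contradiction
      qed
      ultimately show "ln (4 * d' / d) < \<bar>ln \<bar>lin (\<lambda>i. Z i \<omega>) s\<bar> - ln \<bar>lin (\<lambda>i. Z i \<omega>) s'\<bar>\<bar>"
        by (simp add: c_def)
    next
      fix \<omega> s assume "\<forall>s\<le>k. 4 * \<rho> \<bar>lin (\<lambda>i. Z i \<omega>) k\<bar> \<le> d * \<bar>lin (\<lambda>i. Z i \<omega>) s\<bar>" "s \<in> T"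
      then show "4 * \<rho> \<bar>lin (\<lambda>i. Z i \<omega>) k\<bar> \<le> d * \<bar>lin (\<lambda>i. Z i \<omega>) s\<bar>" using T3[of s] by simp
    qed
    also have "\<dots> \<le> (1 - p / 2) ^ card T"
      unfolding p_def by (rule anti_concentration[OF indep ident T1 T2 T3 d \<rho>])
    also have "\<dots> = ((1 - p / 2) ^ c0) ^ m" by (simp add: cT L_def power_mult)
    also have "\<dots> \<le> (1/4) ^ m" using c0 q by (intro power_mono) auto
    finally show ?thesis .
  qed
  show ?thesis using 1 2 3 4 by blast
qed

text \<open>Indices \<open>k < 2^m\<^sub>0\<close> are finitely many and are covered by the hypothesis for fixed \<open>k\<close>. The others
  contribute at most the tail of a summable series that does not depend on \<open>n\<close>, apart from the event that some
  product is too small compared with the radius, whose probability tends to \<open>0\<close> by hypothesis.\<close>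

lemma (in prob_space) no_dip:
  fixes Z :: "nat \<Rightarrow> 'a \<Rightarrow> real \<times> real" and \<rho> :: "nat \<Rightarrow> real \<Rightarrow> real" and N :: "nat \<Rightarrow> nat"
  assumes indep: "indep_vars (\<lambda>_. borel) Z UNIV"
    and ident: "\<And>k. k \<ge> 1 \<Longrightarrow> distr M borel (Z k) = distr M borel (Z 1)"
    and d: "0 < d" "d \<le> d'"
    and p: "prob {\<omega> \<in> space M. \<bar>swap_gap (Z 1 \<omega>) (Z 2 \<omega>)\<bar> \<in> {d..d'}} > 0"
    and visits: "\<And>N. (\<Sum>n<N. prob {\<omega> \<in> space M. \<bar>\<Sum>k=1..n. ln \<bar>fst (Z k \<omega>)\<bar>\<bar> \<le> ln (4 * d' / d)}) \<le> C"
    and nz: "AE \<omega> in M. \<forall>k\<ge>1. fst (Z k \<omega>) \<noteq> 0"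
    and \<rho>: "\<And>n. \<rho> n \<in> borel_measurable borel" "\<And>n x. x > 0 \<Longrightarrow> \<rho> n x > 0"
    and fixed: "\<And>k. k \<ge> 1 \<Longrightarrow> (\<lambda>n. prob {\<omega> \<in> space M. fst (Z 0 \<omega>) + perp (\<lambda>i. Z i \<omega>) k \<noteq> 0 \<and>
        \<bar>fst (Z 0 \<omega>) + perp (\<lambda>i. Z i \<omega>) k\<bar> \<le> \<rho> n \<bar>lin (\<lambda>i. Z i \<omega>) k\<bar>}) \<longlonglongrightarrow> 0"
    and reg: "(\<lambda>n. prob {\<omega> \<in> space M. \<exists>k\<in>{1..N n}. \<exists>s\<in>{..k}.
        4 * \<rho> n \<bar>lin (\<lambda>i. Z i \<omega>) k\<bar> > d * \<bar>lin (\<lambda>i. Z i \<omega>) s\<bar>}) \<longlonglongrightarrow> 0"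
  shows "(\<lambda>n. prob {\<omega> \<in> space M. \<exists>k\<in>{1..N n}. fst (Z 0 \<omega>) + perp (\<lambda>i. Z i \<omega>) k \<noteq> 0 \<and>
        \<bar>fst (Z 0 \<omega>) + perp (\<lambda>i. Z i \<omega>) k\<bar> \<le> \<rho> n \<bar>lin (\<lambda>i. Z i \<omega>) k\<bar>}) \<longlonglongrightarrow> 0"
proof -
  have ident': "\<forall>k\<ge>1. distr M borel (Z k) = distr M borel (Z 1)" using ident by blast
  obtain \<kappa> Cn m1 where \<kappa>: "summable \<kappa>" and Cn': "\<forall>m. Cn m \<in> events \<and> prob (Cn m) \<le> \<kappa> m"
    and dy: "\<forall>m k \<rho>. m \<ge> m1 \<longrightarrow> 2 ^ m \<le> k \<longrightarrow> \<rho> \<in> borel_measurable borel \<longrightarrow> (\<forall>x>0. \<rho> x > 0) \<longrightarrow>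
       prob {\<omega> \<in> space M. \<omega> \<notin> Cn m \<and> \<bar>fst (Z 0 \<omega>) + perp (\<lambda>i. Z i \<omega>) k\<bar> \<le> \<rho> \<bar>lin (\<lambda>i. Z i \<omega>) k\<bar> \<and>
         (\<forall>i\<in>{1..k}. fst (Z i \<omega>) \<noteq> 0) \<and> (\<forall>s\<le>k. 4 * \<rho> \<bar>lin (\<lambda>i. Z i \<omega>) k\<bar> \<le> d * \<bar>lin (\<lambda>i. Z i \<omega>) s\<bar>)} \<le> (1/4) ^ m"
    using dyadic_anti_concentration[OF indep ident' d p visits] by (elim exE conjE) (rule that)
  have Cn: "Cn m \<in> events" "prob (Cn m) \<le> \<kappa> m" for m using Cn' by auto
  have rv: "random_variable borel (Z i)" for i using indep by (auto simp: indep_vars_def)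
  have comp: "random_variable borel (\<lambda>\<omega>. fst (Z i \<omega>))" "random_variable borel (\<lambda>\<omega>. snd (Z i \<omega>))" for i
    by (rule measurable_compose[OF rv borel_measurable_fst_real] measurable_compose[OF rv borel_measurable_snd_real])+
  define A where "A k \<omega> = fst (Z 0 \<omega>) + perp (\<lambda>i. Z i \<omega>) k" for k \<omega>
  define Li where "Li k \<omega> = lin (\<lambda>i. Z i \<omega>) k" for k \<omega>
  define Fi where "Fi k \<omega> = fst (Z k \<omega>)" for k \<omega>
  have [measurable]: "random_variable borel (A k)" "random_variable borel (Li k)" "random_variable borel (Fi k)" for k
    unfolding A_def Li_def Fi_def by (intro borel_measurable_add borel_measurable_perpetuity borel_measurable_partial_prod comp)+
  note \<rho>(1)[measurable]
  define bad where "bad n = {\<omega> \<in> space M. \<exists>k\<in>{1..N n}. A k \<omega> \<noteq> 0 \<and> \<bar>A k \<omega>\<bar> \<le> \<rho> n \<bar>Li k \<omega>\<bar>}" for n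
  define fx where "fx n k = {\<omega> \<in> space M. A k \<omega> \<noteq> 0 \<and> \<bar>A k \<omega>\<bar> \<le> \<rho> n \<bar>Li k \<omega>\<bar>}" for n k
  define rg where "rg n = {\<omega> \<in> space M. \<exists>k\<in>{1..N n}. \<exists>s\<in>{..k}. 4 * \<rho> n \<bar>Li k \<omega>\<bar> > d * \<bar>Li s \<omega>\<bar>}" for n
  define dd where "dd n m k = {\<omega> \<in> space M. \<omega> \<notin> Cn m \<and> \<bar>A k \<omega>\<bar> \<le> \<rho> n \<bar>Li k \<omega>\<bar> \<and>
         (\<forall>i\<in>{1..k}. Fi i \<omega> \<noteq> 0) \<and> (\<forall>s\<in>{..k}. 4 * \<rho> n \<bar>Li k \<omega>\<bar> \<le> d * \<bar>Li s \<omega>\<bar>)}" for n m k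
  have fxm: "fx n k \<in> events" for n k unfolding fx_def by measurable
  have rgm: "rg n \<in> events" for n unfolding rg_def by measurable
  have ddm: "dd n m k \<in> events" for n m k
  proof -
    let ?R = "{\<omega> \<in> space M. \<bar>A k \<omega>\<bar> \<le> \<rho> n \<bar>Li k \<omega>\<bar> \<and>
         (\<forall>i\<in>{1..k}. Fi i \<omega> \<noteq> 0) \<and> (\<forall>s\<in>{..k}. 4 * \<rho> n \<bar>Li k \<omega>\<bar> \<le> d * \<bar>Li s \<omega>\<bar>)}"
    have "?R \<in> events" by measurable
    moreover have "dd n m k = ?R - Cn m" unfolding dd_def by blast
    ultimately show ?thesis using Cn(1)[of m] by (simp only: sets.Diff)
  qed
  have ddp: "prob (dd n m k) \<le> (1/4) ^ m" if "m \<ge> m1" "2 ^ m \<le> k" for n m k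
    using dy[rule_format, OF that \<rho>(1)[of n] \<rho>(2)[of _ n]] unfolding dd_def A_def Li_def Fi_def by (simp only: Ball_def atMost_iff)
  define w where "w m = \<kappa> m + (1/2) ^ m" for m
  have w: "summable w" unfolding w_def by (intro summable_add \<kappa> summable_geometric) simp
  have w0: "w m \<ge> 0" for m using order_trans[OF measure_nonneg Cn(2)[of m]] unfolding w_def by (intro add_nonneg_nonneg) auto
  obtain Nul where Nul: "Nul \<in> null_sets M" "{\<omega> \<in> space M. \<not> (\<forall>k\<ge>1. Fi k \<omega> \<noteq> 0)} \<subseteq> Nul"
    using nz unfolding eventually_ae_filter Fi_def by auto
  \<comment> \<open>Decompose \<open>k\<close> into dyadic intervals from \<open>m\<^sub>0\<close> on.\<close>
  have main: "prob (bad n) \<le> (\<Sum>k\<in>{1..<2 ^ m0}. prob (fx n k)) + prob (rg n) + (\<Sum>i. w (i + m0))" if m0: "m0 \<ge> m1" for n m0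
  proof -
    let ?D = "\<Union>m\<in>{m0..N n}. Cn m \<union> (\<Union>k\<in>{2 ^ m..<2 ^ Suc m}. dd n m k)"
    have Dm: "Cn m \<union> (\<Union>k\<in>{2 ^ m..<2 ^ Suc m}. dd n m k) \<in> events" for m using Cn ddm by auto
    have "bad n \<subseteq> ((\<Union>k\<in>{1..<2 ^ m0}. fx n k) \<union> rg n) \<union> (?D \<union> Nul)"
    proof
      fix \<omega> assume "\<omega> \<in> bad n"
      then obtain k where k: "\<omega> \<in> space M" "k \<in> {1..N n}" "A k \<omega> \<noteq> 0" "\<bar>A k \<omega>\<bar> \<le> \<rho> n \<bar>Li k \<omega>\<bar>" by (auto simp: bad_def)
      show "\<omega> \<in> ((\<Union>k\<in>{1..<2 ^ m0}. fx n k) \<union> rg n) \<union> (?D \<union> Nul)"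
      proof (cases "k < 2 ^ m0 \<or> \<omega> \<in> rg n \<or> \<omega> \<in> Nul")
        case True then show ?thesis using k by (auto simp: fx_def)
      next
        case False
        obtain m where m: "2 ^ m \<le> k" "k < 2 ^ (m + 1)" using ex_power_ivl1[of 2 k] k by auto
        have "m0 \<le> m"
        proof (rule ccontr)
          assume "\<not> m0 \<le> m"
          then have "(2::nat) ^ (m + 1) \<le> 2 ^ m0" by (intro power_increasing) auto
          with m False show False by simp
        qed
        moreover have "m \<le> N n"
        proof -
          have "m < 2 ^ m" by (rule less_exp)
          also note m(1)
          also have "k \<le> N n" using k(2) by simp
          finally show ?thesis by simp
        qed
        moreover have "\<omega> \<in> Cn m \<union> dd n m k"
          using k False Nul(2) by (force simp: dd_def rg_def not_less)
        ultimately show ?thesis using m by auto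
      qed
    qed
    then have "prob (bad n) \<le> prob (((\<Union>k\<in>{1..<2 ^ m0}. fx n k) \<union> rg n) \<union> (?D \<union> Nul))"
      by (rule finite_measure_mono) (use fxm rgm Dm Nul in auto)
    also have "\<dots> \<le> prob ((\<Union>k\<in>{1..<2 ^ m0}. fx n k) \<union> rg n) + prob (?D \<union> Nul)"
      by (rule measure_Un_le) (use fxm rgm Dm Nul in auto)
    also have "prob ((\<Union>k\<in>{1..<2 ^ m0}. fx n k) \<union> rg n) \<le> prob (\<Union>k\<in>{1..<2 ^ m0}. fx n k) + prob (rg n)"
      by (rule measure_Un_le) (use fxm rgm in auto)
    also have "prob (\<Union>k\<in>{1..<2 ^ m0}. fx n k) \<le> (\<Sum>k\<in>{1..<2 ^ m0}. prob (fx n k))"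
      by (rule measure_UNION_le) (use fxm in auto)
    also have "prob (?D \<union> Nul) = prob ?D" by (rule measure_Un_null_set) (use Dm Nul in auto)
    also have "prob ?D \<le> (\<Sum>m\<in>{m0..N n}. prob (Cn m \<union> (\<Union>k\<in>{2 ^ m..<2 ^ Suc m}. dd n m k)))"
      by (rule measure_UNION_le) (use Dm in auto)
    also have "\<dots> \<le> (\<Sum>m\<in>{m0..N n}. w m)"
    proof (rule sum_mono)
      fix m assume m: "m \<in> {m0..N n}"
      have "prob (Cn m \<union> (\<Union>k\<in>{2 ^ m..<2 ^ Suc m}. dd n m k)) \<le> prob (Cn m) + prob (\<Union>k\<in>{2 ^ m..<2 ^ Suc m}. dd n m k)"
        by (rule measure_Un_le) (use Cn ddm in auto)
      also have "prob (\<Union>k\<in>{2 ^ m..<2 ^ Suc m}. dd n m k) \<le> (\<Sum>k\<in>{2 ^ m..<2 ^ Suc m}. prob (dd n m k))"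
        by (rule measure_UNION_le) (use ddm in auto)
      also have "\<dots> \<le> (\<Sum>k\<in>{2 ^ m..<2 ^ Suc m :: nat}. (1/4) ^ m)"
        by (rule sum_mono, rule ddp) (use m m0 in auto)
      also have "\<dots> = (1/2) ^ m"
      proof -
        have "(2::real) ^ m * (1/4) ^ m = (1/2) ^ m" unfolding power_mult_distrib[symmetric] by simp
        then show ?thesis by simp
      qed
      finally show "prob (Cn m \<union> (\<Union>k\<in>{2 ^ m..<2 ^ Suc m}. dd n m k)) \<le> w m" using Cn(2)[of m] by (simp add: w_def)
    qed
    also have "\<dots> \<le> (\<Sum>i. w (i + m0))"
    proof -
      have "(\<Sum>m\<in>{m0..N n}. w m) = (\<Sum>i\<in>(\<lambda>m. m - m0) ` {m0..N n}. w (i + m0))"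
        by (subst sum.reindex) (auto simp: inj_on_def)
      also have "\<dots> \<le> (\<Sum>i. w (i + m0))"
        by (rule sum_le_suminf) (use w w0 in \<open>auto simp: summable_iff_shift\<close>)
      finally show ?thesis .
    qed
    finally show ?thesis by linarith
  qed
  have "(\<lambda>n. prob (bad n)) \<longlonglongrightarrow> 0"
  proof (rule metric_LIMSEQ_I)
    fix r :: real assume r: "r > 0"
    obtain m' where m': "\<And>n. n \<ge> m' \<Longrightarrow> norm (\<Sum>i. w (i + n)) < r/2" using suminf_exist_split[OF _ w, of "r/2"] r by auto
    define m0 where "m0 = max m1 m'"
    have tail: "(\<Sum>i. w (i + m0)) < r/2" using m'[of m0] by (simp add: m0_def)
    have "(\<lambda>n. (\<Sum>k\<in>{1..<2 ^ m0}. prob (fx n k)) + prob (rg n)) \<longlonglongrightarrow> (\<Sum>k\<in>{1..<2 ^ m0::nat}. 0) + 0"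
      by (intro tendsto_add tendsto_sum) (use fixed reg in \<open>auto simp: fx_def rg_def A_def Li_def\<close>)
    then have "\<forall>\<^sub>F n in sequentially. (\<Sum>k\<in>{1..<2 ^ m0}. prob (fx n k)) + prob (rg n) < r/2"
      using r by (intro order_tendstoD(2)) auto
    then have "\<forall>\<^sub>F n in sequentially. prob (bad n) < r"
    proof eventually_elim
      case (elim n)
      have "m0 \<ge> m1" by (simp add: m0_def)
      from main[OF this, of n] elim tail show ?case by linarith
    qed
    then show "\<exists>no. \<forall>n\<ge>no. dist (prob (bad n)) 0 < r" by (simp add: eventually_sequentially)
  qed
  then show ?thesis by (simp add: bad_def A_def Li_def)
qed

section \<open>Perpetuities with a heavy-tailed logarithm\<close>

lemma log_minus_nonneg: "log_minus x \<ge> 0"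
  by (simp add: log_minus_def)

lemma neg_ln_le_log_minus: "- ln x \<le> log_minus x"
  by (simp add: log_minus_def)

lemma borel_measurable_log_minus [measurable]: "log_minus \<in> borel_measurable borel"
  unfolding log_minus_def[abs_def] by measurable

text \<open>\<open>X0\<close> and the pairs \<open>(Mk k, Qk k)\<close> form one independent sequence, with the initial value as the first
  component at index \<open>0\<close>. \<open>M_light\<close> is the common consequence of the two alternatives for \<open>log\<^sup>- \<bar>M\<bar>\<close>.\<close>

locale heavy_perpetuity = prob_space P + regular_tail F l \<alpha> b
  for P :: "'w measure" and F l :: "real \<Rightarrow> real" and \<alpha> :: real and b :: "nat \<Rightarrow> real" +
  fixes Mk Qk :: "nat \<Rightarrow> 'w \<Rightarrow> real" and X0 :: "'w \<Rightarrow> real"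
  assumes indepZ: "indep_vars (\<lambda>_. borel) (\<lambda>k \<omega>. if k = 0 then (X0 \<omega>, 0) else (Mk k \<omega>, Qk k \<omega>)) UNIV"
    and identZ: "\<And>k. k \<ge> 1 \<Longrightarrow> distr P borel (\<lambda>\<omega>. (Mk k \<omega>, Qk k \<omega>)) = distr P borel (\<lambda>\<omega>. (Mk 1 \<omega>, Qk 1 \<omega>))"
    and F_tail: "\<And>k x. k \<ge> 1 \<Longrightarrow> prob {\<omega> \<in> space P. ln \<bar>Qk k \<omega>\<bar> > x} = F x"
    and M_nz: "AE \<omega> in P. \<forall>k\<ge>1. Mk k \<omega> \<noteq> 0"
    and Pi0: "AE \<omega> in P. (\<lambda>n. partial_prod (\<lambda>k. Mk k \<omega>) n) \<longlonglongrightarrow> 0"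
    and b_pos: "\<And>n. n \<ge> 1 \<Longrightarrow> b n > 0"
    and M_light: "(\<lambda>n. real n * expectation (\<lambda>\<omega>. min (log_minus \<bar>Mk 1 \<omega>\<bar>) (b n)) / b n) \<longlonglongrightarrow> 0"
begin

definition Z :: "nat \<Rightarrow> 'w \<Rightarrow> real \<times> real" where
  "Z k \<omega> = (if k = 0 then (X0 \<omega>, 0) else (Mk k \<omega>, Qk k \<omega>))"

lemma Z_indep: "indep_vars (\<lambda>_. borel) Z UNIV"
  using indepZ unfolding Z_def[abs_def] .

lemma Z_rv: "random_variable borel (Z k)"
  using Z_indep by (auto simp: indep_vars_def)

lemma Z_ident: "k \<ge> 1 \<Longrightarrow> distr P borel (Z k) = distr P borel (Z 1)"
  using identZ[of k] by (simp add: Z_def[abs_def])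

lemma Mk_rv [measurable]: "k \<ge> 1 \<Longrightarrow> random_variable borel (Mk k)"
  using measurable_compose[OF Z_rv[of k] borel_measurable_fst_real] by (simp add: Z_def)

lemma Qk_rv [measurable]: "k \<ge> 1 \<Longrightarrow> random_variable borel (Qk k)"
  using measurable_compose[OF Z_rv[of k] borel_measurable_snd_real] by (simp add: Z_def)

lemma X0_rv [measurable]: "random_variable borel X0"
  using measurable_compose[OF Z_rv[of 0] borel_measurable_fst_real] by (simp add: Z_def)

abbreviation "Pi' \<omega> n \<equiv> partial_prod (\<lambda>k. Mk k \<omega>) n"
abbreviation "Y \<omega> n \<equiv> perpetuity (\<lambda>k. Mk k \<omega>) (\<lambda>k. Qk k \<omega>) n"
abbreviation "X \<omega> n \<equiv> affine_rec (\<lambda>k. Mk k \<omega>) (\<lambda>k. Qk k \<omega>) (X0 \<omega>) n"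

lemma Pi_rv [measurable]: "random_variable borel (\<lambda>\<omega>. Pi' \<omega> n)"
  by (rule borel_measurable_partial_prod) (auto intro: Mk_rv)

lemma Y_rv [measurable]: "random_variable borel (\<lambda>\<omega>. Y \<omega> n)"
  by (rule borel_measurable_perpetuity) (auto intro: Mk_rv Qk_rv)

lemma X_rv [measurable]: "random_variable borel (\<lambda>\<omega>. X \<omega> n)"
proof (induction n)
  case (Suc n)
  have "random_variable borel (Mk (Suc n))" "random_variable borel (Qk (Suc n))" by (auto intro: Mk_rv Qk_rv)
  with Suc show ?case by simp
qed simp

lemma b_pos_eventually: "\<forall>\<^sub>F n in sequentially. b n > 0 \<and> n \<ge> 1"
  using eventually_ge_at_top[of 1] by eventually_elim (auto intro: b_pos)

lemma exp_b_at_top: "c > 0 \<Longrightarrow> filterlim (\<lambda>n. exp (c * b n)) at_top sequentially"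
  by (intro filterlim_compose[OF exp_at_top] filterlim_tendsto_pos_mult_at_top[OF tendsto_const _ b_at_top])

lemma exp_b_0: "c > 0 \<Longrightarrow> (\<lambda>n. exp (- c * b n)) \<longlonglongrightarrow> 0"
  using tendsto_inverse_0_at_top[OF exp_b_at_top[of c]] by (simp add: exp_minus)

text \<open>The total downward movement of the walk \<open>ln \<bar>Pi'\<bar>\<close> up to time \<open>n\<close>.\<close>

definition neg_part :: "'w \<Rightarrow> nat \<Rightarrow> real" where
  "neg_part \<omega> n = (\<Sum>i=1..n. log_minus \<bar>Mk i \<omega>\<bar>)"

lemma neg_part_rv [measurable]: "random_variable borel (\<lambda>\<omega>. neg_part \<omega> n)"
  unfolding neg_part_def by (intro borel_measurable_sum) (auto intro!: measurable_compose[OF _ borel_measurable_log_minus] borel_measurable_abs Mk_rv)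

lemma neg_part_mono: "m \<le> n \<Longrightarrow> neg_part \<omega> m \<le> neg_part \<omega> n"
  unfolding neg_part_def by (intro sum_mono2) (auto simp: log_minus_nonneg)

text \<open>Truncate the summands at \<open>b n\<close>; this does not affect the event, as a single truncated summand already
  reaches the level. Then apply Markov's inequality.\<close>

lemma neg_part_small:
  assumes \<delta>: "\<delta> > 0"
  shows "(\<lambda>n. prob {\<omega> \<in> space P. neg_part \<omega> (n * K + 1) > \<delta> * b n}) \<longlonglongrightarrow> 0"
proof -
  \<comment> \<open>With \<open>\<delta>' \<le> 1\<close> a summand that is truncated at \<open>b n\<close> is at least \<open>\<delta>' b n\<close>.\<close>
  define \<delta>' where "\<delta>' = min \<delta> 1"
  have \<delta>': "\<delta>' > 0" "\<delta>' \<le> \<delta>" "\<delta>' \<le> 1" using \<delta> by (auto simp: \<delta>'_def)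
  define e where "e n = expectation (\<lambda>\<omega>. min (log_minus \<bar>Mk 1 \<omega>\<bar>) (b n))" for n
  have gm: "random_variable borel (\<lambda>\<omega>. min (log_minus \<bar>Mk i \<omega>\<bar>) c)" if "i \<ge> 1" for i c
    using Mk_rv[OF that] by measurable
  have ei: "expectation (\<lambda>\<omega>. min (log_minus \<bar>Mk i \<omega>\<bar>) (b n)) = e n" if i: "i \<ge> 1" for i n
  proof -
    have m: "(\<lambda>z :: real \<times> real. min (log_minus \<bar>fst z\<bar>) (b n)) \<in> borel_measurable borel"
      using borel_measurable_fst_real by measurable
    have "expectation (\<lambda>\<omega>. min (log_minus \<bar>Mk i \<omega>\<bar>) (b n)) = (\<integral>z. min (log_minus \<bar>fst z\<bar>) (b n) \<partial>distr P borel (Z i))" if "i \<ge> 1" for i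
      using that by (subst integral_distr[OF Z_rv m]) (simp add: Z_def)
    from this[OF i] this[of 1] show ?thesis unfolding e_def Z_ident[OF i] by simp
  qed
  have bound: "prob {\<omega> \<in> space P. neg_part \<omega> (n * K + 1) > \<delta> * b n} \<le> (real K + 1) / \<delta>' * (real n * e n / b n)"
    if n: "n \<ge> 1" for n
  proof -
    have bn: "b n > 0" by (rule b_pos[OF n])
    let ?T = "\<lambda>\<omega>. \<Sum>i=1..n * K + 1. min (log_minus \<bar>Mk i \<omega>\<bar>) (b n)"
    have nb: "norm (min (log_minus y) (b n)) \<le> b n" for y
      using log_minus_nonneg[of y] bn by (auto simp: min_def)
    have int: "integrable P (\<lambda>\<omega>. min (log_minus \<bar>Mk i \<omega>\<bar>) (b n))" if "i \<ge> 1" for i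
      by (rule integrable_const_bound[of _ "b n"], rule AE_I2, rule nb, rule gm[OF that])
    have e0: "e n \<ge> 0" unfolding e_def by (rule Bochner_Integration.integral_nonneg) (use bn log_minus_nonneg in auto)
    have Tm: "random_variable borel ?T" by (intro borel_measurable_sum gm) auto
    have "prob {\<omega> \<in> space P. neg_part \<omega> (n * K + 1) > \<delta> * b n} \<le> prob {\<omega> \<in> space P. ?T \<omega> \<ge> \<delta>' * b n}"
    proof (rule finite_measure_mono)
      show "{\<omega> \<in> space P. ?T \<omega> \<ge> \<delta>' * b n} \<in> events" using Tm by measurable
      show "{\<omega> \<in> space P. neg_part \<omega> (n * K + 1) > \<delta> * b n} \<subseteq> {\<omega> \<in> space P. ?T \<omega> \<ge> \<delta>' * b n}"
      proof safe
        fix \<omega> assume h: "neg_part \<omega> (n * K + 1) > \<delta> * b n"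
        show "?T \<omega> \<ge> \<delta>' * b n"
        proof (cases "\<exists>i\<in>{1..n * K + 1}. log_minus \<bar>Mk i \<omega>\<bar> > b n")
          case True
          then obtain i where i: "i \<in> {1..n * K + 1}" "log_minus \<bar>Mk i \<omega>\<bar> > b n" by blast
          have "min (log_minus \<bar>Mk i \<omega>\<bar>) (b n) \<le> ?T \<omega>"
            by (rule member_le_sum[OF i(1)]) (use bn log_minus_nonneg in auto)
          moreover have "min (log_minus \<bar>Mk i \<omega>\<bar>) (b n) = b n" using i by simp
          moreover have "\<delta>' * b n \<le> 1 * b n" using \<delta>' bn by (intro mult_right_mono) auto
          ultimately show ?thesis by linarith
        next
          case False
          then have "?T \<omega> = neg_part \<omega> (n * K + 1)" unfolding neg_part_def
            by (intro sum.cong) (auto simp: not_less min_def)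
          moreover have "\<delta>' * b n \<le> \<delta> * b n" using \<delta>' bn by (intro mult_right_mono) auto
          ultimately show ?thesis using h by linarith
        qed
      qed
    qed
    also have "\<dots> \<le> expectation ?T / (\<delta>' * b n)"
    proof (rule integral_Markov_inequality_measure[where A = "space P"])
      show "integrable P ?T" by (rule Bochner_Integration.integrable_sum) (use int in auto)
      show "AE \<omega> in P. 0 \<le> ?T \<omega>"
        by (rule AE_I2, rule sum_nonneg) (use bn log_minus_nonneg in auto)
      show "0 < \<delta>' * b n" using bn \<delta>' by simp
    qed auto
    also have "expectation ?T = (\<Sum>i=1..n * K + 1. e n)"
      by (subst Bochner_Integration.integral_sum) (use int ei in \<open>auto intro!: sum.cong\<close>)
    also have "\<dots> = (real n * real K + 1) * e n" by simp
    also have "(real n * real K + 1) * e n / (\<delta>' * b n) \<le> (real n * (real K + 1)) * e n / (\<delta>' * b n)"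
      using n e0 bn \<delta>' by (intro divide_right_mono mult_right_mono) (auto simp: algebra_simps)
    also have "\<dots> = (real K + 1) / \<delta>' * (real n * e n / b n)" by simp
    finally show ?thesis .
  qed
  show ?thesis
  proof (rule tendsto_sandwich[where f = "\<lambda>_. 0"])
    have "(\<lambda>n. (real K + 1) / \<delta>' * (real n * e n / b n)) \<longlonglongrightarrow> (real K + 1) / \<delta>' * 0"
      using M_light unfolding e_def by (intro tendsto_mult tendsto_const)
    then show "(\<lambda>n. (real K + 1) / \<delta>' * (real n * e n / b n)) \<longlonglongrightarrow> 0" by simp
    show "\<forall>\<^sub>F n in sequentially. prob {\<omega> \<in> space P. neg_part \<omega> (n * K + 1) > \<delta> * b n} \<le> (real K + 1) / \<delta>' * (real n * e n / b n)"
      using eventually_ge_at_top[of 1] by eventually_elim (rule bound)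
  qed auto
qed

text \<open>Every decrease of the walk is bounded by the total downward movement.\<close>

lemma ln_Pi_diff_ge:
  assumes nz: "\<forall>k\<ge>1. Mk k \<omega> \<noteq> 0" and sk: "s \<le> k"
  shows "ln \<bar>Pi' \<omega> k\<bar> - ln \<bar>Pi' \<omega> s\<bar> \<ge> - neg_part \<omega> k"
proof -
  have S: "ln \<bar>Pi' \<omega> n\<bar> = (\<Sum>i=1..n. ln \<bar>Mk i \<omega>\<bar>)" for n by (rule ln_abs_lin(1)) (use nz in auto)
  have "(\<Sum>i=1..k. ln \<bar>Mk i \<omega>\<bar>) = (\<Sum>i=1..s. ln \<bar>Mk i \<omega>\<bar>) + (\<Sum>i=s+1..k. ln \<bar>Mk i \<omega>\<bar>)"
    using sum.ub_add_nat[of 1 s "\<lambda>i. ln \<bar>Mk i \<omega>\<bar>" "k - s"] sk by simp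
  moreover have "- (\<Sum>i=s+1..k. ln \<bar>Mk i \<omega>\<bar>) \<le> (\<Sum>i=s+1..k. log_minus \<bar>Mk i \<omega>\<bar>)"
    unfolding sum_negf[symmetric] by (rule sum_mono) (rule neg_ln_le_log_minus)
  moreover have "(\<Sum>i=s+1..k. log_minus \<bar>Mk i \<omega>\<bar>) \<le> neg_part \<omega> k"
    unfolding neg_part_def by (rule sum_mono2) (auto simp: log_minus_nonneg)
  ultimately show ?thesis unfolding S by linarith
qed

lemma Pi_nz: "\<forall>k\<ge>1. Mk k \<omega> \<noteq> 0 \<Longrightarrow> Pi' \<omega> n \<noteq> 0"
  by (rule ln_abs_lin(2)) auto

lemma sup_Pi_small:
  assumes \<delta>: "\<delta> > 0"
  shows "(\<lambda>n. prob {\<omega> \<in> space P. \<exists>k. \<bar>Pi' \<omega> k\<bar> > exp (\<delta> * b n)}) \<longlonglongrightarrow> 0"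
proof (rule prob_tendsto_0)
  show "AE \<omega> in P. \<forall>\<^sub>F n in sequentially. \<omega> \<notin> {\<omega> \<in> space P. \<exists>k. \<bar>Pi' \<omega> k\<bar> > exp (\<delta> * b n)}"
    using Pi0
  proof eventually_elim
    case (elim \<omega>)
    then have "Bseq (\<lambda>n. Pi' \<omega> n)" by (intro convergent_imp_Bseq convergentI)
    then obtain B where B: "\<And>n. \<bar>Pi' \<omega> n\<bar> \<le> B" by (auto simp: Bseq_def)
    have "\<forall>\<^sub>F n in sequentially. exp (\<delta> * b n) \<ge> B"
      using exp_b_at_top[OF \<delta>] by (simp add: filterlim_at_top)
    then show ?case by eventually_elim (use B in \<open>auto simp: not_less intro: order_trans\<close>)
  qed
qed measurable

lemma visits_bound:
  obtains C where "\<And>N. (\<Sum>n<N. prob {\<omega> \<in> space P. \<bar>\<Sum>k=1..n. ln \<bar>fst (Z k \<omega>)\<bar>\<bar> \<le> c}) \<le> C"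
proof -
  have lnm: "(\<lambda>x :: real \<times> real. ln \<bar>fst x\<bar>) \<in> borel_measurable borel"
    by (intro borel_measurable_ln borel_measurable_abs borel_measurable_fst_real)
  have indepU: "indep_vars (\<lambda>_. borel) (\<lambda>k \<omega>. ln \<bar>fst (Z k \<omega>)\<bar>) {1..}"
    by (rule indep_vars_compose2[OF indep_vars_subset[OF Z_indep]]) (use lnm in auto)
  have identU: "distr P borel (\<lambda>\<omega>. ln \<bar>fst (Z k \<omega>)\<bar>) = distr P borel (\<lambda>\<omega>. ln \<bar>fst (Z 1 \<omega>)\<bar>)" if "k \<ge> 1" for k
  proof -
    have "distr P borel (\<lambda>\<omega>. ln \<bar>fst (Z k \<omega>)\<bar>) = distr (distr P borel (Z k)) borel (\<lambda>x. ln \<bar>fst x\<bar>)" for k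
      by (subst distr_distr[OF lnm Z_rv]) (simp add: comp_def)
    then show ?thesis using Z_ident[OF that] by metis
  qed
  have "AE \<omega> in P. filterlim (\<lambda>n. \<Sum>k=1..n. ln \<bar>fst (Z k \<omega>)\<bar>) at_bot sequentially"
    using M_nz Pi0
  proof eventually_elim
    case (elim \<omega>)
    have S: "(\<Sum>k=1..n. ln \<bar>fst (Z k \<omega>)\<bar>) = ln \<bar>Pi' \<omega> n\<bar>" for n
      using ln_abs_lin(1)[of n "\<lambda>k. Mk k \<omega>"] elim(1) by (auto simp: Z_def intro!: sum.cong)
    have "filterlim (\<lambda>n. \<bar>Pi' \<omega> n\<bar>) (at_right 0) sequentially"
      using tendsto_rabs_zero[OF elim(2)] Pi_nz[OF elim(1)]
      by (intro tendsto_imp_filterlim_at_right) (auto intro!: always_eventually)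
    then show ?case unfolding S by (rule filterlim_compose[OF ln_at_0])
  qed
  from transient_walk_visits[OF indepU _ this] identU that show thesis by blast
qed

text \<open>The probability that the record exceeds \<open>b n\<close> is \<open>1 - (1 - F (b n))^n\<close>.\<close>

lemma big_jump_prob:
  "(\<lambda>n. prob {\<omega> \<in> space P. \<exists>j\<in>{1..n}. ln \<bar>Qk j \<omega>\<bar> > b n}) \<longlonglongrightarrow> 1 - exp (- 1)"
proof -
  have eq: "prob {\<omega> \<in> space P. \<exists>j\<in>{1..n}. ln \<bar>Qk j \<omega>\<bar> > b n} = 1 - (1 - F (b n)) ^ n" if n: "n \<ge> 1" for n
  proof -
    define A where "A = {z :: real \<times> real. \<not> ln \<bar>snd z\<bar> > b n}"
    have A: "A \<in> sets borel"
    proof -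
      have "{z \<in> space borel. \<not> ln \<bar>snd z\<bar> > b n} \<in> sets (borel :: (real \<times> real) measure)"
        using borel_measurable_snd_real by measurable
      then show ?thesis by (simp add: A_def)
    qed
    have "prob (\<Inter>j\<in>{1..n}. Z j -` A \<inter> space P) = (\<Prod>j\<in>{1..n}. prob (Z j -` A \<inter> space P))"
      by (rule indep_varsD[OF Z_indep]) (use n A in auto)
    moreover have "prob (Z j -` A \<inter> space P) = 1 - F (b n)" if j: "j \<in> {1..n}" for j
    proof -
      have ev: "{\<omega> \<in> space P. ln \<bar>Qk j \<omega>\<bar> > b n} \<in> events"
      proof -
        have q: "random_variable borel (Qk j)" using j by (intro Qk_rv) auto
        show ?thesis using q by measurable
      qed
      have "Z j -` A \<inter> space P = space P - {\<omega> \<in> space P. ln \<bar>Qk j \<omega>\<bar> > b n}"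
        using j by (auto simp: A_def Z_def)
      then show ?thesis using F_tail[of j "b n"] j prob_compl[OF ev] by simp
    qed
    moreover have "(\<Inter>j\<in>{1..n}. Z j -` A \<inter> space P) = space P - {\<omega> \<in> space P. \<exists>j\<in>{1..n}. ln \<bar>Qk j \<omega>\<bar> > b n}"
      using n by (auto simp: A_def Z_def)
    ultimately have "prob (space P - {\<omega> \<in> space P. \<exists>j\<in>{1..n}. ln \<bar>Qk j \<omega>\<bar> > b n}) = (1 - F (b n)) ^ n" by simp
    moreover have "{\<omega> \<in> space P. \<exists>j\<in>{1..n}. ln \<bar>Qk j \<omega>\<bar> > b n} \<in> events"
    proof -
      have "{\<omega> \<in> space P. \<exists>j\<in>{1..n}. ln \<bar>Qk j \<omega>\<bar> > b n} = (\<Union>j\<in>{1..n}. {\<omega> \<in> space P. ln \<bar>Qk j \<omega>\<bar> > b n})" by auto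
      also have "\<dots> \<in> events" by (intro sets.finite_UN) (auto intro!: borel_measurable_less Qk_rv borel_measurable_ln borel_measurable_abs)
      finally show ?thesis .
    qed
    ultimately show ?thesis using prob_compl by fastforce
  qed
  have "(\<lambda>n. 1 - (1 - F (b n)) ^ n) \<longlonglongrightarrow> 1 - exp (- 1)"
    by (intro tendsto_diff tendsto_const power_one_minus_tendsto_exp nonneg tail_b_0 b_lim)
  moreover have "\<forall>\<^sub>F n in sequentially. 1 - (1 - F (b n)) ^ n = prob {\<omega> \<in> space P. \<exists>j\<in>{1..n}. ln \<bar>Qk j \<omega>\<bar> > b n}"
    using eventually_ge_at_top[of 1] by eventually_elim (rule eq[symmetric])
  ultimately show ?thesis by (rule Lim_transform_eventually)
qed

end

section \<open>The two sequences do not dip\<close>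

lemma (in prob_space) nonzero_in_window:
  fixes D :: "'a \<Rightarrow> real"
  assumes D: "random_variable borel D" and nz: "\<not> (AE \<omega> in M. D \<omega> = 0)"
  obtains d d' where "0 < d" "d \<le> d'" "prob {\<omega> \<in> space M. \<bar>D \<omega>\<bar> \<in> {d..d'}} > 0"
proof -
  define W where "W k = {\<omega> \<in> space M. \<bar>D \<omega>\<bar> \<in> {1 / real (Suc k)..real (Suc k)}}" for k
  have W: "W k \<in> events" for k unfolding W_def using D by measurable
  have "\<exists>k. prob (W k) > 0"
  proof (rule ccontr)
    assume "\<not> (\<exists>k. prob (W k) > 0)"
    then have "prob (W k) = 0" for k using measure_nonneg[of M "W k"] by (metis less_eq_real_def)
    then have "AE \<omega> in M. \<omega> \<notin> W k" for k using W by (subst (asm) prob_eq_0) auto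
    then have "AE \<omega> in M. \<forall>k. \<omega> \<notin> W k" by (subst AE_all_countable) auto
    then have "AE \<omega> in M. D \<omega> = 0" using AE_space
    proof eventually_elim
      case (elim \<omega>)
      show ?case
      proof (rule ccontr)
        assume "D \<omega> \<noteq> 0"
        obtain k1 where k1: "1 / real (Suc k1) < \<bar>D \<omega>\<bar>" using nat_approx_posE[of "\<bar>D \<omega>\<bar>"] \<open>D \<omega> \<noteq> 0\<close> by auto
        obtain k2 :: nat where k2: "\<bar>D \<omega>\<bar> < real k2" using reals_Archimedean2 by blast
        define k where "k = max k1 k2"
        have "1 / real (Suc k) \<le> 1 / real (Suc k1)" by (rule divide_left_mono) (auto simp: k_def)
        then have "\<omega> \<in> W k" using k1 k2 elim(2) by (auto simp: W_def k_def)
        with elim(1) show False by blast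
      qed
    qed
    with nz show False by contradiction
  qed
  then obtain k where "prob (W k) > 0" by blast
  moreover have "1 / real (Suc k) \<le> real (Suc k)"
  proof -
    have "1 \<le> real (Suc k) * real (Suc k)" by (metis of_nat_1 of_nat_le_iff of_nat_mult le_add1 mult_le_mono nat_mult_1 plus_1_eq_Suc)
    then show ?thesis by (simp add: divide_le_eq)
  qed
  ultimately show thesis using that[of "1 / real (Suc k)" "real (Suc k)"] by (simp add: W_def)
qed

context heavy_perpetuity
begin

lemma swap_gap_rv: "random_variable borel (\<lambda>\<omega>. swap_gap (Z i \<omega>) (Z j \<omega>))"
proof -
  have [measurable]: "random_variable borel (\<lambda>\<omega>. fst (Z i \<omega>))" "random_variable borel (\<lambda>\<omega>. snd (Z i \<omega>))" for i
    by (rule measurable_compose[OF Z_rv borel_measurable_fst_real] measurable_compose[OF Z_rv borel_measurable_snd_real])+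
  show ?thesis unfolding swap_gap_def by measurable
qed

text \<open>If all swap gaps vanish, then \<open>Q\<^sub>j = c (1 - M\<^sub>j)\<close> for all \<open>j\<close> with one number \<open>c\<close>, because some \<open>M\<^sub>i\<close> differs
  from \<open>1\<close>. A value \<open>ln \<bar>Q\<^sub>j\<bar> > b n\<close> with \<open>j \<le> n\<close>, which has asymptotic probability \<open>1 - 1/e\<close>, then forces
  \<open>ln \<bar>M\<^sub>j\<bar> > b n / 2\<close>; as the downward movement is at most \<open>b n / 4\<close> with high probability, \<open>\<bar>\<Pi>\<^sub>n\<bar> > 1\<close>. This contradicts
  \<open>\<Pi>\<^sub>n \<rightarrow> 0\<close>.\<close>

lemma swap_gap_not_zero: "\<not> (AE \<omega> in P. swap_gap (Z 1 \<omega>) (Z 2 \<omega>) = 0)"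
proof
  assume ae: "AE \<omega> in P. swap_gap (Z 1 \<omega>) (Z 2 \<omega>) = 0"
  have all: "AE \<omega> in P. \<forall>i\<in>{1..}. \<forall>j\<in>{1..}. i \<noteq> j \<longrightarrow> swap_gap (Z i \<omega>) (Z j \<omega>) = 0"
  proof (subst AE_ball_countable, simp, intro ballI, subst AE_ball_countable, simp, intro ballI)
    fix i j :: nat assume ij: "i \<in> {1..}" "j \<in> {1..}"
    show "AE \<omega> in P. i \<noteq> j \<longrightarrow> swap_gap (Z i \<omega>) (Z j \<omega>) = 0"
    proof (cases "i = j")
      case False
      define f where "f k = (if k = 1 then i else j)" for k :: nat
      define A where "A z \<longleftrightarrow> swap_gap (z 1) (z 2) = 0" for z :: "nat \<Rightarrow> real \<times> real"
      have [measurable]: "(\<lambda>x. fst (x i)) \<in> borel_measurable (PiM {1, 2} (\<lambda>_. borel :: (real \<times> real) measure))"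
        "(\<lambda>x. snd (x i)) \<in> borel_measurable (PiM {1, 2} (\<lambda>_. borel :: (real \<times> real) measure))"
        if "i \<in> {1, 2}" for i :: nat
        by (rule borel_measurable_fst_component[OF that] borel_measurable_snd_component[OF that])+
      have A: "Measurable.pred (PiM {1, 2} (\<lambda>_. borel)) A" unfolding A_def swap_gap_def by measurable
      have "prob {\<omega> \<in> space P. A (\<lambda>k\<in>{1,2}. Z (f k) \<omega>)} = prob {\<omega> \<in> space P. A (\<lambda>k\<in>{1,2}. Z k \<omega>)}"
      proof (rule prob_reindex_indep[OF Z_indep _ _ _ _ _ A])
        show "inj_on f {1, 2}" using False by (auto simp: f_def)
        show "distr P borel (Z (f k)) = distr P borel (Z k)" if "k \<in> {1, 2}" for k
          using Z_ident[of "f k"] Z_ident[of k] that ij by (auto simp: f_def)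
      qed auto
      then have "prob {\<omega> \<in> space P. swap_gap (Z i \<omega>) (Z j \<omega>) = 0} = prob {\<omega> \<in> space P. swap_gap (Z 1 \<omega>) (Z 2 \<omega>) = 0}"
        by (simp add: A_def f_def)
      also have "\<dots> = 1" using ae swap_gap_rv[of 1 2] by (subst prob_Collect_eq_1) auto
      finally have "AE \<omega> in P. swap_gap (Z i \<omega>) (Z j \<omega>) = 0"
        using swap_gap_rv[of i j] by (subst (asm) prob_Collect_eq_1) auto
      then show ?thesis by eventually_elim simp
    qed simp
  qed
  define A where "A n = {\<omega> \<in> space P. \<exists>j\<in>{1..n}. ln \<bar>Qk j \<omega>\<bar> > b n}" for n
  define B where "B n = {\<omega> \<in> space P. neg_part \<omega> (n * 1 + 1) > 1/4 * b n}" for n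
  have Am: "A n \<in> events" for n
  proof -
    have "A n = (\<Union>j\<in>{1..n}. {\<omega> \<in> space P. ln \<bar>Qk j \<omega>\<bar> > b n})" by (auto simp: A_def)
    also have "\<dots> \<in> events" by (intro sets.finite_UN) (auto intro!: borel_measurable_less Qk_rv borel_measurable_ln borel_measurable_abs)
    finally show ?thesis .
  qed
  have Bm: "B n \<in> events" for n unfolding B_def by measurable
  have "(\<lambda>n. prob (A n - B n)) \<longlonglongrightarrow> 0"
  proof (rule prob_tendsto_0)
    show "A n - B n \<in> events" for n using Am Bm by auto
    show "AE \<omega> in P. \<forall>\<^sub>F n in sequentially. \<omega> \<notin> A n - B n"
      using all M_nz Pi0
    proof eventually_elim
      case (elim \<omega>)
      have gap: "Qk i \<omega> * (1 - Mk j \<omega>) = Qk j \<omega> * (1 - Mk i \<omega>)" if "i \<ge> 1" "j \<ge> 1" for i j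
        using elim(1) that by (cases "i = j") (auto simp: swap_gap_def Z_def)
      \<comment> \<open>Otherwise all products are \<open>1\<close>.\<close>
      have "\<exists>i\<ge>1. Mk i \<omega> \<noteq> 1"
      proof (rule ccontr)
        assume "\<not> (\<exists>i\<ge>1. Mk i \<omega> \<noteq> 1)"
        then have "Pi' \<omega> n = 1" for n by (auto simp: partial_prod_def intro!: prod.neutral)
        with elim(3) show False by (simp add: LIMSEQ_const_iff)
      qed
      then obtain i where i: "i \<ge> 1" "Mk i \<omega> \<noteq> 1" by blast
      define c where "c = max 1 \<bar>Qk i \<omega> / (1 - Mk i \<omega>)\<bar>"
      have Q: "\<bar>Qk j \<omega>\<bar> \<le> c * (1 + \<bar>Mk j \<omega>\<bar>)" if "j \<ge> 1" for j
      proof -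
        have "Qk j \<omega> = Qk i \<omega> / (1 - Mk i \<omega>) * (1 - Mk j \<omega>)" using gap[OF i(1) that] i(2) by (simp add: field_simps)
        then have "\<bar>Qk j \<omega>\<bar> = \<bar>Qk i \<omega> / (1 - Mk i \<omega>)\<bar> * \<bar>1 - Mk j \<omega>\<bar>" by (simp only: abs_mult)
        also have "\<dots> \<le> c * (1 + \<bar>Mk j \<omega>\<bar>)" by (intro mult_mono) (auto simp: c_def)
        finally show ?thesis .
      qed
      have c1: "c \<ge> 1" by (simp add: c_def)
      have e1: "\<forall>\<^sub>F n in sequentially. exp (1/2 * b n) \<ge> 2 * c"
        using exp_b_at_top[of "1/2"] by (simp add: filterlim_at_top)
      have e2: "\<forall>\<^sub>F n in sequentially. \<bar>Pi' \<omega> n\<bar> < 1"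
        using tendsto_rabs_zero[OF elim(3)] by (rule order_tendstoD) simp
      from e1 e2 b_pos_eventually show ?case
      proof eventually_elim
        case (elim n)
        note E = elim
        show ?case
        proof
          assume "\<omega> \<in> A n - B n"
          then obtain j where j: "j \<in> {1..n}" "ln \<bar>Qk j \<omega>\<bar> > b n" and neg: "neg_part \<omega> (n + 1) \<le> 1/4 * b n" and w: "\<omega> \<in> space P"
            by (auto simp: A_def B_def)
          have Qpos: "\<bar>Qk j \<omega>\<bar> > 0" using j E(3) by (cases "Qk j \<omega> = 0") auto
          have "exp (b n) < \<bar>Qk j \<omega>\<bar>" using j(2) Qpos by (metis exp_less_mono exp_ln)
          also have "\<dots> \<le> c * (1 + \<bar>Mk j \<omega>\<bar>)" using Q j by simp
          finally have "exp (1/2 * b n) * exp (1/2 * b n) < c * (1 + \<bar>Mk j \<omega>\<bar>)" by (simp add: exp_add[symmetric])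
          moreover have "2 * c * exp (1/2 * b n) \<le> exp (1/2 * b n) * exp (1/2 * b n)"
            using E(1) by (intro mult_right_mono) auto
          ultimately have "2 * c * exp (1/2 * b n) < c * (1 + \<bar>Mk j \<omega>\<bar>)" by (rule le_less_trans[rotated])
          then have "c * (2 * exp (1/2 * b n)) < c * (1 + \<bar>Mk j \<omega>\<bar>)" by (simp only: mult.assoc mult.left_commute[of c 2])
          then have "2 * exp (1/2 * b n) < 1 + \<bar>Mk j \<omega>\<bar>" using c1 by simp
          moreover have "exp (1/2 * b n) \<ge> 1" using E(3) by simp
          ultimately have "exp (1/2 * b n) < \<bar>Mk j \<omega>\<bar>" by linarith
          then have lnM: "ln \<bar>Mk j \<omega>\<bar> > 1/2 * b n" by (metis exp_gt_zero ln_exp ln_less_cancel_iff less_trans)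
          have S: "ln \<bar>Pi' \<omega> n\<bar> = (\<Sum>i=1..n. ln \<bar>Mk i \<omega>\<bar>)" by (rule ln_abs_lin(1)) (use \<open>\<forall>k\<ge>1. Mk k \<omega> \<noteq> 0\<close> in auto)
          have "(\<Sum>i=1..n. ln \<bar>Mk i \<omega>\<bar>) = ln \<bar>Mk j \<omega>\<bar> + (\<Sum>i\<in>{1..n} - {j}. ln \<bar>Mk i \<omega>\<bar>)"
            using j by (simp add: sum.remove)
          moreover have "- (\<Sum>i\<in>{1..n} - {j}. ln \<bar>Mk i \<omega>\<bar>) \<le> neg_part \<omega> (n + 1)"
          proof -
            have "- (\<Sum>i\<in>{1..n} - {j}. ln \<bar>Mk i \<omega>\<bar>) \<le> (\<Sum>i\<in>{1..n} - {j}. log_minus \<bar>Mk i \<omega>\<bar>)"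
              unfolding sum_negf[symmetric] by (rule sum_mono) (rule neg_ln_le_log_minus)
            also have "\<dots> \<le> neg_part \<omega> (n + 1)" unfolding neg_part_def
              by (rule sum_mono2) (auto simp: log_minus_nonneg)
            finally show ?thesis .
          qed
          ultimately have "ln \<bar>Pi' \<omega> n\<bar> > 0" using lnM neg E(3) unfolding S by linarith
          moreover have "ln \<bar>Pi' \<omega> n\<bar> < 0" using E(2) Pi_nz[OF \<open>\<forall>k\<ge>1. Mk k \<omega> \<noteq> 0\<close>, of n] by (subst ln_less_zero_iff) auto
          ultimately show False by simp
        qed
      qed
    qed
  qed
  moreover have "(\<lambda>n. prob (B n)) \<longlonglongrightarrow> 0" unfolding B_def by (rule neg_part_small) simp
  ultimately have "(\<lambda>n. prob (A n - B n) + prob (B n)) \<longlonglongrightarrow> 0 + 0" by (rule tendsto_add)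
  moreover have "prob (A n) \<le> prob (A n - B n) + prob (B n)" for n
  proof -
    have "prob (A n) \<le> prob ((A n - B n) \<union> B n)" by (rule finite_measure_mono) (use Am Bm in auto)
    also have "\<dots> \<le> prob (A n - B n) + prob (B n)" by (rule measure_Un_le) (use Am Bm in auto)
    finally show ?thesis .
  qed
  ultimately have "1 - exp (- 1) \<le> (0 + 0 :: real)"
    using big_jump_prob by (intro LIMSEQ_le[of "\<lambda>n. prob (A n)"]) (auto simp: A_def)
  then show False by simp
qed

definition no_dip_at :: "('w \<Rightarrow> nat \<Rightarrow> real) \<Rightarrow> bool" where
  "no_dip_at W \<longleftrightarrow> (\<forall>\<epsilon>>0. \<forall>K. (\<lambda>n. prob {\<omega> \<in> space P. \<exists>k\<in>{1..n * K + 1}. W \<omega> k \<noteq> 0 \<and> \<bar>W \<omega> k\<bar> \<le> exp (- \<epsilon> * b n)}) \<longlonglongrightarrow> 0)"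

text \<open>Events that need a downward movement of order \<open>b n\<close> have small probability.\<close>

lemma regularity_tendsto_0:
  assumes \<epsilon>: "\<epsilon> > 0" and d: "d > 0" and Em: "\<And>n. E n \<in> events"
    and sub: "\<And>n. AE \<omega> in P. \<omega> \<in> E n \<longrightarrow> exp (- neg_part \<omega> (n * K + 1)) * d < 4 * exp (- \<epsilon> * b n)"
  shows "(\<lambda>n. prob (E n)) \<longlonglongrightarrow> 0"
proof (rule tendsto_sandwich[where f = "\<lambda>_. 0"])
  show "(\<lambda>n. prob {\<omega> \<in> space P. neg_part \<omega> (n * K + 1) > \<epsilon>/2 * b n}) \<longlonglongrightarrow> 0"
    by (rule neg_part_small) (use \<epsilon> in simp)
  have "\<forall>\<^sub>F n in sequentially. exp (\<epsilon>/2 * b n) \<ge> 4 / d"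
    using exp_b_at_top[of "\<epsilon>/2"] \<epsilon> by (simp add: filterlim_at_top)
  then show "\<forall>\<^sub>F n in sequentially. prob (E n) \<le> prob {\<omega> \<in> space P. neg_part \<omega> (n * K + 1) > \<epsilon>/2 * b n}"
  proof eventually_elim
    case (elim n)
    show ?case
    proof (rule finite_measure_mono_AE)
      show "AE \<omega> in P. \<omega> \<in> E n \<longrightarrow> \<omega> \<in> {\<omega> \<in> space P. neg_part \<omega> (n * K + 1) > \<epsilon>/2 * b n}"
        using sub[of n] AE_space
      proof eventually_elim
        case (elim \<omega>)
        show ?case
        proof (intro impI CollectI conjI elim(2), rule ccontr)
          assume w: "\<omega> \<in> E n" and "\<not> neg_part \<omega> (n * K + 1) > \<epsilon>/2 * b n"
          then have "exp (- (\<epsilon>/2 * b n)) * d \<le> exp (- neg_part \<omega> (n * K + 1)) * d" using d by (intro mult_right_mono) auto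
          also have "\<dots> < 4 * exp (- \<epsilon> * b n)" using elim(1) w by blast
          also have "exp (- \<epsilon> * b n) = exp (- (\<epsilon>/2 * b n)) * exp (- (\<epsilon>/2 * b n))" by (simp add: exp_add[symmetric])
          finally have "exp (- (\<epsilon>/2 * b n)) * d < exp (- (\<epsilon>/2 * b n)) * (4 * exp (- (\<epsilon>/2 * b n)))" by (simp add: mult_ac)
          then have "d < 4 * exp (- (\<epsilon>/2 * b n))" by simp
          moreover have "4 * exp (- (\<epsilon>/2 * b n)) \<le> d"
            using \<open>4 / d \<le> exp (\<epsilon>/2 * b n)\<close> d by (simp add: exp_minus field_simps)
          ultimately show False by simp
        qed
      qed
    qed measurable
  qed
qed auto

text \<open>The initial value is replaced by \<open>0\<close>, and the radius is constant.\<close>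

lemma no_dip_Y: "no_dip_at Y"
  unfolding no_dip_at_def
proof (intro allI impI)
  fix \<epsilon> :: real and K :: nat assume \<epsilon>: "\<epsilon> > 0"
  obtain d d' where d: "0 < d" "d \<le> d'" and p: "prob {\<omega> \<in> space P. \<bar>swap_gap (Z 1 \<omega>) (Z 2 \<omega>)\<bar> \<in> {d..d'}} > 0"
    using nonzero_in_window[OF swap_gap_rv swap_gap_not_zero] .
  obtain C where C: "\<And>N. (\<Sum>n<N. prob {\<omega> \<in> space P. \<bar>\<Sum>k=1..n. ln \<bar>fst (Z k \<omega>)\<bar>\<bar> \<le> ln (4 * d' / d)}) \<le> C"
    using visits_bound[of "ln (4 * d' / d)"] by blast
  define Zy where "Zy k \<omega> = (if k = 0 then (0, 0) else Z k \<omega>)" for k \<omega>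
  have Zy: "Zy k = Z k" if "k \<ge> 1" for k using that by (auto simp: Zy_def)
  have lin: "lin (\<lambda>i. Zy i \<omega>) k = Pi' \<omega> k" for \<omega> k by (rule partial_prod_cong) (auto simp: Zy_def Z_def)
  have perp: "perp (\<lambda>i. Zy i \<omega>) k = Y \<omega> k" for \<omega> k by (rule perpetuity_cong) (auto simp: Zy_def Z_def)
  have fst0: "fst (Zy 0 \<omega>) = 0" for \<omega> by (simp add: Zy_def)
  have "(\<lambda>n. prob {\<omega> \<in> space P. \<exists>k\<in>{1..n * K + 1}. fst (Zy 0 \<omega>) + perp (\<lambda>i. Zy i \<omega>) k \<noteq> 0 \<and>
        \<bar>fst (Zy 0 \<omega>) + perp (\<lambda>i. Zy i \<omega>) k\<bar> \<le> exp (- \<epsilon> * b n)}) \<longlonglongrightarrow> 0"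
  proof (rule no_dip[where \<rho> = "\<lambda>n x. exp (- \<epsilon> * b n)" and Z = Zy and d = d and d' = d' and C = C])
    have "indep_vars (\<lambda>_. borel) (\<lambda>k \<omega>. (if k = 0 then (\<lambda>_. (0, 0)) else (\<lambda>x. x)) (Z k \<omega>)) UNIV"
      by (rule indep_vars_compose2[OF Z_indep]) auto
    moreover have "(\<lambda>k \<omega>. (if k = 0 then (\<lambda>_. (0, 0)) else (\<lambda>x. x)) (Z k \<omega>)) = Zy" by (auto simp: Zy_def fun_eq_iff)
    ultimately show "indep_vars (\<lambda>_. borel) Zy UNIV" by simp
    show "distr P borel (Zy k) = distr P borel (Zy 1)" if "k \<ge> 1" for k
      using Z_ident[OF that] Zy[OF that] Zy[of 1] by simp
    show "0 < d" "d \<le> d'" by fact+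
    show "prob {\<omega> \<in> space P. \<bar>swap_gap (Zy 1 \<omega>) (Zy 2 \<omega>)\<bar> \<in> {d..d'}} > 0" using p by (simp add: Zy)
    show "(\<Sum>n<N. prob {\<omega> \<in> space P. \<bar>\<Sum>k=1..n. ln \<bar>fst (Zy k \<omega>)\<bar>\<bar> \<le> ln (4 * d' / d)}) \<le> C" for N
    proof -
      have "(\<Sum>k=1..n. ln \<bar>fst (Zy k \<omega>)\<bar>) = (\<Sum>k=1..n. ln \<bar>fst (Z k \<omega>)\<bar>)" for n \<omega> by (rule sum.cong) (auto simp: Zy)
      then show ?thesis using C[of N] by simp
    qed
    show "AE \<omega> in P. \<forall>k\<ge>1. fst (Zy k \<omega>) \<noteq> 0" using M_nz by eventually_elim (auto simp: Zy_def Z_def)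
    show "(\<lambda>n. prob {\<omega> \<in> space P. fst (Zy 0 \<omega>) + perp (\<lambda>i. Zy i \<omega>) k \<noteq> 0 \<and>
        \<bar>fst (Zy 0 \<omega>) + perp (\<lambda>i. Zy i \<omega>) k\<bar> \<le> exp (- \<epsilon> * b n)}) \<longlonglongrightarrow> 0" for k
    proof (rule prob_tendsto_0)
      show "{\<omega> \<in> space P. fst (Zy 0 \<omega>) + perp (\<lambda>i. Zy i \<omega>) k \<noteq> 0 \<and>
        \<bar>fst (Zy 0 \<omega>) + perp (\<lambda>i. Zy i \<omega>) k\<bar> \<le> exp (- \<epsilon> * b n)} \<in> events" for n
        unfolding perp fst0 by measurable
      show "AE \<omega> in P. \<forall>\<^sub>F n in sequentially. \<omega> \<notin> {\<omega> \<in> space P. fst (Zy 0 \<omega>) + perp (\<lambda>i. Zy i \<omega>) k \<noteq> 0 \<and>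
        \<bar>fst (Zy 0 \<omega>) + perp (\<lambda>i. Zy i \<omega>) k\<bar> \<le> exp (- \<epsilon> * b n)}"
      proof (rule AE_I2)
        fix \<omega>
        show "\<forall>\<^sub>F n in sequentially. \<omega> \<notin> {\<omega> \<in> space P. fst (Zy 0 \<omega>) + perp (\<lambda>i. Zy i \<omega>) k \<noteq> 0 \<and>
          \<bar>fst (Zy 0 \<omega>) + perp (\<lambda>i. Zy i \<omega>) k\<bar> \<le> exp (- \<epsilon> * b n)}"
        proof (cases "Y \<omega> k = 0")
          case False
          then have "\<forall>\<^sub>F n in sequentially. exp (- \<epsilon> * b n) < \<bar>Y \<omega> k\<bar>" by (intro order_tendstoD(2)[OF exp_b_0[OF \<epsilon>]]) auto
          then show ?thesis unfolding perp fst0 by eventually_elim auto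
        qed (simp add: perp fst0)
      qed
    qed
    show "(\<lambda>n. prob {\<omega> \<in> space P. \<exists>k\<in>{1..n * K + 1}. \<exists>s\<in>{..k}.
        4 * exp (- \<epsilon> * b n) > d * \<bar>lin (\<lambda>i. Zy i \<omega>) s\<bar>}) \<longlonglongrightarrow> 0"
      unfolding lin
    proof (rule regularity_tendsto_0[OF \<epsilon> d(1), where K = K])
      show "{\<omega> \<in> space P. \<exists>k\<in>{1..n * K + 1}. \<exists>s\<in>{..k}. 4 * exp (- \<epsilon> * b n) > d * \<bar>Pi' \<omega> s\<bar>} \<in> events" for n
        by measurable
      fix n
      show "AE \<omega> in P. \<omega> \<in> {\<omega> \<in> space P. \<exists>k\<in>{1..n * K + 1}. \<exists>s\<in>{..k}. 4 * exp (- \<epsilon> * b n) > d * \<bar>Pi' \<omega> s\<bar>} \<longrightarrow>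
         exp (- neg_part \<omega> (n * K + 1)) * d < 4 * exp (- \<epsilon> * b n)"
        using M_nz
      proof eventually_elim
        case (elim \<omega>)
        show ?case
        proof
          assume "\<omega> \<in> {\<omega> \<in> space P. \<exists>k\<in>{1..n * K + 1}. \<exists>s\<in>{..k}. 4 * exp (- \<epsilon> * b n) > d * \<bar>Pi' \<omega> s\<bar>}"
          then obtain k s where "k \<in> {1..n * K + 1}" "s \<in> {..k}" and s2: "4 * exp (- \<epsilon> * b n) > d * \<bar>Pi' \<omega> s\<bar>" by blast
          then have s: "s \<le> n * K + 1" by simp
          have "ln \<bar>Pi' \<omega> s\<bar> \<ge> - neg_part \<omega> (n * K + 1)"
            using ln_Pi_diff_ge[OF elim, of 0 s] neg_part_mono[OF s, of \<omega>] by simp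
          then have "exp (- neg_part \<omega> (n * K + 1)) \<le> \<bar>Pi' \<omega> s\<bar>" using Pi_nz[OF elim, of s] by (subst (asm) ln_ge_iff) auto
          then have "exp (- neg_part \<omega> (n * K + 1)) * d \<le> \<bar>Pi' \<omega> s\<bar> * d" using d by (intro mult_right_mono) auto
          also have "\<dots> < 4 * exp (- \<epsilon> * b n)" using s2 by (simp only: mult.commute)
          finally show "exp (- neg_part \<omega> (n * K + 1)) * d < 4 * exp (- \<epsilon> * b n)" .
        qed
      qed
    qed
  qed auto
  then show "(\<lambda>n. prob {\<omega> \<in> space P. \<exists>k\<in>{1..n * K + 1}. Y \<omega> k \<noteq> 0 \<and> \<bar>Y \<omega> k\<bar> \<le> exp (- \<epsilon> * b n)}) \<longlonglongrightarrow> 0"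
    unfolding perp fst0 by simp
qed

text \<open>Dividing the recursion by the products turns it into the partial sums of a perpetuity with the inverse
  multipliers. Those products grow, but the bounds on dips only use that their logarithms are separated.\<close>

lemma affine_rec_via_inverse:
  assumes "\<forall>k\<ge>1. m k \<noteq> (0::real)"
  shows "affine_rec m q x n = partial_prod m n * (x + perpetuity (\<lambda>i. 1 / m i) (\<lambda>i. q i / m i) n)"
    "partial_prod (\<lambda>i. 1 / m i) n = 1 / partial_prod m n"
proof -
  show inv: "partial_prod (\<lambda>i. 1 / m i) n = 1 / partial_prod m n" for n by (induction n) auto
  show "affine_rec m q x n = partial_prod m n * (x + perpetuity (\<lambda>i. 1 / m i) (\<lambda>i. q i / m i) n)"
  proof (induction n)
    case (Suc n)
    have nz: "partial_prod m n \<noteq> 0" "m (Suc n) \<noteq> 0" using ln_abs_lin(2)[of n m] assms by auto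
    show ?case unfolding affine_rec.simps Suc perpetuity_Suc partial_prod_Suc inv using nz by (simp add: field_simps)
  qed simp
qed

text \<open>\<open>\<bar>X\<^sub>k\<bar> \<le> exp (- \<epsilon> b n)\<close> says that \<open>X\<^sub>0\<close> plus the perpetuity with inverse multipliers is at most
  \<open>exp (- \<epsilon> b n)\<close> times \<open>\<bar>1 / \<Pi>\<^sub>k\<bar>\<close>; this is why the radius in \<open>no_dip\<close> may depend on the product.\<close>

lemma no_dip_X: "no_dip_at X"
  unfolding no_dip_at_def
proof (intro allI impI)
  fix \<epsilon> :: real and K :: nat assume \<epsilon>: "\<epsilon> > 0"
  define Zx where "Zx k \<omega> = (if k = 0 then Z 0 \<omega> else (1 / fst (Z k \<omega>), snd (Z k \<omega>) / fst (Z k \<omega>)))" for k \<omega>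
  have indepx: "indep_vars (\<lambda>_. borel) Zx UNIV"
  proof -
    have m: "(\<lambda>x :: real \<times> real. (1 / fst x, snd x / fst x)) \<in> borel_measurable borel"
      by (intro borel_measurable_Pair borel_measurable_divide borel_measurable_const borel_measurable_fst_real borel_measurable_snd_real)
    have "indep_vars (\<lambda>_. borel) (\<lambda>k \<omega>. (if k = 0 then (\<lambda>x. x) else (\<lambda>x. (1 / fst x, snd x / fst x))) (Z k \<omega>)) UNIV"
      by (rule indep_vars_compose2[OF Z_indep]) (use m in auto)
    moreover have "(\<lambda>k \<omega>. (if k = 0 then (\<lambda>x. x) else (\<lambda>x. (1 / fst x, snd x / fst x))) (Z k \<omega>)) = Zx" by (auto simp: Zx_def fun_eq_iff)
    ultimately show ?thesis by simp
  qed
  have identx: "distr P borel (Zx k) = distr P borel (Zx 1)" if "k \<ge> 1" for k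
  proof -
    have m: "(\<lambda>x :: real \<times> real. (1 / fst x, snd x / fst x)) \<in> borel_measurable borel"
      by (intro borel_measurable_Pair borel_measurable_divide borel_measurable_const borel_measurable_fst_real borel_measurable_snd_real)
    have "distr P borel (Zx k) = distr (distr P borel (Z k)) borel (\<lambda>x. (1 / fst x, snd x / fst x))" if "k \<ge> 1" for k
      using that by (subst distr_distr[OF m Z_rv]) (simp add: comp_def Zx_def[abs_def])
    from this[OF that] this[of 1] show ?thesis unfolding Z_ident[OF that] by simp
  qed
  have Zx_rv: "random_variable borel (Zx k)" for k using indepx by (auto simp: indep_vars_def)
  have comp: "random_variable borel (\<lambda>\<omega>. fst (Zx i \<omega>))" "random_variable borel (\<lambda>\<omega>. snd (Zx i \<omega>))" for i
    by (rule measurable_compose[OF Zx_rv borel_measurable_fst_real] measurable_compose[OF Zx_rv borel_measurable_snd_real])+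
  define A where "A k \<omega> = fst (Zx 0 \<omega>) + perp (\<lambda>i. Zx i \<omega>) k" for k \<omega>
  define L where "L k \<omega> = lin (\<lambda>i. Zx i \<omega>) k" for k \<omega>
  have AL[measurable]: "random_variable borel (A k)" "random_variable borel (L k)" for k
    unfolding A_def L_def by (intro borel_measurable_add borel_measurable_perpetuity borel_measurable_partial_prod comp)+
  have Lx: "L k \<omega> = 1 / Pi' \<omega> k" and Ax: "X \<omega> k = Pi' \<omega> k * A k \<omega>" if nz: "\<forall>k\<ge>1. Mk k \<omega> \<noteq> 0" for k \<omega>
  proof -
    have "L k \<omega> = partial_prod (\<lambda>i. 1 / Mk i \<omega>) k" unfolding L_def by (rule partial_prod_cong) (auto simp: Zx_def Z_def)
    then show "L k \<omega> = 1 / Pi' \<omega> k" using affine_rec_via_inverse(2)[OF nz] by simp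
    have "perp (\<lambda>i. Zx i \<omega>) k = perpetuity (\<lambda>i. 1 / Mk i \<omega>) (\<lambda>i. Qk i \<omega> / Mk i \<omega>) k"
      by (rule perpetuity_cong) (auto simp: Zx_def Z_def)
    then show "X \<omega> k = Pi' \<omega> k * A k \<omega>" using affine_rec_via_inverse(1)[OF nz] by (simp add: A_def Zx_def Z_def)
  qed
  have gapx: "swap_gap (Zx 1 \<omega>) (Zx 2 \<omega>) = - swap_gap (Z 1 \<omega>) (Z 2 \<omega>) / (Mk 1 \<omega> * Mk 2 \<omega>)" if "Mk 1 \<omega> \<noteq> 0" "Mk 2 \<omega> \<noteq> 0" for \<omega>
    using that by (simp add: swap_gap_def Zx_def Z_def field_simps)
  have gnz: "\<not> (AE \<omega> in P. swap_gap (Zx 1 \<omega>) (Zx 2 \<omega>) = 0)"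
  proof
    assume "AE \<omega> in P. swap_gap (Zx 1 \<omega>) (Zx 2 \<omega>) = 0"
    then have "AE \<omega> in P. swap_gap (Z 1 \<omega>) (Z 2 \<omega>) = 0" using M_nz
    proof eventually_elim
      case (elim \<omega>)
      then have "Mk 1 \<omega> \<noteq> 0" "Mk 2 \<omega> \<noteq> 0" by auto
      then show ?case using elim(1) gapx[of \<omega>] by simp
    qed
    with swap_gap_not_zero show False by contradiction
  qed
  have grv: "random_variable borel (\<lambda>\<omega>. swap_gap (Zx 1 \<omega>) (Zx 2 \<omega>))"
    unfolding swap_gap_def by (intro borel_measurable_diff borel_measurable_times comp borel_measurable_const)
  obtain d d' where d: "0 < d" "d \<le> d'" and p: "prob {\<omega> \<in> space P. \<bar>swap_gap (Zx 1 \<omega>) (Zx 2 \<omega>)\<bar> \<in> {d..d'}} > 0"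
    using nonzero_in_window[OF grv gnz] .
  obtain C where C: "\<And>N. (\<Sum>n<N. prob {\<omega> \<in> space P. \<bar>\<Sum>k=1..n. ln \<bar>fst (Z k \<omega>)\<bar>\<bar> \<le> ln (4 * d' / d)}) \<le> C"
    using visits_bound[of "ln (4 * d' / d)"] by blast
  have lim: "(\<lambda>n. prob {\<omega> \<in> space P. \<exists>k\<in>{1..n * K + 1}. A k \<omega> \<noteq> 0 \<and> \<bar>A k \<omega>\<bar> \<le> exp (- \<epsilon> * b n) * \<bar>L k \<omega>\<bar>}) \<longlonglongrightarrow> 0"
    unfolding A_def L_def
  proof (rule no_dip[where \<rho> = "\<lambda>n x. exp (- \<epsilon> * b n) * x" and Z = Zx and d = d and d' = d' and C = C, OF indepx identx d p], unfold A_def[symmetric] L_def[symmetric])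
    show "(\<Sum>n<N. prob {\<omega> \<in> space P. \<bar>\<Sum>k=1..n. ln \<bar>fst (Zx k \<omega>)\<bar>\<bar> \<le> ln (4 * d' / d)}) \<le> C" for N
    proof -
      have "(\<Sum>k=1..n. ln \<bar>fst (Zx k \<omega>)\<bar>) = - (\<Sum>k=1..n. ln \<bar>fst (Z k \<omega>)\<bar>)" for n \<omega>
        unfolding sum_negf[symmetric] by (rule sum.cong) (auto simp: Zx_def ln_div)
      then show ?thesis using C[of N] by simp
    qed
    show "AE \<omega> in P. \<forall>k\<ge>1. fst (Zx k \<omega>) \<noteq> 0" using M_nz by eventually_elim (auto simp: Zx_def Z_def)
    show "(\<lambda>n. prob {\<omega> \<in> space P. A k \<omega> \<noteq> 0 \<and> \<bar>A k \<omega>\<bar> \<le> exp (- \<epsilon> * b n) * \<bar>L k \<omega>\<bar>}) \<longlonglongrightarrow> 0" for k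
    proof (rule prob_tendsto_0)
      show "AE \<omega> in P. \<forall>\<^sub>F n in sequentially. \<omega> \<notin> {\<omega> \<in> space P. A k \<omega> \<noteq> 0 \<and> \<bar>A k \<omega>\<bar> \<le> exp (- \<epsilon> * b n) * \<bar>L k \<omega>\<bar>}"
      proof (rule AE_I2)
        fix \<omega>
        show "\<forall>\<^sub>F n in sequentially. \<omega> \<notin> {\<omega> \<in> space P. A k \<omega> \<noteq> 0 \<and> \<bar>A k \<omega>\<bar> \<le> exp (- \<epsilon> * b n) * \<bar>L k \<omega>\<bar>}"
        proof (cases "A k \<omega> = 0")
          case False
          have "(\<lambda>n. exp (- \<epsilon> * b n) * \<bar>L k \<omega>\<bar>) \<longlonglongrightarrow> 0 * \<bar>L k \<omega>\<bar>" by (intro tendsto_mult exp_b_0 \<epsilon> tendsto_const)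
          then have "\<forall>\<^sub>F n in sequentially. exp (- \<epsilon> * b n) * \<bar>L k \<omega>\<bar> < \<bar>A k \<omega>\<bar>" using False by (intro order_tendstoD(2)) auto
          then show ?thesis by eventually_elim auto
        qed simp
      qed
    qed measurable
    show "(\<lambda>n. prob {\<omega> \<in> space P. \<exists>k\<in>{1..n * K + 1}. \<exists>s\<in>{..k}.
        4 * (exp (- \<epsilon> * b n) * \<bar>L k \<omega>\<bar>) > d * \<bar>L s \<omega>\<bar>}) \<longlonglongrightarrow> 0"
    proof (rule regularity_tendsto_0[OF \<epsilon> d(1), where K = K])
      show "{\<omega> \<in> space P. \<exists>k\<in>{1..n * K + 1}. \<exists>s\<in>{..k}. 4 * (exp (- \<epsilon> * b n) * \<bar>L k \<omega>\<bar>) > d * \<bar>L s \<omega>\<bar>} \<in> events" for n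
        by measurable
      fix n
      show "AE \<omega> in P. \<omega> \<in> {\<omega> \<in> space P. \<exists>k\<in>{1..n * K + 1}. \<exists>s\<in>{..k}. 4 * (exp (- \<epsilon> * b n) * \<bar>L k \<omega>\<bar>) > d * \<bar>L s \<omega>\<bar>} \<longrightarrow>
         exp (- neg_part \<omega> (n * K + 1)) * d < 4 * exp (- \<epsilon> * b n)"
        using M_nz
      proof eventually_elim
        case (elim \<omega>)
        show ?case
        proof
          assume "\<omega> \<in> {\<omega> \<in> space P. \<exists>k\<in>{1..n * K + 1}. \<exists>s\<in>{..k}. 4 * (exp (- \<epsilon> * b n) * \<bar>L k \<omega>\<bar>) > d * \<bar>L s \<omega>\<bar>}"
          then obtain k s where "k \<in> {1..n * K + 1}" "s \<in> {..k}" and s3: "4 * (exp (- \<epsilon> * b n) * \<bar>L k \<omega>\<bar>) > d * \<bar>L s \<omega>\<bar>" by blast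
          then have s: "s \<le> k" "k \<le> n * K + 1" by auto
          have pos: "\<bar>Pi' \<omega> k\<bar> > 0" "\<bar>Pi' \<omega> s\<bar> > 0" using Pi_nz[OF elim] by auto
          have r: "d * \<bar>Pi' \<omega> k\<bar> / \<bar>Pi' \<omega> s\<bar> < 4 * exp (- \<epsilon> * b n)"
            using s3 pos unfolding Lx[OF elim] by (simp add: field_simps)
          have "ln (\<bar>Pi' \<omega> k\<bar> / \<bar>Pi' \<omega> s\<bar>) \<ge> - neg_part \<omega> (n * K + 1)"
            using ln_Pi_diff_ge[OF elim s(1)] neg_part_mono[OF s(2), of \<omega>] pos by (simp add: ln_div)
          then have "exp (- neg_part \<omega> (n * K + 1)) \<le> \<bar>Pi' \<omega> k\<bar> / \<bar>Pi' \<omega> s\<bar>" using pos by (subst (asm) ln_ge_iff) auto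
          then have "exp (- neg_part \<omega> (n * K + 1)) * d \<le> \<bar>Pi' \<omega> k\<bar> / \<bar>Pi' \<omega> s\<bar> * d" using d by (intro mult_right_mono) auto
          with r show "exp (- neg_part \<omega> (n * K + 1)) * d < 4 * exp (- \<epsilon> * b n)" by (simp add: mult.commute)
        qed
      qed
    qed
  qed auto
  show "(\<lambda>n. prob {\<omega> \<in> space P. \<exists>k\<in>{1..n * K + 1}. X \<omega> k \<noteq> 0 \<and> \<bar>X \<omega> k\<bar> \<le> exp (- \<epsilon> * b n)}) \<longlonglongrightarrow> 0"
  proof (rule tendsto_sandwich[where f = "\<lambda>_. 0", OF _ _ tendsto_const lim])
    have "prob {\<omega> \<in> space P. \<exists>k\<in>{1..n * K + 1}. X \<omega> k \<noteq> 0 \<and> \<bar>X \<omega> k\<bar> \<le> exp (- \<epsilon> * b n)}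
       \<le> prob {\<omega> \<in> space P. \<exists>k\<in>{1..n * K + 1}. A k \<omega> \<noteq> 0 \<and> \<bar>A k \<omega>\<bar> \<le> exp (- \<epsilon> * b n) * \<bar>L k \<omega>\<bar>}" for n
    proof (rule finite_measure_mono_AE)
      show "AE \<omega> in P. \<omega> \<in> {\<omega> \<in> space P. \<exists>k\<in>{1..n * K + 1}. X \<omega> k \<noteq> 0 \<and> \<bar>X \<omega> k\<bar> \<le> exp (- \<epsilon> * b n)} \<longrightarrow>
         \<omega> \<in> {\<omega> \<in> space P. \<exists>k\<in>{1..n * K + 1}. A k \<omega> \<noteq> 0 \<and> \<bar>A k \<omega>\<bar> \<le> exp (- \<epsilon> * b n) * \<bar>L k \<omega>\<bar>}"
        using M_nz
      proof eventually_elim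
        case (elim \<omega>)
        have "A k \<omega> \<noteq> 0 \<and> \<bar>A k \<omega>\<bar> \<le> exp (- \<epsilon> * b n) * \<bar>L k \<omega>\<bar>" if "X \<omega> k \<noteq> 0" "\<bar>X \<omega> k\<bar> \<le> exp (- \<epsilon> * b n)" for k
        proof -
          have "\<bar>Pi' \<omega> k\<bar> > 0" using Pi_nz[OF elim] by simp
          then show ?thesis using that unfolding Lx[OF elim] Ax[OF elim] by (auto simp: abs_mult field_simps)
        qed
        then show ?case by blast
      qed
    qed measurable
    then show "\<forall>\<^sub>F n in sequentially. prob {\<omega> \<in> space P. \<exists>k\<in>{1..n * K + 1}. X \<omega> k \<noteq> 0 \<and> \<bar>X \<omega> k\<bar> \<le> exp (- \<epsilon> * b n)}
       \<le> prob {\<omega> \<in> space P. \<exists>k\<in>{1..n * K + 1}. A k \<omega> \<noteq> 0 \<and> \<bar>A k \<omega>\<bar> \<le> exp (- \<epsilon> * b n) * \<bar>L k \<omega>\<bar>}" by simp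
  qed auto
qed

end

section \<open>Laws of the quantised block maxima\<close>

text \<open>Pass from distribution functions to point probabilities one coordinate at a time, since
  \<open>q = v\<close> is the difference of the events \<open>q < v + 1\<close> and \<open>q < v\<close>.\<close>

lemma levels_pmf_tendsto:
  fixes q :: "nat \<Rightarrow> 'w \<Rightarrow> nat \<Rightarrow> nat" and q' :: "'v \<Rightarrow> nat \<Rightarrow> nat"
  assumes P: "prob_space P" and S: "prob_space S"
    and m: "\<And>n a r. {\<omega> \<in> space P. q n \<omega> a < r} \<in> sets P" and m': "\<And>a r. {\<omega> \<in> space S. q' \<omega> a < r} \<in> sets S"
    and lim: "\<And>r. (\<lambda>n. measure P {\<omega> \<in> space P. \<forall>a<N. q n \<omega> a < r a}) \<longlonglongrightarrow> measure S {\<omega> \<in> space S. \<forall>a<N. q' \<omega> a < r a}"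
  shows "(\<lambda>n. measure P {\<omega> \<in> space P. \<forall>a<N. q n \<omega> a = v a}) \<longlonglongrightarrow> measure S {\<omega> \<in> space S. \<forall>a<N. q' \<omega> a = v a}"
proof -
  \<comment> \<open>the first \<open>A\<close> coordinates are prescribed, the others are bounded\<close>
  define ev where "ev A r x \<longleftrightarrow> (\<forall>a<N. if a < A then x a = v a else x a < r a)" for A :: nat and r x :: "nat \<Rightarrow> nat"
  have meas: "{\<omega> \<in> space M. ev A r (p \<omega>)} \<in> sets M" if "\<And>a r. {\<omega> \<in> space M. p \<omega> a < r} \<in> sets M"
    for M :: "'z measure" and p :: "'z \<Rightarrow> nat \<Rightarrow> nat" and A r
  proof -
    have lt[measurable]: "Measurable.pred M (\<lambda>\<omega>. p \<omega> a < r)" for a r using that by (simp add: pred_def)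
    have "Measurable.pred M (\<lambda>\<omega>. p \<omega> a < Suc r \<and> \<not> p \<omega> a < r)" for a r by measurable
    moreover have "(\<lambda>\<omega>. p \<omega> a < Suc r \<and> \<not> p \<omega> a < r) = (\<lambda>\<omega>. p \<omega> a = r)" for a r by auto
    ultimately have eq[measurable]: "Measurable.pred M (\<lambda>\<omega>. p \<omega> a = r)" for a r by simp
    have "Measurable.pred M (\<lambda>\<omega>. \<forall>a\<in>{..<N}. if a < A then p \<omega> a = v a else p \<omega> a < r a)" by measurable
    then show ?thesis by (simp add: ev_def pred_def)
  qed
  have diff: "measure M {\<omega> \<in> space M. ev (Suc A) r (p \<omega>)} =
      measure M {\<omega> \<in> space M. ev A (r(A := Suc (v A))) (p \<omega>)} - measure M {\<omega> \<in> space M. ev A (r(A := v A)) (p \<omega>)}"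
    if "prob_space M" "\<And>a r. {\<omega> \<in> space M. p \<omega> a < r} \<in> sets M" "A < N" for M :: "'z measure" and p A r
  proof -
    interpret M: prob_space M by fact
    have split_at: "(\<forall>a<N. if a = A then C else Q a) \<longleftrightarrow> (\<forall>a<N. a \<noteq> A \<longrightarrow> Q a) \<and> C" for C Q
      using \<open>A < N\<close> by auto
    have ag: "(if a < A then x a = v a else x a < (r(A := c)) a) \<longleftrightarrow>
       (if a = A then x A < c else if a < A then x a = v a else x a < r a)" for x :: "nat \<Rightarrow> nat" and a c by auto
    define Rst where "Rst x \<longleftrightarrow> (\<forall>a<N. a \<noteq> A \<longrightarrow> (if a < A then x a = v a else x a < r a))" for x :: "nat \<Rightarrow> nat"
    have 1: "ev A (r(A := c)) x \<longleftrightarrow> Rst x \<and> x A < c" for c x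
      unfolding ev_def ag Rst_def by (rule split_at)
    have 2: "ev (Suc A) r x \<longleftrightarrow> Rst x \<and> x A = v A" for x
      unfolding ev_def Rst_def using \<open>A < N\<close> by (auto simp: less_Suc_eq)
    have eq: "{\<omega> \<in> space M. ev (Suc A) r (p \<omega>)} = {\<omega> \<in> space M. ev A (r(A := Suc (v A))) (p \<omega>)} - {\<omega> \<in> space M. ev A (r(A := v A)) (p \<omega>)}"
      unfolding 1 2 by auto
    have sub: "{\<omega> \<in> space M. ev A (r(A := v A)) (p \<omega>)} \<subseteq> {\<omega> \<in> space M. ev A (r(A := Suc (v A))) (p \<omega>)}"
      unfolding 1 by auto
    show ?thesis unfolding eq by (rule M.finite_measure_Diff[OF meas meas sub]) (rule that(2))+
  qed
  have "(\<lambda>n. measure P {\<omega> \<in> space P. ev A r (q n \<omega>)}) \<longlonglongrightarrow> measure S {\<omega> \<in> space S. ev A r (q' \<omega>)}" if "A \<le> N" for A r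
    using that
  proof (induction A arbitrary: r)
    case 0 then show ?case using lim[of r] by (simp add: ev_def)
  next
    case (Suc A)
    then have A: "A < N" by simp
    show ?case unfolding diff[OF P m A] diff[OF S m' A]
      by (intro tendsto_diff Suc.IH) (use A in auto)
  qed
  from this[of N] show ?thesis by (simp add: ev_def)
qed

text \<open>Only the first \<open>N\<close> levels enter, and they are at most \<open>R\<close>, so there are finitely many grid paths. Different
  levels may give the same path; its probability is a finite sum of point probabilities.\<close>

lemma grid_path_law_tendsto:
  fixes q :: "nat \<Rightarrow> 'w \<Rightarrow> nat \<Rightarrow> nat" and q' :: "'v \<Rightarrow> nat \<Rightarrow> nat"
    and N R k :: nat and \<eta> :: real
  assumes P: "prob_space P" and S: "prob_space S"
    and m: "\<And>n a r. {\<omega> \<in> space P. q n \<omega> a < r} \<in> sets P" and m': "\<And>a r. {\<omega> \<in> space S. q' \<omega> a < r} \<in> sets S"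
    and lim: "\<And>r. (\<lambda>n. measure P {\<omega> \<in> space P. \<forall>a<N. q n \<omega> a < r a}) \<longlonglongrightarrow> measure S {\<omega> \<in> space S. \<forall>a<N. q' \<omega> a < r a}"
    and R: "\<And>n \<omega> a. q n \<omega> a \<le> R" "\<And>\<omega> a. q' \<omega> a \<le> R"
  defines "Gn \<equiv> \<lambda>n \<omega>. grid_path k \<eta> (\<lambda>a. if a < N then q n \<omega> a else 0)"
    and "G \<equiv> \<lambda>\<omega>. grid_path k \<eta> (\<lambda>a. if a < N then q' \<omega> a else 0)"
  obtains F where "finite F" "F \<subseteq> skorokhod_D" "\<And>n. Gn n \<in> measurable P (count_space F)" "G \<in> measurable S (count_space F)"
    "\<And>x. x \<in> F \<Longrightarrow> (\<lambda>n. measure P {\<omega> \<in> space P. Gn n \<omega> = x}) \<longlonglongrightarrow> measure S {\<omega> \<in> space S. G \<omega> = x}"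
proof -
  define \<V> where "\<V> = {v :: nat \<Rightarrow> nat. \<forall>a. (a \<in> {..<N} \<longrightarrow> v a \<in> {..R}) \<and> (a \<notin> {..<N} \<longrightarrow> v a = 0)}"
  have fin: "finite \<V>" unfolding \<V>_def by (rule finite_set_of_finite_funs) auto
  define cut where "cut x = (\<lambda>a. if a < N then x a else 0)" for x :: "nat \<Rightarrow> nat"
  define F where "F = grid_path k \<eta> ` \<V>"
  have cutV: "cut x \<in> \<V>" if "\<And>a. x a \<le> R" for x using that by (auto simp: cut_def \<V>_def)
  have cut_eq: "cut x = v \<longleftrightarrow> (\<forall>a<N. x a = v a)" if "v \<in> \<V>" for x v
    using that by (auto simp: cut_def \<V>_def fun_eq_iff)
  have meq: "{\<omega> \<in> space M. \<forall>a<N. p \<omega> a = v a} \<in> sets M" if "\<And>a r. {\<omega> \<in> space M. p \<omega> a < r} \<in> sets M"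
    for M :: "'z measure" and p :: "'z \<Rightarrow> nat \<Rightarrow> nat" and v
  proof -
    have [measurable]: "Measurable.pred M (\<lambda>\<omega>. p \<omega> a < r)" for a r using that by (simp add: pred_def)
    have "Measurable.pred M (\<lambda>\<omega>. p \<omega> a < Suc r \<and> \<not> p \<omega> a < r)" for a r by measurable
    moreover have "(\<lambda>\<omega>. p \<omega> a < Suc r \<and> \<not> p \<omega> a < r) = (\<lambda>\<omega>. p \<omega> a = r)" for a r by auto
    ultimately have [measurable]: "Measurable.pred M (\<lambda>\<omega>. p \<omega> a = r)" for a r by simp
    have "Measurable.pred M (\<lambda>\<omega>. \<forall>a\<in>{..<N}. p \<omega> a = v a)" by measurable
    then show ?thesis by (simp add: pred_def)
  qed
  have law: "{\<omega> \<in> space M. grid_path k \<eta> (cut (p \<omega>)) = x} \<in> sets M \<and>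
      measure M {\<omega> \<in> space M. grid_path k \<eta> (cut (p \<omega>)) = x} = (\<Sum>v\<in>{v \<in> \<V>. grid_path k \<eta> v = x}. measure M {\<omega> \<in> space M. \<forall>a<N. p \<omega> a = v a})"
    if "prob_space M" and pm: "\<And>a r. {\<omega> \<in> space M. p \<omega> a < r} \<in> sets M" and pR: "\<And>\<omega> a. p \<omega> a \<le> R"
    for M :: "'z measure" and p :: "'z \<Rightarrow> nat \<Rightarrow> nat" and x
  proof -
    interpret M: prob_space M by fact
    let ?V = "{v \<in> \<V>. grid_path k \<eta> v = x}"
    have eq: "{\<omega> \<in> space M. grid_path k \<eta> (cut (p \<omega>)) = x} = (\<Union>v\<in>?V. {\<omega> \<in> space M. \<forall>a<N. p \<omega> a = v a})"
    proof (intro set_eqI iffI)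
      fix \<omega> assume "\<omega> \<in> {\<omega> \<in> space M. grid_path k \<eta> (cut (p \<omega>)) = x}"
      then show "\<omega> \<in> (\<Union>v\<in>?V. {\<omega> \<in> space M. \<forall>a<N. p \<omega> a = v a})"
        using cutV[OF pR] by (intro UN_I[of "cut (p \<omega>)"]) (auto simp: cut_def)
    next
      fix \<omega> assume "\<omega> \<in> (\<Union>v\<in>?V. {\<omega> \<in> space M. \<forall>a<N. p \<omega> a = v a})"
      then obtain v where v: "v \<in> \<V>" "grid_path k \<eta> v = x" "\<omega> \<in> space M" "\<forall>a<N. p \<omega> a = v a" by auto
      then have "cut (p \<omega>) = v" using cut_eq by blast
      then show "\<omega> \<in> {\<omega> \<in> space M. grid_path k \<eta> (cut (p \<omega>)) = x}" using v by simp
    qed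
    have disj: "disjoint_family_on (\<lambda>v. {\<omega> \<in> space M. \<forall>a<N. p \<omega> a = v a}) ?V"
      unfolding disjoint_family_on_def
    proof (intro ballI impI equals0I)
      fix v v' \<omega> assume v: "v \<in> ?V" "v' \<in> ?V" "v \<noteq> v'"
        and w: "\<omega> \<in> {\<omega> \<in> space M. \<forall>a<N. p \<omega> a = v a} \<inter> {\<omega> \<in> space M. \<forall>a<N. p \<omega> a = v' a}"
      have "cut (p \<omega>) = v" by (subst cut_eq) (use v w in auto)
      moreover have "cut (p \<omega>) = v'" by (subst cut_eq) (use v w in auto)
      ultimately show False using v by simp
    qed
    have mv: "{\<omega> \<in> space M. \<forall>a<N. p \<omega> a = v a} \<in> sets M" for v by (rule meq) (rule pm)
    have finV: "finite ?V" using fin by simp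
    show ?thesis unfolding eq
    proof
      show "(\<Union>v\<in>?V. {\<omega> \<in> space M. \<forall>a<N. p \<omega> a = v a}) \<in> sets M" by (rule sets.finite_UN[OF finV mv])
      show "measure M (\<Union>v\<in>?V. {\<omega> \<in> space M. \<forall>a<N. p \<omega> a = v a}) = (\<Sum>v\<in>?V. measure M {\<omega> \<in> space M. \<forall>a<N. p \<omega> a = v a})"
        by (rule M.finite_measure_finite_Union[OF finV _ disj]) (use mv in blast)
    qed
  qed
  have mG: "(\<lambda>\<omega>. grid_path k \<eta> (cut (p \<omega>))) \<in> measurable M (count_space F)"
    if "prob_space M" and pm: "\<And>a r. {\<omega> \<in> space M. p \<omega> a < r} \<in> sets M" and pR: "\<And>\<omega> a. p \<omega> a \<le> R"
    for M :: "'z measure" and p :: "'z \<Rightarrow> nat \<Rightarrow> nat"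
  proof (subst measurable_count_space_eq2)
    show "finite F" using fin by (simp add: F_def)
    have pre: "(\<lambda>\<omega>. grid_path k \<eta> (cut (p \<omega>))) -` {x} \<inter> space M = {\<omega> \<in> space M. grid_path k \<eta> (cut (p \<omega>)) = x}" for x by auto
    show "(\<lambda>\<omega>. grid_path k \<eta> (cut (p \<omega>))) \<in> space M \<rightarrow> F \<and> (\<forall>a\<in>F. (\<lambda>\<omega>. grid_path k \<eta> (cut (p \<omega>))) -` {a} \<inter> space M \<in> sets M)"
    proof (intro conjI ballI Pi_I)
      show "grid_path k \<eta> (cut (p \<omega>)) \<in> F" for \<omega> unfolding F_def by (rule imageI, rule cutV, rule pR)
      show "(\<lambda>\<omega>. grid_path k \<eta> (cut (p \<omega>))) -` {x} \<inter> space M \<in> sets M" for x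
        unfolding pre by (rule conjunct1[OF law[OF that]])
    qed
  qed
  show thesis
  proof (rule that[of F])
    show "finite F" using fin by (simp add: F_def)
    show "F \<subseteq> skorokhod_D" by (auto simp: F_def grid_path_in_D)
    show "Gn n \<in> measurable P (count_space F)" for n
      using mG[OF P m R(1)] unfolding Gn_def cut_def .
    show "G \<in> measurable S (count_space F)"
      using mG[OF S m' R(2)] unfolding G_def cut_def .
    show "(\<lambda>n. measure P {\<omega> \<in> space P. Gn n \<omega> = x}) \<longlonglongrightarrow> measure S {\<omega> \<in> space S. G \<omega> = x}" for x
    proof -
      have "measure P {\<omega> \<in> space P. Gn n \<omega> = x} = (\<Sum>v\<in>{v \<in> \<V>. grid_path k \<eta> v = x}. measure P {\<omega> \<in> space P. \<forall>a<N. q n \<omega> a = v a})" for n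
        unfolding Gn_def cut_def[symmetric] by (rule conjunct2[OF law[OF P]]) (rule m, rule R(1))
      moreover have "measure S {\<omega> \<in> space S. G \<omega> = x} = (\<Sum>v\<in>{v \<in> \<V>. grid_path k \<eta> v = x}. measure S {\<omega> \<in> space S. \<forall>a<N. q' \<omega> a = v a})"
        unfolding G_def cut_def[symmetric] by (rule conjunct2[OF law[OF S]]) (rule m', rule R(2))
      moreover have "(\<lambda>n. \<Sum>v\<in>{v \<in> \<V>. grid_path k \<eta> v = x}. measure P {\<omega> \<in> space P. \<forall>a<N. q n \<omega> a = v a})
         \<longlonglongrightarrow> (\<Sum>v\<in>{v \<in> \<V>. grid_path k \<eta> v = x}. measure S {\<omega> \<in> space S. \<forall>a<N. q' \<omega> a = v a})"
        by (rule tendsto_sum, rule levels_pmf_tendsto[OF P S]) (rule m m' lim)+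
      ultimately show ?thesis by simp
    qed
  qed
qed

text \<open>The sample point with index \<open>k\<close> is placed at time \<open>k / n\<close>.\<close>

definition index_block :: "nat \<Rightarrow> nat \<Rightarrow> nat \<Rightarrow> nat set" where
  "index_block m n a = {k. real a / real m \<le> real k / real n \<and> real k / real n < (real a + 1) / real m}"

lemma index_block_eq:
  assumes "m \<ge> 1" "n \<ge> 1"
  shows "index_block m n a = {nat \<lceil>real a * real n / real m\<rceil>..<nat \<lceil>(real a + 1) * real n / real m\<rceil>}"
proof (intro set_eqI)
  fix k
  have "k \<in> index_block m n a \<longleftrightarrow> real a * real n / real m \<le> real k \<and> real k < (real a + 1) * real n / real m"
    using assms by (auto simp: index_block_def field_simps)
  also have "\<dots> \<longleftrightarrow> k \<in> {nat \<lceil>real a * real n / real m\<rceil>..<nat \<lceil>(real a + 1) * real n / real m\<rceil>}"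
    using nat_ceiling_le_eq[of "real a * real n / real m" k] nat_ceiling_le_eq[of "(real a + 1) * real n / real m" k]
    by (simp only: atLeastLessThan_iff) linarith
  finally show "k \<in> index_block m n a \<longleftrightarrow> k \<in> {nat \<lceil>real a * real n / real m\<rceil>..<nat \<lceil>(real a + 1) * real n / real m\<rceil>}" .
qed

lemma card_index_block:
  assumes "m \<ge> 1" "n \<ge> 1"
  shows "\<bar>real (card (index_block m n a)) - real n / real m\<bar> \<le> 1" "finite (index_block m n a)"
proof -
  show "finite (index_block m n a)" by (simp add: index_block_eq[OF assms])
  define x y where "x = real a * real n / real m" and "y = (real a + 1) * real n / real m"
  have xy: "0 \<le> x" "x \<le> y" "y - x = real n / real m"
    using assms by (auto simp: x_def y_def field_simps)
  have "nat \<lceil>x\<rceil> \<le> nat \<lceil>y\<rceil>" using xy by (intro nat_mono ceiling_mono)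
  then have "real (card (index_block m n a)) = real (nat \<lceil>y\<rceil>) - real (nat \<lceil>x\<rceil>)"
    by (simp add: index_block_eq[OF assms] x_def y_def of_nat_diff)
  also have "\<dots> = of_int \<lceil>y\<rceil> - of_int \<lceil>x\<rceil>" using xy by (simp add: of_nat_nat)
  finally show "\<bar>real (card (index_block m n a)) - real n / real m\<bar> \<le> 1"
    using xy(3) by linarith
qed

lemma card_index_block_times:
  assumes m: "m \<ge> 1" and lim: "(\<lambda>n. real n * f n) \<longlonglongrightarrow> x" and f: "f \<longlonglongrightarrow> 0" "\<And>n. f n \<ge> 0"
  shows "(\<lambda>n. real (card (index_block m n a)) * f n) \<longlonglongrightarrow> x / real m"
proof -
  have "(\<lambda>n. (real (card (index_block m n a)) - real n / real m) * f n) \<longlonglongrightarrow> 0"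
  proof (rule Lim_null_comparison[OF _ f(1)])
    show "\<forall>\<^sub>F n in sequentially. norm ((real (card (index_block m n a)) - real n / real m) * f n) \<le> f n"
      using eventually_ge_at_top[of 1]
    proof eventually_elim
      case (elim n)
      have "\<bar>real (card (index_block m n a)) - real n / real m\<bar> * f n \<le> 1 * f n"
        using card_index_block(1)[OF m elim] f(2) by (intro mult_right_mono) auto
      then show ?case using f(2)[of n] by (simp add: abs_mult)
    qed
  qed
  moreover have "(\<lambda>n. real n * f n * (1 / real m)) \<longlonglongrightarrow> x * (1 / real m)" by (intro tendsto_mult lim tendsto_const)
  ultimately have "(\<lambda>n. (real (card (index_block m n a)) - real n / real m) * f n + real n * f n * (1 / real m)) \<longlonglongrightarrow> 0 + x * (1 / real m)"
    by (rule tendsto_add)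
  then show ?thesis by (simp add: algebra_simps)
qed

context heavy_perpetuity
begin

text \<open>The scaled sample as a point configuration. The shift by one index corresponds to the
  time shift in the path, which at time \<open>s\<close> shows the sequence at index \<open>\<lfloor>n s\<rfloor> + 1\<close>.\<close>

definition obs_time :: "nat \<Rightarrow> nat \<Rightarrow> real" where "obs_time n k = real k / real n"

definition obs_height :: "nat \<Rightarrow> 'w \<Rightarrow> nat \<Rightarrow> ereal" where "obs_height n \<omega> k = ereal (ln \<bar>Qk (Suc k) \<omega>\<bar> / b n)"

lemma lnQ_event: "i \<ge> 1 \<Longrightarrow> {\<omega> \<in> space P. ln \<bar>Qk i \<omega>\<bar> > x} \<in> events"
  by (auto intro!: borel_measurable_less Qk_rv borel_measurable_ln borel_measurable_abs)

lemma obs_height_gt: "n \<ge> 1 \<Longrightarrow> obs_height n \<omega> k > ereal x \<longleftrightarrow> ln \<bar>Qk (Suc k) \<omega>\<bar> > x * b n"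
  using b_pos[of n] by (simp add: obs_height_def pos_less_divide_eq)

lemma obs_height_event: "{\<omega> \<in> space P. obs_height n \<omega> k > ereal x} \<in> events"
proof -
  have [measurable]: "random_variable borel (Qk (Suc k))" by (rule Qk_rv) simp
  show ?thesis unfolding obs_height_def less_ereal.simps by measurable
qed

lemma block_hit_obs:
  "block_hit m (obs_time n) (obs_height n \<omega>) a x \<longleftrightarrow> (\<exists>k\<in>index_block m n a. obs_height n \<omega> k > ereal x)"
  by (auto simp: block_hit_def index_block_def obs_time_def)

lemma block_level_obs_event:
  "{\<omega> \<in> space P. block_level m R \<eta> (obs_time n) (obs_height n \<omega>) a < r} \<in> events"
proof -
  have [measurable]: "Measurable.pred P (\<lambda>\<omega>. block_hit m (obs_time n) (obs_height n \<omega>) a x)" for x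
  proof -
    have [measurable]: "Measurable.pred P (\<lambda>\<omega>. obs_height n \<omega> k > ereal x)" for k using obs_height_event by (simp add: pred_def)
    show ?thesis unfolding block_hit_obs by measurable
  qed
  have "(\<lambda>\<omega>. card {r \<in> {1..R}. block_hit m (obs_time n) (obs_height n \<omega>) a (real r * \<eta>)}) =
     (\<lambda>\<omega>. \<Sum>r\<in>{1..R}. if block_hit m (obs_time n) (obs_height n \<omega>) a (real r * \<eta>) then 1 else 0)"
    by (simp add: sum.If_cases Int_def)
  also have "\<dots> \<in> measurable P (count_space UNIV)" by measurable
  finally have [measurable]: "(\<lambda>\<omega>. block_level m R \<eta> (obs_time n) (obs_height n \<omega>) a) \<in> measurable P (count_space UNIV)"
    unfolding block_level_def .
  show ?thesis by measurable
qed

lemma no_large_prob: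
  assumes n: "n \<ge> 1" and A: "finite A" and B: "\<And>a. a \<in> A \<Longrightarrow> finite (B a)" "disjoint_family_on B A"
  shows "prob {\<omega> \<in> space P. \<forall>a\<in>A. \<forall>k\<in>B a. \<not> obs_height n \<omega> k > ereal (x a)} = (\<Prod>a\<in>A. (1 - F (x a * b n)) ^ card (B a))"
proof -
  define J where "J = (\<Union>a\<in>A. B a)"
  have J: "finite J" using A B by (auto simp: J_def)
  define C where "C i = {z :: real \<times> real. \<forall>a\<in>A. i - 1 \<in> B a \<longrightarrow> \<not> ln \<bar>snd z\<bar> > x a * b n}" for i
  have Cm: "C i \<in> sets borel" for i
  proof -
    have "(\<lambda>z :: real \<times> real. ln \<bar>snd z\<bar>) \<in> borel_measurable borel"
      by (intro borel_measurable_ln borel_measurable_abs borel_measurable_snd_real)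
    then have [measurable]: "Measurable.pred borel (\<lambda>z :: real \<times> real. ln \<bar>snd z\<bar> > c)" for c
      unfolding pred_def by (rule borel_measurable_less[OF borel_measurable_const])
    have "Measurable.pred borel (\<lambda>z :: real \<times> real. \<forall>a\<in>A. i - 1 \<in> B a \<longrightarrow> \<not> ln \<bar>snd z\<bar> > x a * b n)"
      using A by (intro pred_intros_finite) measurable
    then show ?thesis by (simp add: C_def pred_def)
  qed
  have pk: "prob (Z (Suc k) -` C (Suc k) \<inter> space P) = 1 - F (x a * b n)" if "a \<in> A" "k \<in> B a" for a k
  proof -
    have uniq: "a' = a" if "a' \<in> A" "k \<in> B a'" for a'
    proof (rule ccontr)
      assume "a' \<noteq> a"
      then have "B a' \<inter> B a = {}" using B(2) that \<open>a \<in> A\<close> unfolding disjoint_family_on_def by blast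
      then show False using that \<open>k \<in> B a\<close> by blast
    qed
    have "Z (Suc k) -` C (Suc k) \<inter> space P = space P - {\<omega> \<in> space P. ln \<bar>Qk (Suc k) \<omega>\<bar> > x a * b n}"
    proof -
      have "Z (Suc k) \<omega> \<in> C (Suc k) \<longleftrightarrow> (\<forall>a'\<in>A. k \<in> B a' \<longrightarrow> \<not> ln \<bar>Qk (Suc k) \<omega>\<bar> > x a' * b n)" for \<omega>
        by (simp add: C_def Z_def)
      moreover have "(\<forall>a'\<in>A. k \<in> B a' \<longrightarrow> \<not> ln \<bar>Qk (Suc k) \<omega>\<bar> > x a' * b n) \<longleftrightarrow> \<not> ln \<bar>Qk (Suc k) \<omega>\<bar> > x a * b n" for \<omega>
      proof
        assume "\<forall>a'\<in>A. k \<in> B a' \<longrightarrow> \<not> ln \<bar>Qk (Suc k) \<omega>\<bar> > x a' * b n"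
        then show "\<not> ln \<bar>Qk (Suc k) \<omega>\<bar> > x a * b n" using that by blast
      next
        assume h: "\<not> ln \<bar>Qk (Suc k) \<omega>\<bar> > x a * b n"
        show "\<forall>a'\<in>A. k \<in> B a' \<longrightarrow> \<not> ln \<bar>Qk (Suc k) \<omega>\<bar> > x a' * b n"
        proof (intro ballI impI)
          fix a' assume "a' \<in> A" "k \<in> B a'"
          with uniq have "a' = a" by blast
          with h show "\<not> ln \<bar>Qk (Suc k) \<omega>\<bar> > x a' * b n" by simp
        qed
      qed
      ultimately show ?thesis by blast
    qed
    moreover have "prob (space P - {\<omega> \<in> space P. ln \<bar>Qk (Suc k) \<omega>\<bar> > x a * b n}) = 1 - F (x a * b n)"
    proof -
      have ev: "{\<omega> \<in> space P. ln \<bar>Qk (Suc k) \<omega>\<bar> > x a * b n} \<in> events" by (rule lnQ_event) simp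
      show ?thesis unfolding prob_compl[OF ev] by (subst F_tail) auto
    qed
    ultimately show ?thesis by simp
  qed
  have ev: "{\<omega> \<in> space P. \<forall>a\<in>A. \<forall>k\<in>B a. \<not> obs_height n \<omega> k > ereal (x a)} = (\<Inter>i\<in>Suc ` J. Z i -` C i \<inter> space P) \<inter> space P"
    unfolding obs_height_gt[OF n] J_def by (auto simp: C_def Z_def)
  have prodJ: "(\<Prod>i\<in>Suc ` J. prob (Z i -` C i \<inter> space P)) = (\<Prod>a\<in>A. (1 - F (x a * b n)) ^ card (B a))"
  proof -
    have "(\<Prod>i\<in>Suc ` J. prob (Z i -` C i \<inter> space P)) = (\<Prod>k\<in>J. prob (Z (Suc k) -` C (Suc k) \<inter> space P))"
      by (subst prod.reindex) auto
    also have "\<dots> = (\<Prod>a\<in>A. \<Prod>k\<in>B a. prob (Z (Suc k) -` C (Suc k) \<inter> space P))"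
      unfolding J_def by (rule prod.UNION_disjoint) (use A B in \<open>auto simp: disjoint_family_on_def\<close>)
    also have "\<dots> = (\<Prod>a\<in>A. \<Prod>k\<in>B a. 1 - F (x a * b n))" using pk by (intro prod.cong refl) auto
    finally show ?thesis by simp
  qed
  show ?thesis
  proof (cases "J = {}")
    case True
    then have "\<forall>a\<in>A. B a = {}" by (auto simp: J_def)
    then have "{\<omega> \<in> space P. \<forall>a\<in>A. \<forall>k\<in>B a. \<not> obs_height n \<omega> k > ereal (x a)} = space P" by auto
    then show ?thesis using \<open>\<forall>a\<in>A. B a = {}\<close> by (simp add: prob_space)
  next
    case False
    have "prob (\<Inter>i\<in>Suc ` J. Z i -` C i \<inter> space P) = (\<Prod>i\<in>Suc ` J. prob (Z i -` C i \<inter> space P))"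
      by (rule indep_varsD[OF Z_indep]) (use False J Cm in auto)
    moreover have "(\<Inter>i\<in>Suc ` J. Z i -` C i \<inter> space P) \<inter> space P = (\<Inter>i\<in>Suc ` J. Z i -` C i \<inter> space P)" using False by auto
    ultimately show ?thesis unfolding ev prodJ[symmetric] by simp
  qed
qed

lemma F_scaled_0: "x > 0 \<Longrightarrow> (\<lambda>n. F (x * b n)) \<longlonglongrightarrow> 0"
proof -
  assume x: "x > 0"
  have "(\<lambda>n. real n * F (x * b n) * (1 / real n)) \<longlonglongrightarrow> x powr (- \<alpha>) * 0"
    by (intro tendsto_mult scaled_tail x lim_1_over_n)
  moreover have "\<forall>\<^sub>F n in sequentially. real n * F (x * b n) * (1 / real n) = F (x * b n)"
    using eventually_gt_at_top[of 0] by eventually_elim simp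
  ultimately show ?thesis by (auto elim: Lim_transform_eventually)
qed

text \<open>The sample analogue of the void probability: an independent product over the blocks, each with about \<open>n / m\<close>
  indices, and \<open>n F(x b n) \<rightarrow> x powr (- \<alpha>)\<close>.\<close>

lemma block_levels_obs_tendsto:
  assumes m: "m \<ge> 1" and \<eta>: "\<eta> > 0"
  shows "(\<lambda>n. prob {\<omega> \<in> space P. \<forall>a<N. block_level m R \<eta> (obs_time n) (obs_height n \<omega>) a < r a}) \<longlonglongrightarrow>
    (if \<exists>a<N. r a = 0 then 0 else exp (- (\<Sum>a\<in>{a. a < N \<and> r a \<le> R}. (real (r a) * \<eta>) powr (- \<alpha>) / real m)))"
proof (cases "\<exists>a<N. r a = 0")
  case True
  then have "{\<omega> \<in> space P. \<forall>a<N. block_level m R \<eta> (obs_time n) (obs_height n \<omega>) a < r a} = {}" for n by auto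
  then show ?thesis using True by (simp only: measure_empty if_True) simp
next
  case False
  then have r: "\<And>a. a < N \<Longrightarrow> r a \<ge> 1" by (metis One_nat_def Suc_leI neq0_conv)
  define A where "A = {a. a < N \<and> r a \<le> R}"
  have A: "finite A" by (simp add: A_def)
  have pos: "real (r a) * \<eta> > 0" if "a \<in> A" for a using r[of a] that \<eta> by (auto simp: A_def)
  have eq: "prob {\<omega> \<in> space P. \<forall>a<N. block_level m R \<eta> (obs_time n) (obs_height n \<omega>) a < r a}
     = (\<Prod>a\<in>A. (1 - F ((real (r a) * \<eta>) * b n)) ^ card (index_block m n a))" if n: "n \<ge> 1" for n
  proof -
    have "{\<omega> \<in> space P. \<forall>a<N. block_level m R \<eta> (obs_time n) (obs_height n \<omega>) a < r a}
       = {\<omega> \<in> space P. \<forall>a\<in>A. \<forall>k\<in>index_block m n a. \<not> obs_height n \<omega> k > ereal (real (r a) * \<eta>)}"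
      unfolding block_level_less_iff[OF \<eta>] block_hit_obs using r by (auto simp: A_def not_less)
    also have "prob \<dots> = (\<Prod>a\<in>A. (1 - F ((real (r a) * \<eta>) * b n)) ^ card (index_block m n a))"
    proof (rule no_large_prob[OF n A])
      show "finite (index_block m n a)" for a by (rule card_index_block(2)[OF m n])
      have "False" if "a < a'" "k \<in> index_block m n a" "k \<in> index_block m n a'" for a a' k
      proof -
        have "real a' / real m < (real a + 1) / real m" using that by (auto simp: index_block_def)
        then have "real a' < real a + 1" using m by (simp add: divide_less_cancel)
        then show False using that by simp
      qed
      then show "disjoint_family_on (index_block m n) A"
        unfolding disjoint_family_on_def by (metis disjoint_iff linorder_neqE_nat)
    qed
    finally show ?thesis .
  qed
  have "(\<lambda>n. \<Prod>a\<in>A. (1 - F ((real (r a) * \<eta>) * b n)) ^ card (index_block m n a)) \<longlonglongrightarrow>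
     (\<Prod>a\<in>A. exp (- ((real (r a) * \<eta>) powr (- \<alpha>) / real m)))"
    by (intro tendsto_prod power_one_minus_tendsto_exp card_index_block_times nonneg F_scaled_0 scaled_tail pos m)
  moreover have "(\<Prod>a\<in>A. exp (- ((real (r a) * \<eta>) powr (- \<alpha>) / real m))) = exp (- (\<Sum>a\<in>A. (real (r a) * \<eta>) powr (- \<alpha>) / real m))"
    using A by (simp add: exp_sum[symmetric] sum_negf)
  moreover have "\<forall>\<^sub>F n in sequentially. (\<Prod>a\<in>A. (1 - F ((real (r a) * \<eta>) * b n)) ^ card (index_block m n a)) =
     prob {\<omega> \<in> space P. \<forall>a<N. block_level m R \<eta> (obs_time n) (obs_height n \<omega>) a < r a}"
    using eventually_ge_at_top[of 1] by eventually_elim (rule eq[symmetric])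
  ultimately show ?thesis unfolding if_not_P[OF False] A_def[symmetric] by (auto elim: Lim_transform_eventually)
qed

end

section \<open>Sums dominated by their largest term\<close>

lemma powr_neg_diff_le:
  fixes \<alpha> a x h :: real
  assumes "0 < a" "a \<le> x" "0 \<le> h" "0 < \<alpha>"
  shows "x powr (- \<alpha>) - (x + h) powr (- \<alpha>) \<le> h * (\<alpha> * a powr (- \<alpha> - 1))" "(x + h) powr (- \<alpha>) \<le> x powr (- \<alpha>)"
proof -
  show le: "(x + h) powr (- \<alpha>) \<le> x powr (- \<alpha>)" using assms by (intro powr_mono2') auto
  show "x powr (- \<alpha>) - (x + h) powr (- \<alpha>) \<le> h * (\<alpha> * a powr (- \<alpha> - 1))"
  proof (cases "h = 0")
    case False
    have "\<exists>z. x < z \<and> z < x + h \<and> (x + h) powr (- \<alpha>) - x powr (- \<alpha>) = (x + h - x) * (- \<alpha> * z powr (- \<alpha> - 1))"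
      by (rule MVT2) (use assms False in \<open>auto intro!: derivative_eq_intros\<close>)
    then obtain z where z: "x < z" "(x + h) powr (- \<alpha>) - x powr (- \<alpha>) = h * (- \<alpha> * z powr (- \<alpha> - 1))" by auto
    have "z powr (- \<alpha> - 1) \<le> a powr (- \<alpha> - 1)" using assms z by (intro powr_mono2') auto
    then have "h * (\<alpha> * z powr (- \<alpha> - 1)) \<le> h * (\<alpha> * a powr (- \<alpha> - 1))" using assms by (intro mult_left_mono) auto
    then show ?thesis using z(2) by simp
  qed simp
qed

text \<open>Deterministic comparison of \<open>ln \<bar>W\<bar> / b\<close> with the record \<open>v\<close>. If \<open>v > 2a\<close>, all other terms are smaller than
  the largest one by the factor \<open>exp (\<kappa> b)\<close>, up to the errors \<open>exp (2 \<delta> b)\<close> of the coefficients and \<open>exp (\<delta> b)\<close> for the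
  number of terms; \<open>6 \<delta> \<le> \<kappa>\<close> absorbs these. If \<open>v \<le> 2a\<close>, only a lower bound for \<open>\<bar>W\<bar>\<close> is needed, which is assumed
  unless \<open>W = 0\<close>; in that case \<open>ln \<bar>W\<bar> = 0\<close> by convention.\<close>

lemma log_sum_near_max:
  fixes q c :: "nat \<Rightarrow> real" and b v \<delta> \<kappa> a e1 c0 :: real
  assumes b: "b > 0" and \<delta>: "\<delta> > 0" "6 * \<delta> \<le> \<kappa>" and \<kappa>: "\<kappa> \<le> a"
    and k: "real k + 1 \<le> exp (\<delta> * b)" "2 \<le> exp (\<delta> * b)"
    and c0: "\<bar>c0\<bar> \<le> exp (2 * \<delta> * b)"
    and c: "\<And>i. i \<in> {1..k} \<Longrightarrow> exp (- (2 * \<delta> * b)) \<le> \<bar>c i\<bar>" "\<And>i. i \<in> {1..k} \<Longrightarrow> \<bar>c i\<bar> \<le> exp (2 * \<delta> * b)"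
    and v: "v \<ge> 0" "\<And>i. i \<in> {1..k} \<Longrightarrow> ln \<bar>q i\<bar> \<le> v * b" "v = 0 \<or> (\<exists>i\<in>{1..k}. ln \<bar>q i\<bar> = v * b)"
    and gap: "\<And>i i'. i \<in> {1..k} \<Longrightarrow> i' \<in> {1..k} \<Longrightarrow> i \<noteq> i' \<Longrightarrow> ln \<bar>q i\<bar> > a * b \<Longrightarrow> ln \<bar>q i'\<bar> > a * b \<Longrightarrow>
        \<bar>ln \<bar>q i\<bar> - ln \<bar>q i'\<bar>\<bar> > \<kappa> * b"
    and W: "W = c0 + (\<Sum>i=1..k. c i * q i)"
    and e1: "e1 \<ge> 0" and dip: "W \<noteq> 0 \<Longrightarrow> \<bar>W\<bar> > exp (- e1 * b)"
  shows "\<bar>ln \<bar>W\<bar> / b - v\<bar> \<le> 2 * a + e1 + 3 * \<delta>"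
proof -
  have a: "a > 0" using \<delta> \<kappa> by linarith
  have summand: "\<bar>c i * q i\<bar> \<le> exp ((x + 2 * \<delta>) * b)" if i: "i \<in> {1..k}" and x: "ln \<bar>q i\<bar> \<le> x * b" for i x
  proof -
    have "\<bar>q i\<bar> \<le> exp (x * b)"
    proof (cases "q i = 0")
      case False
      then have "\<bar>q i\<bar> = exp (ln \<bar>q i\<bar>)" by simp
      also have "\<dots> \<le> exp (x * b)" using x by simp
      finally show ?thesis .
    qed simp
    then have "\<bar>c i\<bar> * \<bar>q i\<bar> \<le> exp (2 * \<delta> * b) * exp (x * b)" using c(2)[OF i] by (intro mult_mono) auto
    also have "\<dots> = exp ((x + 2 * \<delta>) * b)" by (simp add: exp_add[symmetric] algebra_simps)
    finally show ?thesis by (simp add: abs_mult)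
  qed
  have upper: "\<bar>W\<bar> \<le> exp ((v + 3 * \<delta>) * b)"
  proof -
    have "\<bar>W\<bar> \<le> \<bar>c0\<bar> + (\<Sum>i=1..k. \<bar>c i * q i\<bar>)" unfolding W by (rule order_trans[OF abs_triangle_ineq]) (intro add_left_mono sum_abs)
    also have "\<dots> \<le> exp ((v + 2 * \<delta>) * b) + (\<Sum>i=1..k. exp ((v + 2 * \<delta>) * b))"
    proof (intro add_mono sum_mono summand v(2))
      have "exp (2 * \<delta> * b) \<le> exp ((v + 2 * \<delta>) * b)" using v(1) b by (simp add: algebra_simps)
      with c0 show "\<bar>c0\<bar> \<le> exp ((v + 2 * \<delta>) * b)" by (rule order_trans)
    qed auto
    also have "\<dots> = (real k + 1) * exp ((v + 2 * \<delta>) * b)" by (simp add: algebra_simps)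
    also have "\<dots> \<le> exp (\<delta> * b) * exp ((v + 2 * \<delta>) * b)" using k by (intro mult_right_mono) auto
    also have "\<dots> = exp ((v + 3 * \<delta>) * b)" by (simp add: exp_add[symmetric] algebra_simps)
    finally show ?thesis .
  qed
  have up: "ln \<bar>W\<bar> / b \<le> v + 3 * \<delta>"
  proof (cases "W = 0")
    case False
    then have "ln \<bar>W\<bar> \<le> ln (exp ((v + 3 * \<delta>) * b))" using upper by (subst ln_le_cancel_iff) auto
    then have "ln \<bar>W\<bar> \<le> (v + 3 * \<delta>) * b" by simp
    then show ?thesis using b by (simp add: pos_divide_le_eq)
  qed (use v \<delta> in auto)
  have low: "ln \<bar>W\<bar> / b \<ge> v - 2 * a - e1 - 3 * \<delta>"
  proof (cases "v > 2 * a")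
    case False
    show ?thesis
    proof (cases "W = 0")
      case True then show ?thesis using False e1 \<delta> by simp
    next
      case W0: False
      have "exp (- e1 * b) < \<bar>W\<bar>" by (rule dip[OF W0])
      then have "- e1 * b < ln \<bar>W\<bar>" using W0 by (subst exp_less_cancel_iff[symmetric]) simp
      then have "- e1 < ln \<bar>W\<bar> / b" using b by (simp add: pos_less_divide_eq)
      then show ?thesis using False \<delta> by linarith
    qed
  next
    case True
    then obtain i0 where i0: "i0 \<in> {1..k}" "ln \<bar>q i0\<bar> = v * b" using v(3) a by auto
    have "ln \<bar>q i0\<bar> > 0" using i0 True a b by simp
    then have "q i0 \<noteq> 0" by auto
    then have q0: "\<bar>q i0\<bar> = exp (v * b)" using i0(2) by (metis exp_ln zero_less_abs_iff)
    have rest: "ln \<bar>q i\<bar> \<le> (v - \<kappa>) * b" if i: "i \<in> {1..k}" "i \<noteq> i0" for i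
    proof (cases "ln \<bar>q i\<bar> > a * b")
      case False
      have "a * b \<le> (v - \<kappa>) * b" using True \<kappa> b by (intro mult_right_mono) auto
      then show ?thesis using False by linarith
    next
      case big: True
      have "a * b < v * b" using True a b by (intro mult_strict_right_mono) auto
      then have "\<bar>ln \<bar>q i\<bar> - ln \<bar>q i0\<bar>\<bar> > \<kappa> * b" using gap[OF i(1) i0(1) i(2) big] i0(2) by simp
      then show ?thesis using v(2)[OF i(1)] i0(2) by (simp add: algebra_simps abs_if split: if_splits)
    qed
    have bound: "\<bar>W - c i0 * q i0\<bar> \<le> exp ((v - 3 * \<delta>) * b)"
    proof -
      have "W - c i0 * q i0 = c0 + (\<Sum>i\<in>{1..k} - {i0}. c i * q i)" unfolding W using i0(1) by (simp add: sum.remove)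
      then have "\<bar>W - c i0 * q i0\<bar> \<le> \<bar>c0\<bar> + (\<Sum>i\<in>{1..k} - {i0}. \<bar>c i * q i\<bar>)"
        using abs_triangle_ineq[of c0 "\<Sum>i\<in>{1..k} - {i0}. c i * q i"] sum_abs[of "\<lambda>i. c i * q i" "{1..k} - {i0}"] by linarith
      also have "\<dots> \<le> exp ((v - \<kappa> + 2 * \<delta>) * b) + (\<Sum>i\<in>{1..k} - {i0}. exp ((v - \<kappa> + 2 * \<delta>) * b))"
      proof (intro add_mono sum_mono summand rest)
        have "2 * \<delta> * b \<le> (v - \<kappa> + 2 * \<delta>) * b" using True \<kappa> a b by (intro mult_right_mono) auto
        then have "exp (2 * \<delta> * b) \<le> exp ((v - \<kappa> + 2 * \<delta>) * b)" by simp
        then show "\<bar>c0\<bar> \<le> exp ((v - \<kappa> + 2 * \<delta>) * b)" using c0 by linarith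
      qed auto
      also have "\<dots> = (1 + real (card ({1..k} - {i0}))) * exp ((v - \<kappa> + 2 * \<delta>) * b)" by (simp add: algebra_simps)
      also have "\<dots> \<le> (real k + 1) * exp ((v - \<kappa> + 2 * \<delta>) * b)" using i0(1) by (intro mult_right_mono) auto
      also have "\<dots> \<le> exp (\<delta> * b) * exp ((v - \<kappa> + 2 * \<delta>) * b)" using k by (intro mult_right_mono) auto
      also have "\<dots> = exp ((v - \<kappa> + 3 * \<delta>) * b)" by (simp add: exp_add[symmetric] algebra_simps)
      also have "\<dots> \<le> exp ((v - 3 * \<delta>) * b)" using \<delta> b by simp
      finally show ?thesis .
    qed
    have "\<bar>c i0 * q i0\<bar> \<ge> exp ((v - 2 * \<delta>) * b)"
    proof -
      have "exp ((v - 2 * \<delta>) * b) = exp (- (2 * \<delta> * b)) * exp (v * b)" by (simp add: exp_add[symmetric] algebra_simps)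
      also have "\<dots> \<le> \<bar>c i0\<bar> * exp (v * b)" using c(1)[OF i0(1)] by (intro mult_right_mono) auto
      finally show ?thesis by (simp add: abs_mult q0)
    qed
    moreover have "exp ((v - 2 * \<delta>) * b) \<ge> 2 * exp ((v - 3 * \<delta>) * b)"
    proof -
      have "exp ((v - 2 * \<delta>) * b) = exp (\<delta> * b) * exp ((v - 3 * \<delta>) * b)" by (simp add: exp_add[symmetric] algebra_simps)
      then show ?thesis using k(2) by simp
    qed
    ultimately have "\<bar>W\<bar> \<ge> exp ((v - 3 * \<delta>) * b)" using bound by linarith
    then have "ln \<bar>W\<bar> \<ge> (v - 3 * \<delta>) * b"
    proof -
      assume h: "exp ((v - 3 * \<delta>) * b) \<le> \<bar>W\<bar>"
      then have "\<bar>W\<bar> > 0" by (meson exp_gt_zero less_le_trans)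
      then show ?thesis using h by (subst ln_ge_iff) auto
    qed
    then have "ln \<bar>W\<bar> / b \<ge> v - 3 * \<delta>" using b by (simp add: pos_le_divide_eq)
    then show ?thesis using a e1 by linarith
  qed
  show ?thesis using up low a e1 by (simp add: abs_le_iff)
qed

section \<open>Configurations without coinciding large points\<close>

text \<open>The hypotheses of \<open>running_sup_near_grid_path\<close>: no large point at the start, no two large points in one
  block, and no point above the cap of the block levels.\<close>

definition tame_blocks :: "nat \<Rightarrow> nat \<Rightarrow> nat \<Rightarrow> real \<Rightarrow> (nat \<Rightarrow> real) \<Rightarrow> (nat \<Rightarrow> ereal) \<Rightarrow> bool" where
  "tame_blocks m N R \<eta> t j \<longleftrightarrow> \<not> block_hit m t j 0 \<eta> \<and>
    (\<forall>a<N. \<forall>k k'. real a / real m \<le> t k \<longrightarrow> t k < (real a + 1) / real m \<longrightarrow> j k > ereal \<eta> \<longrightarrow>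
        real a / real m \<le> t k' \<longrightarrow> t k' < (real a + 1) / real m \<longrightarrow> j k' > ereal \<eta> \<longrightarrow> k = k') \<and>
    (\<forall>k. t k < real N / real m \<longrightarrow> j k \<le> ereal ((real R + 1) * \<eta>))"

text \<open>The union bound for a failure of one of the three conditions, one summand for each of them.\<close>

definition tame_rate :: "real \<Rightarrow> nat \<Rightarrow> nat \<Rightarrow> nat \<Rightarrow> real \<Rightarrow> real" where
  "tame_rate \<alpha> m N R \<eta> = \<eta> powr (- \<alpha>) / real m + real N * (\<eta> powr (- \<alpha>) / real m)\<^sup>2
     + real N * (((real R + 1) * \<eta>) powr (- \<alpha>) / real m)"

lemma tame_rate_tendsto_0:
  assumes \<eta>: "\<eta> > 0" and \<alpha>: "\<alpha> > 0"
  shows "(\<lambda>m. tame_rate \<alpha> m (m * K) m \<eta>) \<longlonglongrightarrow> 0"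
proof -
  define p where "p = \<eta> powr (- \<alpha>)"
  have "(\<lambda>m. (p + real K * p\<^sup>2) * (1 / real m) + real K * ((real m + 1) * \<eta>) powr (- \<alpha>)) \<longlonglongrightarrow> (p + real K * p\<^sup>2) * 0 + real K * 0"
  proof (intro tendsto_add tendsto_mult tendsto_const lim_1_over_n)
    have "filterlim (\<lambda>m. (real m + 1) * \<eta>) at_top sequentially"
      by (rule filterlim_at_top_mult_tendsto_pos[OF tendsto_const \<eta>],
          rule filterlim_at_top_mono[OF filterlim_real_sequentially]) simp
    then show "(\<lambda>m. ((real m + 1) * \<eta>) powr (- \<alpha>)) \<longlonglongrightarrow> 0" using \<alpha> by (intro tendsto_neg_powr) auto
  qed
  moreover have "\<forall>\<^sub>F m in sequentially. (p + real K * p\<^sup>2) * (1 / real m) + real K * ((real m + 1) * \<eta>) powr (- \<alpha>) = tame_rate \<alpha> m (m * K) m \<eta>"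
    using eventually_gt_at_top[of 0]
    by eventually_elim (simp add: tame_rate_def p_def[symmetric] field_simps power2_eq_square)
  ultimately show ?thesis by (auto elim: Lim_transform_eventually)
qed

text \<open>Union bound over the blocks.\<close>

lemma (in prm_pareto) tame_blocks_prm:
  assumes m: "m \<ge> 1" and \<eta>: "\<eta> > 0"
  obtains B where "B \<in> events" "prob B \<le> tame_rate \<alpha> m N R \<eta>"
    "\<And>\<omega>. \<omega> \<in> space S - B \<Longrightarrow> tame_blocks m N R \<eta> (\<lambda>k. t k \<omega>) (\<lambda>k. j k \<omega>)"
proof -
  define A where "A a x = {real a / real m..<(real a + 1) / real m} \<times> {ereal x<..}" for a x
  have pos: "0 \<le> real a / real m" "real a / real m \<le> (real a + 1) / real m" for a by (auto simp: divide_right_mono)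
  have len: "(real a + 1) / real m - real a / real m = 1 / real m" for a by (simp add: diff_divide_distrib[symmetric])
  have A: "A a x \<in> sets E" "emeasure E (A a x) < \<infinity>" "measure E (A a x) = x powr (- \<alpha>) / real m" if "x > 0" for a x
    unfolding A_def using rectangle(1)[OF pos that] rectangle_measure[OF pos that] by (auto simp: len)
  have x3: "(real R + 1) * \<eta> > 0" using \<eta> by simp
  define B1 where "B1 = {\<omega> \<in> space S. \<exists>k. (t k \<omega>, j k \<omega>) \<in> A 0 \<eta>}"
  have B1: "B1 \<in> events" "prob B1 \<le> \<eta> powr (- \<alpha>) / real m"
    unfolding B1_def using hit_prob_le[OF A(1,2)[OF \<eta>], of 0] A(3)[OF \<eta>, of 0] by auto
  have "\<exists>B. B \<in> events \<and> prob B \<le> (\<eta> powr (- \<alpha>) / real m)\<^sup>2 \<and>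
    (\<forall>\<omega> k k'. \<omega> \<in> space S - B \<longrightarrow> (t k \<omega>, j k \<omega>) \<in> A a \<eta> \<longrightarrow> (t k' \<omega>, j k' \<omega>) \<in> A a \<eta> \<longrightarrow> k = k')" for a
    using two_points_prob_le[OF A(1,2)[OF \<eta>], of a] unfolding A(3)[OF \<eta>] by metis
  then obtain B2 where B2: "\<And>a. B2 a \<in> events" "\<And>a. prob (B2 a) \<le> (\<eta> powr (- \<alpha>) / real m)\<^sup>2"
    "\<And>a \<omega> k k'. \<omega> \<in> space S - B2 a \<Longrightarrow> (t k \<omega>, j k \<omega>) \<in> A a \<eta> \<Longrightarrow> (t k' \<omega>, j k' \<omega>) \<in> A a \<eta> \<Longrightarrow> k = k'" by metis
  define B3 where "B3 a = {\<omega> \<in> space S. \<exists>k. (t k \<omega>, j k \<omega>) \<in> A a ((real R + 1) * \<eta>)}" for a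
  have B3: "B3 a \<in> events" "prob (B3 a) \<le> ((real R + 1) * \<eta>) powr (- \<alpha>) / real m" for a
    unfolding B3_def using hit_prob_le[OF A(1,2)[OF x3], of a] A(3)[OF x3, of a] by auto
  define B where "B = B1 \<union> ((\<Union>a<N. B2 a) \<union> (\<Union>a<N. B3 a))"
  show thesis
  proof (rule that[of B])
    show "B \<in> events" using B1 B2(1) B3(1) by (auto simp: B_def)
    have "prob B \<le> prob B1 + (prob (\<Union>a<N. B2 a) + prob (\<Union>a<N. B3 a))"
      unfolding B_def by (rule order_trans[OF measure_Un_le add_left_mono[OF measure_Un_le]]) (use B1 B2(1) B3(1) in auto)
    also have "\<dots> \<le> \<eta> powr (- \<alpha>) / real m + ((\<Sum>a<N. (\<eta> powr (- \<alpha>) / real m)\<^sup>2) + (\<Sum>a<N. ((real R + 1) * \<eta>) powr (- \<alpha>) / real m))"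
    proof (intro add_mono B1(2))
      show "prob (\<Union>a<N. B2 a) \<le> (\<Sum>a<N. (\<eta> powr (- \<alpha>) / real m)\<^sup>2)"
        by (rule order_trans[OF measure_UNION_le sum_mono[OF B2(2)]]) (use B2(1) in auto)
      show "prob (\<Union>a<N. B3 a) \<le> (\<Sum>a<N. ((real R + 1) * \<eta>) powr (- \<alpha>) / real m)"
        by (rule order_trans[OF measure_UNION_le sum_mono[OF B3(2)]]) (use B3(1) in auto)
    qed
    finally show "prob B \<le> tame_rate \<alpha> m N R \<eta>" by (simp add: tame_rate_def)
    fix \<omega> assume w: "\<omega> \<in> space S - B"
    have "\<not> block_hit m (\<lambda>k. t k \<omega>) (\<lambda>k. j k \<omega>) 0 \<eta>"
      using w by (auto simp: B_def B1_def A_def block_hit_def)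
    moreover have "k = k'" if "a < N" "real a / real m \<le> t k \<omega>" "t k \<omega> < (real a + 1) / real m" "j k \<omega> > ereal \<eta>"
        "real a / real m \<le> t k' \<omega>" "t k' \<omega> < (real a + 1) / real m" "j k' \<omega> > ereal \<eta>" for a k k'
      by (rule B2(3)[of \<omega> a]) (use w that in \<open>auto simp: B_def A_def\<close>)
    moreover have "j k \<omega> \<le> ereal ((real R + 1) * \<eta>)" if k: "t k \<omega> < real N / real m" for k
    proof -
      define a where "a = nat \<lfloor>real m * t k \<omega>\<rfloor>"
      have t0: "t k \<omega> \<ge> 0" using points w by auto
      then have "0 \<le> \<lfloor>real m * t k \<omega>\<rfloor>" by simp
      then have "real a = of_int \<lfloor>real m * t k \<omega>\<rfloor>" by (simp add: a_def)
      then have a: "real a \<le> real m * t k \<omega>" "real m * t k \<omega> < real a + 1" by linarith+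
      then have blk: "real a / real m \<le> t k \<omega>" "t k \<omega> < (real a + 1) / real m" using m by (auto simp: field_simps)
      have "real m * t k \<omega> < real N" using k m by (simp add: field_simps)
      then have "a < N" using a by linarith
      then have "\<omega> \<notin> B3 a" using w by (auto simp: B_def)
      then show ?thesis using blk w by (auto simp: B3_def A_def not_less)
    qed
    ultimately show "tame_blocks m N R \<eta> (\<lambda>k. t k \<omega>) (\<lambda>k. j k \<omega>)" unfolding tame_blocks_def by blast
  qed
qed

context heavy_perpetuity
begin

lemma pair_prob:
  assumes "i \<ge> 1" "i' \<ge> 1" "i \<noteq> i'" and A: "A \<in> sets borel"
  shows "{\<omega> \<in> space P. ln \<bar>Qk i \<omega>\<bar> \<in> A \<and> ln \<bar>Qk i' \<omega>\<bar> \<in> A} \<in> events"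
    "prob {\<omega> \<in> space P. ln \<bar>Qk i \<omega>\<bar> \<in> A \<and> ln \<bar>Qk i' \<omega>\<bar> \<in> A} =
     prob {\<omega> \<in> space P. ln \<bar>Qk i \<omega>\<bar> \<in> A} * prob {\<omega> \<in> space P. ln \<bar>Qk i' \<omega>\<bar> \<in> A}"
proof -
  have [measurable]: "random_variable borel (Qk i)" "random_variable borel (Qk i')" by (rule Qk_rv; fact)+
  note A[measurable]
  show "{\<omega> \<in> space P. ln \<bar>Qk i \<omega>\<bar> \<in> A \<and> ln \<bar>Qk i' \<omega>\<bar> \<in> A} \<in> events" by measurable
  define C where "C = (\<lambda>z :: real \<times> real. ln \<bar>snd z\<bar>) -` A"
  have C: "C \<in> sets borel"
  proof -
    have "(\<lambda>z :: real \<times> real. ln \<bar>snd z\<bar>) \<in> borel_measurable borel"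
      by (intro borel_measurable_ln borel_measurable_abs borel_measurable_snd_real)
    from measurable_sets[OF this A] show ?thesis by (simp add: C_def)
  qed
  have "prob (\<Inter>k\<in>{i, i'}. Z k -` C \<inter> space P) = (\<Prod>k\<in>{i, i'}. prob (Z k -` C \<inter> space P))"
    by (rule indep_varsD[OF Z_indep]) (use C in auto)
  moreover have "Z k -` C \<inter> space P = {\<omega> \<in> space P. ln \<bar>Qk k \<omega>\<bar> \<in> A}" if "k \<ge> 1" for k
    using that by (auto simp: Z_def C_def)
  moreover have "(\<Inter>k\<in>{i, i'}. Z k -` C \<inter> space P) = {\<omega> \<in> space P. ln \<bar>Qk i \<omega>\<bar> \<in> A \<and> ln \<bar>Qk i' \<omega>\<bar> \<in> A}"
    using assms by (auto simp: Z_def C_def)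
  ultimately show "prob {\<omega> \<in> space P. ln \<bar>Qk i \<omega>\<bar> \<in> A \<and> ln \<bar>Qk i' \<omega>\<bar> \<in> A} =
     prob {\<omega> \<in> space P. ln \<bar>Qk i \<omega>\<bar> \<in> A} * prob {\<omega> \<in> space P. ln \<bar>Qk i' \<omega>\<bar> \<in> A}" using assms by simp
qed

text \<open>There are at most \<open>(card J)\<^sup>2\<close> pairs, and each of them has probability \<open>x\<^sup>2\<close>.\<close>

lemma two_in_set_prob:
  assumes J: "finite J" "\<And>i. i \<in> J \<Longrightarrow> i \<ge> 1" and A: "A \<in> sets borel"
    and x: "\<And>i. i \<in> J \<Longrightarrow> prob {\<omega> \<in> space P. ln \<bar>Qk i \<omega>\<bar> \<in> A} = x"
  defines "B \<equiv> {\<omega> \<in> space P. \<exists>i\<in>J. \<exists>i'\<in>J. i \<noteq> i' \<and> ln \<bar>Qk i \<omega>\<bar> \<in> A \<and> ln \<bar>Qk i' \<omega>\<bar> \<in> A}"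
  shows "B \<in> events" "prob B \<le> (real (card J) * x)\<^sup>2"
proof -
  define D where "D i i' = {\<omega> \<in> space P. ln \<bar>Qk i \<omega>\<bar> \<in> A \<and> ln \<bar>Qk i' \<omega>\<bar> \<in> A}" for i i'
  have B: "B = (\<Union>i\<in>J. \<Union>i'\<in>J - {i}. D i i')" by (auto simp: B_def D_def)
  have D: "D i i' \<in> events" "prob (D i i') = x * x" if "i \<in> J" "i' \<in> J - {i}" for i i'
    unfolding D_def using pair_prob[OF J(2) J(2) _ A, of i i'] x that by auto
  show "B \<in> events" unfolding B using J(1) D(1) by (intro sets.finite_UN) auto
  have "prob B \<le> (\<Sum>i\<in>J. prob (\<Union>i'\<in>J - {i}. D i i'))"
    unfolding B by (rule measure_UNION_le[OF J(1)]) (use J(1) D(1) in \<open>auto intro!: sets.finite_UN\<close>)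
  also have "\<dots> \<le> (\<Sum>i\<in>J. \<Sum>i'\<in>J - {i}. prob (D i i'))"
    by (intro sum_mono measure_UNION_le) (use J(1) D(1) in auto)
  also have "\<dots> \<le> (\<Sum>i\<in>J. \<Sum>i'\<in>J. x * x)"
  proof (rule sum_mono)
    fix i assume i: "i \<in> J"
    have "(\<Sum>i'\<in>J - {i}. prob (D i i')) = (\<Sum>i'\<in>J - {i}. x * x)" by (rule sum.cong) (use D(2) i in auto)
    also have "\<dots> \<le> (\<Sum>i'\<in>J. x * x)" by (rule sum_mono2) (use J in auto)
    finally show "(\<Sum>i'\<in>J - {i}. prob (D i i')) \<le> (\<Sum>i'\<in>J. x * x)" .
  qed
  also have "\<dots> = (real (card J) * x)\<^sup>2" by (simp add: power2_eq_square)
  finally show "prob B \<le> (real (card J) * x)\<^sup>2" .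
qed

lemma large_value_prob:
  assumes J: "finite J" "\<And>i. i \<in> J \<Longrightarrow> i \<ge> 1"
  shows "{\<omega> \<in> space P. \<exists>i\<in>J. ln \<bar>Qk i \<omega>\<bar> > x} \<in> events" "prob {\<omega> \<in> space P. \<exists>i\<in>J. ln \<bar>Qk i \<omega>\<bar> > x} \<le> real (card J) * F x"
proof -
  have eq: "{\<omega> \<in> space P. \<exists>i\<in>J. ln \<bar>Qk i \<omega>\<bar> > x} = (\<Union>i\<in>J. {\<omega> \<in> space P. ln \<bar>Qk i \<omega>\<bar> > x})" by auto
  have ev: "{\<omega> \<in> space P. ln \<bar>Qk i \<omega>\<bar> > x} \<in> events" if "i \<in> J" for i by (rule lnQ_event[OF J(2)[OF that]])
  show "{\<omega> \<in> space P. \<exists>i\<in>J. ln \<bar>Qk i \<omega>\<bar> > x} \<in> events" unfolding eq by (intro sets.finite_UN J(1) ev)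
  have "prob (\<Union>i\<in>J. {\<omega> \<in> space P. ln \<bar>Qk i \<omega>\<bar> > x}) \<le> (\<Sum>i\<in>J. prob {\<omega> \<in> space P. ln \<bar>Qk i \<omega>\<bar> > x})"
    by (rule measure_UNION_le[OF J(1) ev])
  also have "\<dots> = (\<Sum>i\<in>J. F x)" by (rule sum.cong[OF refl F_tail[OF J(2)]])
  finally show "prob {\<omega> \<in> space P. \<exists>i\<in>J. ln \<bar>Qk i \<omega>\<bar> > x} \<le> real (card J) * F x" unfolding eq by simp
qed

text \<open>The union bound for the sample converges to the one for the Poisson points.\<close>

lemma tame_blocks_obs:
  assumes m: "m \<ge> 1" and \<eta>: "\<eta> > 0" and \<gamma>: "\<gamma> > tame_rate \<alpha> m N R \<eta>"
  obtains B where "\<And>n. n \<ge> 1 \<Longrightarrow> B n \<in> events" "\<forall>\<^sub>F n in sequentially. prob (B n) < \<gamma>"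
    "\<And>n \<omega>. n \<ge> 1 \<Longrightarrow> \<omega> \<in> space P - B n \<Longrightarrow> tame_blocks m N R \<eta> (obs_time n) (obs_height n \<omega>)"
proof -
  have x3: "(real R + 1) * \<eta> > 0" using \<eta> by simp
  define B1 where "B1 n = {\<omega> \<in> space P. \<exists>i\<in>Suc ` index_block m n 0. ln \<bar>Qk i \<omega>\<bar> > \<eta> * b n}" for n
  define B2 where "B2 n a = {\<omega> \<in> space P. \<exists>i\<in>Suc ` index_block m n a. \<exists>i'\<in>Suc ` index_block m n a. i \<noteq> i' \<and> ln \<bar>Qk i \<omega>\<bar> \<in> {\<eta> * b n<..} \<and> ln \<bar>Qk i' \<omega>\<bar> \<in> {\<eta> * b n<..}}" for n a
  define B3 where "B3 n a = {\<omega> \<in> space P. \<exists>i\<in>Suc ` index_block m n a. ln \<bar>Qk i \<omega>\<bar> > (real R + 1) * \<eta> * b n}" for n a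
  have fin: "finite (Suc ` index_block m n a)" if "n \<ge> 1" for n a using card_index_block(2)[OF m that] by simp
  have card: "card (Suc ` index_block m n a) = card (index_block m n a)" for n a by (rule card_image) simp
  have ge1: "i \<ge> 1" if "i \<in> Suc ` index_block m n a" for i n a using that by auto
  have B1: "B1 n \<in> events" "prob (B1 n) \<le> real (card (index_block m n 0)) * F (\<eta> * b n)" if "n \<ge> 1" for n
    unfolding B1_def card[symmetric] by (rule large_value_prob[OF fin[OF that] ge1]; assumption)+
  have B2: "B2 n a \<in> events" "prob (B2 n a) \<le> (real (card (index_block m n a)) * F (\<eta> * b n))\<^sup>2" if n: "n \<ge> 1" for n a
  proof -
    have x: "prob {\<omega> \<in> space P. ln \<bar>Qk i \<omega>\<bar> \<in> {\<eta> * b n<..}} = F (\<eta> * b n)" if "i \<in> Suc ` index_block m n a" for i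
      using F_tail[OF ge1[OF that]] by simp
    show "B2 n a \<in> events" "prob (B2 n a) \<le> (real (card (index_block m n a)) * F (\<eta> * b n))\<^sup>2"
      unfolding B2_def card[symmetric] by (rule two_in_set_prob[OF fin[OF n] ge1 _ x]; (assumption | simp))+
  qed
  have B3: "B3 n a \<in> events" "prob (B3 n a) \<le> real (card (index_block m n a)) * F ((real R + 1) * \<eta> * b n)" if "n \<ge> 1" for n a
    unfolding B3_def card[symmetric] by (rule large_value_prob[OF fin[OF that] ge1]; assumption)+
  define B where "B n = B1 n \<union> ((\<Union>a<N. B2 n a) \<union> (\<Union>a<N. B3 n a))" for n
  define bd where "bd n = real (card (index_block m n 0)) * F (\<eta> * b n) +
    ((\<Sum>a<N. (real (card (index_block m n a)) * F (\<eta> * b n))\<^sup>2) + (\<Sum>a<N. real (card (index_block m n a)) * F ((real R + 1) * \<eta> * b n)))" for n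
  have lim: "(\<lambda>n. real (card (index_block m n a)) * F (x * b n)) \<longlonglongrightarrow> x powr (- \<alpha>) / real m" if "x > 0" for a x
    by (rule card_index_block_times[OF m scaled_tail[OF that] F_scaled_0[OF that] nonneg])
  have "bd \<longlonglongrightarrow> \<eta> powr (- \<alpha>) / real m + ((\<Sum>a<N. (\<eta> powr (- \<alpha>) / real m)\<^sup>2) + (\<Sum>a<N. ((real R + 1) * \<eta>) powr (- \<alpha>) / real m))"
    unfolding bd_def by (intro tendsto_add tendsto_sum tendsto_power lim \<eta> x3)
  then have "bd \<longlonglongrightarrow> tame_rate \<alpha> m N R \<eta>" by (simp add: tame_rate_def add.assoc)
  then have ev: "\<forall>\<^sub>F n in sequentially. bd n < \<gamma>" using \<gamma> by (rule order_tendstoD)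
  show thesis
  proof (rule that[of B])
    show Bm: "B n \<in> events" if "n \<ge> 1" for n using B1(1) B2(1) B3(1) that by (auto simp: B_def)
    show "\<forall>\<^sub>F n in sequentially. prob (B n) < \<gamma>"
      using ev eventually_ge_at_top[of 1]
    proof eventually_elim
      case (elim n)
      have "prob (B n) \<le> prob (B1 n) + (prob (\<Union>a<N. B2 n a) + prob (\<Union>a<N. B3 n a))"
        unfolding B_def by (rule order_trans[OF measure_Un_le add_left_mono[OF measure_Un_le]]) (use B1 B2(1) B3(1) elim in auto)
      also have "\<dots> \<le> bd n" unfolding bd_def
      proof (intro add_mono B1(2) elim(2))
        show "prob (\<Union>a<N. B2 n a) \<le> (\<Sum>a<N. (real (card (index_block m n a)) * F (\<eta> * b n))\<^sup>2)"
          by (rule order_trans[OF measure_UNION_le sum_mono[OF B2(2)]]) (use B2(1) elim in auto)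
        show "prob (\<Union>a<N. B3 n a) \<le> (\<Sum>a<N. real (card (index_block m n a)) * F ((real R + 1) * \<eta> * b n))"
          by (rule order_trans[OF measure_UNION_le sum_mono[OF B3(2)]]) (use B3(1) elim in auto)
      qed
      finally show ?case using elim by simp
    qed
    fix n \<omega> assume n: "n \<ge> 1" and w: "\<omega> \<in> space P - B n"
    note gt = obs_height_gt[OF n]
    have "\<not> block_hit m (obs_time n) (obs_height n \<omega>) 0 \<eta>"
      using w unfolding block_hit_obs gt by (auto simp: B_def B1_def)
    moreover have "k = k'" if a: "a < N" and k: "real a / real m \<le> obs_time n k" "obs_time n k < (real a + 1) / real m" "obs_height n \<omega> k > ereal \<eta>"
        "real a / real m \<le> obs_time n k'" "obs_time n k' < (real a + 1) / real m" "obs_height n \<omega> k' > ereal \<eta>" for a k k'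
    proof (rule ccontr)
      assume ne: "k \<noteq> k'"
      have "k \<in> index_block m n a" "k' \<in> index_block m n a" using k by (auto simp: index_block_def obs_time_def)
      then have "\<omega> \<in> B2 n a" using k w ne unfolding gt B2_def by auto
      with w a show False by (auto simp: B_def)
    qed
    moreover have "obs_height n \<omega> k \<le> ereal ((real R + 1) * \<eta>)" if k: "obs_time n k < real N / real m" for k
    proof -
      define a where "a = nat \<lfloor>real m * obs_time n k\<rfloor>"
      have "0 \<le> \<lfloor>real m * obs_time n k\<rfloor>" by (simp add: obs_time_def)
      then have "real a = of_int \<lfloor>real m * obs_time n k\<rfloor>" by (simp add: a_def)
      then have a: "real a \<le> real m * obs_time n k" "real m * obs_time n k < real a + 1" by linarith+
      then have "real a / real m \<le> obs_time n k" "obs_time n k < (real a + 1) / real m" using m by (auto simp: field_simps)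
      then have blk: "k \<in> index_block m n a" by (simp add: index_block_def obs_time_def)
      have "real m * obs_time n k < real N" using k m by (simp add: field_simps)
      then have "a < N" using a by linarith
      then have "\<omega> \<notin> B3 n a" using w by (auto simp: B_def)
      then have "\<not> obs_height n \<omega> k > ereal ((real R + 1) * \<eta>)" using blk w unfolding gt by (auto simp: B3_def)
      then show ?thesis by (simp add: not_less)
    qed
    ultimately show "tame_blocks m N R \<eta> (obs_time n) (obs_height n \<omega>)" unfolding tame_blocks_def by blast
  qed
qed

end

section \<open>The logarithm follows the record\<close>

context heavy_perpetuity
begin

text \<open>Values above \<open>a + H\<close> are unlikely. Cover \<open>(a, a + H]\<close> by \<open>R\<close> overlapping cells of length \<open>2 \<kappa>\<close>, where \<open>\<kappa> = H / R\<close>; two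
  values at distance at most \<open>\<kappa>\<close> lie in a common cell. The expected number of pairs in one cell is of order
  \<open>\<kappa>\<^sup>2\<close>, because \<open>x powr (- \<alpha>)\<close> is Lipschitz above \<open>a\<close>; the sum over the cells is of order \<open>1 / R\<close>.\<close>

lemma gap_event:
  assumes a: "a > 0" and \<gamma>: "\<gamma> > 0"
  obtains \<kappa> B where "0 < \<kappa>" "\<kappa> \<le> a" "\<forall>n\<ge>1. B n \<in> events" "\<forall>\<^sub>F n in sequentially. prob (B n) < \<gamma>"
    "\<forall>n\<ge>1. \<forall>\<omega>\<in>space P - B n. \<forall>i\<in>{1..n * K + 1}. \<forall>i'\<in>{1..n * K + 1}. i \<noteq> i' \<longrightarrow>
       ln \<bar>Qk i \<omega>\<bar> > a * b n \<longrightarrow> ln \<bar>Qk i' \<omega>\<bar> > a * b n \<longrightarrow> \<bar>ln \<bar>Qk i \<omega>\<bar> - ln \<bar>Qk i' \<omega>\<bar>\<bar> > \<kappa> * b n"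
proof -
  define \<phi> where "\<phi> x = x powr (- \<alpha>)" for x :: real
  have "((\<lambda>H. real K * \<phi> (a + H)) \<longlongrightarrow> real K * 0) at_top"
    unfolding \<phi>_def
    by (intro tendsto_mult tendsto_const tendsto_neg_powr filterlim_tendsto_add_at_top[OF tendsto_const] filterlim_ident) (use alpha in auto)
  then have "\<forall>\<^sub>F H in at_top. real K * \<phi> (a + H) < \<gamma> / 2" using \<gamma> by (intro order_tendstoD(2)) auto
  then have "\<forall>\<^sub>F H in at_top. real K * \<phi> (a + H) < \<gamma> / 2 \<and> H > 0" using eventually_gt_at_top[of 0] by eventually_elim auto
  then obtain H where H: "real K * \<phi> (a + H) < \<gamma> / 2" "H > 0" by (auto simp: eventually_at_top_linorder)
  define C where "C = \<alpha> * a powr (- \<alpha> - 1)"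
  have C: "C \<ge> 0" using alpha by (simp add: C_def)
  have "(\<lambda>R. (real K * (2 * H * C))\<^sup>2 * (1 / real R)) \<longlonglongrightarrow> (real K * (2 * H * C))\<^sup>2 * 0"
    by (intro tendsto_mult tendsto_const lim_1_over_n)
  then have "\<forall>\<^sub>F R in sequentially. (real K * (2 * H * C))\<^sup>2 * (1 / real R) < \<gamma> / 2" using \<gamma> by (intro order_tendstoD(2)) auto
  moreover have "\<forall>\<^sub>F R in sequentially. real R \<ge> max 1 (H / a)"
    using filterlim_real_sequentially unfolding filterlim_at_top by blast
  ultimately have "\<forall>\<^sub>F R in sequentially. (real K * (2 * H * C))\<^sup>2 * (1 / real R) < \<gamma> / 2 \<and> real R \<ge> max 1 (H / a)"
    by eventually_elim auto
  then obtain R where R: "(real K * (2 * H * C))\<^sup>2 * (1 / real R) < \<gamma> / 2" "real R \<ge> 1" "real R \<ge> H / a"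
    by (auto simp: eventually_sequentially)
  define \<kappa> where "\<kappa> = H / real R"
  have \<kappa>: "0 < \<kappa>" "\<kappa> \<le> a" "real R * \<kappa> = H" using R H a by (auto simp: \<kappa>_def field_simps)
  define lo where "lo r = a + real r * \<kappa>" for r :: nat
  have lo: "lo r \<ge> a" "lo r > 0" for r using \<kappa> a by (auto simp: lo_def intro: add_pos_nonneg)
  define J where "J n = {1..n * K + 1}" for n
  define cell where "cell n r = {lo r * b n<..lo (r + 2) * b n}" for n r
  define B1 where "B1 n = {\<omega> \<in> space P. \<exists>i\<in>J n. ln \<bar>Qk i \<omega>\<bar> > (a + H) * b n}" for n
  define B2 where "B2 n r = {\<omega> \<in> space P. \<exists>i\<in>J n. \<exists>i'\<in>J n. i \<noteq> i' \<and> ln \<bar>Qk i \<omega>\<bar> \<in> cell n r \<and> ln \<bar>Qk i' \<omega>\<bar> \<in> cell n r}" for n r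
  have J: "finite (J n)" "\<And>i. i \<in> J n \<Longrightarrow> i \<ge> 1" "card (J n) = n * K + 1" for n by (auto simp: J_def)
  have B1: "B1 n \<in> events" "prob (B1 n) \<le> real (n * K + 1) * F ((a + H) * b n)" for n
    unfolding B1_def J(3)[of n, symmetric] by (rule large_value_prob[OF J(1,2)]; assumption)+
  have cellp: "prob {\<omega> \<in> space P. ln \<bar>Qk i \<omega>\<bar> \<in> cell n r} = F (lo r * b n) - F (lo (r + 2) * b n)" if n: "n \<ge> 1" and i: "i \<in> J n" for n r i
  proof -
    have i1: "i \<ge> 1" using J(2)[OF i] .
    have le: "lo r * b n \<le> lo (r + 2) * b n" using b_pos[OF n] \<kappa> by (intro mult_right_mono) (auto simp: lo_def algebra_simps)
    have eq: "{\<omega> \<in> space P. ln \<bar>Qk i \<omega>\<bar> \<in> cell n r} = {\<omega> \<in> space P. ln \<bar>Qk i \<omega>\<bar> > lo r * b n} - {\<omega> \<in> space P. ln \<bar>Qk i \<omega>\<bar> > lo (r + 2) * b n}"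
      by (auto simp: cell_def)
    have sub: "{\<omega> \<in> space P. ln \<bar>Qk i \<omega>\<bar> > lo (r + 2) * b n} \<subseteq> {\<omega> \<in> space P. ln \<bar>Qk i \<omega>\<bar> > lo r * b n}"
      using le by auto
    show ?thesis unfolding eq finite_measure_Diff[OF lnQ_event[OF i1] lnQ_event[OF i1] sub] F_tail[OF i1] ..
  qed
  have B2: "B2 n r \<in> events" "prob (B2 n r) \<le> (real (n * K + 1) * (F (lo r * b n) - F (lo (r + 2) * b n)))\<^sup>2" if n: "n \<ge> 1" for n r
    unfolding B2_def J(3)[of n, symmetric]
    by (rule two_in_set_prob[OF J(1,2) _ cellp[OF n]]; (assumption | simp add: cell_def))+
  define B where "B n = B1 n \<union> (\<Union>r<R. B2 n r)" for n
  have lim: "(\<lambda>n. real (n * K + 1) * F (x * b n)) \<longlonglongrightarrow> real K * \<phi> x" if "x > 0" for x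
  proof -
    have "(\<lambda>n. real K * (real n * F (x * b n)) + F (x * b n)) \<longlonglongrightarrow> real K * \<phi> x + 0"
      unfolding \<phi>_def by (intro tendsto_add tendsto_mult tendsto_const scaled_tail F_scaled_0 that)
    then show ?thesis by (simp add: algebra_simps)
  qed
  define bd where "bd n = real (n * K + 1) * F ((a + H) * b n) +
     (\<Sum>r<R. (real (n * K + 1) * F (lo r * b n) - real (n * K + 1) * F (lo (r + 2) * b n))\<^sup>2)" for n
  have "bd \<longlonglongrightarrow> real K * \<phi> (a + H) + (\<Sum>r<R. (real K * \<phi> (lo r) - real K * \<phi> (lo (r + 2)))\<^sup>2)"
    unfolding bd_def by (intro tendsto_add tendsto_sum tendsto_power tendsto_diff lim lo) (use a H in auto)
  moreover have "(\<Sum>r<R. (real K * \<phi> (lo r) - real K * \<phi> (lo (r + 2)))\<^sup>2) \<le> (real K * (2 * H * C))\<^sup>2 * (1 / real R)"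
  proof -
    have "(real K * \<phi> (lo r) - real K * \<phi> (lo (r + 2)))\<^sup>2 \<le> (real K * (2 * \<kappa> * C))\<^sup>2" for r
    proof -
      have e: "lo (r + 2) = lo r + 2 * \<kappa>" by (simp add: lo_def algebra_simps)
      have d: "0 \<le> \<phi> (lo r) - \<phi> (lo (r + 2))" "\<phi> (lo r) - \<phi> (lo (r + 2)) \<le> 2 * \<kappa> * C"
        unfolding e \<phi>_def C_def using powr_neg_diff_le[OF a lo(1)[of r], of "2 * \<kappa>" \<alpha>] \<kappa> alpha by auto
      have "real K * \<phi> (lo r) - real K * \<phi> (lo (r + 2)) = real K * (\<phi> (lo r) - \<phi> (lo (r + 2)))" by (simp add: algebra_simps)
      moreover have "\<dots> \<le> real K * (2 * \<kappa> * C)" using d by (intro mult_left_mono) auto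
      moreover have "0 \<le> real K * (\<phi> (lo r) - \<phi> (lo (r + 2)))" using d by simp
      ultimately show ?thesis by (intro power_mono) auto
    qed
    then have "(\<Sum>r<R. (real K * \<phi> (lo r) - real K * \<phi> (lo (r + 2)))\<^sup>2) \<le> (\<Sum>r<R. (real K * (2 * \<kappa> * C))\<^sup>2)" by (intro sum_mono)
    also have "\<dots> = (real K * (2 * H * C))\<^sup>2 * (1 / real R)"
      using R by (simp add: \<kappa>_def power2_eq_square field_simps)
    finally show ?thesis .
  qed
  ultimately have ev: "\<forall>\<^sub>F n in sequentially. bd n < \<gamma>" using R(1) H(1) by (elim order_tendstoD(2)) linarith
  show thesis
  proof (rule that[of \<kappa> B])
    show "0 < \<kappa>" "\<kappa> \<le> a" by fact+
    show "\<forall>n\<ge>1. B n \<in> events" using B1(1) B2(1) by (auto simp: B_def)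
    show "\<forall>\<^sub>F n in sequentially. prob (B n) < \<gamma>"
      using ev eventually_ge_at_top[of 1]
    proof eventually_elim
      case (elim n)
      have "prob (B n) \<le> prob (B1 n) + prob (\<Union>r<R. B2 n r)"
        unfolding B_def by (rule measure_Un_le) (use B1 B2(1) elim in auto)
      also have "prob (\<Union>r<R. B2 n r) \<le> (\<Sum>r<R. prob (B2 n r))" by (rule measure_UNION_le) (use B2(1) elim in auto)
      also have "\<dots> \<le> (\<Sum>r<R. (real (n * K + 1) * (F (lo r * b n) - F (lo (r + 2) * b n)))\<^sup>2)" by (intro sum_mono B2(2) elim)
      also have "\<dots> = (\<Sum>r<R. (real (n * K + 1) * F (lo r * b n) - real (n * K + 1) * F (lo (r + 2) * b n))\<^sup>2)"
        by (simp only: right_diff_distrib)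
      finally show ?case using elim B1(2)[of n] by (simp add: bd_def)
    qed
    show "\<forall>n\<ge>1. \<forall>\<omega>\<in>space P - B n. \<forall>i\<in>{1..n * K + 1}. \<forall>i'\<in>{1..n * K + 1}. i \<noteq> i' \<longrightarrow>
       ln \<bar>Qk i \<omega>\<bar> > a * b n \<longrightarrow> ln \<bar>Qk i' \<omega>\<bar> > a * b n \<longrightarrow> \<bar>ln \<bar>Qk i \<omega>\<bar> - ln \<bar>Qk i' \<omega>\<bar>\<bar> > \<kappa> * b n"
    proof (intro allI ballI impI)
    fix n \<omega> i i' assume n: "n \<ge> 1" and w: "\<omega> \<in> space P - B n" and i: "i \<in> {1..n * K + 1}" "i' \<in> {1..n * K + 1}" "i \<noteq> i'"
      and big: "ln \<bar>Qk i \<omega>\<bar> > a * b n" "ln \<bar>Qk i' \<omega>\<bar> > a * b n"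
    have bn: "b n > 0" by (rule b_pos[OF n])
    have main: "\<bar>ln \<bar>Qk i \<omega>\<bar> - ln \<bar>Qk i' \<omega>\<bar>\<bar> > \<kappa> * b n" if i: "i \<in> J n" "i' \<in> J n" "i \<noteq> i'" and big: "ln \<bar>Qk i \<omega>\<bar> > a * b n" and le: "ln \<bar>Qk i \<omega>\<bar> \<le> ln \<bar>Qk i' \<omega>\<bar>" for i i'
    proof (rule ccontr)
      assume close: "\<not> \<bar>ln \<bar>Qk i \<omega>\<bar> - ln \<bar>Qk i' \<omega>\<bar>\<bar> > \<kappa> * b n"
      define x where "x = ln \<bar>Qk i \<omega>\<bar> / b n"
      define y where "y = ln \<bar>Qk i' \<omega>\<bar> / b n"
      have xy: "ln \<bar>Qk i \<omega>\<bar> = x * b n" "ln \<bar>Qk i' \<omega>\<bar> = y * b n" using bn by (auto simp: x_def y_def)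
      have x: "a < x" "x \<le> y" "y \<le> x + \<kappa>"
      proof -
        show "a < x" using big bn unfolding xy by simp
        show "x \<le> y" using le bn unfolding xy by simp
        have "y * b n \<le> (x + \<kappa>) * b n" using close le unfolding xy by (simp add: algebra_simps)
        then show "y \<le> x + \<kappa>" using bn by simp
      qed
      have "\<not> x > a + H"
      proof
        assume "x > a + H"
        then have "ln \<bar>Qk i \<omega>\<bar> > (a + H) * b n" unfolding xy using bn by simp
        then have "\<omega> \<in> B1 n" using i w by (auto simp: B1_def)
        with w show False by (auto simp: B_def)
      qed
      \<comment> \<open>The cells are open on the left, hence the ceiling.\<close>
      define r where "r = nat (\<lceil>(x - a) / \<kappa>\<rceil> - 1)"
      have pos: "(x - a) / \<kappa> > 0" using x \<kappa> by simp
      then have "\<lceil>(x - a) / \<kappa>\<rceil> \<ge> 1" by simp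
      then have rr: "real r = of_int \<lceil>(x - a) / \<kappa>\<rceil> - 1" by (simp add: r_def)
      have "real r < (x - a) / \<kappa>" "(x - a) / \<kappa> \<le> real r + 1" unfolding rr by linarith+
      then have "real r * \<kappa> < x - a" "x - a \<le> (real r + 1) * \<kappa>" using \<kappa> by (auto simp: field_simps)
      then have c: "lo r < x" "y \<le> lo (r + 2)" using x by (auto simp: lo_def algebra_simps)
      have "real r * \<kappa> < real R * \<kappa>" using \<open>real r * \<kappa> < x - a\<close> \<open>\<not> x > a + H\<close> \<kappa>(3) by linarith
      then have "r < R" using \<kappa>(1) by (simp only: mult_less_cancel_right_pos of_nat_less_iff)
      have "ln \<bar>Qk i \<omega>\<bar> \<in> cell n r" "ln \<bar>Qk i' \<omega>\<bar> \<in> cell n r"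
        unfolding xy cell_def using c x bn by (auto intro!: mult_right_mono mult_strict_right_mono)
      then have "\<omega> \<in> B2 n r" using i w by (auto simp: B2_def)
      with \<open>r < R\<close> w show False by (auto simp: B_def)
    qed
    show "\<bar>ln \<bar>Qk i \<omega>\<bar> - ln \<bar>Qk i' \<omega>\<bar>\<bar> > \<kappa> * b n"
    proof (cases "ln \<bar>Qk i \<omega>\<bar> \<le> ln \<bar>Qk i' \<omega>\<bar>")
      case True then show ?thesis using main[of i i'] i big by (simp add: J_def)
    next
      case False then show ?thesis using main[of i' i] i big by (simp add: J_def abs_minus_commute)
    qed
    qed
  qed
qed

text \<open>What \<open>X\<close> and \<open>Y\<close> have in common: a linear combination of the \<open>Q\<^sub>i\<close> whose coefficients have
  logarithms bounded by the fluctuations of the walk \<open>ln \<bar>Pi'\<bar>\<close>.\<close>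

definition log_dominated :: "('w \<Rightarrow> nat \<Rightarrow> real) \<Rightarrow> bool" where
  "log_dominated W \<longleftrightarrow> (\<forall>\<omega> k D. D \<ge> 0 \<longrightarrow> (\<forall>i\<ge>1. Mk i \<omega> \<noteq> 0) \<longrightarrow> neg_part \<omega> k \<le> D \<longrightarrow>
     (\<forall>i. \<bar>Pi' \<omega> i\<bar> \<le> exp D) \<longrightarrow> \<bar>X0 \<omega>\<bar> \<le> exp D \<longrightarrow>
     (\<exists>c0 c. W \<omega> k = c0 + (\<Sum>i=1..k. c i * Qk i \<omega>) \<and> \<bar>c0\<bar> \<le> exp (2 * D) \<and>
        (\<forall>i\<in>{1..k}. exp (- (2 * D)) \<le> \<bar>c i\<bar> \<and> \<bar>c i\<bar> \<le> exp (2 * D))))"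

lemma log_dominated_Y: "log_dominated Y"
  unfolding log_dominated_def
proof (intro allI impI)
  fix \<omega> k and D :: real
  assume D: "D \<ge> 0" and nz: "\<forall>i\<ge>1. Mk i \<omega> \<noteq> 0" and neg: "neg_part \<omega> k \<le> D" and P: "\<forall>i. \<bar>Pi' \<omega> i\<bar> \<le> exp D"
  have "exp (- (2 * D)) \<le> \<bar>Pi' \<omega> (i - 1)\<bar> \<and> \<bar>Pi' \<omega> (i - 1)\<bar> \<le> exp (2 * D)" if i: "i \<in> {1..k}" for i
  proof
    have "ln \<bar>Pi' \<omega> (i - 1)\<bar> \<ge> - neg_part \<omega> (i - 1)" using ln_Pi_diff_ge[OF nz, of 0 "i - 1"] by simp
    moreover have "neg_part \<omega> (i - 1) \<le> neg_part \<omega> k" using i by (intro neg_part_mono) auto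
    ultimately have "ln \<bar>Pi' \<omega> (i - 1)\<bar> \<ge> - (2 * D)" using neg D by linarith
    then show "exp (- (2 * D)) \<le> \<bar>Pi' \<omega> (i - 1)\<bar>" using Pi_nz[OF nz] by (subst (asm) ln_ge_iff) auto
    have "exp D \<le> exp (2 * D)" using D by simp
    then show "\<bar>Pi' \<omega> (i - 1)\<bar> \<le> exp (2 * D)" using P by (meson order_trans)
  qed
  then show "\<exists>c0 c. Y \<omega> k = c0 + (\<Sum>i=1..k. c i * Qk i \<omega>) \<and> \<bar>c0\<bar> \<le> exp (2 * D) \<and>
        (\<forall>i\<in>{1..k}. exp (- (2 * D)) \<le> \<bar>c i\<bar> \<and> \<bar>c i\<bar> \<le> exp (2 * D))"
    by (intro exI[of _ 0] exI[of _ "\<lambda>i. Pi' \<omega> (i - 1)"]) (auto simp: perpetuity_def)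
qed

lemma affine_rec_expand:
  assumes "\<forall>i\<ge>1. m i \<noteq> (0::real)"
  shows "affine_rec m q x n = partial_prod m n * x + (\<Sum>i=1..n. partial_prod m n / partial_prod m i * q i)"
proof (induction n)
  case (Suc n)
  have "partial_prod m (Suc n) \<noteq> 0" using ln_abs_lin(2)[of "Suc n" m] assms by auto
  moreover have "m (Suc n) * (\<Sum>i=1..n. partial_prod m n / partial_prod m i * q i) = (\<Sum>i=1..n. partial_prod m (Suc n) / partial_prod m i * q i)"
    unfolding sum_distrib_left by (rule sum.cong) (auto simp: mult_ac)
  ultimately show ?case using Suc by (simp add: distrib_left mult_ac)
qed simp

lemma log_dominated_X: "log_dominated X"
  unfolding log_dominated_def
proof (intro allI impI)
  fix \<omega> k and D :: real
  assume D: "D \<ge> 0" and nz: "\<forall>i\<ge>1. Mk i \<omega> \<noteq> 0" and neg: "neg_part \<omega> k \<le> D" and P: "\<forall>i. \<bar>Pi' \<omega> i\<bar> \<le> exp D" and X0: "\<bar>X0 \<omega>\<bar> \<le> exp D"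
  have "exp (- (2 * D)) \<le> \<bar>Pi' \<omega> k / Pi' \<omega> i\<bar> \<and> \<bar>Pi' \<omega> k / Pi' \<omega> i\<bar> \<le> exp (2 * D)" if i: "i \<in> {1..k}" for i
  proof -
    have pos: "\<bar>Pi' \<omega> k\<bar> > 0" "\<bar>Pi' \<omega> i\<bar> > 0" using Pi_nz[OF nz] by auto
    have l: "ln \<bar>Pi' \<omega> k / Pi' \<omega> i\<bar> = ln \<bar>Pi' \<omega> k\<bar> - ln \<bar>Pi' \<omega> i\<bar>" using pos by (simp add: abs_divide ln_div)
    have p: "\<bar>Pi' \<omega> k / Pi' \<omega> i\<bar> > 0" using pos by simp
    have "ln \<bar>Pi' \<omega> k\<bar> - ln \<bar>Pi' \<omega> i\<bar> \<ge> - neg_part \<omega> k" by (rule ln_Pi_diff_ge[OF nz]) (use i in auto)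
    then have 1: "- (2 * D) \<le> ln \<bar>Pi' \<omega> k / Pi' \<omega> i\<bar>" unfolding l using neg D by linarith
    have "ln \<bar>Pi' \<omega> i\<bar> \<ge> - neg_part \<omega> i" using ln_Pi_diff_ge[OF nz, of 0 i] by simp
    moreover have "neg_part \<omega> i \<le> neg_part \<omega> k" using i by (intro neg_part_mono) auto
    moreover have "ln \<bar>Pi' \<omega> k\<bar> \<le> D"
    proof -
      have "ln \<bar>Pi' \<omega> k\<bar> \<le> ln (exp D)" using P pos by (subst ln_le_cancel_iff) auto
      then show ?thesis by simp
    qed
    ultimately have 2: "ln \<bar>Pi' \<omega> k / Pi' \<omega> i\<bar> \<le> 2 * D" unfolding l using neg by linarith
    have "exp (- (2 * D)) \<le> exp (ln \<bar>Pi' \<omega> k / Pi' \<omega> i\<bar>)" "exp (ln \<bar>Pi' \<omega> k / Pi' \<omega> i\<bar>) \<le> exp (2 * D)"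
      unfolding exp_le_cancel_iff using 1 2 by auto
    then show ?thesis unfolding exp_ln[OF p] by (rule conjI)
  qed
  moreover have "\<bar>Pi' \<omega> k * X0 \<omega>\<bar> \<le> exp (2 * D)"
  proof -
    have "\<bar>Pi' \<omega> k\<bar> * \<bar>X0 \<omega>\<bar> \<le> exp D * exp D" using P X0 by (intro mult_mono) auto
    then show ?thesis by (simp add: abs_mult exp_add[symmetric])
  qed
  ultimately show "\<exists>c0 c. X \<omega> k = c0 + (\<Sum>i=1..k. c i * Qk i \<omega>) \<and> \<bar>c0\<bar> \<le> exp (2 * D) \<and>
        (\<forall>i\<in>{1..k}. exp (- (2 * D)) \<le> \<bar>c i\<bar> \<and> \<bar>c i\<bar> \<le> exp (2 * D))"
    using affine_rec_expand[OF nz] by (intro exI[of _ "Pi' \<omega> k * X0 \<omega>"] exI[of _ "\<lambda>i. Pi' \<omega> k / Pi' \<omega> i"]) auto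
qed

text \<open>The record never falls below \<open>0\<close>, in accordance with the empty supremum in the limit.\<close>

definition record_height :: "nat \<Rightarrow> 'w \<Rightarrow> nat \<Rightarrow> real" where
  "record_height n \<omega> k = Max (insert 0 ((\<lambda>i. ln \<bar>Qk i \<omega>\<bar> / b n) ` {1..k}))"

lemma record_height:
  "record_height n \<omega> k \<ge> 0" "\<And>i. i \<in> {1..k} \<Longrightarrow> ln \<bar>Qk i \<omega>\<bar> / b n \<le> record_height n \<omega> k"
  "record_height n \<omega> k = 0 \<or> (\<exists>i\<in>{1..k}. ln \<bar>Qk i \<omega>\<bar> / b n = record_height n \<omega> k)"
proof -
  show "record_height n \<omega> k \<ge> 0" "\<And>i. i \<in> {1..k} \<Longrightarrow> ln \<bar>Qk i \<omega>\<bar> / b n \<le> record_height n \<omega> k"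
    unfolding record_height_def by (rule Max_ge; force)+
  have "record_height n \<omega> k \<in> insert 0 ((\<lambda>i. ln \<bar>Qk i \<omega>\<bar> / b n) ` {1..k})"
    unfolding record_height_def by (rule Max_in) auto
  then show "record_height n \<omega> k = 0 \<or> (\<exists>i\<in>{1..k}. ln \<bar>Qk i \<omega>\<bar> / b n = record_height n \<omega> k)" by auto
qed

lemma running_sup_record_height:
  assumes n: "n \<ge> 1"
  shows "running_sup (obs_time n) (obs_height n \<omega>) (\<lambda>s. record_height n \<omega> (nat \<lfloor>real n * s\<rfloor> + 1))"
  unfolding running_sup_def
proof (intro allI impI)
  fix s :: real assume s: "s \<ge> 0"
  define N where "N = nat \<lfloor>real n * s\<rfloor>"
  have iff: "obs_time n k \<le> s \<longleftrightarrow> Suc k \<in> {1..N + 1}" for k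
  proof -
    have "obs_time n k \<le> s \<longleftrightarrow> real k \<le> real n * s" using n by (simp add: obs_time_def field_simps)
    also have "\<dots> \<longleftrightarrow> k \<le> N" unfolding N_def using s by (simp add: le_nat_iff le_floor_iff)
    finally show ?thesis by auto
  qed
  note rh = record_height[where n = n and \<omega> = \<omega> and k = "N + 1"]
  show "0 \<le> record_height n \<omega> (nat \<lfloor>real n * s\<rfloor> + 1) \<and>
      (\<forall>k. obs_time n k \<le> s \<longrightarrow> obs_height n \<omega> k \<le> ereal (record_height n \<omega> (nat \<lfloor>real n * s\<rfloor> + 1))) \<and>
      (\<forall>c\<ge>0. (\<forall>k. obs_time n k \<le> s \<longrightarrow> obs_height n \<omega> k \<le> ereal c) \<longrightarrow> record_height n \<omega> (nat \<lfloor>real n * s\<rfloor> + 1) \<le> c)"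
    unfolding N_def[symmetric] iff obs_height_def
  proof (intro conjI allI impI)
    show "0 \<le> record_height n \<omega> (N + 1)" by (rule rh)
    show "ereal (ln \<bar>Qk (Suc k) \<omega>\<bar> / b n) \<le> ereal (record_height n \<omega> (N + 1))" if "Suc k \<in> {1..N + 1}" for k
      using rh(2)[OF that] by simp
    fix c :: real assume c: "0 \<le> c" "\<forall>k. Suc k \<in> {1..N + 1} \<longrightarrow> ereal (ln \<bar>Qk (Suc k) \<omega>\<bar> / b n) \<le> ereal c"
    show "record_height n \<omega> (N + 1) \<le> c"
      using rh(3)
    proof
      assume "\<exists>i\<in>{1..N + 1}. ln \<bar>Qk i \<omega>\<bar> / b n = record_height n \<omega> (N + 1)"
      then obtain i where i: "i \<in> {1..N + 1}" "ln \<bar>Qk i \<omega>\<bar> / b n = record_height n \<omega> (N + 1)" by blast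
      then obtain k where "i = Suc k" by (cases i) auto
      then show ?thesis using c(2) i by auto
    qed (use c in simp)
  qed
qed

text \<open>Collect the exceptional events: two close large values, a dip of \<open>W\<close>, and a large fluctuation of the
  walk or of the initial value. Off these events \<open>log_sum_near_max\<close> applies at every index up to \<open>n K + 1\<close>; the number of terms is
  harmless because \<open>n / b n \<rightarrow> 0\<close>.\<close>

lemma log_path_near_record:
  assumes dip: "no_dip_at W" and dom: "log_dominated W" and Wm: "\<And>k. random_variable borel (\<lambda>\<omega>. W \<omega> k)"
    and \<epsilon>: "\<epsilon> > 0" and \<gamma>: "\<gamma> > 0"
  obtains B where "\<forall>n\<ge>1. B n \<in> events" "\<forall>\<^sub>F n in sequentially. prob (B n) < \<gamma>"
    "\<forall>\<^sub>F n in sequentially. \<forall>\<omega>\<in>space P - B n. \<forall>k\<in>{1..n * K + 1}. \<bar>ln \<bar>W \<omega> k\<bar> / b n - record_height n \<omega> k\<bar> \<le> \<epsilon>"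
proof -
  define a where "a = \<epsilon> / 8"
  have a: "a > 0" using \<epsilon> by (simp add: a_def)
  have \<gamma>2: "\<gamma> / 2 > 0" using \<gamma> by simp
  obtain \<kappa> B0 where \<kappa>: "0 < \<kappa>" "\<kappa> \<le> a" and B0: "\<forall>n\<ge>1. B0 n \<in> events" "\<forall>\<^sub>F n in sequentially. prob (B0 n) < \<gamma> / 2"
    and gap: "\<forall>n\<ge>1. \<forall>\<omega>\<in>space P - B0 n. \<forall>i\<in>{1..n * K + 1}. \<forall>i'\<in>{1..n * K + 1}. i \<noteq> i' \<longrightarrow>
       ln \<bar>Qk i \<omega>\<bar> > a * b n \<longrightarrow> ln \<bar>Qk i' \<omega>\<bar> > a * b n \<longrightarrow> \<bar>ln \<bar>Qk i \<omega>\<bar> - ln \<bar>Qk i' \<omega>\<bar>\<bar> > \<kappa> * b n"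
    by (rule gap_event[OF a \<gamma>2, where K = K])
  define \<delta> where "\<delta> = \<kappa> / 6"
  have \<delta>: "\<delta> > 0" "6 * \<delta> \<le> \<kappa>" using \<kappa> by (auto simp: \<delta>_def)
  \<comment> \<open>The constants are such that \<open>2 a + e1 + 3 \<delta> \<le> \<epsilon>\<close>.\<close>
  define e1 where "e1 = \<epsilon> / 4"
  have e1: "e1 > 0" using \<epsilon> by (simp add: e1_def)
  define D1 where "D1 n = {\<omega> \<in> space P. \<exists>k\<in>{1..n * K + 1}. W \<omega> k \<noteq> 0 \<and> \<bar>W \<omega> k\<bar> \<le> exp (- e1 * b n)}" for n
  define D2 where "D2 n = {\<omega> \<in> space P. neg_part \<omega> (n * K + 1) > \<delta> * b n}" for n
  define D3 where "D3 n = {\<omega> \<in> space P. \<exists>k. \<bar>Pi' \<omega> k\<bar> > exp (\<delta> * b n)}" for n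
  define D4 where "D4 n = {\<omega> \<in> space P. \<bar>X0 \<omega>\<bar> > exp (\<delta> * b n)}" for n
  note Wm[measurable]
  have Dm: "D1 n \<in> events" "D2 n \<in> events" "D3 n \<in> events" "D4 n \<in> events" for n
    unfolding D1_def D2_def D3_def D4_def by measurable
  have D1: "(\<lambda>n. prob (D1 n)) \<longlonglongrightarrow> 0" using dip e1 unfolding no_dip_at_def D1_def by blast
  have D2: "(\<lambda>n. prob (D2 n)) \<longlonglongrightarrow> 0" unfolding D2_def by (rule neg_part_small[OF \<delta>(1)])
  have D3: "(\<lambda>n. prob (D3 n)) \<longlonglongrightarrow> 0" unfolding D3_def by (rule sup_Pi_small[OF \<delta>(1)])
  have D4: "(\<lambda>n. prob (D4 n)) \<longlonglongrightarrow> 0"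
  proof (rule prob_tendsto_0[OF Dm(4)], rule AE_I2)
    fix \<omega>
    have "\<forall>\<^sub>F n in sequentially. exp (\<delta> * b n) \<ge> \<bar>X0 \<omega>\<bar>" using exp_b_at_top[OF \<delta>(1)] by (simp add: filterlim_at_top)
    then show "\<forall>\<^sub>F n in sequentially. \<omega> \<notin> D4 n" by eventually_elim (auto simp: D4_def)
  qed
  obtain Nul where Nul: "Nul \<in> null_sets P" "{\<omega> \<in> space P. \<not> (\<forall>k\<ge>1. Mk k \<omega> \<noteq> 0)} \<subseteq> Nul"
    using M_nz unfolding eventually_ae_filter by auto
  define B where "B n = B0 n \<union> (((D1 n \<union> D2 n) \<union> (D3 n \<union> D4 n)) \<union> Nul)" for n
  show thesis
  proof (rule that[of B])
    show "\<forall>n\<ge>1. B n \<in> events" unfolding B_def using B0(1) Dm null_setsD2[OF Nul(1)] by (intro allI impI sets.Un) auto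
    have "(\<lambda>n. (prob (D1 n) + prob (D2 n)) + (prob (D3 n) + prob (D4 n))) \<longlonglongrightarrow> (0 + 0) + (0 + 0)"
      by (intro tendsto_add D1 D2 D3 D4)
    then have "\<forall>\<^sub>F n in sequentially. (prob (D1 n) + prob (D2 n)) + (prob (D3 n) + prob (D4 n)) < \<gamma> / 2"
      using \<gamma>2 by (intro order_tendstoD(2)) auto
    then show "\<forall>\<^sub>F n in sequentially. prob (B n) < \<gamma>"
      using B0(2) eventually_ge_at_top[of 1]
    proof eventually_elim
      case (elim n)
      have "prob (B n) \<le> prob (B0 n) + prob (((D1 n \<union> D2 n) \<union> (D3 n \<union> D4 n)) \<union> Nul)"
        unfolding B_def by (rule measure_Un_le) (use B0 Dm Nul elim in auto)
      also have "prob (((D1 n \<union> D2 n) \<union> (D3 n \<union> D4 n)) \<union> Nul) = prob ((D1 n \<union> D2 n) \<union> (D3 n \<union> D4 n))"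
        by (rule measure_Un_null_set) (use Dm Nul in auto)
      also have "\<dots> \<le> prob (D1 n \<union> D2 n) + prob (D3 n \<union> D4 n)" by (rule measure_Un_le) (use Dm in auto)
      also have "\<dots> \<le> (prob (D1 n) + prob (D2 n)) + (prob (D3 n) + prob (D4 n))"
        by (intro add_mono measure_Un_le Dm)
      finally show ?case using elim by linarith
    qed
    have "(\<lambda>n. real (K + 2) * (real n / b n)) \<longlonglongrightarrow> real (K + 2) * 0" by (intro tendsto_mult tendsto_const n_over_b)
    then have ev1: "\<forall>\<^sub>F n in sequentially. real (K + 2) * (real n / b n) < \<delta>" using \<delta> by (intro order_tendstoD(2)) auto
    have ev2: "\<forall>\<^sub>F n in sequentially. exp (\<delta> * b n) \<ge> 2" using exp_b_at_top[OF \<delta>(1)] by (simp add: filterlim_at_top)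
    show "\<forall>\<^sub>F n in sequentially. \<forall>\<omega>\<in>space P - B n. \<forall>k\<in>{1..n * K + 1}. \<bar>ln \<bar>W \<omega> k\<bar> / b n - record_height n \<omega> k\<bar> \<le> \<epsilon>"
      using ev1 ev2 eventually_ge_at_top[of 1]
    proof eventually_elim
      case (elim n)
      have n: "n \<ge> 1" by fact
      have bn: "b n > 0" by (rule b_pos[OF n])
      show ?case
      proof (intro ballI)
        fix \<omega> k assume w: "\<omega> \<in> space P - B n" and k: "k \<in> {1..n * K + 1}"
        have nz: "\<forall>i\<ge>1. Mk i \<omega> \<noteq> 0" using w Nul(2) by (auto simp: B_def)
        have d: "\<omega> \<notin> B0 n" "\<omega> \<notin> D1 n" "\<omega> \<notin> D2 n" "\<omega> \<notin> D3 n" "\<omega> \<notin> D4 n" "\<omega> \<in> space P" using w by (auto simp: B_def)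
        have "neg_part \<omega> k \<le> neg_part \<omega> (n * K + 1)" using k by (intro neg_part_mono) auto
        then have neg: "neg_part \<omega> k \<le> \<delta> * b n" using d by (auto simp: D2_def)
        have Pib: "\<forall>i. \<bar>Pi' \<omega> i\<bar> \<le> exp (\<delta> * b n)" using d by (auto simp: D3_def not_less)
        have X0b: "\<bar>X0 \<omega>\<bar> \<le> exp (\<delta> * b n)" using d by (auto simp: D4_def)
        have db: "0 \<le> \<delta> * b n" using \<delta> bn by simp
        obtain c0 c where c: "W \<omega> k = c0 + (\<Sum>i=1..k. c i * Qk i \<omega>)" "\<bar>c0\<bar> \<le> exp (2 * (\<delta> * b n))"
          "\<And>i. i \<in> {1..k} \<Longrightarrow> exp (- (2 * (\<delta> * b n))) \<le> \<bar>c i\<bar>" "\<And>i. i \<in> {1..k} \<Longrightarrow> \<bar>c i\<bar> \<le> exp (2 * (\<delta> * b n))"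
          using dom[unfolded log_dominated_def, rule_format, OF db _ neg] nz Pib X0b by blast
        note rh = record_height[where n = n and \<omega> = \<omega> and k = k]
        have "\<bar>ln \<bar>W \<omega> k\<bar> / b n - record_height n \<omega> k\<bar> \<le> 2 * a + e1 + 3 * \<delta>"
        proof (rule log_sum_near_max[OF bn \<delta> \<kappa>(2)])
          have "real k + 1 \<le> real (K + 2) * real n"
          proof -
            have "k + 1 \<le> n * K + 2" using k by simp
            also have "\<dots> \<le> n * K + 2 * n" using n by simp
            finally have "k + 1 \<le> (K + 2) * n" by (simp add: algebra_simps)
            then have "real (k + 1) \<le> real ((K + 2) * n)" by (rule of_nat_mono)
            then show ?thesis by (simp only: of_nat_mult of_nat_add of_nat_1)
          qed
          also have "\<dots> \<le> \<delta> * b n" using elim(1) bn by (simp add: field_simps)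
          also have "\<dots> \<le> exp (\<delta> * b n)" using exp_ge_add_one_self[of "\<delta> * b n"] by linarith
          finally show "real k + 1 \<le> exp (\<delta> * b n)" .
          show "2 \<le> exp (\<delta> * b n)" by fact
          show "\<bar>c0\<bar> \<le> exp (2 * \<delta> * b n)" using c(2) by (simp add: mult.assoc)
          show "exp (- (2 * \<delta> * b n)) \<le> \<bar>c i\<bar>" "\<bar>c i\<bar> \<le> exp (2 * \<delta> * b n)" if "i \<in> {1..k}" for i
            using c(3,4)[OF that] by (simp_all add: mult.assoc)
          show "0 \<le> record_height n \<omega> k" by (rule rh)
          show "ln \<bar>Qk i \<omega>\<bar> \<le> record_height n \<omega> k * b n" if "i \<in> {1..k}" for i
            using rh(2)[OF that] bn by (simp add: pos_divide_le_eq)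
          show "record_height n \<omega> k = 0 \<or> (\<exists>i\<in>{1..k}. ln \<bar>Qk i \<omega>\<bar> = record_height n \<omega> k * b n)"
            using rh(3) bn by (auto simp: field_simps)
          show "\<kappa> * b n < \<bar>ln \<bar>Qk i \<omega>\<bar> - ln \<bar>Qk i' \<omega>\<bar>\<bar>"
            if "i \<in> {1..k}" "i' \<in> {1..k}" "i \<noteq> i'" "a * b n < ln \<bar>Qk i \<omega>\<bar>" "a * b n < ln \<bar>Qk i' \<omega>\<bar>" for i i'
            by (rule gap[rule_format, OF n]) (use d k that in auto)
          show "W \<omega> k = c0 + (\<Sum>i=1..k. c i * Qk i \<omega>)" by (rule c)
          show "0 \<le> e1" using e1 by simp
          show "exp (- e1 * b n) < \<bar>W \<omega> k\<bar>" if "W \<omega> k \<noteq> 0"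
          proof (rule ccontr)
            assume "\<not> exp (- e1 * b n) < \<bar>W \<omega> k\<bar>"
            then have "W \<omega> k \<noteq> 0 \<and> \<bar>W \<omega> k\<bar> \<le> exp (- e1 * b n)" using that by simp
            then have "\<omega> \<in> D1 n" unfolding D1_def by (intro CollectI conjI[OF d(6)] bexI[OF _ k])
            then show False using d(2) by contradiction
          qed
        qed
        also have "\<dots> \<le> \<epsilon>" using \<kappa>(2) \<epsilon> by (simp add: a_def e1_def \<delta>_def)
        finally show "\<bar>ln \<bar>W \<omega> k\<bar> / b n - record_height n \<omega> k\<bar> \<le> \<epsilon>" .
      qed
    qed
  qed
qed

end

section \<open>Convergence of the paths\<close>

lemma tame_blocks_near_grid_path:
  fixes m N R :: nat and T \<eta> :: real
  assumes m: "m \<ge> 1" and \<eta>: "\<eta> > 0" and N: "real m * T + 1 < real N"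
    and V: "running_sup t j V" and t0: "\<And>k. t k \<ge> 0" and tame: "tame_blocks m N R \<eta> t j"
  obtains h where "h \<in> time_changes" "\<forall>s\<ge>0. \<bar>h s - s\<bar> < 1 / real m"
    "\<forall>s\<in>{0..T}. \<bar>V (h s) - grid_path m \<eta> (\<lambda>a. if a < N then block_level m R \<eta> t j a else 0) s\<bar> \<le> \<eta>"
proof -
  note tm = tame[unfolded tame_blocks_def]
  show thesis
  proof (rule running_sup_near_grid_path[OF m \<eta> N V t0])
    show "\<not> block_hit m t j 0 \<eta>" using tm by (rule conjunct1)
    show "k = k'" if "a < N" "real a / real m \<le> t k" "t k < (real a + 1) / real m" "ereal \<eta> < j k"
      "real a / real m \<le> t k'" "t k' < (real a + 1) / real m" "ereal \<eta> < j k'" for a k k'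
      by (rule tm[THEN conjunct2, THEN conjunct1, rule_format, OF that])
    show "j k \<le> ereal ((real R + 1) * \<eta>)" if "t k < real N / real m" for k
      by (rule tm[THEN conjunct2, THEN conjunct2, rule_format, OF that])
    show "(if a < N then block_level m R \<eta> t j a else 0) = block_level m R \<eta> t j a" if "a < N" for a
      using that by simp
  next
    fix h assume h: "h \<in> time_changes" "\<And>s. s \<ge> 0 \<Longrightarrow> \<bar>h s - s\<bar> < 1 / real m"
      "\<And>s. 0 \<le> s \<Longrightarrow> s \<le> T \<Longrightarrow> \<bar>V (h s) - grid_path m \<eta> (\<lambda>a. if a < N then block_level m R \<eta> t j a else 0) s\<bar> \<le> \<eta>"
    show thesis by (rule that[OF h(1)]) (use h in auto)
  qed
qed

lemma scaled_log_path_measurable: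
  assumes "\<And>k. (\<lambda>\<omega>. W \<omega> k) \<in> borel_measurable P"
  shows "(\<lambda>\<omega>. scaled_log_path b (W \<omega>) n) \<in> measurable P (borel_of J1_topology)"
proof -
  have "(\<lambda>\<omega>. \<lambda>s\<in>{0..}. (\<lambda>i \<omega>. ln \<bar>W \<omega> (i + 1)\<bar> / b n) (nat \<lfloor>real n * s\<rfloor>) \<omega>) \<in> measurable P (borel_of J1_topology)"
    using assms by (intro step_path_measurable borel_measurable_divide borel_measurable_ln borel_measurable_abs) auto
  then show ?thesis by (simp add: scaled_log_path_def)
qed

lemma scaled_log_path_in_D:
  "scaled_log_path b z n \<in> skorokhod_D"
  unfolding scaled_log_path_def by (rule step_path_in_D[of "real n" "\<lambda>i. ln \<bar>z (i + 1)\<bar> / b n"]) (rule of_nat_0_le_iff)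

context heavy_perpetuity
begin

text \<open>For given \<open>T\<close> and \<open>e\<close>, choose \<open>\<eta> = e / 4\<close> and then \<open>m\<close> so large that \<open>1 / m < \<eta>\<close> and untame configurations have
  probability less than \<open>\<eta>\<close>. Both the record process and the limit are then close to their grid paths, and the path of \<open>W\<close>
  is close to the record process. The horizon \<open>K\<close> exceeds \<open>T + 1\<close> because a time change may move \<open>T\<close> to the right
  by \<open>1 / m\<close>.\<close>

lemma log_path_converges:
  fixes S :: "'v measure"
  assumes prm: "prm_pareto S \<mu> t j \<alpha>"
    and dip: "no_dip_at W" and dom: "log_dominated W" and Wm: "\<And>k. random_variable borel (\<lambda>\<omega>. W \<omega> k)"
  shows "converges_weakly J1_topology P (\<lambda>n \<omega>. scaled_log_path b (W \<omega>) n) S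
    (\<lambda>\<omega>. sup_process (\<lambda>k. t k \<omega>) (\<lambda>k. j k \<omega>))"
proof -
  interpret S: prm_pareto S \<mu> t j \<alpha> by fact
  have P: "prob_space P" by unfold_locales
  show ?thesis
  proof (rule converges_weakly_J1I[OF P S.S scaled_log_path_measurable[OF Wm]])
    fix T e :: real assume T: "T > 0" and e: "e > 0"
    define \<eta> where "\<eta> = e / 4"
    have \<eta>: "\<eta> > 0" using e by (simp add: \<eta>_def)
    define K where "K = nat \<lceil>T\<rceil> + 2"
    have K: "real K \<ge> T + 2" by (simp add: K_def) linarith
    have "\<forall>\<^sub>F m in sequentially. tame_rate \<alpha> m (m * K) m \<eta> < \<eta>"
      using tame_rate_tendsto_0[OF \<eta> S.alpha] \<eta> by (rule order_tendstoD(2))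
    moreover have "\<forall>\<^sub>F m in sequentially. 1 / real m < \<eta>" using lim_1_over_n \<eta> by (rule order_tendstoD(2))
    ultimately have "\<forall>\<^sub>F m in sequentially. tame_rate \<alpha> m (m * K) m \<eta> < \<eta> \<and> 1 / real m < \<eta> \<and> m \<ge> 1"
      using eventually_ge_at_top[of 1] by eventually_elim auto
    then obtain m where m: "tame_rate \<alpha> m (m * K) m \<eta> < \<eta>" "1 / real m < \<eta>" "m \<ge> 1"
      by (auto simp: eventually_sequentially)
    define N where "N = m * K"
    have N: "real m * T + 1 < real N"
    proof -
      have "real m * (T + 2) \<le> real m * real K" using K by (intro mult_left_mono) auto
      moreover have "real m \<ge> 1" using m(3) by simp
      ultimately show ?thesis by (simp add: N_def algebra_simps)
    qed
    define q where "q n \<omega> = block_level m m \<eta> (obs_time n) (obs_height n \<omega>)" for n \<omega>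
    define q' where "q' \<omega> = block_level m m \<eta> (\<lambda>k. t k \<omega>) (\<lambda>k. j k \<omega>)" for \<omega>
    define Gn where "Gn n \<omega> = grid_path m \<eta> (\<lambda>a. if a < N then q n \<omega> a else 0)" for n \<omega>
    define G where "G \<omega> = grid_path m \<eta> (\<lambda>a. if a < N then q' \<omega> a else 0)" for \<omega>
    have lim: "(\<lambda>n. prob {\<omega> \<in> space P. \<forall>a<N. q n \<omega> a < r a}) \<longlonglongrightarrow> measure S {\<omega> \<in> space S. \<forall>a<N. q' \<omega> a < r a}" for r
      unfolding q_def q'_def S.block_levels_prob(1)[OF m(3) \<eta>] by (rule block_levels_obs_tendsto[OF m(3) \<eta>])
    have meas: "{\<omega> \<in> space P. q n \<omega> a < r} \<in> events" for n a r
      unfolding q_def by (rule block_level_obs_event)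
    have meas': "{\<omega> \<in> space S. q' \<omega> a < r} \<in> sets S" for a r
      unfolding q'_def by (rule S.block_levels_prob(2)[OF m(3) \<eta>])
    have le: "q n \<omega> a \<le> m" "q' \<omega>' a \<le> m" for n \<omega> \<omega>' a
      unfolding q_def q'_def by (rule block_level_le)+
    obtain F where F: "finite F" "F \<subseteq> skorokhod_D" "\<And>n. Gn n \<in> measurable P (count_space F)" "G \<in> measurable S (count_space F)"
      "\<And>x. x \<in> F \<Longrightarrow> (\<lambda>n. prob {\<omega> \<in> space P. Gn n \<omega> = x}) \<longlonglongrightarrow> measure S {\<omega> \<in> space S. G \<omega> = x}"
    proof (rule grid_path_law_tendsto[OF P S.S meas meas' lim le, where k = m and \<eta> = \<eta>])
      fix F assume "finite F" "F \<subseteq> skorokhod_D"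
        "\<And>n. (\<lambda>\<omega>. grid_path m \<eta> (\<lambda>a. if a < N then q n \<omega> a else 0)) \<in> measurable P (count_space F)"
        "(\<lambda>\<omega>. grid_path m \<eta> (\<lambda>a. if a < N then q' \<omega> a else 0)) \<in> measurable S (count_space F)"
        "\<And>x. x \<in> F \<Longrightarrow> (\<lambda>n. prob {\<omega> \<in> space P. grid_path m \<eta> (\<lambda>a. if a < N then q n \<omega> a else 0) = x})
           \<longlonglongrightarrow> measure S {\<omega> \<in> space S. grid_path m \<eta> (\<lambda>a. if a < N then q' \<omega> a else 0) = x}"
      note F = this
      show thesis
        by (rule that[OF F(1,2)]) (simp_all only: Gn_def[abs_def] G_def[abs_def] F(3,4) F(5))
    qed
    have close_S: "J1_close S (\<lambda>\<omega>. sup_process (\<lambda>k. t k \<omega>) (\<lambda>k. j k \<omega>)) G T e"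
    proof -
      obtain B where B: "B \<in> sets S" "measure S B \<le> tame_rate \<alpha> m N m \<eta>"
        "\<And>\<omega>. \<omega> \<in> space S - B \<Longrightarrow> tame_blocks m N m \<eta> (\<lambda>k. t k \<omega>) (\<lambda>k. j k \<omega>)"
        by (rule S.tame_blocks_prm[OF m(3) \<eta>]) (rule that)
      obtain B' where B': "B' \<in> null_sets S" "\<And>\<omega>. \<omega> \<in> space S - B' \<Longrightarrow>
         running_sup (\<lambda>k. t k \<omega>) (\<lambda>k. j k \<omega>) (sup_process (\<lambda>k. t k \<omega>) (\<lambda>k. j k \<omega>)) \<and>
         sup_process (\<lambda>k. t k \<omega>) (\<lambda>k. j k \<omega>) \<in> skorokhod_D"
        by (rule S.sup_process_running_sup) (rule that)
      show ?thesis
      proof (rule J1_closeI)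
        show "B \<union> B' \<in> sets S" using B B' by auto
        have "measure S (B \<union> B') = measure S B" by (rule measure_Un_null_set) (use B B' in auto)
        then show "measure S (B \<union> B') < e" using B(2) m(1) e unfolding N_def[symmetric] by (simp add: \<eta>_def)
        fix \<omega> assume w: "\<omega> \<in> space S - (B \<union> B')"
        then have wB: "\<omega> \<in> space S - B" "\<omega> \<in> space S - B'" "\<omega> \<in> space S" by auto
        have t0: "t k \<omega> \<ge> 0" for k using S.points[OF wB(3)] by (rule conjunct1)
        obtain h where h: "h \<in> time_changes" "\<forall>s\<ge>0. \<bar>h s - s\<bar> < 1 / real m"
          "\<forall>s\<in>{0..T}. \<bar>sup_process (\<lambda>k. t k \<omega>) (\<lambda>k. j k \<omega>) (h s) - G \<omega> s\<bar> \<le> \<eta>"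
          unfolding G_def q'_def
          by (rule tame_blocks_near_grid_path[OF m(3) \<eta> N B'(2)[OF wB(2), THEN conjunct1] t0 B(3)[OF wB(1)]])
        show "sup_process (\<lambda>k. t k \<omega>) (\<lambda>k. j k \<omega>) \<in> J1_nbhd (G \<omega>) T e"
        proof (rule J1_nbhdI[OF B'(2)[OF wB(2), THEN conjunct2] h(1)])
          fix s :: real assume s: "s \<ge> 0"
          show "\<bar>h s - s\<bar> < e" using h(2)[rule_format, OF s] m(2) e by (simp add: \<eta>_def)
          assume "s \<le> T"
          then have "\<bar>sup_process (\<lambda>k. t k \<omega>) (\<lambda>k. j k \<omega>) (h s) - G \<omega> s\<bar> \<le> \<eta>" using h(3) s by simp
          then show "\<bar>sup_process (\<lambda>k. t k \<omega>) (\<lambda>k. j k \<omega>) (h s) - G \<omega> s\<bar> < e" using e by (simp add: \<eta>_def)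
        qed
      qed
    qed
    have close_P: "\<forall>\<^sub>F n in sequentially. J1_close P (\<lambda>\<omega>. scaled_log_path b (W \<omega>) n) (Gn n) T e"
    proof -
      obtain B where B: "\<And>n. n \<ge> 1 \<Longrightarrow> B n \<in> events" "\<forall>\<^sub>F n in sequentially. prob (B n) < \<eta>"
        "\<And>n \<omega>. n \<ge> 1 \<Longrightarrow> \<omega> \<in> space P - B n \<Longrightarrow> tame_blocks m N m \<eta> (obs_time n) (obs_height n \<omega>)"
        by (rule tame_blocks_obs[OF m(3) \<eta> m(1)[folded N_def]]) (rule that)
      obtain B' where B': "\<forall>n\<ge>1. B' n \<in> events" "\<forall>\<^sub>F n in sequentially. prob (B' n) < \<eta>"
        and near: "\<forall>\<^sub>F n in sequentially. \<forall>\<omega>\<in>space P - B' n. \<forall>k\<in>{1..n * K + 1}. \<bar>ln \<bar>W \<omega> k\<bar> / b n - record_height n \<omega> k\<bar> \<le> \<eta>"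
        by (rule log_path_near_record[OF dip dom Wm \<eta> \<eta>, where K = K])
      show ?thesis using B(2) B'(2) near eventually_ge_at_top[of 1]
      proof eventually_elim
        case (elim n)
        have n: "n \<ge> 1" by fact
        have Bm: "B n \<in> events" "B' n \<in> events" using B(1) B'(1) n by auto
        show ?case
        proof (rule J1_closeI)
          show "B n \<union> B' n \<in> events" using Bm by auto
          have "prob (B n \<union> B' n) \<le> prob (B n) + prob (B' n)" by (rule measure_Un_le) (fact Bm)+
          then show "prob (B n \<union> B' n) < e" using elim(1,2) e by (simp add: \<eta>_def)
          fix \<omega> assume "\<omega> \<in> space P - (B n \<union> B' n)"
          then have wB: "\<omega> \<in> space P - B n" "\<omega> \<in> space P - B' n" by auto
          have t0: "obs_time n k \<ge> 0" for k by (simp add: obs_time_def)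
          obtain h where h: "h \<in> time_changes" "\<forall>s\<ge>0. \<bar>h s - s\<bar> < 1 / real m"
            "\<forall>s\<in>{0..T}. \<bar>record_height n \<omega> (nat \<lfloor>real n * h s\<rfloor> + 1) - Gn n \<omega> s\<bar> \<le> \<eta>"
            unfolding Gn_def q_def
            by (rule tame_blocks_near_grid_path[OF m(3) \<eta> N running_sup_record_height[OF n] t0 B(3)[OF n wB(1)]])
          show "scaled_log_path b (W \<omega>) n \<in> J1_nbhd (Gn n \<omega>) T e"
          proof (rule J1_nbhdI[OF scaled_log_path_in_D h(1)])
            fix s :: real assume s: "s \<ge> 0"
            have hs: "\<bar>h s - s\<bar> < \<eta>" "\<bar>h s - s\<bar> < 1" 
            proof -
              have "1 / real m \<le> 1" using m(3) by simp
              then show "\<bar>h s - s\<bar> < \<eta>" "\<bar>h s - s\<bar> < 1" using h(2)[rule_format, OF s] m(2) by linarith+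
            qed
            then show "\<bar>h s - s\<bar> < e" using e by (simp add: \<eta>_def)
            have "h ` {0..} = {0..}" using h(1) by (simp add: time_changes_def)
            then have h0: "h s \<ge> 0" using s by (metis atLeast_iff imageI)
            assume sT: "s \<le> T"
            have "h s \<le> real K" using hs(2) sT K by linarith
            then have "real n * h s \<le> real n * real K" by (intro mult_left_mono) auto
            then have "nat \<lfloor>real n * h s\<rfloor> \<le> n * K" by (simp add: nat_le_iff floor_le_iff)
            then have k: "nat \<lfloor>real n * h s\<rfloor> + 1 \<in> {1..n * K + 1}" by simp
            have 1: "\<bar>ln \<bar>W \<omega> (nat \<lfloor>real n * h s\<rfloor> + 1)\<bar> / b n - record_height n \<omega> (nat \<lfloor>real n * h s\<rfloor> + 1)\<bar> \<le> \<eta>"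
              using elim(3) wB(2) k by blast
            have 2: "\<bar>record_height n \<omega> (nat \<lfloor>real n * h s\<rfloor> + 1) - Gn n \<omega> s\<bar> \<le> \<eta>" using h(3) s sT by simp
            have 3: "scaled_log_path b (W \<omega>) n (h s) = ln \<bar>W \<omega> (nat \<lfloor>real n * h s\<rfloor> + 1)\<bar> / b n"
              using h0 by (simp add: scaled_log_path_def)
            show "\<bar>scaled_log_path b (W \<omega>) n (h s) - Gn n \<omega> s\<bar> < e"
              unfolding 3 using 1 2 e unfolding \<eta>_def by linarith
          qed
        qed
      qed
    qed
    show "\<exists>F Gn G. finite F \<and> F \<subseteq> skorokhod_D \<and>
       (\<forall>n. Gn n \<in> measurable P (count_space F)) \<and> G \<in> measurable S (count_space F) \<and>
       (\<forall>x\<in>F. (\<lambda>n. measure P {\<omega>\<in>space P. Gn n \<omega> = x}) \<longlonglongrightarrow> measure S {\<omega>\<in>space S. G \<omega> = x}) \<and>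
       (\<forall>\<^sub>F n in sequentially. J1_close P (\<lambda>\<omega>. scaled_log_path b (W \<omega>) n) (Gn n) T e) \<and>
       J1_close S (\<lambda>\<omega>. sup_process (\<lambda>k. t k \<omega>) (\<lambda>k. j k \<omega>)) G T e"
      using F close_P close_S by (intro exI[of _ F] exI[of _ Gn] exI[of _ G] conjI allI ballI)
  qed
qed

end

section \<open>Independence of the initial value and the theorem\<close>

text \<open>Independence of the initial value from the \<open>\<sigma>\<close>-algebra of the whole sequence, together with independence within
  the sequence, is independence of the extended sequence: for finitely many indices, split off index \<open>0\<close>.\<close>

lemma (in prob_space) indep_vars_insert_initial:
  fixes Z :: "nat \<Rightarrow> 'a \<Rightarrow> real \<times> real"
  assumes Z: "indep_vars (\<lambda>_. borel) Z {1..}" and X0: "random_variable borel X0"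
    and indep: "indep_set (sets (vimage_algebra (space M) X0 borel))
          (sets (vimage_algebra (space M) (\<lambda>\<omega>. \<lambda>k\<in>{1..}. Z k \<omega>) (PiM {1..} (\<lambda>_. borel))))"
  shows "indep_vars (\<lambda>_. borel) (\<lambda>k \<omega>. if k = 0 then (X0 \<omega>, 0) else Z k \<omega>) UNIV"
proof -
  define V where "V = vimage_algebra (space M) (\<lambda>\<omega>. \<lambda>k\<in>{1..}. Z k \<omega>) (PiM {1..} (\<lambda>_. borel :: (real \<times> real) measure))"
  have Zrv: "random_variable borel (Z k)" if "k \<ge> 1" for k using Z that by (auto simp: indep_vars_def)
  have pair: "(\<lambda>x. (x, 0::real)) \<in> borel_measurable (borel :: real measure)" by (intro borel_measurable_Pair) auto
  define W where "W k \<omega> = (if k = 0 then (X0 \<omega>, 0) else Z k \<omega>)" for k \<omega>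
  have W0: "W 0 = (\<lambda>\<omega>. (X0 \<omega>, 0))" and Wk: "k \<ge> 1 \<Longrightarrow> W k = Z k" for k by (auto simp: W_def[abs_def])
  have Wrv: "random_variable borel (W k)" for k
  proof (cases "k = 0")
    case True then show ?thesis using measurable_compose[OF X0 pair] by (simp add: W0)
  next
    case False then show ?thesis using Zrv[of k] Wk[of k] by simp
  qed
  define E where "E k = {W k -` A \<inter> space M | A. A \<in> sets (borel :: (real \<times> real) measure)}" for k
  have E_events: "E k \<subseteq> events" for k using measurable_sets[OF Wrv[of k]] by (auto simp: E_def)
  have E0: "A \<in> sets (vimage_algebra (space M) X0 borel)" if A: "A \<in> E 0" for A
  proof -
    obtain B where B: "B \<in> sets borel" "A = W 0 -` B \<inter> space M" using A by (auto simp: E_def)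
    have "(\<lambda>x. (x, 0::real)) -` B \<in> sets (borel :: real measure)" using measurable_sets[OF pair B(1)] by simp
    then have "X0 -` ((\<lambda>x. (x, 0)) -` B) \<inter> space M \<in> sets (vimage_algebra (space M) X0 borel)" by (rule in_vimage_algebra)
    then show ?thesis unfolding B(2) W0 by (simp add: vimage_def)
  qed
  have Ek: "A \<in> sets V" if A: "A \<in> E k" and k: "k \<ge> 1" for A k
  proof -
    obtain B where B: "B \<in> sets borel" "A = W k -` B \<inter> space M" using A by (auto simp: E_def)
    have "(\<lambda>\<omega>. \<lambda>k\<in>{1..}. Z k \<omega>) \<in> space M \<rightarrow> space (PiM {1..} (\<lambda>_. borel :: (real \<times> real) measure))"
      by (auto simp: space_PiM)
    then have "(\<lambda>\<omega>. \<lambda>k\<in>{1..}. Z k \<omega>) \<in> measurable V (PiM {1..} (\<lambda>_. borel))"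
      unfolding V_def by (rule measurable_vimage_algebra1)
    from measurable_compose[OF this measurable_component_singleton[of k]] k
    have "(\<lambda>\<omega>. Z k \<omega>) \<in> measurable V borel" by simp
    then show ?thesis using measurable_sets[of "Z k" V borel B] B k by (simp add: Wk V_def)
  qed
  have Z_sets: "indep_sets E {1..}"
  proof -
    have "indep_sets (\<lambda>k. {Z k -` A \<inter> space M | A. A \<in> sets borel}) {1..}" using Z by (simp add: indep_vars_def2)
    then show ?thesis by (rule indep_sets_cong[THEN iffD1, rotated 2]) (auto simp: E_def Wk)
  qed
  have "indep_sets E UNIV"
  proof (rule indep_setsI)
    show "E k \<subseteq> events" for k by (rule E_events)
    fix A and J :: "nat set" assume J: "J \<noteq> {}" "J \<subseteq> UNIV" "finite J" and A: "\<forall>k\<in>J. A k \<in> E k"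
    have pos: "prob (\<Inter>k\<in>I. A k) = (\<Prod>k\<in>I. prob (A k))" if "I \<subseteq> J" "I \<noteq> {}" "0 \<notin> I" for I
    proof (rule indep_setsD[OF Z_sets])
      show "I \<subseteq> {1..}" using that by (auto simp: Suc_le_eq intro: Nat.gr0I)
      show "finite I" using that(1) J(3) by (rule finite_subset)
      show "\<forall>k\<in>I. A k \<in> E k" using A that by auto
    qed fact
    show "prob (\<Inter>k\<in>J. A k) = (\<Prod>k\<in>J. prob (A k))"
    proof (cases "0 \<in> J")
      case False then show ?thesis using pos[of J] J by simp
    next
      case True
      define I where "I = J - {0}"
      have JI: "J = insert 0 I" "0 \<notin> I" "finite I" "I \<subseteq> J" using True J by (auto simp: I_def)
      show ?thesis
      proof (cases "I = {}")
        case True then show ?thesis by (simp add: JI(1))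
      next
        case False
        have "(\<Inter>k\<in>I. A k) \<in> sets V"
        proof (rule sets.finite_INT[OF JI(3) False])
          show "A k \<in> sets V" if "k \<in> I" for k
          proof (rule Ek)
            show "A k \<in> E k" using A that JI by auto
            show "k \<ge> 1" using that JI(2) by (cases k) auto
          qed
        qed
        moreover have "A 0 \<in> sets (vimage_algebra (space M) X0 borel)" using A True by (intro E0) auto
        ultimately have "prob (A 0 \<inter> (\<Inter>k\<in>I. A k)) = prob (A 0) * prob (\<Inter>k\<in>I. A k)"
          unfolding V_def by (intro indep_setD[OF indep])
        then show ?thesis using pos[OF JI(4) False JI(2)] JI by simp
      qed
    qed
  qed
  then have "indep_vars (\<lambda>_. borel) W UNIV"
    unfolding indep_vars_def2 E_def using Wrv by simp
  then show ?thesis by (simp add: W_def[abs_def])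
qed

theorem theorem1p5:
  fixes P :: "'w measure" and S :: "'v measure"
    and M Q X0 :: "'w \<Rightarrow> real" and Mk Qk :: "nat \<Rightarrow> 'w \<Rightarrow> real"
    and \<alpha> :: real and l :: "real \<Rightarrow> real" and b :: "nat \<Rightarrow> real"
    and \<mu> :: "ereal measure" and t :: "nat \<Rightarrow> 'v \<Rightarrow> real" and j :: "nat \<Rightarrow> 'v \<Rightarrow> ereal"
  defines "X \<equiv> \<lambda>n \<omega>. affine_rec (\<lambda>k. Mk k \<omega>) (\<lambda>k. Qk k \<omega>) (X0 \<omega>) n"
    and "Y \<equiv> \<lambda>n \<omega>. perpetuity (\<lambda>k. Mk k \<omega>) (\<lambda>k. Qk k \<omega>) n"
    and "tailQ \<equiv> \<lambda>x. measure P {\<omega>\<in>space P. ln \<bar>Q \<omega>\<bar> > x}"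
  assumes P: "prob_space P"
    and MQ_meas: "(\<lambda>\<omega>. (M \<omega>, Q \<omega>)) \<in> borel_measurable P"
    and MQ_indep: "prob_space.indep_vars P (\<lambda>_. borel) (\<lambda>k \<omega>. (Mk k \<omega>, Qk k \<omega>)) {1..}"
    and MQ_copies: "\<And>k. k \<ge> 1 \<Longrightarrow>
          distr P borel (\<lambda>\<omega>. (Mk k \<omega>, Qk k \<omega>)) = distr P borel (\<lambda>\<omega>. (M \<omega>, Q \<omega>))"
    and X0_meas: "X0 \<in> borel_measurable P"
    and X0_indep: "prob_space.indep_set P
          (sets (vimage_algebra (space P) X0 borel))
          (sets (vimage_algebra (space P) (\<lambda>\<omega>. \<lambda>k\<in>{1..}. (Mk k \<omega>, Qk k \<omega>))
             (PiM {1..} (\<lambda>_. borel))))"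
    and M_nonzero: "measure P {\<omega>\<in>space P. M \<omega> = 0} = 0"
    and Pi_to_0: "AE \<omega> in P. (\<lambda>n. partial_prod (\<lambda>k. Mk k \<omega>) n) \<longlonglongrightarrow> 0"
    and alpha: "0 < \<alpha>" "\<alpha> \<le> 1"
    and l_slow: "slowly_varying l"
    and tail: "tailQ \<sim>[at_top] (\<lambda>x. x powr (- \<alpha>) * l x)"
    and b_pos: "\<And>n. n \<ge> 1 \<Longrightarrow> b n > 0"
    and b_lim: "(\<lambda>n. real n * tailQ (b n)) \<longlonglongrightarrow> 1"
    and alpha_1: "\<alpha> = 1 \<Longrightarrow> filterlim l at_top at_top"
    and M_small: "(\<integral>\<^sup>+\<omega>. ennreal (log_minus \<bar>M \<omega>\<bar>) \<partial>P) = \<infinity> \<Longrightarrow>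
          ((\<lambda>x. (\<integral>\<omega>. min (log_minus \<bar>M \<omega>\<bar>) x \<partial>P) / (x * tailQ x)) \<longlongrightarrow> 0) at_top"
    and S: "prob_space S"
    and mu_sets: "sets \<mu> = sets (restrict_space borel {0<..})"
    and mu: "\<And>x::real. x > 0 \<Longrightarrow> emeasure \<mu> {ereal x<..} = ennreal (x powr (- \<alpha>))"
    and points: "\<And>k \<omega>. \<omega> \<in> space S \<Longrightarrow> t k \<omega> \<ge> 0 \<and> j k \<omega> > 0"
    and prm: "poisson_random_measure S (restrict_space lborel {0..} \<Otimes>\<^sub>M \<mu>)
          (\<lambda>\<omega>. sum_dirac (restrict_space lborel {0..} \<Otimes>\<^sub>M \<mu>) (\<lambda>k. (t k \<omega>, j k \<omega>)))"
  shows "((\<forall>k\<ge>1. measure P {\<omega>\<in>space P. Y k \<omega> = 0} = 0) \<longrightarrow>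
            converges_weakly J1_topology
              P (\<lambda>n \<omega>. scaled_log_path b (\<lambda>k. Y k \<omega>) n)
              S (\<lambda>\<omega>. sup_process (\<lambda>k. t k \<omega>) (\<lambda>k. j k \<omega>)))
       \<and> ((\<forall>k\<ge>1. measure P {\<omega>\<in>space P. X k \<omega> = 0} = 0) \<longrightarrow>
            converges_weakly J1_topology
              P (\<lambda>n \<omega>. scaled_log_path b (\<lambda>k. X k \<omega>) n)
              S (\<lambda>\<omega>. sup_process (\<lambda>k. t k \<omega>) (\<lambda>k. j k \<omega>)))"
proof -
  interpret P: prob_space P by (rule P)
  have rvM: "M \<in> borel_measurable P" and rvQ: "Q \<in> borel_measurable P"
    using measurable_compose[OF MQ_meas borel_measurable_fst_real] measurable_compose[OF MQ_meas borel_measurable_snd_real] by simp_all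
  have rvZ: "(\<lambda>\<omega>. (Mk k \<omega>, Qk k \<omega>)) \<in> borel_measurable P" if "k \<ge> 1" for k
    using MQ_indep that by (auto simp: P.indep_vars_def)
  have copy_prob: "measure P {\<omega>\<in>space P. (Mk k \<omega>, Qk k \<omega>) \<in> A} = measure P {\<omega>\<in>space P. (M \<omega>, Q \<omega>) \<in> A}"
    if k: "k \<ge> 1" and A: "A \<in> sets borel" for k A
  proof -
    have "measure (distr P borel (\<lambda>\<omega>. (Mk k \<omega>, Qk k \<omega>))) A = measure (distr P borel (\<lambda>\<omega>. (M \<omega>, Q \<omega>))) A"
      by (simp only: MQ_copies[OF k])
    then show ?thesis
      by (subst (asm) (1 2) measure_distr) (auto simp: rvZ[OF k] MQ_meas A vimage_def Int_def conj_commute)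
  qed
  have setQ: "{x::real \<times> real. ln \<bar>snd x\<bar> > c} \<in> sets borel" for c
  proof -
    have "(\<lambda>x::real \<times> real. ln \<bar>snd x\<bar>) \<in> borel_measurable borel"
      by (intro borel_measurable_ln borel_measurable_abs borel_measurable_snd_real)
    from measurable_sets[OF this, of "{c<..}"] show ?thesis by (simp add: vimage_def)
  qed
  have setM: "{x::real \<times> real. fst x = 0} \<in> sets borel"
    using measurable_sets[OF borel_measurable_fst_real, of "{0}"] by (simp add: vimage_def)
  have tail_anti: "tailQ y \<le> tailQ x" if "x \<le> y" for x y
  proof -
    have "{\<omega> \<in> space P. ln \<bar>Q \<omega>\<bar> > x} \<in> P.events"
      using rvQ by (auto intro!: borel_measurable_less borel_measurable_ln borel_measurable_abs)
    then show ?thesis unfolding tailQ_def using that by (intro P.finite_measure_mono) auto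
  qed
  interpret regular_tail tailQ l \<alpha> b
  proof
    show "0 \<le> tailQ x" for x by (simp add: tailQ_def)
  qed (fact tail_anti alpha l_slow tail b_lim alpha_1)+
  \<comment> \<open>the two alternatives for \<open>log\<^sup>- \<bar>M\<bar>\<close>\<close>
  have truncated: "((\<lambda>x. P.expectation (\<lambda>\<omega>. min (log_minus \<bar>M \<omega>\<bar>) x) / (x * tailQ x)) \<longlongrightarrow> 0) at_top"
  proof (cases "(\<integral>\<^sup>+\<omega>. ennreal (log_minus \<bar>M \<omega>\<bar>) \<partial>P) = \<infinity>")
    case True then show ?thesis by (rule M_small)
  next
    case False
    have nn: "log_minus y \<ge> 0" for y by (simp add: log_minus_def)
    have rv: "(\<lambda>\<omega>. log_minus \<bar>M \<omega>\<bar>) \<in> borel_measurable P"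
      unfolding log_minus_def by (intro borel_measurable_max borel_measurable_uminus borel_measurable_ln borel_measurable_abs rvM borel_measurable_const)
    have int: "integrable P (\<lambda>\<omega>. log_minus \<bar>M \<omega>\<bar>)"
      using False by (intro integrableI_nonneg rv AE_I2 nn) (simp add: top.not_eq_extremum)
    show ?thesis
    proof (rule bounded_truncated)
      fix x :: real assume x: "x > 0"
      have m: "(\<lambda>\<omega>. min (log_minus \<bar>M \<omega>\<bar>) x) \<in> borel_measurable P" using rv by simp
      have i: "integrable P (\<lambda>\<omega>. min (log_minus \<bar>M \<omega>\<bar>) x)"
        by (rule Bochner_Integration.integrable_bound[OF int m]) (use nn x in auto)
      have "P.expectation (\<lambda>\<omega>. min (log_minus \<bar>M \<omega>\<bar>) x) \<le> P.expectation (\<lambda>\<omega>. log_minus \<bar>M \<omega>\<bar>)"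
        by (rule integral_mono[OF i int]) simp
      moreover have "0 \<le> P.expectation (\<lambda>\<omega>. min (log_minus \<bar>M \<omega>\<bar>) x)"
        using nn x by (intro Bochner_Integration.integral_nonneg) auto
      ultimately show "\<bar>P.expectation (\<lambda>\<omega>. min (log_minus \<bar>M \<omega>\<bar>) x)\<bar> \<le> P.expectation (\<lambda>\<omega>. log_minus \<bar>M \<omega>\<bar>)" by simp
    qed
  qed
  have M1: "P.expectation (\<lambda>\<omega>. min (log_minus \<bar>Mk 1 \<omega>\<bar>) x) = P.expectation (\<lambda>\<omega>. min (log_minus \<bar>M \<omega>\<bar>) x)" for x
  proof -
    have f: "(\<lambda>z::real \<times> real. min (log_minus \<bar>fst z\<bar>) x) \<in> borel_measurable borel"
      unfolding log_minus_def
      by (intro borel_measurable_min borel_measurable_max borel_measurable_uminus borel_measurable_ln borel_measurable_abs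
          borel_measurable_fst_real borel_measurable_const)
    have "P.expectation (\<lambda>\<omega>. min (log_minus \<bar>Mk 1 \<omega>\<bar>) x) = integral\<^sup>L (distr P borel (\<lambda>\<omega>. (Mk 1 \<omega>, Qk 1 \<omega>))) (\<lambda>z. min (log_minus \<bar>fst z\<bar>) x)"
      by (subst integral_distr[OF rvZ f]) simp_all
    also have "distr P borel (\<lambda>\<omega>. (Mk 1 \<omega>, Qk 1 \<omega>)) = distr P borel (\<lambda>\<omega>. (M \<omega>, Q \<omega>))"
      by (rule MQ_copies) simp
    also have "integral\<^sup>L \<dots> (\<lambda>z. min (log_minus \<bar>fst z\<bar>) x) = P.expectation (\<lambda>\<omega>. min (log_minus \<bar>M \<omega>\<bar>) x)"
      by (subst integral_distr[OF MQ_meas f]) simp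
    finally show ?thesis .
  qed
  interpret H: heavy_perpetuity P tailQ l \<alpha> b Mk Qk X0
  proof
    show "P.indep_vars (\<lambda>_. borel) (\<lambda>k \<omega>. if k = 0 then (X0 \<omega>, 0) else (Mk k \<omega>, Qk k \<omega>)) UNIV"
      by (rule P.indep_vars_insert_initial[OF MQ_indep X0_meas X0_indep])
    show "distr P borel (\<lambda>\<omega>. (Mk k \<omega>, Qk k \<omega>)) = distr P borel (\<lambda>\<omega>. (Mk 1 \<omega>, Qk 1 \<omega>))" if "k \<ge> 1" for k
      using MQ_copies[OF that] MQ_copies[of 1] by simp
    show "P.prob {\<omega> \<in> space P. ln \<bar>Qk k \<omega>\<bar> > x} = tailQ x" if "k \<ge> 1" for k x
      using copy_prob[OF that setQ[of x]] by (simp add: tailQ_def)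
    show "AE \<omega> in P. \<forall>k\<ge>1. Mk k \<omega> \<noteq> 0"
    proof -
      have "AE \<omega> in P. Mk k \<omega> \<noteq> 0" if k: "k \<ge> 1" for k
      proof (rule AE_I)
        have "(\<lambda>\<omega>. fst (Mk k \<omega>, Qk k \<omega>)) \<in> borel_measurable P" by (rule measurable_compose[OF rvZ[OF k] borel_measurable_fst_real])
        then have rv: "Mk k \<in> borel_measurable P" by simp
        show "{\<omega> \<in> space P. \<not> Mk k \<omega> \<noteq> 0} \<subseteq> {\<omega> \<in> space P. Mk k \<omega> = 0}" by auto
        show "{\<omega> \<in> space P. Mk k \<omega> = 0} \<in> P.events" using rv by simp
        have "P.prob {\<omega> \<in> space P. Mk k \<omega> = 0} = 0"
          using copy_prob[OF k setM] M_nonzero by simp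
        then show "emeasure P {\<omega> \<in> space P. Mk k \<omega> = 0} = 0" by (simp add: P.emeasure_eq_measure)
      qed
      then have "AE \<omega> in P. \<forall>k. k \<ge> 1 \<longrightarrow> Mk k \<omega> \<noteq> 0" by (subst AE_all_countable) auto
      then show ?thesis by simp
    qed
    show "(\<lambda>n. real n * P.expectation (\<lambda>\<omega>. min (log_minus \<bar>Mk 1 \<omega>\<bar>) (b n)) / b n) \<longlonglongrightarrow> 0"
      unfolding M1 by (rule n_truncated_over_b[OF truncated])
  qed (fact Pi_to_0 b_pos)+
  have prm: "prm_pareto S \<mu> t j \<alpha>"
    by (rule prm_pareto.intro[OF S alpha(1) mu_sets mu points prm])
  have "converges_weakly J1_topology P (\<lambda>n \<omega>. scaled_log_path b (\<lambda>k. Y k \<omega>) n)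
      S (\<lambda>\<omega>. sup_process (\<lambda>k. t k \<omega>) (\<lambda>k. j k \<omega>))"
    unfolding Y_def by (rule H.log_path_converges[OF prm H.no_dip_Y H.log_dominated_Y H.Y_rv])
  moreover have "converges_weakly J1_topology P (\<lambda>n \<omega>. scaled_log_path b (\<lambda>k. X k \<omega>) n)
      S (\<lambda>\<omega>. sup_process (\<lambda>k. t k \<omega>) (\<lambda>k. j k \<omega>))"
    unfolding X_def by (rule H.log_path_converges[OF prm H.no_dip_X H.log_dominated_X H.X_rv])
  ultimately show ?thesis by simp
qed

end
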